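(* Let $M$ be an isotropic dilation matrix and $s\in\mathbb{N}$. Assume that $\{\psi_{\mu,j,k}\}$, $\{\widetilde\psi_{\mu,j,k}\}$, $\mu=2,\dots,u$, is an MRA-based wavelet system in $(H^s(\mathbb{R}^d),H^{-s}(\mathbb{R}^d))$ generated by $\varphi,\widetilde\varphi$. If, for some $n>s$, $$\widehat{\widetilde b}_\mu(\xi)=O(|\xi|^n)\quad\text{as }\xi\to\mathbf{0},\qquad \mu=2,\dots,u,$$ then the MRA-based wavelet system produces a pair of dual wavelet frames in $(H^s(\mathbb{R}^d),H^{-s}(\mathbb{R}^d))$, which provides simultaneous approximation order $(s,n)$, i.e. there is a constant $C$, not depending on $j$ and $f$, such that for all $f\in H^n(\mathbb{R}^d)$ and all $j\in\mathbb{N}_0$ $$\sum_{r=0}^{s}\|M^{*j}\|^{-r}\left|f-\sum_{k\in\mathbb{Z}^d}\langle f,\widetilde\varphi_{0k}\rangle\varphi_{0k}-\sum_{i=0}^{j-1}\sum_{\mu=2}^{u}\sum_{k\in\mathbb{Z}^d}\langle f,\widetilde\psi_{\mu,i,k}\rangle\psi_{\mu,i,k}\right|_{H^r}\le C\,\|M^{*-j}\|^n\,|f|_{H^n}.$$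
   Context: A dilation matrix is $M\in\mathbb{Z}^{d\times d}$ all of whose eigenvalues are greater than 1 in modulus; $m=|\det M|$; $M^*$ is its (conjugate) transpose, $M^{*j}=(M^* )^j$, $M^{*-j}=(M^* )^{-j}$; $\|\cdot\|$ is the operator norm induced by the Euclidean norm $|\cdot|$. $M$ is isotropic if all its eigenvalues are equal in modulus, to $\rho=m^{1/d}$, and there are positive constants $C_1,C_2$ with $C_1\rho^j\le\|M^j\|\le C_2\rho^j$ for all $j\in\mathbb{Z}$. $\mathbf{0}$ is the origin; $\mathbb{N}_0=\mathbb{N}\cup\{0\}$. The Fourier transform is $\widehat f(\xi)=\int_{\mathbb{R}^d}f(x)e^{-2\pi i(x,\xi)}dx$, extended to tempered distributions. For real $s$, $H^s(\mathbb{R}^d)$ is the Hilbert space of tempered distributions with $\|f\|_{H^s}^2=\int|\widehat f(\xi)|^2(1+|\xi|^2)^sd\xi<\infty$; for $f\in H^s$, $g\in H^{-s}$, $\langle f,g\rangle=\int\widehat f(\xi)\overline{\widehat g(\xi)}d\xi$; $|f|_{H^r}^2=\int|\xi|^{2r}|\widehat f(\xi)|^2d\xi$. For $g$ on $\mathbb{R}^d$, $g_{jk}(x)=m^{j/2}g(M^jx+k)$, and $\psi_{\mu,j,k}=(\psi_\mu)_{jk}$, $\widetilde\psi_{\mu,j,k}=(\widetilde\psi_\mu)_{jk}$. Masks and scaling functions. For a finitely supported sequence $a=\{a(k)\}_{k\in\mathbb{Z}^d}$ its symbol is $\widehat a(\xi)=\sum_ka(k)e^{2\pi i(k,\xi)}$;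 $a$ is a mask if $\widehat a(\mathbf{0})=1$. The scaling function of a mask $a$ is the compactly supported tempered distribution $\varphi$, with normalization $\widehat\varphi(\mathbf{0})=1$, solving $\varphi(x)=m\sum_ka(k)\varphi(Mx+k)$, i.e. $\widehat\varphi(\xi)=\widehat a(M^{*-1}\xi)\widehat\varphi(M^{*-1}\xi)$. The Sobolev smoothness exponent is $\nu_2(\varphi)=\sup\{\nu\in\mathbb{R}:\int|\widehat\varphi(\xi)|^2(1+|\xi|^2)^\nu d\xi<\infty\}$. MRA-based wavelet system in $(H^s(\mathbb{R}^d),H^{-s}(\mathbb{R}^d))$ generated by $\varphi,\widetilde\varphi$. Let $a,\widetilde a$ be two masks with scaling functions $\varphi,\widetilde\varphi$ such that $\nu_2(\varphi)>s$ and $\nu_2(\widetilde\varphi)>-s$. Put $b_1=a$, $\widetilde b_1=\widetilde a$, and let $D(M^* )=M^*[0,1)^d\cap\mathbb{Z}^d$ (which has $m$ elements). Let $u\ge m$ and let $\widehat b_\mu,\widehat{\widetilde b}_\mu$, $\mu=2,\dots,u$, be trigonometric polynomials (wavelet masks) such that the $u\times m$ matrices $$\mathcal{L}(\xi)=\{\widehat b_\mu(\xi+M^{*-1}q)\}_{\mu=1,\dots,u}^{q\in D(M^* )},\qquad \widetilde{\mathcal{L}}(\xi)=\{\widehat{\widetilde b}_\mu(\xi+M^{*-1}q)\}_{\mu=1,\dots,u}^{q\in D(M^* )}$$ satisfy $\mathcal{L}(\xi)^*\widetilde{\mathcal{L}}(\xi)=I_m$ for all $\xi$. The wavelet functions $\psi_\mu,\widetilde\psi_\mu$,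 $\mu=2,\dots,u$, are defined by $\widehat{\psi_\mu}(\xi)=\widehat b_\mu(M^{*-1}\xi)\widehat\varphi(M^{*-1}\xi)$ and $\widehat{\widetilde\psi_\mu}(\xi)=\widehat{\widetilde b}_\mu(M^{*-1}\xi)\widehat{\widetilde\varphi}(M^{*-1}\xi)$. The pair $\{\psi_{\mu,j,k}\}$, $\{\widetilde\psi_{\mu,j,k}\}$ is the MRA-based wavelet system. Dual wavelet frames. For $j\ge0$ let $\psi^s_{\mu,j,k}=m^{-js/d}\psi_{\mu,j,k}$ and $\widetilde\psi^{-s}_{\mu,j,k}=m^{js/d}\widetilde\psi_{\mu,j,k}$. The system produces a pair of dual wavelet frames in $(H^s(\mathbb{R}^d),H^{-s}(\mathbb{R}^d))$ if $\{\varphi_{0k}\}_{k}\cup\{\psi^s_{\mu,j,k}\}_{\mu=2,\dots,u,\,j\ge0,\,k}$ is a frame in $H^s(\mathbb{R}^d)$, $\{\widetilde\varphi_{0k}\}_{k}\cup\{\widetilde\psi^{-s}_{\mu,j,k}\}_{\mu=2,\dots,u,\,j\ge0,\,k}$ is a frame in $H^{-s}(\mathbb{R}^d)$, and for every $f\in H^s(\mathbb{R}^d)$ $$f=\sum_{k}\langle f,\widetilde\varphi_{0k}\rangle\varphi_{0k}+\sum_{j=0}^{\infty}\sum_{\mu=2}^u\sum_{k}\langle f,\widetilde\psi_{\mu,j,k}\rangle\psi_{\mu,j,k}$$ with unconditional convergence in $H^s(\mathbb{R}^d)$. *)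

theory Defs
  imports "HOL-Analysis.Analysis" "HOL-Library.Landau_Symbols"
begin

section \<open>Tempered distributions and their Fourier transforms\<close>

text \<open>
  Mixed partial derivatives; the list is the sequence of coordinates to differentiate in.
\<close>

definition partial :: "'n::finite \<Rightarrow> (real^'n \<Rightarrow> complex) \<Rightarrow> real^'n \<Rightarrow> complex" where
  "partial i f x = vector_derivative (\<lambda>t. f (x + t *\<^sub>R axis i 1)) (at 0)"

primrec partials :: "'n::finite list \<Rightarrow> (real^'n \<Rightarrow> complex) \<Rightarrow> real^'n \<Rightarrow> complex" where
  "partials [] f = f"
| "partials (i # is) f = partial i (partials is f)"

definition schwartz :: "(real^'n::finite \<Rightarrow> complex) set" where
  "schwartz = {f. (\<forall>is x. partials is f differentiable (at x)) \<and>
                  (\<forall>is N. bounded (range (\<lambda>x. norm x ^ N *\<^sub>R partials is f x)))}"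

definition schwartz_seminorm :: "nat \<Rightarrow> (real^'n::finite \<Rightarrow> complex) \<Rightarrow> real" where
  "schwartz_seminorm N f =
     (SUP (is, x) \<in> {is. length is \<le> N} \<times> UNIV. (1 + norm x) ^ N * norm (partials is f x))"

text \<open>
  Distributions are functionals on all functions, of which only the values on the Schwartz
  space matter; nothing below depends on the values elsewhere.
\<close>

type_synonym 'n dist = "(real^'n \<Rightarrow> complex) \<Rightarrow> complex"

definition tempered_distribution :: "'n::finite dist \<Rightarrow> bool" where
  "tempered_distribution T \<longleftrightarrow>
     (\<forall>f\<in>schwartz. \<forall>g\<in>schwartz. T (\<lambda>x. f x + g x) = T f + T g) \<and>
     (\<forall>c. \<forall>f\<in>schwartz. T (\<lambda>x. c * f x) = c * T f) \<and>
     (\<exists>C N. \<forall>f\<in>schwartz. norm (T f) \<le> C * schwartz_seminorm N f)"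

definition compactly_supported :: "'n::finite dist \<Rightarrow> bool" where
  "compactly_supported T \<longleftrightarrow>
     (\<exists>K. compact K \<and> (\<forall>f\<in>schwartz. closure {x. f x \<noteq> 0} \<inter> K = {} \<longrightarrow> T f = 0))"

definition fourier :: "(real^'n::finite \<Rightarrow> complex) \<Rightarrow> real^'n \<Rightarrow> complex" where
  "fourier f \<xi> = (LINT x|lborel. f x * exp (- 2 * complex_of_real pi * \<i> * complex_of_real (x \<bullet> \<xi>)))"

definition dist_fourier :: "'n::finite dist \<Rightarrow> 'n dist" where
  "dist_fourier T = (\<lambda>f. T (fourier f))"

definition represents :: "(real^'n::finite \<Rightarrow> complex) \<Rightarrow> 'n dist \<Rightarrow> bool" where
  "represents h T \<longleftrightarrow> h \<in> borel_measurable borel \<and>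
     (\<forall>f\<in>schwartz. integrable lborel (\<lambda>x. h x * f x) \<and> T f = (LINT x|lborel. h x * f x))"

text \<open>
  The Fourier transform of \<open>T\<close> as a function. It is unique up to null sets; the continuous
  version is taken whenever there is one, so that point values such as the one at the origin
  make sense for compactly supported \<open>T\<close>.
\<close>

definition fourier_fun :: "'n::finite dist \<Rightarrow> real^'n \<Rightarrow> complex" where
  "fourier_fun T = (SOME h. represents h (dist_fourier T) \<and>
     ((\<exists>g. continuous_on UNIV g \<and> represents g (dist_fourier T)) \<longrightarrow> continuous_on UNIV h))"


section \<open>Sobolev spaces\<close>

definition sobolev :: "real \<Rightarrow> 'n::finite dist set" where
  "sobolev s = {T. tempered_distribution T \<and> (\<exists>h. represents h (dist_fourier T)) \<and>
     integrable lborel (\<lambda>\<xi>. (norm (fourier_fun T \<xi>))\<^sup>2 * (1 + (norm \<xi>)\<^sup>2) powr s)}"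

definition sobolev_norm :: "real \<Rightarrow> 'n::finite dist \<Rightarrow> real" where
  "sobolev_norm s T =
     sqrt (LINT \<xi>|lborel. (norm (fourier_fun T \<xi>))\<^sup>2 * (1 + (norm \<xi>)\<^sup>2) powr s)"

definition sobolev_inner :: "real \<Rightarrow> 'n::finite dist \<Rightarrow> 'n dist \<Rightarrow> complex" where
  "sobolev_inner s S T = (LINT \<xi>|lborel.
     fourier_fun S \<xi> * cnj (fourier_fun T \<xi>) * complex_of_real ((1 + (norm \<xi>)\<^sup>2) powr s))"

text \<open>The duality between \<open>H\<^sup>s\<close> and \<open>H\<^sup>-\<^sup>s\<close>, for every \<open>s\<close>.\<close>

definition pairing :: "'n::finite dist \<Rightarrow> 'n dist \<Rightarrow> complex" where
  "pairing f g = (LINT \<xi>|lborel. fourier_fun f \<xi> * cnj (fourier_fun g \<xi>))"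

text \<open>For \<open>r = 0\<close> the convention \<open>0 powr 0 = 0\<close> alters the integrand only at the origin.\<close>

definition sobolev_seminorm :: "real \<Rightarrow> 'n::finite dist \<Rightarrow> real" where
  "sobolev_seminorm r T =
     sqrt (LINT \<xi>|lborel. norm \<xi> powr (2 * r) * (norm (fourier_fun T \<xi>))\<^sup>2)"

definition smoothness_exponent :: "'n::finite dist \<Rightarrow> ereal" where
  "smoothness_exponent T = Sup {ereal \<nu> | \<nu>. T \<in> sobolev \<nu>}"

text \<open>Unconditional convergence in \<open>H\<^sup>s\<close>: convergence of the net of finite partial sums.\<close>

definition sobolev_has_sum ::
    "real \<Rightarrow> ('i \<Rightarrow> 'n::finite dist) \<Rightarrow> 'i set \<Rightarrow> 'n dist \<Rightarrow> bool" where
  "sobolev_has_sum s e I S \<longleftrightarrow> S \<in> sobolev s \<and> (\<forall>i\<in>I. e i \<in> sobolev s) \<and>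
     ((\<lambda>F. sobolev_norm s (\<lambda>\<eta>. S \<eta> - (\<Sum>i\<in>F. e i \<eta>))) \<longlongrightarrow> 0) (finite_subsets_at_top I)"

definition sobolev_summable ::
    "real \<Rightarrow> ('i \<Rightarrow> 'n::finite dist) \<Rightarrow> 'i set \<Rightarrow> bool" where
  "sobolev_summable s e I \<longleftrightarrow> (\<exists>S. sobolev_has_sum s e I S)"

definition sobolev_sum ::
    "real \<Rightarrow> ('i \<Rightarrow> 'n::finite dist) \<Rightarrow> 'i set \<Rightarrow> 'n dist" where
  "sobolev_sum s e I = (SOME S. sobolev_has_sum s e I S)"

definition sobolev_frame ::
    "real \<Rightarrow> ('i \<Rightarrow> 'n::finite dist) \<Rightarrow> 'i set \<Rightarrow> bool" where
  "sobolev_frame s e I \<longleftrightarrow> (\<forall>i\<in>I. e i \<in> sobolev s) \<and>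
     (\<exists>A B. 0 < A \<and> (\<forall>f\<in>sobolev s.
        (\<lambda>i. (cmod (sobolev_inner s f (e i)))\<^sup>2) summable_on I \<and>
        A * (sobolev_norm s f)\<^sup>2 \<le> (\<Sum>\<^sub>\<infinity>i\<in>I. (cmod (sobolev_inner s f (e i)))\<^sup>2) \<and>
        (\<Sum>\<^sub>\<infinity>i\<in>I. (cmod (sobolev_inner s f (e i)))\<^sup>2) \<le> B * (sobolev_norm s f)\<^sup>2))"


section \<open>Dilation matrices\<close>

text \<open>
  Matrix powers are defined here because \<open>^\<close> on the type of matrices is the entrywise power.
\<close>

definition matpow :: "real^'n^'n::finite \<Rightarrow> nat \<Rightarrow> real^'n^'n" where
  "matpow M j = (((**) M) ^^ j) (mat 1)"

definition matpowi :: "real^'n^'n::finite \<Rightarrow> int \<Rightarrow> real^'n^'n" where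
  "matpowi M j = (if 0 \<le> j then matpow M (nat j) else matpow (matrix_inv M) (nat (- j)))"

definition opnorm :: "real^'n^'n::finite \<Rightarrow> real" where
  "opnorm M = onorm ((*v) M)"

definition eigenval :: "real^'n^'n::finite \<Rightarrow> complex \<Rightarrow> bool" where
  "eigenval M c \<longleftrightarrow> (\<exists>v. v \<noteq> 0 \<and> map_matrix complex_of_real M *v v = c *s v)"

definition dilation_matrix :: "real^'n^'n::finite \<Rightarrow> bool" where
  "dilation_matrix M \<longleftrightarrow> (\<forall>i j. M $ i $ j \<in> \<int>) \<and> (\<forall>c. eigenval M c \<longrightarrow> 1 < cmod c)"

definition isotropic :: "real^'n^'n::finite \<Rightarrow> bool" where
  "isotropic M \<longleftrightarrow> (let \<rho> = \<bar>det M\<bar> powr (1 / real CARD('n)) in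
     (\<forall>c. eigenval M c \<longrightarrow> cmod c = \<rho>) \<and>
     (\<exists>C1 C2. 0 < C1 \<and> 0 < C2 \<and>
        (\<forall>j::int. C1 * \<rho> powi j \<le> opnorm (matpowi M j) \<and> opnorm (matpowi M j) \<le> C2 * \<rho> powi j)))"

definition vec_of_int :: "int^'n::finite \<Rightarrow> real^'n" where
  "vec_of_int k = (\<chi> i. of_int (k $ i))"

definition digits :: "real^'n^'n::finite \<Rightarrow> (int^'n) set" where
  "digits A = {q. vec_of_int q \<in> (\<lambda>x. A *v x) ` {x. \<forall>i. 0 \<le> x $ i \<and> x $ i < 1}}"

text \<open>
  The distribution \<open>T (A x + b)\<close>, defined by transposing the substitution
  \<open>x = A\<^sup>-\<^sup>1 (y - b)\<close>.
\<close>

definition affine_subst :: "real^'n^'n::finite \<Rightarrow> real^'n \<Rightarrow> 'n dist \<Rightarrow> 'n dist" where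
  "affine_subst A b T =
     (\<lambda>\<eta>. T (\<lambda>y. \<eta> (matrix_inv A *v (y - b))) / complex_of_real \<bar>det A\<bar>)"

definition dil_shift :: "real^'n^'n::finite \<Rightarrow> nat \<Rightarrow> int^'n \<Rightarrow> 'n dist \<Rightarrow> 'n dist" where
  "dil_shift M j k g = (\<lambda>\<eta>. complex_of_real (\<bar>det M\<bar> powr (real j / 2)) *
     affine_subst (matpow M j) (vec_of_int k) g \<eta>)"


section \<open>MRA-based wavelet systems\<close>

definition symbol :: "(int^'n::finite \<Rightarrow> complex) \<Rightarrow> real^'n \<Rightarrow> complex" where
  "symbol a \<xi> = (\<Sum>k | a k \<noteq> 0.
     a k * exp (2 * complex_of_real pi * \<i> * complex_of_real (vec_of_int k \<bullet> \<xi>)))"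

definition mask :: "(int^'n::finite \<Rightarrow> complex) \<Rightarrow> bool" where
  "mask a \<longleftrightarrow> finite {k. a k \<noteq> 0} \<and> symbol a 0 = 1"

definition scaling_function ::
    "real^'n^'n::finite \<Rightarrow> (int^'n \<Rightarrow> complex) \<Rightarrow> 'n dist \<Rightarrow> bool" where
  "scaling_function M a \<phi> \<longleftrightarrow>
     tempered_distribution \<phi> \<and> compactly_supported \<phi> \<and> fourier_fun \<phi> 0 = 1 \<and>
     (\<forall>\<eta>\<in>schwartz. \<phi> \<eta> =
        complex_of_real \<bar>det M\<bar> * (\<Sum>k | a k \<noteq> 0. a k * affine_subst M (vec_of_int k) \<phi> \<eta>))"

definition wavelet_function ::
    "real^'n^'n::finite \<Rightarrow> (int^'n \<Rightarrow> complex) \<Rightarrow> 'n dist \<Rightarrow> 'n dist \<Rightarrow> bool" where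
  "wavelet_function M b \<phi> \<psi> \<longleftrightarrow> tempered_distribution \<psi> \<and>
     represents (\<lambda>\<xi>. symbol b (matrix_inv (transpose M) *v \<xi>) *
                      fourier_fun \<phi> (matrix_inv (transpose M) *v \<xi>)) (dist_fourier \<psi>)"

definition modulation_matrix ::
    "real^'n^'n::finite \<Rightarrow> (nat \<Rightarrow> int^'n \<Rightarrow> complex) \<Rightarrow> real^'n \<Rightarrow> nat \<Rightarrow> int^'n \<Rightarrow> complex" where
  "modulation_matrix M b \<xi> \<mu> q = symbol (b \<mu>) (\<xi> + matrix_inv (transpose M) *v vec_of_int q)"

definition mra_wavelet_system ::
    "real^'n^'n::finite \<Rightarrow> real \<Rightarrow> nat \<Rightarrow>
     (int^'n \<Rightarrow> complex) \<Rightarrow> (int^'n \<Rightarrow> complex) \<Rightarrow>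
     (nat \<Rightarrow> int^'n \<Rightarrow> complex) \<Rightarrow> (nat \<Rightarrow> int^'n \<Rightarrow> complex) \<Rightarrow>
     'n dist \<Rightarrow> 'n dist \<Rightarrow> (nat \<Rightarrow> 'n dist) \<Rightarrow> (nat \<Rightarrow> 'n dist) \<Rightarrow> bool" where
  "mra_wavelet_system M s u a a' b b' \<phi> \<phi>' \<psi> \<psi>' \<longleftrightarrow>
     mask a \<and> mask a' \<and>
     scaling_function M a \<phi> \<and> scaling_function M a' \<phi>' \<and>
     ereal s < smoothness_exponent \<phi> \<and> ereal (- s) < smoothness_exponent \<phi>' \<and>
     \<bar>det M\<bar> \<le> real u \<and>
     b 1 = a \<and> b' 1 = a' \<and>
     (\<forall>\<mu>\<in>{2..u}. finite {k. b \<mu> k \<noteq> 0} \<and> finite {k. b' \<mu> k \<noteq> 0}) \<and>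
     (\<forall>\<xi>. \<forall>q\<in>digits (transpose M). \<forall>q'\<in>digits (transpose M).
        (\<Sum>\<mu>\<in>{1..u}. cnj (modulation_matrix M b \<xi> \<mu> q) * modulation_matrix M b' \<xi> \<mu> q') =
        (if q = q' then 1 else 0)) \<and>
     (\<forall>\<mu>\<in>{2..u}. wavelet_function M (b \<mu>) \<phi> (\<psi> \<mu>) \<and> wavelet_function M (b' \<mu>) \<phi>' (\<psi>' \<mu>))"


section \<open>Dual wavelet frames and approximation order\<close>

text \<open>
  The scaling functions and the wavelets of a system form one indexed family:
  \<open>Inl k\<close> stands for \<open>\<phi>\<^sub>0\<^sub>k\<close> and \<open>Inr (\<mu>, j, k)\<close> for \<open>\<psi>\<^sub>\<mu>\<^sub>j\<^sub>k\<close>.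
\<close>

type_synonym 'n index = "(int^'n) + nat \<times> nat \<times> (int^'n)"

definition wavelet_index :: "nat \<Rightarrow> 'n::finite index set" where
  "wavelet_index u = UNIV <+> ({2..u} \<times> UNIV \<times> UNIV)"

text \<open>The wavelets at level \<open>j\<close> are weighted by \<open>m powr (- j s / d)\<close>.\<close>

definition weighted_family ::
    "real^'n^'n::finite \<Rightarrow> real \<Rightarrow> 'n dist \<Rightarrow> (nat \<Rightarrow> 'n dist) \<Rightarrow>
     'n index \<Rightarrow> 'n dist" where
  "weighted_family M s \<phi> \<psi> i = (case i of
       Inl k \<Rightarrow> dil_shift M 0 k \<phi>
     | Inr (\<mu>, j, k) \<Rightarrow> (\<lambda>\<eta>. complex_of_real (\<bar>det M\<bar> powr (- (real j * s / real CARD('n)))) *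
                              dil_shift M j k (\<psi> \<mu>) \<eta>))"

text \<open>
  With \<open>\<theta>\<close> and \<open>\<theta>'\<close> a function and its dual counterpart, the term
  \<open>\<langle>f, \<theta>'\<^sub>j\<^sub>k\<rangle> \<theta>\<^sub>j\<^sub>k\<close> of a reconstruction series.
\<close>

definition recon_term ::
    "real^'n^'n::finite \<Rightarrow> 'n dist \<Rightarrow> 'n dist \<Rightarrow> 'n dist \<Rightarrow> nat \<Rightarrow> int^'n \<Rightarrow> 'n dist" where
  "recon_term M \<theta> \<theta>' f j k = (\<lambda>\<eta>. pairing f (dil_shift M j k \<theta>') * dil_shift M j k \<theta> \<eta>)"

definition recon_family ::
    "real^'n^'n::finite \<Rightarrow> 'n dist \<Rightarrow> 'n dist \<Rightarrow> (nat \<Rightarrow> 'n dist) \<Rightarrow> (nat \<Rightarrow> 'n dist) \<Rightarrow> 'n dist \<Rightarrow>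
     'n index \<Rightarrow> 'n dist" where
  "recon_family M \<phi> \<phi>' \<psi> \<psi>' f i = (case i of
       Inl k \<Rightarrow> recon_term M \<phi> \<phi>' f 0 k
     | Inr (\<mu>, j, k) \<Rightarrow> recon_term M (\<psi> \<mu>) (\<psi>' \<mu>) f j k)"

definition dual_wavelet_frames ::
    "real^'n^'n::finite \<Rightarrow> real \<Rightarrow> nat \<Rightarrow>
     'n dist \<Rightarrow> 'n dist \<Rightarrow> (nat \<Rightarrow> 'n dist) \<Rightarrow> (nat \<Rightarrow> 'n dist) \<Rightarrow> bool" where
  "dual_wavelet_frames M s u \<phi> \<phi>' \<psi> \<psi>' \<longleftrightarrow>
     sobolev_frame s (weighted_family M s \<phi> \<psi>) (wavelet_index u) \<and>
     sobolev_frame (- s) (weighted_family M (- s) \<phi>' \<psi>') (wavelet_index u) \<and>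
     (\<forall>f\<in>sobolev s. sobolev_has_sum s (recon_family M \<phi> \<phi>' \<psi> \<psi>' f) (wavelet_index u) f)"

text \<open>The part of the reconstruction series with levels below \<open>j\<close>, the inner series in \<open>H\<^sup>s\<close>.\<close>

definition partial_recon ::
    "real^'n^'n::finite \<Rightarrow> real \<Rightarrow> nat \<Rightarrow>
     'n dist \<Rightarrow> 'n dist \<Rightarrow> (nat \<Rightarrow> 'n dist) \<Rightarrow> (nat \<Rightarrow> 'n dist) \<Rightarrow> nat \<Rightarrow> 'n dist \<Rightarrow> 'n dist" where
  "partial_recon M s u \<phi> \<phi>' \<psi> \<psi>' j f = (\<lambda>\<eta>.
     sobolev_sum s (recon_term M \<phi> \<phi>' f 0) UNIV \<eta> +
     (\<Sum>i<j. \<Sum>\<mu>\<in>{2..u}. sobolev_sum s (recon_term M (\<psi> \<mu>) (\<psi>' \<mu>) f i) UNIV \<eta>))"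

definition simultaneous_approximation_order ::
    "real^'n^'n::finite \<Rightarrow> nat \<Rightarrow> real \<Rightarrow> nat \<Rightarrow>
     'n dist \<Rightarrow> 'n dist \<Rightarrow> (nat \<Rightarrow> 'n dist) \<Rightarrow> (nat \<Rightarrow> 'n dist) \<Rightarrow> bool" where
  "simultaneous_approximation_order M s n u \<phi> \<phi>' \<psi> \<psi>' \<longleftrightarrow>
     (\<forall>f\<in>sobolev n. sobolev_summable s (recon_term M \<phi> \<phi>' f 0) UNIV \<and>
        (\<forall>i. \<forall>\<mu>\<in>{2..u}. sobolev_summable s (recon_term M (\<psi> \<mu>) (\<psi>' \<mu>) f i) UNIV)) \<and>
     (\<exists>C. \<forall>f\<in>sobolev n. \<forall>j.
        (\<Sum>r\<le>s. inverse (opnorm (matpow (transpose M) j) ^ r) *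
           sobolev_seminorm r (\<lambda>\<eta>. f \<eta> - partial_recon M s u \<phi> \<phi>' \<psi> \<psi>' j f \<eta>))
        \<le> C * opnorm (matpow (matrix_inv (transpose M)) j) powr n * sobolev_seminorm n f)"

end

theory Submission
 imports Defs "HOL-Probability.Probability" "HOL-Complex_Analysis.Cauchy_Integral_Formula"
begin

text \<open>
 Everything takes place on the Fourier side, where an element of \<open>H\<^sup>s\<close> is a function in a weighted
 \<open>L\<^sup>2\<close> space. With \<open>N = M\<^sup>*\<close>, the level operator
 \<open>F \<mapsto> \<Sum>\<^sub>k \<langle>F, \<theta>'\<^sub>j\<^sub>k\<rangle> \<theta>\<^sub>j\<^sub>k\<close> is multiplication of \<open>\<theta> (N\<^sup>-\<^sup>j w)\<close> by the
 periodization of \<open>F (N\<^sup>j w)\<close> times the conjugate of \<open>\<theta>'\<close>, so a weighted Cauchy-Schwarz inequality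
 on each lattice coset bounds it. The biorthogonality of the modulation matrices makes the levels of all
 generators telescope to the next level of the scaling functions, which converges pointwise to \<open>F\<close> when
 \<open>F\<close> has compact support. Because the dual masks vanish to order \<open>n\<close>, level \<open>j\<close> has \<open>H\<^sup>r\<close> norm at most a
 constant times \<open>\<rho>\<^sup>j\<^sup>(\<^sup>r\<^sup>-\<^sup>n\<^sup>) |F|\<close>; summing the levels from \<open>J\<close> on and applying Fatou's lemma gives
 the approximation order. The Bessel bounds come from summing over \<open>j\<close> weights comparable to
 \<open>min (Y q\<^sup>j)\<^sup>\<alpha> (Y q\<^sup>j)\<^sup>-\<^sup>\<beta>\<close>, a bounded geometric sum; duality turns them into synthesis bounds and,
 together with the reconstruction formula, into lower frame bounds.
\<close>

text \<open>The two families are treated asymmetrically. Only the dual masks vanish at the origin.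
  The Bessel bound for the dual family, tested on \<open>wL2 s\<close>, combines this vanishing with
  controlled growth (t' < s). The bound for the primal family, tested on \<open>wL2 (- s)\<close>,
  rests on surplus smoothness alone (t > s). The gaps t' < s < t and s < n are the exponents that
  make the sums over levels bounded in both directions. The smoothness hypotheses are integral
  conditions, whereas the coset estimates need lattice sums bounded uniformly. Compact support
  bridges the two: the distribution is unchanged by a smooth cutoff, so its transform reproduces
  itself under convolution with a Schwartz kernel, which ties each point value to an average. A
  second obstacle is that a coset sum converges only almost everywhere for a general F, so
  telescoping is an a.e. statement, and passing from truncated to general F needs a limit argument
  of its own.\<close>

abbreviation "borel_fun \<equiv> borel_measurable borel"
abbreviation "cplx \<equiv> complex_of_real"
abbreviation "nsum \<equiv> nn_integral (count_space UNIV)"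
lemmas integrable_bound_fun = Bochner_Integration.integrable_bound

section \<open>The Schwartz space\<close>

lemma partial_eq_derivative:
 fixes f :: "real^'n::finite => complex"
 assumes "(f has_derivative D) (at x)"
 shows "partial i f x = D (axis i 1)"
proof -
 have "((%t. x + t *\<^sub>R axis i 1) has_derivative (%t. t *\<^sub>R axis i 1)) (at (0::real))"
  by (auto intro!: derivative_eq_intros)
 then have "((%t. f (x + t *\<^sub>R axis i 1)) has_derivative (%t. D (t *\<^sub>R axis i 1))) (at (0::real))"
  using has_derivative_compose[of "%t. x + t *\<^sub>R axis i 1" _ 0 UNIV f D] assms by simp
 moreover have "D (t *\<^sub>R axis i 1) = t *\<^sub>R D (axis i 1)" for t
  using has_derivative_bounded_linear[OF assms] by (simp add: linear_simps)
 ultimately have "((%t. f (x + t *\<^sub>R axis i 1)) has_vector_derivative D (axis i 1)) (at 0)"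
  by (simp add: has_vector_derivative_def)
 then show ?thesis by (simp add: partial_def vector_derivative_at)
qed

definition rapid :: "(real^'n::finite => complex) => bool" where
 "rapid f \<longleftrightarrow> (\<forall>N. bounded (range (%x. norm x ^ N *\<^sub>R f x)))"

lemma power_one_plus_le:
 fixes t :: real
 assumes "0 <= t"
 shows "(1 + t) ^ N <= 2 ^ N*(1 + t ^ N)"
proof (cases "t <= 1")
 case True
 then have "(1 + t) ^ N <= 2 ^ N" using assms by (intro power_mono) auto
 also have "... <= 2 ^ N*(1 + t ^ N)" using assms by simp
 finally show ?thesis .
next
 case False
 then have "(1 + t) ^ N <= (2*t) ^ N" using assms by (intro power_mono) auto
 also have "... <= 2 ^ N*(1 + t ^ N)" by (simp add: power_mult_distrib)
 finally show ?thesis .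
qed

lemma rapid_iff: "rapid f \<longleftrightarrow> (\<forall>N. \<exists>C. \<forall>x. (1 + norm x) ^ N*norm (f x) <= C)"
proof
 assume f: "rapid f"
 show "\<forall>N. \<exists>C. \<forall>x. (1 + norm x) ^ N*norm (f x) <= C"
 proof
  fix N
  obtain A where A: "!!x. norm (norm x ^ N *\<^sub>R f x) <= A"
   using f unfolding rapid_def bounded_iff by blast
  obtain B where B: "!!x. norm (norm x ^ 0 *\<^sub>R f x) <= B"
   using f unfolding rapid_def bounded_iff by blast
  have "(1 + norm x) ^ N*norm (f x) <= 2 ^ N*(B + A)" for x
  proof -
   have "(1 + norm x) ^ N*norm (f x) <= 2 ^ N*(1 + norm x ^ N)*norm (f x)"
    by (intro mult_right_mono power_one_plus_le) auto
   also have "... = 2 ^ N*(norm (f x) + norm x ^ N*norm (f x))" by (simp add: algebra_simps)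
   also have "... <= 2 ^ N*(B + A)" using A[of x] B[of x] by (intro mult_left_mono add_mono) auto
   finally show ?thesis .
  qed
  then show "\<exists>C. \<forall>x. (1 + norm x) ^ N*norm (f x) <= C" by blast
 qed
next
 assume *: "\<forall>N. \<exists>C. \<forall>x. (1 + norm x) ^ N*norm (f x) <= C"
 show "rapid f"
  unfolding rapid_def
 proof
  fix N
  obtain C where C: "!!x. (1 + norm x) ^ N*norm (f x) <= C" using*by blast
  have "norm (norm x ^ N *\<^sub>R f x) <= C" for x
  proof -
   have "norm x ^ N*norm (f x) <= (1 + norm x) ^ N*norm (f x)"
    by (intro mult_right_mono power_mono) auto
   then show ?thesis using C[of x] by simp
  qed
  then show "bounded (range (%x. norm x ^ N *\<^sub>R f x))" unfolding bounded_iff by blast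
 qed
qed

text \<open>\<open>schwartz\<close> quantifies over partial derivatives of every order. A family
  closed under first partials contains all iterated ones, so it is enough to exhibit such a family
  and check its members once.\<close>

lemma schwartz_coinduct:
 assumes "f\<in>X"
  and "!!g x. g\<in>X ==> g differentiable (at x)"
  and "!!g. g\<in>X ==> rapid g"
  and "!!g i. g\<in>X ==> partial i g\<in>X"
 shows "f\<in>schwartz"
proof -
 have "partials is f\<in>X" for "is" by (induction "is") (use assms in auto)
 then show ?thesis using assms(2,3) unfolding schwartz_def rapid_def by blast
qed

lemma schwartzD:
 assumes "f\<in>schwartz"
 shows schwartz_differentiable: "f differentiable (at x)"
  and schwartz_rapid: "rapid f"
  and schwartz_partial: "partial i f\<in>schwartz"
  and schwartz_partials: "partials is f\<in>schwartz"
proof -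
 show "f differentiable (at x)" using assms unfolding schwartz_def
  by (metis (mono_tags, lifting) mem_Collect_eq partials.simps(1))
 show "rapid f" unfolding rapid_def
 proof
  fix N
  have "\<forall>is N. bounded (range (%x. norm x ^ N *\<^sub>R partials is f x))"
   using assms by (simp add: schwartz_def)
  from this[rule_format, of N "[]"] show "bounded (range (%x. norm x ^ N *\<^sub>R f x))" by simp
 qed
 have "partials is (partials js f) = partials (is @ js) f" for "is" js by (induction "is") auto
 then have *: "partials is f\<in>schwartz" for "is"
  using assms by (auto simp: schwartz_def)
 then show "partials is f\<in>schwartz" .
 show "partial i f\<in>schwartz" using *[of "[i]"] by simp
qed

lemma schwartz_has_derivative:
 "f\<in>schwartz ==> (f has_derivative frechet_derivative f (at x)) (at x)"
 using schwartz_differentiable frechet_derivative_works by blast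

lemma schwartz_continuous: "f\<in>schwartz ==> continuous_on UNIV f"
 by (simp add: continuous_at_imp_continuous_on differentiable_imp_continuous_within schwartz_differentiable)

lemma schwartz_measurable [measurable_dest]: "f\<in>schwartz ==> f\<in>borel_fun"
 by (simp add: borel_measurable_continuous_onI schwartz_continuous)

lemma schwartz_bound: "f\<in>schwartz ==> \<exists>C>0. \<forall>x. (1 + norm x) ^ N*norm (f x) <= C"
proof -
 assume "f\<in>schwartz"
 then obtain C where "\<forall>x. (1 + norm x) ^ N*norm (f x) <= C"
  using schwartz_rapid rapid_iff by blast
 then show ?thesis by (intro exI[of _ "max C 1"]) (auto simp: max_def intro: order_trans)
qed

lemma rapid_add: "rapid f ==> rapid g ==> rapid (%x. f x + g x)"
 unfolding rapid_def by (simp add: scaleR_right_distrib bounded_plus_comp)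

text \<open>The product and chain rules leave a generating family and land in finite sums of its
  members; this closure repairs that. Zero is not adjoined, so \<open>fsums_sum\<close> asks for a
  nonempty index set.\<close>

inductive_set fsums :: "('a => complex) set => ('a => complex) set" for X where
 base: "f\<in>X ==> f\<in>fsums X"
| add: "f\<in>fsums X ==> g\<in>fsums X ==> (%x. f x + g x)\<in>fsums X"

lemma fsums_sum:
 assumes "finite I" "I ~= {}" "!!i. i\<in>I ==> f i\<in>fsums X"
 shows "(%x. \<Sum>i\<in>I. f i x)\<in>fsums X"
 using assms by (induction rule: finite_ne_induct) (auto intro: fsums.add)

lemma partial_add:
 assumes "f differentiable (at x)" "g differentiable (at x)"
 shows "partial i (%x. f x + g x) x = partial i f x + partial i g x"
proof -
 obtain D E where D: "(f has_derivative D) (at x)" and E: "(g has_derivative E) (at x)"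
  using assms by (auto simp: differentiable_def)
 show ?thesis
  using partial_eq_derivative[OF has_derivative_add[OF D E]] partial_eq_derivative[OF D] partial_eq_derivative[OF E]
  by simp
qed

lemma schwartz_fsums:
 assumes f: "f\<in>fsums X"
  and diff: "!!g x. g\<in>X ==> g differentiable (at x)"
  and rap: "!!g. g\<in>X ==> rapid g"
  and part: "!!g i. g\<in>X ==> partial i g\<in>fsums X"
 shows "f\<in>schwartz"
proof (rule schwartz_coinduct[OF f])
 show d: "g differentiable (at x)" if "g\<in>fsums X" for g x
  using that by induction (auto intro: diff)
 show "rapid g" if "g\<in>fsums X" for g
  using that by induction (auto intro: rap rapid_add)
 show "partial i g\<in>fsums X" if "g\<in>fsums X" for g i
  using that
 proof induction
  case (add f g)
  then have "partial i (%x. f x + g x) = (%x. partial i f x + partial i g x)"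
   by (auto simp: fun_eq_iff intro!: partial_add d)
  then show ?case using add fsums.add by auto
 qed (auto intro: part)
qed

lemma schwartz_add:
 assumes "f\<in>schwartz" "g\<in>schwartz"
 shows "(%x. f x + g x)\<in>schwartz"
 by (rule schwartz_fsums[of _ schwartz])
   (use assms in \<open>auto intro: fsums.intros schwartzD\<close>)

lemma partial_mult:
 assumes "f differentiable (at x)" "g differentiable (at x)"
 shows "partial i (%x. f x*g x) x = f x*partial i g x + partial i f x*g x"
proof -
 obtain D E where D: "(f has_derivative D) (at x)" and E: "(g has_derivative E) (at x)"
  using assms by (auto simp: differentiable_def)
 show ?thesis
  using partial_eq_derivative[OF has_derivative_mult[OF D E]] partial_eq_derivative[OF D] partial_eq_derivative[OF E]
  by simp
qed

text \<open>By the product rule a partial of q g is a sum of two products of the same kind.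
  Constants, coordinates, characters and Schwartz functions supply the families \<open>Y\<close>
  used below.\<close>

lemma schwartz_multiplier:
 assumes "p\<in>Y" and f: "f\<in>schwartz"
  and diff: "!!q x. q\<in>Y ==> q differentiable (at x)"
  and growth: "!!q. q\<in>Y ==> \<exists>C K. \<forall>x. norm (q x) <= C*(1 + norm x) ^ K"
  and part: "!!q i. q\<in>Y ==> partial i q\<in>Y"
 shows "(%x. p x*f x)\<in>schwartz"
proof (rule schwartz_fsums[of _ "{(%x. q x*g x) | q g. q\<in>Y \<and> g\<in>schwartz}"])
 show "(%x. p x*f x)\<in>fsums {(%x. q x*g x) | q g. q\<in>Y \<and> g\<in>schwartz}"
  by (rule fsums.base) (use assms in blast)
next
 fix h x assume "h\<in>{(%x. q x*g x) | q g. q\<in>Y \<and> g\<in>schwartz}"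
 then obtain q g where h: "h = (%x. q x*g x)" and q: "q\<in>Y" and g: "g\<in>schwartz" by blast
 show "h differentiable (at x)" unfolding h using diff[OF q] schwartz_differentiable[OF g] by simp
next
 fix h assume "h\<in>{(%x. q x*g x) | q g. q\<in>Y \<and> g\<in>schwartz}"
 then obtain q g where h: "h = (%x. q x*g x)" and q: "q\<in>Y" and g: "g\<in>schwartz" by blast
 obtain C K where C: "!!x. norm (q x) <= C*(1 + norm x) ^ K" using growth[OF q] by blast
 show "rapid h"
  unfolding rapid_iff
 proof
  fix N
  obtain B where B: "!!x. (1 + norm x) ^ (N + K)*norm (g x) <= B"
   using schwartz_bound[OF g] by blast
  have C0: "0 <= C" using C[of 0] norm_ge_zero[of "q 0"] by (simp del: norm_ge_zero)
  have "(1 + norm x) ^ N*norm (h x) <= C*B" for x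
  proof -
   have "(1 + norm x) ^ N*norm (h x) <= (1 + norm x) ^ N*((C*(1 + norm x) ^ K)*norm (g x))"
    unfolding h norm_mult by (intro mult_left_mono mult_right_mono C) auto
   also have "... = C*((1 + norm x) ^ (N + K)*norm (g x))" by (simp add: power_add)
   also have "... <= C*B" using B C0 by (intro mult_left_mono) auto
   finally show ?thesis .
  qed
  then show "\<exists>C. \<forall>x. (1 + norm x) ^ N*norm (h x) <= C" by blast
 qed
next
 fix h i assume "h\<in>{(%x. q x*g x) | q g. q\<in>Y \<and> g\<in>schwartz}"
 then obtain q g where h: "h = (%x. q x*g x)" and q: "q\<in>Y" and g: "g\<in>schwartz" by blast
 have "partial i h = (%x. q x*partial i g x + partial i q x*g x)"
  unfolding h using partial_mult[OF diff[OF q] schwartz_differentiable[OF g]] by auto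
 moreover have "...\<in>fsums {(%x. q x*g x) | q g. q\<in>Y \<and> g\<in>schwartz}"
  by (intro fsums.add; rule fsums.base) (use q g part schwartz_partial in blast)+
 ultimately show "partial i h\<in>fsums {(%x. q x*g x) | q g. q\<in>Y \<and> g\<in>schwartz}" by simp
qed

lemma schwartz_mult:
 assumes "f\<in>schwartz" "g\<in>schwartz"
 shows "(%x. f x*g x)\<in>schwartz"
proof (rule schwartz_multiplier[OF assms])
 show "\<exists>C K. \<forall>x. norm (q x) <= C*(1 + norm x) ^ K" if "q\<in>schwartz" for q :: "real^'a => complex"
 proof -
  have "\<exists>C>0. \<forall>x. (1 + norm x) ^ 0*norm (q x) <= C" by (rule schwartz_bound[OF that])
  then obtain C where "\<forall>x. norm (q x) <= C" by auto
  then show ?thesis by (intro exI[of _ C] exI[of _ 0]) auto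
 qed
qed (auto intro: schwartzD)

lemma schwartz_cmult:
 assumes "f\<in>schwartz"
 shows "(%x. c*f x)\<in>schwartz"
proof (rule schwartz_multiplier[of "%_. c" "range (%c _. c)", OF _ assms])
 fix q :: "real^'a => complex" and i assume "q\<in>range (%c _. c)"
 then obtain d where q: "q = (%_. d)" by auto
 show "\<exists>C K. \<forall>x. norm (q x) <= C*(1 + norm x) ^ K" unfolding q by (intro exI[of _ "norm d"] exI[of _ 0]) auto
 have "partial i q = (%_. 0)"
  unfolding q using partial_eq_derivative[OF has_derivative_const[of d]] by auto
 then show "partial i q\<in>range (%c _. c)" by auto
qed auto


lemma schwartz_diff: "f\<in>schwartz ==> g\<in>schwartz ==> (%x. f x - g x)\<in>schwartz"
 using schwartz_add[of f "%x. (-1)*g x"] schwartz_cmult[of g "-1"] by simp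

lemma schwartz_coordinate:
 assumes "f\<in>schwartz"
 shows "(%x. cplx (x $ i)*f x)\<in>schwartz"
proof (rule schwartz_multiplier[of _ "range (%c _. c) \<union> {%x. cplx (x $ i)}", OF _ assms])
 fix q :: "real^'a => complex" and j x assume q: "q\<in>range (%c _. c) \<union> {%x. cplx (x $ i)}"
 have i: "((%x. cplx (x $ i)) has_derivative (%h. cplx (h $ i))) (at x)" for x :: "real^'a"
  by (intro bounded_linear_imp_has_derivative bounded_linear_compose[OF bounded_linear_of_real] bounded_linear_vec_nth)
 then have "(%x. cplx (x $ i)) differentiable (at x)" for x :: "real^'a"
  unfolding differentiable_def by blast
 then show "q differentiable (at x)" using q by auto
 have "partial j (%x. cplx (x $ i)) = (%x. cplx (axis j 1 $ i))"
  using partial_eq_derivative[OF i] by auto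
 moreover have "partial j (%_. d) = (%_. 0)" for d
  using partial_eq_derivative[OF has_derivative_const[of d]] by auto
 ultimately show "partial j q\<in>range (%c _. c) \<union> {%x. cplx (x $ i)}"
  using q by auto
 show "\<exists>C K. \<forall>x. norm (q x) <= C*(1 + norm x) ^ K"
 proof (cases "q\<in>range (%c _. c)")
  case True
  then obtain d where q: "q = (%_. d)" by auto
  show ?thesis unfolding q by (intro exI[of _ "norm d"] exI[of _ 0]) auto
 next
  case False
  then have "q = (%x. cplx (x $ i))" using q by auto
  moreover have "norm (x $ i) <= 1 + norm x" for x :: "real^'a"
   using component_le_norm_cart[of x i] by simp
  ultimately show ?thesis by (intro exI[of _ 1] exI[of _ 1]) auto
 qed
qed auto

section \<open>Characters and linear substitutions\<close>

definition character :: "real^'n::finite => real^'n => complex" where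
 "character k x = exp (2*cplx pi*\<i>*cplx (k \<bullet> x))"

lemma norm_character [simp]: "norm (character k x) = 1"
 by (simp add: character_def norm_exp_eq_Re)

lemma character_has_derivative:
 "(character k has_derivative (%h. 2*cplx pi*\<i>*cplx (k \<bullet> h)*character k x)) (at x)"
proof -
 have "((%x. cplx (k \<bullet> x)) has_derivative (%h. cplx (k \<bullet> h))) (at x)"
  by (intro bounded_linear_imp_has_derivative bounded_linear_compose[OF bounded_linear_of_real] bounded_linear_inner_right)
 then have "((%x. 2*cplx pi*\<i>*cplx (k \<bullet> x)) has_derivative (%h. 2*cplx pi*\<i>*cplx (k \<bullet> h))) (at x)"
  by (rule has_derivative_mult_right)
 then have "((%x. exp (2*cplx pi*\<i>*cplx (k \<bullet> x))) has_derivative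
   (%h. (2*cplx pi*\<i>*cplx (k \<bullet> h))*exp (2*cplx pi*\<i>*cplx (k \<bullet> x)))) (at x)"
  using has_derivative_compose[OF _ DERIV_exp[unfolded has_field_derivative_def]]
  by (auto simp: mult.commute)
 then show ?thesis by (simp add: character_def[abs_def])
qed

lemma continuous_on_character: "continuous_on A (character k)"
 unfolding character_def[abs_def] by (intro continuous_intros)

lemma character_measurable [measurable]: "character k\<in>borel_fun"
 by (intro borel_measurable_continuous_onI continuous_on_character)

lemma schwartz_character:
 assumes "f\<in>schwartz"
 shows "(%x. character k x*f x)\<in>schwartz"
proof (rule schwartz_multiplier[of _ "range (%c x. c*character k x)", OF _ assms])
 show "character k\<in>range (%c x. c*character k x)" by (rule image_eqI[of _ _ 1]) auto
 fix q :: "real^'a => complex" and j x assume "q\<in>range (%c x. c*character k x)"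
 then obtain c where q: "q = (%x. c*character k x)" by auto
 have d: "(q has_derivative (%h. c*(2*cplx pi*\<i>*cplx (k \<bullet> h)*character k x))) (at x)" for x
  unfolding q by (intro has_derivative_mult_right character_has_derivative)
 then show "q differentiable (at x)" by (auto simp: differentiable_def)
 have "partial j q = (%x. (c*(2*cplx pi*\<i>*cplx (k \<bullet> axis j 1)))*character k x)"
  using partial_eq_derivative[OF d] by (auto simp: mult.assoc)
 then show "partial j q\<in>range (%c x. c*character k x)" by auto
 show "\<exists>C K. \<forall>x. norm (q x) <= C*(1 + norm x) ^ K"
  unfolding q by (intro exI[of _ "norm c"] exI[of _ 0]) (auto simp: norm_mult)
qed

lemma has_derivative_eq_sum_partial:
 fixes f :: "real^'n::finite => complex"
 assumes D: "(f has_derivative D) (at x)"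
 shows "D v = (\<Sum>j\<in>UNIV. cplx (v $ j)*partial j f x)"
proof -
 have l: "linear D" using D has_derivative_linear by blast
 have "v = (\<Sum>j\<in>UNIV. (v $ j) *\<^sub>R axis j 1)"
  by (simp add: vec_eq_iff axis_def if_distrib cong: if_cong)
 then have "D v = (\<Sum>j\<in>UNIV. (v $ j) *\<^sub>R D (axis j 1))"
  by (metis (no_types, lifting) l linear_cmul linear_sum sum.cong)
 then show ?thesis by (simp add: partial_eq_derivative[OF D] scaleR_conv_of_real)
qed

text \<open>The left inverse bounds the norm of x by a multiple of the norm of A x, which transfers
  decay. By the chain rule a partial of g(A x) is a constant-coefficient combination of partials of
  g taken at A x.\<close>

lemma schwartz_matrix:
 fixes A B :: "real^'n^'n::finite"
 assumes f: "f\<in>schwartz" and AB: "B ** A = mat 1"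
 shows "(%x. f (A *v x))\<in>schwartz"
proof -
 let ?X = "{(%x. c*g (A *v x)) | c g. g\<in>schwartz}"
 have inv: "B *v (A *v x) = x" for x by (simp add: matrix_vector_mul_assoc AB)
 have "(%x. 1*f (A *v x))\<in>schwartz"
 proof (rule schwartz_fsums[of _ ?X])
  show "(%x. 1*f (A *v x))\<in>fsums ?X"
   by (rule fsums.base) (use f in blast)
 next
  fix h x assume "h\<in>?X"
  then obtain c g where h: "h = (%x. c*g (A *v x))" and g: "g\<in>schwartz" by blast
  have "(%x. g (A *v x)) differentiable (at x)"
   by (rule differentiable_compose[of g]) (use g in \<open>auto intro: schwartz_differentiable simp: linear_imp_differentiable\<close>)
  then show "h differentiable (at x)" unfolding h by simp
 next
  fix h assume "h\<in>?X"
  then obtain c g where h: "h = (%x. c*g (A *v x))" and g: "g\<in>schwartz" by blast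
  obtain K where K: "!!y. norm (B *v y) <= norm y*K" and K0: "0 < K"
   using bounded_linear.pos_bounded[OF matrix_vector_mul_bounded_linear[of B]] by blast
  show "rapid h" unfolding rapid_iff
  proof
   fix N
   obtain C where C: "!!x. (1 + norm x) ^ N*norm (g x) <= C" using schwartz_bound[OF g] by blast
   have "(1 + norm x) ^ N*norm (h x) <= norm c*(1 + K) ^ N*C" for x
   proof -
    have "norm x <= norm (A *v x)*K" using K[of "A *v x"] by (simp add: inv)
    moreover have "(1 + K)*(1 + norm (A *v x)) = 1 + norm (A *v x) + K + norm (A *v x)*K"
     by (simp add: algebra_simps)
    ultimately have "1 + norm x <= (1 + K)*(1 + norm (A *v x))"
     using K0 norm_ge_zero[of "A *v x"] by linarith
    then have "(1 + norm x) ^ N <= (1 + K) ^ N*(1 + norm (A *v x)) ^ N"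
     by (subst power_mult_distrib[symmetric]) (intro power_mono, auto)
    then have "(1 + norm x) ^ N*norm (h x) <= ((1 + K) ^ N*(1 + norm (A *v x)) ^ N)*(norm c*norm (g (A *v x)))"
     unfolding h norm_mult by (intro mult_right_mono) auto
    also have "... = norm c*(1 + K) ^ N*((1 + norm (A *v x)) ^ N*norm (g (A *v x)))" by simp
    also have "... <= norm c*(1 + K) ^ N*C" using C K0 by (intro mult_left_mono) auto
    finally show ?thesis .
   qed
   then show "\<exists>C. \<forall>x. (1 + norm x) ^ N*norm (h x) <= C" by blast
  qed
 next
  fix h i assume "h\<in>?X"
  then obtain c g where h: "h = (%x. c*g (A *v x))" and g: "g\<in>schwartz" by blast
  have "partial i h = (%x. \<Sum>j\<in>UNIV. (c*cplx ((A *v axis i 1) $ j))*partial j g (A *v x))"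
  proof
   fix x
   have D: "(g has_derivative frechet_derivative g (at (A *v x))) (at (A *v x))"
    by (rule schwartz_has_derivative[OF g])
   have "((%x. g (A *v x)) has_derivative (%h. frechet_derivative g (at (A *v x)) (A *v h))) (at x)"
    using has_derivative_compose[where f = "%x. A *v x" and s = UNIV and x = x and g = g
      and f' = "%h. A *v h" and g' = "frechet_derivative g (at (A *v x))"] D
    by (simp add: bounded_linear_imp_has_derivative matrix_vector_mul_bounded_linear)
   then have "(h has_derivative (%y. c*frechet_derivative g (at (A *v x)) (A *v y))) (at x)"
    unfolding h by (rule has_derivative_mult_right)
   from partial_eq_derivative[OF this, of i]
   show "partial i h x = (\<Sum>j\<in>UNIV. (c*cplx ((A *v axis i 1) $ j))*partial j g (A *v x))"
    by (simp add: has_derivative_eq_sum_partial[OF D] sum_distrib_left mult.assoc)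
  qed
  moreover have "...\<in>fsums ?X"
   by (rule fsums_sum) (auto intro!: fsums.base schwartz_partial[OF g])
  ultimately show "partial i h\<in>fsums ?X" by simp
 qed
 then show ?thesis by simp
qed

section \<open>Lebesgue measure on coordinate space\<close>

lemma measurable_vec_nth [measurable (raw)]:
 fixes f :: "'a => real^'n::finite"
 assumes "f\<in>borel_measurable M"
 shows "(%x. f x $ i)\<in>borel_measurable M"
 by (rule measurable_compose[OF assms borel_measurable_continuous_onI]) (intro continuous_intros)

lemma measurable_vec_lambda [measurable (raw)]:
 fixes f :: "'n::finite => 'a => real"
 assumes "!!i. f i\<in>borel_measurable M"
 shows "(%x. \<chi> i. f i x)\<in>borel_measurable M"
 by (rule borel_measurable_euclidean_space[THEN iffD2])
   (use assms in \<open>auto simp: Basis_vec_def inner_axis\<close>)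

lemma measurable_matrix_vector [measurable (raw)]:
 fixes A :: "real^'n^'m::finite" and f :: "'a => real^'n::finite"
 assumes "f\<in>borel_measurable M"
 shows "(%x. A *v f x)\<in>borel_measurable M"
 by (rule measurable_compose[OF assms borel_measurable_continuous_onI]) (intro continuous_intros)

interpretation lborel_product: product_sigma_finite "%_::'i. lborel :: real measure"
 by standard

text \<open>Both measures give a box its volume. The identification makes Fubini available one
  coordinate at a time.\<close>

lemma lborel_vec_eq:
 "(lborel :: (real^'n::finite) measure) = distr (\<Pi>\<^sub>M i\<in>UNIV. lborel) borel (%f. \<chi> i. f i)"
proof (rule lborel_eqI)
 fix l u :: "real^'n" assume le: "!!b. b\<in>Basis ==> l \<bullet> b <= u \<bullet> b"
 have lu: "l $ i <= u $ i" for i using le[of "axis i 1"] by (simp add: inner_axis)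
 have [measurable]: "(%f. \<chi> i. f i)\<in>(\<Pi>\<^sub>M i\<in>UNIV. lborel) \<rightarrow>\<^sub>M (borel :: (real^'n) measure)"
  by (intro measurable_vec_lambda) measurable
 have "(%f. \<chi> i. f i) -` box l u \<inter> space (\<Pi>\<^sub>M i\<in>UNIV. lborel :: real measure) = (\<Pi>\<^sub>E i\<in>UNIV. {l $ i<..<u $ i})"
  by (auto simp: space_PiM mem_box_cart PiE_def Pi_def)
 then have "emeasure (distr (\<Pi>\<^sub>M i\<in>UNIV. lborel) borel (%f. \<chi> i. f i)) (box l u) =
   (\<Prod>i\<in>UNIV. emeasure lborel {l $ i<..<u $ i})"
  by (simp add: emeasure_distr lborel_product.emeasure_PiM)
 also have "... = (\<Prod>i\<in>UNIV. ennreal (u $ i - l $ i))" using lu by simp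
 also have "... = ennreal (\<Prod>b\<in>Basis. (u - l) \<bullet> b)"
  using lu by (simp add: prod_ennreal Basis_vec_def UNION_singleton_eq_range prod.reindex axis_eq_axis inj_on_def inner_axis)
 finally show "emeasure (distr (\<Pi>\<^sub>M i\<in>UNIV. lborel) borel (%f. \<chi> i. f i)) (box l u) =
   ennreal (\<Prod>b\<in>Basis. (u - l) \<bullet> b)" .
qed simp

lemma
 fixes g :: "'n::finite => real => 'a::{real_normed_field,banach,second_countable_topology}"
 assumes "!!i. integrable lborel (g i)"
 shows integrable_lborel_vec_prod: "integrable lborel (%x::real^'n. \<Prod>i\<in>UNIV. g i (x $ i))"
  and integral_lborel_vec_prod: "(LBINT x. (\<Prod>i\<in>UNIV. g i ((x::real^'n) $ i))) = (\<Prod>i\<in>UNIV. integral\<^sup>L lborel (g i))"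
proof -
 have [measurable]: "(%f. \<chi> i. f i)\<in>(\<Pi>\<^sub>M i\<in>UNIV. lborel) \<rightarrow>\<^sub>M (borel :: (real^'n) measure)"
  by (intro measurable_vec_lambda) measurable
 have [measurable]: "g i\<in>borel_fun" for i
  using assms[of i] by (simp add: borel_measurable_integrable)
 have [measurable]: "(%x::real^'n. \<Prod>i\<in>UNIV. g i (x $ i))\<in>borel_fun"
  by measurable
 show "integrable lborel (%x::real^'n. \<Prod>i\<in>UNIV. g i (x $ i))"
  unfolding lborel_vec_eq
  by (subst integrable_distr_eq) (auto intro: lborel_product.product_integrable_prod assms)
 show "(LBINT x. (\<Prod>i\<in>UNIV. g i ((x::real^'n) $ i))) = (\<Prod>i\<in>UNIV. integral\<^sup>L lborel (g i))"
  unfolding lborel_vec_eq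
  by (subst integral_distr) (auto intro: lborel_product.product_integral_prod assms)
qed

lemma nn_integral_lborel_coordinate:
 fixes F :: "real^'n::finite => ennreal"
 assumes [measurable]: "F\<in>borel_fun"
 shows "(\<integral>\<^sup>+x. F x \<partial>lborel) = (\<integral>\<^sup>+x. \<integral>\<^sup>+y. F (\<chi> i. if i = m then y else x i) \<partial>lborel \<partial>(\<Pi>\<^sub>M i\<in>UNIV - {m}. lborel))"
proof -
 have [measurable]: "(%f. \<chi> i. f i)\<in>(\<Pi>\<^sub>M i\<in>UNIV. lborel) \<rightarrow>\<^sub>M (borel :: (real^'n) measure)"
  by (intro measurable_vec_lambda) measurable
 have "(\<integral>\<^sup>+x. F x \<partial>lborel) = (\<integral>\<^sup>+x. F (\<chi> i. x i) \<partial>(\<Pi>\<^sub>M i\<in>UNIV. lborel))"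
  unfolding lborel_vec_eq by (subst nn_integral_distr) auto
 also have "... = (\<integral>\<^sup>+x. F (\<chi> i. x i) \<partial>(\<Pi>\<^sub>M i\<in>insert m (UNIV - {m}). lborel))"
  by (simp add: insert_absorb)
 also have "... = (\<integral>\<^sup>+x. \<integral>\<^sup>+y. F (\<chi> i. (x(m := y)) i) \<partial>lborel \<partial>(\<Pi>\<^sub>M i\<in>UNIV - {m}. lborel))"
  by (rule lborel_product.product_nn_integral_insert) (auto simp: insert_absorb)
 finally show ?thesis by (simp add: fun_upd_def)
qed

lemma nn_integral_lborel_translate:
 fixes F :: "'a::euclidean_space => ennreal"
 assumes "F\<in>borel_fun"
 shows "(\<integral>\<^sup>+x. F (x + c) \<partial>lborel) = (\<integral>\<^sup>+x. F x \<partial>lborel)"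
 using nn_integral_distr[of "(+) c" lborel borel F] assms
 by (simp add: lborel_distr_plus add.commute)

lemma axis_nth_if: "axis i (1::real) $ j = (if j = i then 1 else 0)"
 by (simp add: axis_def)

lemma sum_Basis_vec:
 fixes h :: "real^'n::finite => 'a::comm_monoid_add"
 shows "(\<Sum>b\<in>Basis. h b) = (\<Sum>i\<in>UNIV. h (axis i 1))"
proof -
 have "(Basis :: (real^'n) set) = range (%i. axis i 1)" by (auto simp: Basis_vec_def)
 then have "sum h Basis = sum h (range (%i. axis i 1))" by (rule arg_cong)
 then show ?thesis by (simp add: sum.reindex inj_on_def axis_eq_axis)
qed

text \<open>The formula is stable under products, so elementary matrices suffice. A zero row
  contradicts the determinant hypothesis, a diagonal matrix is the affine formula, a transposition
  maps boxes to boxes, and a shear is a translation in one coordinate with the others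
  frozen.\<close>

lemma nn_integral_lborel_matrix:
 fixes A :: "real^'n^'n::finite"
 assumes "det A ~= 0" "F\<in>borel_fun"
 shows "ennreal \<bar>det A\<bar>*(\<integral>\<^sup>+x. F (A *v x) \<partial>lborel) = (\<integral>\<^sup>+x. F x \<partial>lborel)"
proof -
 define P where "P A \<longleftrightarrow> (det A ~= 0 --> (\<forall>F\<in>borel_fun.
   ennreal \<bar>det A\<bar>*(\<integral>\<^sup>+x. F (A *v x) \<partial>lborel) = (\<integral>\<^sup>+x. F x \<partial>lborel)))" for A :: "real^'n^'n"
 have "P A"
 proof (rule induct_matrix_elementary_alt)
  fix A B assume PA: "P A" and PB: "P B"
  show "P (A ** B)" unfolding P_def
  proof (intro impI ballI)
   fix F :: "real^'n => ennreal"
   assume d: "det (A ** B) ~= 0" and [measurable]: "F\<in>borel_fun"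
   then have dA: "det A ~= 0" and dB: "det B ~= 0" by (auto simp: det_mul)
   have "ennreal \<bar>det (A ** B)\<bar>*(\<integral>\<^sup>+x. F ((A ** B) *v x) \<partial>lborel) =
    ennreal \<bar>det A\<bar>*(ennreal \<bar>det B\<bar>*(\<integral>\<^sup>+x. F (A *v (B *v x)) \<partial>lborel))"
    by (simp add: det_mul abs_mult ennreal_mult mult.assoc matrix_vector_mul_assoc)
   also have "ennreal \<bar>det B\<bar>*(\<integral>\<^sup>+x. F (A *v (B *v x)) \<partial>lborel) = (\<integral>\<^sup>+x. F (A *v x) \<partial>lborel)"
    by (rule PB[unfolded P_def, rule_format, OF dB, of "%x. F (A *v x)"]) measurable
   also have "ennreal \<bar>det A\<bar>*(\<integral>\<^sup>+x. F (A *v x) \<partial>lborel) = (\<integral>\<^sup>+x. F x \<partial>lborel)"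
    by (rule PA[unfolded P_def, rule_format, OF dA]) measurable
   finally show "ennreal \<bar>det (A ** B)\<bar>*(\<integral>\<^sup>+x. F ((A ** B) *v x) \<partial>lborel) = (\<integral>\<^sup>+x. F x \<partial>lborel)" .
  qed
 next
  fix A :: "real^'n^'n" and i assume "row i A = 0"
  then show "P A" by (simp add: P_def det_zero_row(2))
 next
  fix A :: "real^'n^'n" assume diag: "!!i j. i ~= j ==> A $ i $ j = 0"
  show "P A" unfolding P_def
  proof (intro impI ballI)
   fix F :: "real^'n => ennreal"
   assume d: "det A ~= 0" and [measurable]: "F\<in>borel_fun"
   have det: "det A = (\<Prod>i\<in>UNIV. A $ i $ i)" by (rule det_diagonal) (rule diag)
   then have nz: "A $ i $ i ~= 0" for i using d by auto
   define c where "c b = A $ (THE i. b = axis i 1) $ (THE i. b = axis i 1)" for b :: "real^'n"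
   have c: "c (axis i 1) = A $ i $ i" for i by (simp add: c_def axis_eq_axis)
   have c0: "c b ~= 0" if "b\<in>Basis" for b using that nz by (auto simp: Basis_vec_def c)
   have A: "A *v x = 0 + (\<Sum>j\<in>Basis. (c j*(x \<bullet> j)) *\<^sub>R j)" for x
   proof -
    have "(\<Sum>j\<in>UNIV. A $ i $ j*x $ j) = A $ i $ i*x $ i" for i
     by (subst sum.remove[of _ i]) (auto simp: diag)
    then show ?thesis
     by (simp add: vec_eq_iff matrix_vector_mult_def sum_Basis_vec c inner_axis axis_nth_if if_distrib cong: if_cong)
   qed
   have "(\<Prod>j\<in>Basis. \<bar>c j\<bar>) = \<bar>det A\<bar>"
    by (simp add: det abs_prod Basis_vec_def UNION_singleton_eq_range prod.reindex inj_on_def axis_eq_axis c)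
   then have "lborel = density (distr lborel borel (%x. A *v x)) (%_. ennreal \<bar>det A\<bar>)"
    using lborel_affine_euclidean[of c 0] c0 by (simp add: A)
   then have "(\<integral>\<^sup>+x. F x \<partial>lborel) = (\<integral>\<^sup>+x. F x \<partial>density (distr lborel borel (%x. A *v x)) (%_. ennreal \<bar>det A\<bar>))"
    by simp
   also have "... = ennreal \<bar>det A\<bar>*(\<integral>\<^sup>+x. F (A *v x) \<partial>lborel)"
    by (simp add: nn_integral_density nn_integral_distr nn_integral_cmult)
   finally show "ennreal \<bar>det A\<bar>*(\<integral>\<^sup>+x. F (A *v x) \<partial>lborel) = (\<integral>\<^sup>+x. F x \<partial>lborel)" by simp
  qed
 next
  fix m n :: 'n assume mn: "m ~= n"
  let ?S = "(\<chi> i j. mat 1 $ i $ Transposition.transpose m n j) :: real^'n^'n"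
  have S: "?S *v x = (\<chi> i. x $ Transposition.transpose m n i)" for x
  proof -
   have "(\<Sum>j\<in>UNIV. mat 1 $ i $ Transposition.transpose m n j*x $ j) = x $ Transposition.transpose m n i" for i
   proof -
    have "(\<Sum>j\<in>UNIV. mat 1 $ i $ Transposition.transpose m n j*x $ j) =
     (\<Sum>j\<in>UNIV. (if j = Transposition.transpose m n i then x $ j else 0))"
     by (rule sum.cong) (auto simp: mat_def)
    then show ?thesis by simp
   qed
   then show ?thesis by (simp add: vec_eq_iff matrix_vector_mult_def)
  qed
  have det: "\<bar>det ?S\<bar> = 1"
  proof -
   have "det ?S = of_int (sign (Transposition.transpose m n))*det (mat 1 :: real^'n^'n)"
    by (rule det_permute_columns) (simp add: permutes_swap_id)
   then show ?thesis using mn by (simp add: sign_swap_id)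
  qed
  have distr: "lborel = distr lborel borel ((*v) ?S)"
  proof (rule lborel_eqI)
   fix l u :: "real^'n" assume le: "!!b. b\<in>Basis ==> l \<bullet> b <= u \<bullet> b"
   have lu: "l $ i <= u $ i" for i using le[of "axis i 1"] by (simp add: inner_axis)
   let ?t = "%x. (\<chi> i. x $ Transposition.transpose m n i) :: real^'n"
   have "(*v) ?S -` box l u \<inter> space lborel = box (?t l) (?t u)"
   proof -
    have "(\<forall>i. l $ i < x $ Transposition.transpose m n i \<and> x $ Transposition.transpose m n i < u $ i) \<longleftrightarrow>
     (\<forall>i. l $ Transposition.transpose m n i < x $ i \<and> x $ i < u $ Transposition.transpose m n i)" (is "?L \<longleftrightarrow> ?R")
     for x :: "real^'n"
    proof
     show ?R if ?L
     proof
      fix i show "l $ Transposition.transpose m n i < x $ i \<and> x $ i < u $ Transposition.transpose m n i"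
       using that[rule_format, of "Transposition.transpose m n i"] by simp
     qed
     show ?L if ?R
     proof
      fix i show "l $ i < x $ Transposition.transpose m n i \<and> x $ Transposition.transpose m n i < u $ i"
       using that[rule_format, of "Transposition.transpose m n i"] by simp
     qed
    qed
    then show ?thesis by (simp add: S mem_box_cart set_eq_iff)
   qed
   then have "emeasure (distr lborel borel ((*v) ?S)) (box l u) = emeasure lborel (box (?t l) (?t u))"
    by (simp add: emeasure_distr)
   also have "... = ennreal (\<Prod>b\<in>Basis. (?t u - ?t l) \<bullet> b)"
    by (rule emeasure_lborel_box) (auto simp: Basis_vec_def inner_axis lu)
   also have "(\<Prod>b\<in>Basis. (?t u - ?t l) \<bullet> b) = (\<Prod>i\<in>UNIV. (u - l) $ Transposition.transpose m n i)"
    by (simp add: Basis_vec_def UNION_singleton_eq_range prod.reindex inj_on_def axis_eq_axis inner_axis)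
   also have "... = (\<Prod>i\<in>UNIV. (u - l) $ i)"
    by (rule prod.permute[symmetric, unfolded o_def]) (simp add: permutes_swap_id)
   also have "... = (\<Prod>b\<in>Basis. (u - l) \<bullet> b)"
    by (simp add: Basis_vec_def UNION_singleton_eq_range prod.reindex inj_on_def axis_eq_axis inner_axis)
   finally show "emeasure (distr lborel borel ((*v) ?S)) (box l u) = ennreal (\<Prod>b\<in>Basis. (u - l) \<bullet> b)" .
  qed simp
  have "(\<integral>\<^sup>+x. F (?S *v x) \<partial>lborel) = (\<integral>\<^sup>+x. F x \<partial>lborel)"
   if F: "F\<in>borel_fun" for F
  proof -
   have "(\<integral>\<^sup>+x. F (?S *v x) \<partial>lborel) = (\<integral>\<^sup>+x. F x \<partial>distr lborel borel ((*v) ?S))"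
    by (rule nn_integral_distr[symmetric]) (use F in auto)
   also have "... = (\<integral>\<^sup>+x. F x \<partial>lborel)" by (rule arg_cong[OF distr[symmetric]])
   finally show ?thesis .
  qed
  then show "P ?S" unfolding P_def det by simp
 next
  fix m n :: 'n assume mn: "m ~= n"
  let ?S = "(\<chi> i j. of_bool (i = m \<and> j = n \<or> i = j)) :: real^'n^'n"
  have S: "?S *v x = (\<chi> i. if i = m then x $ m + x $ n else x $ i)" for x
  proof -
   have "(\<Sum>j\<in>UNIV. of_bool (i = m \<and> j = n \<or> i = j)*x $ j) = (if i = m then x $ m + x $ n else x $ i)" for i
   proof -
    have "(\<Sum>j\<in>UNIV. of_bool (i = m \<and> j = n \<or> i = j)*x $ j) =
      (\<Sum>j\<in>UNIV. (if j = i then x $ j else 0) + (if j = n then (if i = m then x $ j else 0) else 0))"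
     by (rule sum.cong) (use mn in auto)
    then show ?thesis by (simp add: sum.distrib)
   qed
   then show ?thesis by (simp add: vec_eq_iff matrix_vector_mult_def)
  qed
  have det: "det ?S = 1"
  proof -
   have "?S = (\<chi> k. if k = m then row m (mat 1) + 1 *s row n (mat 1) else row k (mat 1 :: real^'n^'n))"
    using mn by (auto simp: vec_eq_iff row_def mat_def)
   then show ?thesis using det_row_operation[OF mn, of "mat 1" 1] by simp
  qed
  have "(\<integral>\<^sup>+x. F (?S *v x) \<partial>lborel) = (\<integral>\<^sup>+x. F x \<partial>lborel)"
   if [measurable]: "F\<in>borel_fun" for F
  proof -
   have "(\<integral>\<^sup>+x. F (?S *v x) \<partial>lborel) =
    (\<integral>\<^sup>+x. \<integral>\<^sup>+y. F (?S *v (\<chi> i. if i = m then y else x i)) \<partial>lborel \<partial>(\<Pi>\<^sub>M i\<in>UNIV - {m}. lborel))"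
    by (rule nn_integral_lborel_coordinate) measurable
   also have "... = (\<integral>\<^sup>+x. \<integral>\<^sup>+y. F (\<chi> i. if i = m then y + x n else x i) \<partial>lborel \<partial>(\<Pi>\<^sub>M i\<in>UNIV - {m}. lborel))"
    using mn by (intro nn_integral_cong arg_cong[of _ _ F]) (unfold S, auto simp: vec_eq_iff)
   also have "... = (\<integral>\<^sup>+x. \<integral>\<^sup>+y. F (\<chi> i. if i = m then y else x i) \<partial>lborel \<partial>(\<Pi>\<^sub>M i\<in>UNIV - {m}. lborel))"
   proof (rule nn_integral_cong)
    fix x :: "'n => real"
    have "(%y. F (\<chi> i. if i = m then y else x i))\<in>borel_fun" by measurable
    from nn_integral_lborel_translate[OF this, of "x n"]
    show "(\<integral>\<^sup>+y. F (\<chi> i. if i = m then y + x n else x i) \<partial>lborel) = (\<integral>\<^sup>+y. F (\<chi> i. if i = m then y else x i) \<partial>lborel)" .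
   qed
   also have "... = (\<integral>\<^sup>+x. F x \<partial>lborel)"
    by (rule nn_integral_lborel_coordinate[symmetric]) measurable
   finally show ?thesis .
  qed
  then show "P ?S" unfolding P_def det by simp
 qed
 then show ?thesis using assms unfolding P_def by blast
qed

lemma lborel_distr_matrix:
 fixes A :: "real^'n^'n::finite"
 assumes "det A ~= 0"
 shows "distr lborel borel ((*v) A) = density lborel (%_. ennreal (1/\<bar>det A\<bar>))"
proof (rule measure_eqI)
 fix X assume "X\<in>sets (distr lborel borel ((*v) A))"
 then have [measurable]: "X\<in>sets borel" by simp
 have e: "emeasure (distr lborel borel ((*v) A)) X = (\<integral>\<^sup>+x. indicator X (A *v x) \<partial>lborel)"
  by (subst nn_integral_indicator[symmetric]) (auto simp: nn_integral_distr simp del: nn_integral_indicator)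
 have "emeasure (density lborel (%_. ennreal (1/\<bar>det A\<bar>))) X = ennreal (1/\<bar>det A\<bar>)*(\<integral>\<^sup>+x. indicator X x \<partial>lborel)"
  by (simp add: emeasure_density nn_integral_cmult)
 also have "... = (ennreal (1/\<bar>det A\<bar>)*ennreal \<bar>det A\<bar>)*(\<integral>\<^sup>+x. indicator X (A *v x) \<partial>lborel)"
  using nn_integral_lborel_matrix[OF assms, of "indicator X"] by (simp add: mult.assoc)
 also have "ennreal (1/\<bar>det A\<bar>)*ennreal \<bar>det A\<bar> = 1"
  using assms by (simp flip: ennreal_mult)
 finally show "emeasure (distr lborel borel ((*v) A)) X = emeasure (density lborel (%_. ennreal (1/\<bar>det A\<bar>))) X"
  by (simp add: e)
qed simp

lemma
 fixes A :: "real^'n^'n::finite" and F :: "real^'n => 'a::{banach,second_countable_topology}"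
 assumes d: "det A ~= 0" and [measurable]: "F\<in>borel_fun"
 shows integrable_lborel_matrix: "integrable lborel (%x. F (A *v x)) \<longleftrightarrow> integrable lborel F"
  and integral_lborel_matrix: "(LBINT x. F (A *v x)) = (1/\<bar>det A\<bar>) *\<^sub>R (LBINT x. F x)"
proof -
 have "integrable lborel (%x. F (A *v x)) \<longleftrightarrow> integrable (distr lborel borel ((*v) A)) F"
  by (subst integrable_distr_eq) auto
 also have "... \<longleftrightarrow> integrable lborel (%x. (1/\<bar>det A\<bar>) *\<^sub>R F x)"
  unfolding lborel_distr_matrix[OF d] by (subst integrable_density) auto
 also have "... \<longleftrightarrow> integrable lborel F"
  using d integrable_scaleR_right[of "\<bar>det A\<bar>" lborel "%x. (1/\<bar>det A\<bar>) *\<^sub>R F x"] by auto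
 finally show "integrable lborel (%x. F (A *v x)) \<longleftrightarrow> integrable lborel F" .
 have "(LBINT x. F (A *v x)) = integral\<^sup>L (distr lborel borel ((*v) A)) F"
  by (subst integral_distr) auto
 also have "... = (LBINT x. (1/\<bar>det A\<bar>) *\<^sub>R F x)"
  unfolding lborel_distr_matrix[OF d] by (subst integral_density) auto
 finally show "(LBINT x. F (A *v x)) = (1/\<bar>det A\<bar>) *\<^sub>R (LBINT x. F x)" by simp
qed

lemma
 fixes F :: "'b::euclidean_space => 'a::{banach,second_countable_topology}"
 assumes [measurable]: "F\<in>borel_fun"
 shows integrable_lborel_translate: "integrable lborel (%x. F (x + c)) \<longleftrightarrow> integrable lborel F"
  and integral_lborel_translate: "(LBINT x. F (x + c)) = (LBINT x. F x)"
proof -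
 have "integrable (distr lborel borel ((+) c)) F \<longleftrightarrow> integrable lborel (%x. F (c + x))"
  by (rule integrable_distr_eq) auto
 then show "integrable lborel (%x. F (x + c)) \<longleftrightarrow> integrable lborel F"
  by (simp add: lborel_distr_plus add.commute)
 have "integral\<^sup>L (distr lborel borel ((+) c)) F = (LBINT x. F (c + x))"
  by (rule integral_distr) auto
 then show "(LBINT x. F (x + c)) = (LBINT x. F x)"
  by (simp add: lborel_distr_plus add.commute)
qed

section \<open>Integer translates\<close>

text \<open>Twice the dimension is the exponent for which the product of the integrable functions
  1/(1 + x_i^2) dominates.\<close>

definition decay :: "real^'n::finite => real" where
 "decay x = inverse ((1 + norm x) ^ (2*CARD('n)))"

lemma decay_pos: "0 < decay x" by (simp add: decay_def add_pos_nonneg)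
lemma decay_nonneg [simp]: "0 <= decay x" using decay_pos[of x] by simp

lemma decay_measurable [measurable]: "decay\<in>borel_fun"
 unfolding decay_def[abs_def] by measurable

lemma decay_compare:
 fixes x y :: "real^'n::finite"
 assumes "1 + norm y <= c*(1 + norm x)" "0 <= c"
 shows "decay x <= c ^ (2*CARD('n))*decay y"
proof -
 have "(1 + norm y) ^ (2*CARD('n)) <= (c*(1 + norm x)) ^ (2*CARD('n))"
  using assms by (intro power_mono) auto
 then have "inverse ((1 + norm x) ^ (2*CARD('n))) <= c ^ (2*CARD('n))*inverse ((1 + norm y) ^ (2*CARD('n)))"
  unfolding power_mult_distrib by (simp add: divide_simps add_pos_nonneg mult.commute)
 then show ?thesis by (simp add: decay_def)
qed

lemma integrable_decay: "integrable lborel (decay :: real^'n::finite => real)"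
proof -
 have "integrable lborel (%x::real^'n. \<Prod>i\<in>UNIV. inverse (1 + (x $ i)^2))"
  by (rule integrable_lborel_vec_prod)
    (use integrable_inverse_1_plus_square in \<open>simp add: set_integrable_def\<close>)
 then show ?thesis
 proof (rule integrable_bound_fun)
  show "AE x::real^'n in lborel. norm (decay x) <= norm (\<Prod>i\<in>UNIV. inverse (1 + (x $ i)^2))"
  proof (rule AE_I2)
   fix x :: "real^'n"
   have "(\<Prod>i\<in>UNIV. 1 + (x $ i)^2) <= (\<Prod>i\<in>(UNIV::'n set). (1 + norm x)^2)"
   proof (intro prod_mono conjI)
    fix i
    have "(x $ i)^2 <= (norm x)^2" using component_le_norm_cart[of x i] by (simp add: abs_le_square_iff[symmetric])
    then show "1 + (x $ i)^2 <= (1 + norm x)^2" using norm_ge_zero[of x] by (simp add: power2_sum del: norm_ge_zero)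
   qed simp
   also have "... = (1 + norm x) ^ (2*CARD('n))" by (simp add: power_mult)
   finally have "(\<Prod>i\<in>UNIV. 1 + (x $ i)^2) <= (1 + norm x) ^ (2*CARD('n))" .
   moreover have "0 < (\<Prod>i\<in>UNIV. 1 + (x $ i)^2)" by (intro prod_pos) (simp add: add_pos_nonneg)
   ultimately show "norm (decay x) <= norm (\<Prod>i\<in>UNIV. inverse (1 + (x $ i)^2))"
    unfolding decay_def using prod_inversef[of "%i. 1 + (x $ i)^2" UNIV]
    by (simp add: o_def abs_prod le_imp_inverse_le)
  qed
 qed measurable
qed

lemma vec_of_int_add [simp]: "vec_of_int (k + l) = vec_of_int k + vec_of_int l"
 by (simp add: vec_of_int_def vec_eq_iff)
lemma vec_of_int_minus [simp]: "vec_of_int (- k) = - vec_of_int k"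
 by (simp add: vec_of_int_def vec_eq_iff)
lemma vec_of_int_diff [simp]: "vec_of_int (k - l) = vec_of_int k - vec_of_int l"
 by (simp add: vec_of_int_def vec_eq_iff)
lemma vec_of_int_zero [simp]: "vec_of_int 0 = 0"
 by (simp add: vec_of_int_def vec_eq_iff)
lemma vec_of_int_eq [simp]: "vec_of_int k = vec_of_int l \<longleftrightarrow> k = l"
 by (simp add: vec_of_int_def vec_eq_iff)
lemma vec_of_int_nth [simp]: "vec_of_int k $ i = of_int (k $ i)"
 by (simp add: vec_of_int_def)

definition unit_cube :: "(real^'n::finite) set" where
 "unit_cube = {x. \<forall>i. 0 <= x $ i \<and> x $ i < 1}"

lemma unit_cube_measurable [measurable]: "unit_cube\<in>sets borel"
 unfolding unit_cube_def by measurable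

lemma norm_unit_cube: "x\<in>unit_cube ==> norm (x :: real^'n::finite) <= CARD('n)"
proof -
 assume "x\<in>unit_cube"
 then have "(\<Sum>i\<in>UNIV. \<bar>x $ i\<bar>) <= (\<Sum>i\<in>(UNIV::'n set). 1)"
  by (intro sum_mono) (auto simp: unit_cube_def less_imp_le)
 then show ?thesis using norm_le_l1_cart[of x] by simp
qed

lemma emeasure_unit_cube: "emeasure lborel (unit_cube :: (real^'n::finite) set) = 1"
proof -
 have eq: "indicator unit_cube x = (\<Prod>i\<in>UNIV. indicator {0..<1} (x $ i) :: real)" for x :: "real^'n"
  by (auto simp: unit_cube_def indicator_def prod_eq_1_iff intro!: prod.neutral)
 have i: "integrable lborel (%t::real. indicator {0..<1} t :: real)"
  by (intro integrable_real_indicator) auto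
 have int: "integrable lborel (%x::real^'n. indicator unit_cube x :: real)"
  unfolding eq by (rule integrable_lborel_vec_prod) (rule i)
 have "(LBINT x. indicator (unit_cube :: (real^'n) set) x :: real) = 1"
  unfolding eq by (subst integral_lborel_vec_prod) (use i in auto)
 moreover have "(\<integral>\<^sup>+x. ennreal (indicator (unit_cube :: (real^'n) set) x) \<partial>lborel) = ennreal (LBINT x. indicator (unit_cube :: (real^'n) set) x)"
  by (rule nn_integral_eq_integral[OF int]) simp
 ultimately show ?thesis by (simp add: ennreal_indicator)
qed

lemma unit_cube_translate_iff: "x - vec_of_int l\<in>unit_cube \<longleftrightarrow> l = (\<chi> i. \<lfloor>x $ i\<rfloor>)"
proof
 assume "x - vec_of_int l\<in>unit_cube"
 then have "\<lfloor>x $ i\<rfloor> = l $ i" for i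
  by (intro floor_unique) (auto simp: unit_cube_def algebra_simps dest: spec[of _ i])
 then show "l = (\<chi> i. \<lfloor>x $ i\<rfloor>)" by (simp add: vec_eq_iff)
next
 assume l: "l = (\<chi> i. \<lfloor>x $ i\<rfloor>)"
 show "x - vec_of_int l\<in>unit_cube" unfolding unit_cube_def l
  by (auto, linarith+)
qed

lemma measurable_count_space_pair:
 assumes "!!l::'i::countable. f l\<in>borel_measurable M"
 shows "case_prod f\<in>borel_measurable (count_space UNIV \<Otimes>\<^sub>M M)"
 by (rule measurable_pair_measure_countable1) (use assms in auto)

lemma borel_measurable_nn_integral_count [measurable (raw)]:
 fixes f :: "'i::countable => 'a => ennreal"
 assumes "!!l. f l\<in>borel_measurable M"
 shows "(%x. nsum (%l. f l x))\<in>borel_measurable M"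
proof (rule sigma_finite_measure.borel_measurable_nn_integral)
 show "sigma_finite_measure (count_space (UNIV :: 'i set))"
  by (rule sigma_finite_measure_count_space_countable) auto
 show "(%(x, l). f l x)\<in>borel_measurable (M \<Otimes>\<^sub>M count_space UNIV)"
  using measurable_pair_swap[OF measurable_count_space_pair[of f M, OF assms]] by simp
qed

lemma borel_measurable_lebesgue_integral_count [measurable (raw)]:
 fixes f :: "'i::countable => 'a => 'b::{banach,second_countable_topology}"
 assumes "!!l. f l\<in>borel_measurable M"
 shows "(%x. LINT l|count_space UNIV. f l x)\<in>borel_measurable M"
proof (rule sigma_finite_measure.borel_measurable_lebesgue_integral)
 show "sigma_finite_measure (count_space (UNIV :: 'i set))"
  by (rule sigma_finite_measure_count_space_countable) auto
 show "(%(x, l). f l x)\<in>borel_measurable (M \<Otimes>\<^sub>M count_space UNIV)"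
  using measurable_pair_swap[OF measurable_count_space_pair[of f M, OF assms]] by simp
qed

text \<open>Every point lies in exactly one integer translate of the half-open cube; Tonelli and
  translation invariance do the rest.\<close>

lemma nn_integral_periodize:
 fixes F :: "real^'n::finite => ennreal"
 assumes [measurable]: "F\<in>borel_fun"
 shows "(\<integral>\<^sup>+x. F x \<partial>lborel) = (\<integral>\<^sup>+x. indicator unit_cube x*(nsum (%l. F (x + vec_of_int l))) \<partial>lborel)"
proof -
 have one: "(nsum (%l. F x*indicator unit_cube (x - vec_of_int l))) = F x" for x
 proof -
  let ?l = "(\<chi> i. \<lfloor>x $ i\<rfloor>) :: int^'n"
  have "(nsum (%l. F x*indicator unit_cube (x - vec_of_int l))) =
   (\<Sum>l\<in>{?l}. F x*indicator unit_cube (x - vec_of_int l))"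
   by (rule nn_integral_count_space') (auto simp: unit_cube_translate_iff indicator_def)
  then show ?thesis using unit_cube_translate_iff[of x ?l] by simp
 qed
 have "(\<integral>\<^sup>+x. F x \<partial>lborel) = (\<integral>\<^sup>+x. nsum (%l. F x*indicator unit_cube (x - vec_of_int l)) \<partial>lborel)"
  by (simp add: one)
 also have "... = (\<integral>\<^sup>+l. \<integral>\<^sup>+x. F x*indicator unit_cube (x - vec_of_int l) \<partial>lborel \<partial>count_space UNIV)"
  by (intro nn_integral_count_space_nn_integral) auto
 also have "... = (\<integral>\<^sup>+l. \<integral>\<^sup>+x. F (x + vec_of_int l)*indicator unit_cube x \<partial>lborel \<partial>count_space UNIV)"
 proof (rule nn_integral_cong)
  fix l :: "int^'n"
  show "(\<integral>\<^sup>+x. F x*indicator unit_cube (x - vec_of_int l) \<partial>lborel) = (\<integral>\<^sup>+x. F (x + vec_of_int l)*indicator unit_cube x \<partial>lborel)"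
   using nn_integral_lborel_translate[of "%x. F x*indicator unit_cube (x - vec_of_int l)" "vec_of_int l"] by simp
 qed
 also have "... = (\<integral>\<^sup>+x. nsum (%l. F (x + vec_of_int l)*indicator unit_cube x) \<partial>lborel)"
  by (intro nn_integral_count_space_nn_integral[symmetric]) auto
 also have "... = (\<integral>\<^sup>+x. indicator unit_cube x*(nsum (%l. F (x + vec_of_int l))) \<partial>lborel)"
  by (rule nn_integral_cong, subst nn_integral_multc) (simp_all add: mult.commute)
 finally show ?thesis .
qed

text \<open>In \<open>?H\<close> the cell moves, in \<open>?G\<close> the function does. For each l
  they are translates of one another, and both are absolutely integrable over lattice times space,
  so Fubini applies to both.\<close>

lemma
 fixes F :: "real^'n::finite => 'a::{banach,second_countable_topology}"
 assumes F: "integrable lborel F"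
 shows AE_integrable_translates: "AE x in lborel. x\<in>unit_cube --> integrable (count_space UNIV) (%l. F (x + vec_of_int l))"
  and integrable_periodize: "integrable lborel (%x. indicator unit_cube x *\<^sub>R (LINT l|count_space UNIV. F (x + vec_of_int l)))"
  and integral_periodize: "(LBINT x. F x) = (LBINT x. indicator unit_cube x *\<^sub>R (LINT l|count_space UNIV. F (x + vec_of_int l)))"
proof -
 have [measurable]: "F\<in>borel_fun" using F by (simp add: borel_measurable_integrable)
 interpret pair_sigma_finite "count_space (UNIV :: (int^'n) set)" "lborel :: (real^'n) measure"
  by (intro pair_sigma_finite.intro sigma_finite_measure_count_space_countable sigma_finite_lborel) auto
 let ?G = "%l x. indicator unit_cube x *\<^sub>R F (x + vec_of_int l)"
 let ?H = "%l x. indicator unit_cube (x - vec_of_int l) *\<^sub>R F x"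
 have [measurable]: "case_prod ?G\<in>borel_measurable (count_space UNIV \<Otimes>\<^sub>M lborel)"
  "case_prod ?H\<in>borel_measurable (count_space UNIV \<Otimes>\<^sub>M lborel)"
  by (rule measurable_count_space_pair, measurable)+
 have fin: "(\<integral>\<^sup>+l. \<integral>\<^sup>+x. ennreal (norm (?G l x)) \<partial>lborel \<partial>count_space UNIV) < \<infinity>"
 proof -
  have "(\<integral>\<^sup>+l. \<integral>\<^sup>+x. ennreal (norm (?G l x)) \<partial>lborel \<partial>count_space UNIV) =
   (\<integral>\<^sup>+x. nsum (%l. indicator unit_cube x*ennreal (norm (F (x + vec_of_int l)))) \<partial>lborel)"
   by (subst nn_integral_count_space_nn_integral[symmetric])
     (auto simp: indicator_def intro!: nn_integral_cong)
  also have "... = (\<integral>\<^sup>+x. ennreal (norm (F x)) \<partial>lborel)"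
   by (subst (2) nn_integral_periodize) (auto simp: nn_integral_cmult)
  also have "... < \<infinity>" using F by (simp add: integrable_iff_bounded)
  finally show ?thesis .
 qed
 have eqGH: "(\<integral>\<^sup>+x. ennreal (norm (?H l x)) \<partial>lborel) = (\<integral>\<^sup>+x. ennreal (norm (?G l x)) \<partial>lborel)" for l
  using nn_integral_lborel_translate[of "%x. ennreal (norm (?H l x))" "vec_of_int l"] by simp
 have intG: "integrable (count_space UNIV \<Otimes>\<^sub>M lborel) (case_prod ?G)"
  by (rule integrableI_bounded) (use fin in \<open>simp_all add: lborel.nn_integral_fst[symmetric]\<close>)
 have intH: "integrable (count_space UNIV \<Otimes>\<^sub>M lborel) (case_prod ?H)"
  by (rule integrableI_bounded) (use fin eqGH in \<open>simp_all add: lborel.nn_integral_fst[symmetric]\<close>)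
 have G: "(LINT l|count_space UNIV. ?G l x) = indicator unit_cube x *\<^sub>R (LINT l|count_space UNIV. F (x + vec_of_int l))" for x
  by (cases "x\<in>unit_cube") auto
 have H: "(LINT l|count_space UNIV. ?H l x) = F x" for x
 proof -
  let ?l = "(\<chi> i. \<lfloor>x $ i\<rfloor>) :: int^'n"
  have "(LINT l|count_space UNIV. ?H l x) = (\<Sum>l\<in>{?l}. ?H l x)"
   by (rule lebesgue_integral_count_space_finite_support[THEN trans])
     (cases "F x = 0"; simp add: unit_cube_translate_iff indicator_def)+
  then show ?thesis using unit_cube_translate_iff[of x ?l] by simp
 qed
 show "AE x in lborel. x\<in>unit_cube --> integrable (count_space UNIV) (%l. F (x + vec_of_int l))"
  using AE_integrable_snd[OF intG] by eventually_elim auto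
 show "integrable lborel (%x. indicator unit_cube x *\<^sub>R (LINT l|count_space UNIV. F (x + vec_of_int l)))"
  using integrable_snd[OF intG] by (simp add: G)
 have "(LBINT x. F x) = (LBINT x. (LINT l|count_space UNIV. ?H l x))" by (simp add: H)
 also have "... = (LINT l|count_space UNIV. (LBINT x. ?H l x))" by (rule Fubini_integral[OF intH])
 also have "... = (LINT l|count_space UNIV. (LBINT x. ?G l x))"
  using integral_lborel_translate[of "%x. ?H l x" "vec_of_int l" for l] by simp
 also have "... = (LBINT x. (LINT l|count_space UNIV. ?G l x))" by (rule Fubini_integral[OF intG, symmetric])
 finally show "(LBINT x. F x) = (LBINT x. indicator unit_cube x *\<^sub>R (LINT l|count_space UNIV. F (x + vec_of_int l)))"
  by (simp add: G)
qed

text \<open>Each term is at most a constant times \<open>decay\<close> anywhere in the corresponding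
  unit cell after pulling back by \<open>B\<close>. Averaging over the cell turns the lattice sum
  into the integral of \<open>decay\<close>, whatever x and y are. The added 1 keeps the constant
  positive.\<close>

lemma lattice_sum_decay:
 fixes A B :: "real^'n^'n::finite"
 assumes AB: "B ** A = mat 1"
 obtains C where "0 < C" "!!x y. (nsum (%l. ennreal (decay (y - A *v (x + vec_of_int l))))) <= ennreal C"
proof -
 obtain K where K: "!!y. norm (B *v y) <= norm y*K" and K0: "0 < K"
  using bounded_linear.pos_bounded[OF matrix_vector_mul_bounded_linear[of B]] by blast
 have inv: "B *v (A *v x) = x" for x by (simp add: matrix_vector_mul_assoc AB)
 define c where "c = (1 + K)*(1 + CARD('n))"
 have c0: "0 < c" using K0 by (simp add: c_def add_pos_nonneg)
 have le: "decay (y - A *v (x + vec_of_int l)) <= c ^ (2*CARD('n))*decay ((x - B *v y) + z + vec_of_int l)"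
  if "z\<in>unit_cube" for x y z :: "real^'n" and l
 proof (rule decay_compare)
  let ?v = "y - A *v (x + vec_of_int l)"
  have "(x - B *v y) + z + vec_of_int l = z - B *v ?v"
   by (simp add: matrix_vector_mult_diff_distrib inv)
  then have "norm ((x - B *v y) + z + vec_of_int l) = norm (z - B *v ?v)" by (rule arg_cong)
  then have "norm ((x - B *v y) + z + vec_of_int l) <= CARD('n) + norm ?v*K"
   using norm_triangle_ineq4[of z "B *v ?v"] norm_unit_cube[OF that] K[of ?v] by linarith
  then have "1 + norm ((x - B *v y) + z + vec_of_int l) <= 1 + (CARD('n) + norm ?v*K)" by simp
  also have "... <= c*(1 + norm ?v)"
   using K0 unfolding c_def by (simp add: algebra_simps)
  finally show "1 + norm ((x - B *v y) + z + vec_of_int l) <= c*(1 + norm ?v)" .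
 qed (use c0 in simp)
 define I where "I = (LBINT x. decay (x :: real^'n))"
 have I: "(\<integral>\<^sup>+x. ennreal (decay (x :: real^'n)) \<partial>lborel) = ennreal I"
  unfolding I_def by (rule nn_integral_eq_integral[OF integrable_decay]) simp
 have I0: "0 <= I" unfolding I_def by simp
 have "(nsum (%l. ennreal (decay (y - A *v (x + vec_of_int l))))) <= ennreal (c ^ (2*CARD('n))*I + 1)" for x y
 proof -
  let ?S = "(nsum (%l. ennreal (decay (y - A *v (x + vec_of_int l)))))"
  have "?S = (\<integral>\<^sup>+z. indicator (unit_cube :: (real^'n) set) z*?S \<partial>lborel)"
   by (simp add: nn_integral_multc emeasure_unit_cube)
  also have "... <= (\<integral>\<^sup>+z. ennreal (c ^ (2*CARD('n)))*(indicator unit_cube z*(nsum (%l. ennreal (decay ((x - B *v y) + z + vec_of_int l))))) \<partial>lborel)"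
  proof (intro nn_integral_mono)
   fix z :: "real^'n"
   show "indicator unit_cube z*?S <= ennreal (c ^ (2*CARD('n)))*(indicator unit_cube z*(nsum (%l. ennreal (decay ((x - B *v y) + z + vec_of_int l)))))"
   proof (cases "z\<in>unit_cube")
    case True
    have "?S <= (nsum (%l. ennreal (c ^ (2*CARD('n)))*ennreal (decay ((x - B *v y) + z + vec_of_int l))))"
     using c0 le[OF True, of y x] by (intro nn_integral_mono) (simp flip: ennreal_mult add: ennreal_leI)
    then show ?thesis using True by (simp add: nn_integral_cmult)
   qed simp
  qed
  also have "... = ennreal (c ^ (2*CARD('n)))*(\<integral>\<^sup>+z. indicator unit_cube z*(nsum (%l. ennreal (decay (z + vec_of_int l + (x - B *v y))))) \<partial>lborel)"
   by (subst nn_integral_cmult) (simp_all add: algebra_simps)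
  also have "... = ennreal (c ^ (2*CARD('n)))*(\<integral>\<^sup>+z. ennreal (decay (z + (x - B *v y))) \<partial>lborel)"
   by (subst nn_integral_periodize[symmetric]) auto
  also have "... = ennreal (c ^ (2*CARD('n))*I)"
   using c0 I0 nn_integral_lborel_translate[of "%z. ennreal (decay (z :: real^'n))"]
   by (simp add: I ennreal_mult)
  also have "... <= ennreal (c ^ (2*CARD('n))*I + 1)" by (intro ennreal_leI) simp
  finally show ?thesis .
 qed
 moreover have "0 < c ^ (2*CARD('n))*I + 1" using c0 I0 by (simp add: add_nonneg_pos)
 ultimately show ?thesis by (rule that[rotated])
qed

section \<open>The Fourier transform on the Schwartz space\<close>

lemma measurable_character [measurable (raw)]:
 fixes f g :: "'a => real^'n::finite"
 assumes [measurable]: "f\<in>borel_measurable M" "g\<in>borel_measurable M"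
 shows "(%x. character (f x) (g x))\<in>borel_measurable M"
 unfolding character_def by measurable

lemma character_add_left: "character (k + l) x = character k x*character l x"
 by (simp add: character_def inner_add_left distrib_left exp_add)
lemma character_add_right: "character k (x + y) = character k x*character k y"
 by (simp add: character_def inner_add_right distrib_left exp_add)
lemma character_commute: "character k x = character x k"
 by (simp add: character_def inner_commute)
lemma character_minus: "character (- k) x = cnj (character k x)"
 by (simp add: character_def exp_cnj)
lemma character_minus_right: "character k (- x) = cnj (character k x)"
 by (simp add: character_def exp_cnj)
lemma character_zero [simp]: "character 0 x = 1" "character k 0 = 1"
 by (simp_all add: character_def)

lemma fourier_eq: "fourier f w = (LBINT x. character (- w) x*f x)"
 unfolding fourier_def character_def by (simp add: inner_commute mult.commute)

definition ifourier :: "(real^'n::finite => complex) => real^'n => complex" where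
 "ifourier f x = fourier f (- x)"

lemma ifourier_eq: "ifourier f x = (LBINT w. character x w*f w)"
 by (simp add: ifourier_def fourier_eq)

lemma rapid_decay_bound:
 assumes "rapid (f :: real^'n::finite => complex)"
 obtains C where "0 < C" "!!x. (1 + norm x) ^ N*norm (f x) <= C*decay x"
proof -
 obtain C where C: "!!x. (1 + norm x) ^ (N + 2*CARD('n))*norm (f x) <= C"
  using assms unfolding rapid_iff by blast
 show ?thesis
 proof (rule that[of "max C 1"])
  fix x :: "real^'n"
  have p: "0 < (1 + norm x) ^ (2*CARD('n))" by (simp add: add_pos_nonneg)
  have "(1 + norm x) ^ (2*CARD('n))*((1 + norm x) ^ N*norm (f x)) <= max C 1"
   using C[of x] by (simp add: power_add mult_ac)
  then show "(1 + norm x) ^ N*norm (f x) <= max C 1*decay x"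
   using p by (simp add: decay_def field_simps)
 qed simp
qed

lemma integrable_rapid:
 assumes "rapid f" and [measurable]: "f\<in>borel_fun"
 shows "integrable lborel (%x. (1 + norm x) ^ N*norm (f x))"
proof -
 obtain C where C: "0 < C" "!!x. (1 + norm x) ^ N*norm (f x) <= C*decay x"
  using rapid_decay_bound[OF assms(1)] by blast
 have "integrable lborel (%x. C*decay x)" by (intro integrable_mult_right integrable_decay)
 then show ?thesis
  by (rule integrable_bound_fun) (use C in \<open>auto simp: abs_mult\<close>)
qed

lemma integrable_schwartz_norm: "f\<in>schwartz ==> integrable lborel (%x. (1 + norm x) ^ N*norm (f x))"
 by (intro integrable_rapid schwartz_rapid schwartz_measurable)

lemma integrable_schwartz: "f\<in>schwartz ==> integrable lborel f"
 using integrable_schwartz_norm[of f 0] schwartz_measurable[of f]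
 by (simp add: integrable_norm_iff)

lemma norm_fourier_le: "norm (fourier f w) <= (LBINT x. norm (f x))"
proof -
 have "norm (fourier f w) <= (LBINT x. norm (character (- w) x*f x))"
  unfolding fourier_eq by (rule integral_norm_bound)
 then show ?thesis by (simp add: norm_mult)
qed

text \<open>This replaces integration by parts. Difference quotients have integral 0 by translation
  invariance, and the mean value inequality bounds them by a multiple of \<open>decay\<close>, so
  dominated convergence passes to the derivative.\<close>

lemma integral_partial_eq_0:
 assumes g: "g\<in>schwartz"
 shows "(LBINT x. partial i g x) = 0"
proof -
 define e where "e = (axis i 1 :: real^'a)"
 have ne: "norm e = 1" by (simp add: e_def)
 have [measurable]: "g\<in>borel_fun" "partial i g\<in>borel_fun"
  using g by (auto intro: schwartz_measurable schwartz_partial)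
 obtain C where C: "0 < C" "!!x. (1 + norm x) ^ 0*norm (partial i g x) <= C*decay x"
  using rapid_decay_bound[OF schwartz_rapid[OF schwartz_partial[OF g]]] by blast
 define t where "t n = 1/real (Suc n)" for n
 have t: "0 < t n" "t n <= 1" for n by (auto simp: t_def)
 have vd: "((%\<tau>. g (x + \<tau> *\<^sub>R e)) has_vector_derivative partial i g (x + \<tau> *\<^sub>R e)) (at \<tau> within S)" for x \<tau> S
 proof -
  obtain D where D: "(g has_derivative D) (at (x + \<tau> *\<^sub>R e))"
   using schwartz_differentiable[OF g] by (auto simp: differentiable_def)
  have "((%\<tau>. x + \<tau> *\<^sub>R e) has_derivative (%s. s *\<^sub>R e)) (at \<tau> within S)"
   by (auto intro!: derivative_eq_intros)
  from has_derivative_compose[OF this D]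
  have "((%\<tau>. g (x + \<tau> *\<^sub>R e)) has_derivative (%s. D (s *\<^sub>R e))) (at \<tau> within S)" .
  moreover have "D (s *\<^sub>R e) = s *\<^sub>R partial i g (x + \<tau> *\<^sub>R e)" for s
   using has_derivative_bounded_linear[OF D] partial_eq_derivative[OF D, of i]
   by (simp add: linear_simps e_def)
  ultimately show ?thesis by (simp add: has_vector_derivative_def)
 qed
 have "(%n. LBINT x. (1/t n) *\<^sub>R (g (x + t n *\<^sub>R e) - g x)) \<longlonglongrightarrow> (LBINT x. partial i g x)"
 proof (rule integral_dominated_convergence)
  show "integrable lborel (%x::real^'a. 2 ^ (2*CARD('a))*C*decay x)"
   by (intro integrable_mult_right integrable_decay)
  show "AE x in lborel. (%n. (1/t n) *\<^sub>R (g (x + t n *\<^sub>R e) - g x)) \<longlonglongrightarrow> partial i g x"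
  proof (rule AE_I2)
   fix x
   have "((%\<tau>. g (x + \<tau> *\<^sub>R e)) has_vector_derivative partial i g x) (at 0)"
    using vd[of x 0] by simp
   then have q: "((%h. norm (g (x + (0 + h) *\<^sub>R e) - g (x + 0 *\<^sub>R e) - h *\<^sub>R partial i g x)/norm h) \<longlongrightarrow> 0) (at 0)"
    unfolding has_vector_derivative_def has_derivative_at by blast
   moreover have "norm (g (x + (0 + h) *\<^sub>R e) - g (x + 0 *\<^sub>R e) - h *\<^sub>R partial i g x)/norm h =
     norm ((1/h) *\<^sub>R (g (x + h *\<^sub>R e) - g x) - partial i g x)" if "h ~= 0" for h
   proof -
    have "(1/h) *\<^sub>R (g (x + h *\<^sub>R e) - g x) - partial i g x = (1/h) *\<^sub>R (g (x + h *\<^sub>R e) - g x - h *\<^sub>R partial i g x)"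
     using that by (simp add: scaleR_right_diff_distrib)
    then show ?thesis by simp
   qed
   ultimately have "((%h. norm ((1/h) *\<^sub>R (g (x + h *\<^sub>R e) - g x) - partial i g x)) \<longlongrightarrow> 0) (at 0)"
    by (intro Lim_transform_eventually[OF q]) (simp add: eventually_at_filter)
   then have "((%h. (1/h) *\<^sub>R (g (x + h *\<^sub>R e) - g x)) \<longlongrightarrow> partial i g x) (at 0)"
    by (rule LIM_zero_cancel[OF tendsto_norm_zero_cancel])
   moreover have "filterlim t (at 0) sequentially"
   proof -
    have "t \<longlonglongrightarrow> 0" unfolding t_def[abs_def] by (rule LIMSEQ_inverse_real_of_nat[unfolded inverse_eq_divide])
    then show ?thesis unfolding filterlim_at by (simp add: less_imp_neq[OF t(1), symmetric])
   qed
   ultimately show "(%n. (1/t n) *\<^sub>R (g (x + t n *\<^sub>R e) - g x)) \<longlonglongrightarrow> partial i g x"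
    by (rule filterlim_compose)
  qed
  fix n
  show "AE x in lborel. norm ((1/t n) *\<^sub>R (g (x + t n *\<^sub>R e) - g x)) <= 2 ^ (2*CARD('a))*C*decay x"
  proof (rule AE_I2)
   fix x :: "real^'a"
   let ?B = "2 ^ (2*CARD('a))*C*decay x"
   have "norm (g (x + t n *\<^sub>R e) - g (x + 0 *\<^sub>R e)) <= ?B*norm (t n - 0)"
   proof (rule differentiable_bound[of "{0..1}" "%\<tau>. g (x + \<tau> *\<^sub>R e)" "%\<tau> h. h *\<^sub>R partial i g (x + \<tau> *\<^sub>R e)"])
    fix \<tau> :: real assume \<tau>: "\<tau>\<in>{0..1}"
    show "((%\<tau>. g (x + \<tau> *\<^sub>R e)) has_derivative (%h. h *\<^sub>R partial i g (x + \<tau> *\<^sub>R e))) (at \<tau> within {0..1})"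
     using vd by (simp add: has_vector_derivative_def)
    have "decay (x + \<tau> *\<^sub>R e) <= 2 ^ (2*CARD('a))*decay x"
    proof (rule decay_compare)
     have "norm x <= norm (x + \<tau> *\<^sub>R e) + norm (\<tau> *\<^sub>R e)"
      using norm_triangle_ineq4[of "x + \<tau> *\<^sub>R e" "\<tau> *\<^sub>R e"] by simp
     then have "norm x <= norm (x + \<tau> *\<^sub>R e) + 1" using \<tau> ne by simp
     moreover have "1 + a <= 2*(1 + b)" if "a <= b + 1" "0 <= b" for a b :: real
      using that by simp
     ultimately show "1 + norm x <= 2*(1 + norm (x + \<tau> *\<^sub>R e))" using norm_ge_zero by blast
    qed simp
    then have "norm (partial i g (x + \<tau> *\<^sub>R e)) <= ?B"
     using order_trans[OF C(2)[of "x + \<tau> *\<^sub>R e"] mult_left_mono[of "decay (x + \<tau> *\<^sub>R e)" "2 ^ (2*CARD('a))*decay x" C]] C(1)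
     by (simp add: mult_ac)
    then show "onorm (%h. h *\<^sub>R partial i g (x + \<tau> *\<^sub>R e)) <= ?B"
     by (intro onorm_bound) (use C(1) in \<open>auto simp: mult.commute[of "\<bar>_\<bar>"] intro!: mult_right_mono\<close>)
   qed (use t in \<open>auto simp: less_imp_le\<close>)
   then show "norm ((1/t n) *\<^sub>R (g (x + t n *\<^sub>R e) - g x)) <= ?B"
    using t(1)[of n] by (simp add: divide_simps mult_ac del: scaleR_right_diff_distrib)
  qed
 qed measurable
 moreover have "(LBINT x. (1/t n) *\<^sub>R (g (x + t n *\<^sub>R e) - g x)) = 0" for n
  using integrable_schwartz[OF g]
  by (simp add: Bochner_Integration.integral_diff integrable_lborel_translate integral_lborel_translate)
 ultimately have "(%n. 0) \<longlonglongrightarrow> (LBINT x. partial i g x)" by (simp only:)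
 then show ?thesis by (simp add: LIMSEQ_const_iff)
qed

lemma fourier_partial:
 assumes f: "f\<in>schwartz"
 shows "fourier (partial i f) w = 2*cplx pi*\<i>*cplx (w $ i)*fourier f w"
proof -
 have g: "(%x. character (- w) x*f x)\<in>schwartz" by (rule schwartz_character[OF f])
 have p: "partial i (%x. character (- w) x*f x) x =
   character (- w) x*partial i f x - (2*cplx pi*\<i>*cplx (w $ i))*(character (- w) x*f x)" for x
 proof -
  have "partial i (character (- w)) x = - (2*cplx pi*\<i>*cplx (w $ i))*character (- w) x"
   using partial_eq_derivative[OF character_has_derivative[of "- w" x], of i] by (simp add: inner_axis)
  moreover have "character (- w) differentiable (at x)"
   using character_has_derivative unfolding differentiable_def by blast
  ultimately show ?thesis
   by (subst partial_mult) (auto intro: schwartz_differentiable[OF f])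
 qed
 have i1: "integrable lborel (%x. character (- w) x*partial i f x)"
  by (intro integrable_schwartz schwartz_character schwartz_partial f)
 have i2: "integrable lborel (%x. character (- w) x*f x)"
  by (intro integrable_schwartz g)
 have "0 = (LBINT x. character (- w) x*partial i f x - (2*cplx pi*\<i>*cplx (w $ i))*(character (- w) x*f x))"
  using integral_partial_eq_0[OF g, of i] by (simp add: p)
 also have "... = fourier (partial i f) w - 2*cplx pi*\<i>*cplx (w $ i)*fourier f w"
  using i1 i2 by (subst Bochner_Integration.integral_diff) (auto simp: fourier_eq)
 finally show ?thesis by simp
qed

text \<open>A real supremum is informative only when bounded above. Here it is, because there are
  finitely many lists of length at most N and each contributes a bounded function.\<close>

lemma schwartz_seminorm_ge:
 fixes f :: "real^'n::finite => complex"
 assumes f: "f\<in>schwartz" and "length is <= N"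
 shows "(1 + norm x) ^ N*norm (partials is f x) <= schwartz_seminorm N f"
proof -
 let ?h = "%(is, x). (1 + norm x) ^ N*norm (partials is f x)"
 have "\<exists>C>0. \<forall>x. (1 + norm x) ^ N*norm (partials is f x) <= C" for "is"
  by (rule schwartz_bound[OF schwartz_partials[OF f]])
 then obtain C where C: "!!is x. (1 + norm x) ^ N*norm (partials is f x) <= C is" by metis
 have fin: "finite {is :: 'n list. length is <= N}"
  using finite_lists_length_le[of "UNIV :: 'n set" N] by simp
 have "bdd_above (?h ` ({is. length is <= N} \<times> UNIV))"
 proof (rule bdd_aboveI2)
  fix z assume "z\<in>{is :: 'n list. length is <= N} \<times> (UNIV :: (real^'n) set)"
  then obtain js y where z: "z = (js, y)" and js: "length js <= N" by auto
  have "C js <= Max (C ` {is. length is <= N})" by (rule Max_ge) (use fin js in auto)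
  then show "?h z <= Max (C ` {is. length is <= N})" using C[of y js] z by simp
 qed
 then have "?h (is, x) <= (SUP z\<in>{is. length is <= N} \<times> UNIV. ?h z)"
  by (rule cSUP_upper[rotated]) (use assms in auto)
 then show ?thesis by (simp add: schwartz_seminorm_def)
qed

text \<open>One seminorm works for all f; the continuity of distributions given on the Fourier side
  needs this uniformity. Differentiating K times in the coordinate where w is largest supplies K
  powers of the norm of w.\<close>

lemma fourier_bound:
 obtains C N where "!!(f :: real^'n::finite => complex) w. f\<in>schwartz ==>
  (1 + norm w) ^ K*norm (fourier f w) <= C * schwartz_seminorm N f"
proof -
 \<comment> \<open>The seminorm must allow K derivatives and leave a weight of twice the dimension
   for integrability.\<close>
 define N where "N = max K (2*CARD('n))"
 define I where "I = (LBINT x. decay (x :: real^'n))"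
 have I0: "0 <= I" unfolding I_def by simp
 have basic: "norm (fourier (partials is f) w) <= schwartz_seminorm N f*I"
  if f: "f\<in>schwartz" and l: "length is <= K" for f :: "real^'n => complex" and "is" w
 proof -
  have le: "norm (partials is f x) <= schwartz_seminorm N f*decay x" for x
  proof -
   have "(1 + norm x) ^ (2*CARD('n))*norm (partials is f x) <= (1 + norm x) ^ N*norm (partials is f x)"
    by (intro mult_right_mono power_increasing) (auto simp: N_def)
   also have "... <= schwartz_seminorm N f"
    by (rule schwartz_seminorm_ge[OF f]) (use l in \<open>simp add: N_def\<close>)
   finally have "(1 + norm x) ^ (2*CARD('n))*norm (partials is f x) <= schwartz_seminorm N f" .
   moreover have "0 < (1 + norm x) ^ (2*CARD('n))" by (simp add: add_pos_nonneg)
   ultimately show ?thesis by (simp add: decay_def field_simps)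
  qed
  have "norm (fourier (partials is f) w) <= (LBINT x. norm (partials is f x))"
   by (rule norm_fourier_le)
  also have "... <= (LBINT x. schwartz_seminorm N f*decay (x :: real^'n))"
   by (rule integral_mono)
     (auto intro!: le integrable_norm integrable_schwartz schwartz_partials f integrable_mult_right integrable_decay)
  finally show ?thesis by (simp add: I_def)
 qed
 have rep: "norm (fourier (partials (replicate k i) f) w) = (2*pi*\<bar>w $ i\<bar>) ^ k*norm (fourier f w)"
  if "f\<in>schwartz" for f :: "real^'n => complex" and k i w
  by (induction k) (simp_all add: fourier_partial schwartz_partials[OF that] norm_mult abs_mult mult_ac)
 let ?d = "real CARD('n)"
 have "(1 + norm w) ^ K*norm (fourier f w) <= 2 ^ K*(1 + ?d ^ K*?d)*I * schwartz_seminorm N f"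
  if f: "f\<in>schwartz" for f :: "real^'n => complex" and w
 proof -
  let ?S = "schwartz_seminorm N f*I"
  have coord: "\<bar>w $ i\<bar> ^ K*norm (fourier f w) <= ?S" for i
  proof -
   have "\<bar>w $ i\<bar> ^ K <= (2*pi*\<bar>w $ i\<bar>) ^ K"
    using pi_gt3 mult_right_mono[of 1 "2*pi" "\<bar>w $ i\<bar>"] by (intro power_mono) auto
   then have "\<bar>w $ i\<bar> ^ K*norm (fourier f w) <= (2*pi*\<bar>w $ i\<bar>) ^ K*norm (fourier f w)"
    by (rule mult_right_mono) simp
   also have "... = norm (fourier (partials (replicate K i) f) w)" by (simp add: rep[OF f])
   also have "... <= ?S" by (rule basic[OF f]) simp
   finally show ?thesis .
  qed
  have zero: "norm (fourier f w) <= ?S" using basic[OF f, of "[]"] by simp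
  obtain i where i: "!!j. \<bar>w $ j\<bar> <= \<bar>w $ i\<bar>"
  proof -
   have "Max (range (%j. \<bar>w $ j\<bar>))\<in>range (%j. \<bar>w $ j\<bar>)" by (rule Max_in) auto
   then obtain i where "Max (range (%j. \<bar>w $ j\<bar>)) = \<bar>w $ i\<bar>" by (rule imageE)
   then show ?thesis using that[of i] Max_ge[of "range (%j. \<bar>w $ j\<bar>)"] by auto
  qed
  have "norm w <= (\<Sum>j\<in>UNIV. \<bar>w $ j\<bar>)" by (rule norm_le_l1_cart)
  also have "... <= (\<Sum>j\<in>(UNIV::'n set). \<bar>w $ i\<bar>)" by (intro sum_mono i)
  finally have "norm w <= ?d*\<bar>w $ i\<bar>" by simp
  then have "norm w ^ K <= ?d ^ K*\<bar>w $ i\<bar> ^ K"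
   by (subst power_mult_distrib[symmetric]) (intro power_mono, auto)
  then have "norm w ^ K*norm (fourier f w) <= ?d ^ K*(\<bar>w $ i\<bar> ^ K*norm (fourier f w))"
   using mult_right_mono[of "norm w ^ K" "?d ^ K*\<bar>w $ i\<bar> ^ K" "norm (fourier f w)"] by (simp add: mult_ac)
  also have "... <= ?d ^ K*?S" by (intro mult_left_mono coord) simp
  also have "... <= (?d ^ K*?d)*?S"
  proof -
   have "0 <= ?S" using zero order_trans[OF norm_ge_zero] by blast
   moreover have "1 <= ?d" by (simp add: Suc_le_eq)
   ultimately have "?d ^ K*?S*1 <= ?d ^ K*?S*?d"
    by (intro mult_left_mono mult_nonneg_nonneg[of "?d ^ K" ?S]) auto
   then show ?thesis by (simp add: mult_ac)
  qed
  finally have big: "norm w ^ K*norm (fourier f w) <= (?d ^ K*?d)*?S" .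
  have "(1 + norm w) ^ K*norm (fourier f w) <= 2 ^ K*(1 + norm w ^ K)*norm (fourier f w)"
   by (intro mult_right_mono power_one_plus_le) auto
  also have "... = 2 ^ K*(norm (fourier f w) + norm w ^ K*norm (fourier f w))" by (simp add: algebra_simps)
  also have "... <= 2 ^ K*(?S + (?d ^ K*?d)*?S)" by (intro mult_left_mono add_mono zero big) auto
  also have "... = 2 ^ K*(1 + ?d ^ K*?d)*I * schwartz_seminorm N f" by (simp add: algebra_simps)
  finally show ?thesis .
 qed
 then show ?thesis by (rule that)
qed

lemma rapid_fourier: "f\<in>schwartz ==> rapid (fourier f)"
 unfolding rapid_iff
proof
 fix K assume f: "f\<in>schwartz"
 obtain C N where "!!(f :: real^'a => complex) w. f\<in>schwartz ==>
  (1 + norm w) ^ K*norm (fourier f w) <= C * schwartz_seminorm N f" using fourier_bound by blast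
 then show "\<exists>C. \<forall>x. (1 + norm x) ^ K*norm (fourier f x) <= C" using f by blast
qed

text \<open>The second-order Taylor bound for the exponential gives a remainder of at most the
  squared increment times a finite second moment of f.\<close>

lemma fourier_has_derivative:
 assumes f: "f\<in>schwartz"
 shows "(fourier f has_derivative (%\<eta>. LBINT x. cplx (x \<bullet> \<eta>)*(- 2*cplx pi*\<i>*(character (- w) x*f x)))) (at w)"
  (is "(_ has_derivative ?D) _")
proof -
 have [measurable]: "f\<in>borel_fun" using f by auto
 define g where "g x = - 2*cplx pi*\<i>*(character (- w) x*f x)" for x
 have g: "g\<in>schwartz" unfolding g_def[abs_def] by (intro schwartz_cmult schwartz_character f)
 have gi: "integrable lborel (%x. cplx (x $ i)*g x)" for i
  by (intro integrable_schwartz schwartz_coordinate g)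
 have D: "?D \<eta> = (\<Sum>i\<in>UNIV. \<eta> $ i *\<^sub>R (LBINT x. cplx (x $ i)*g x))" for \<eta>
 proof -
  have "?D \<eta> = (LBINT x. (\<Sum>i\<in>UNIV. \<eta> $ i *\<^sub>R (cplx (x $ i)*g x)))"
   by (intro Bochner_Integration.integral_cong)
     (unfold g_def[symmetric], auto simp: inner_vec_def sum_distrib_right sum_distrib_left scaleR_conv_of_real mult_ac)
  also have "... = (\<Sum>i\<in>UNIV. \<eta> $ i *\<^sub>R (LBINT x. cplx (x $ i)*g x))"
   by (subst Bochner_Integration.integral_sum) (auto intro!: gi)
  finally show ?thesis .
 qed
 have Dint: "integrable lborel (%x. cplx (x \<bullet> \<eta>)*g x)" for \<eta>
 proof -
  have "integrable lborel (%x. (\<Sum>i\<in>UNIV. \<eta> $ i *\<^sub>R (cplx (x $ i)*g x)))"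
   by (intro Bochner_Integration.integrable_sum integrable_scaleR_right gi)
  then show ?thesis
   by (rule back_subst[where P = "integrable lborel"]) (auto simp: fun_eq_iff inner_vec_def sum_distrib_right sum_distrib_left scaleR_conv_of_real mult_ac)
 qed
 have bl: "bounded_linear ?D"
  unfolding D by (intro bounded_linear_sum bounded_linear_compose[OF bounded_linear_scaleR_left] bounded_linear_vec_nth)
 define C where "C = (LBINT x. (2*pi)^2*((1 + norm x) ^ 2*norm (f x)))"
 have bound: "norm (fourier f (w + \<eta>) - fourier f w - ?D \<eta>) <= C*norm \<eta> ^ 2" for \<eta>
 proof -
  have i1: "integrable lborel (%x. character (- (w + \<eta>)) x*f x)" "integrable lborel (%x. character (- w) x*f x)"
   by (intro integrable_schwartz schwartz_character f)+
  let ?r = "%x. character (- (w + \<eta>)) x*f x - character (- w) x*f x - cplx (x \<bullet> \<eta>)*g x"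
  have eq: "fourier f (w + \<eta>) - fourier f w - ?D \<eta> = (LBINT x. ?r x)"
   using i1 Dint[of \<eta>] by (simp add: fourier_eq g_def Bochner_Integration.integral_diff)
  have "norm (fourier f (w + \<eta>) - fourier f w - ?D \<eta>) <= (LBINT x. norm (?r x))"
   unfolding eq by (rule integral_norm_bound)
  also have "... <= (LBINT x. norm \<eta> ^ 2*((2*pi)^2*((1 + norm x) ^ 2*norm (f x))))"
  proof (intro integral_mono integrable_norm Bochner_Integration.integrable_diff i1 Dint integrable_mult_right integrable_schwartz_norm f)
   fix x
   define \<theta> where "\<theta> = - (2*pi*(x \<bullet> \<eta>))"
   have "character (- (w + \<eta>)) x = character (- w) x*iexp \<theta>"
    by (simp add: character_def \<theta>_def inner_add_left inner_diff_left inner_commute exp_add[symmetric] algebra_simps)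
   then have "?r x = character (- w) x*f x*(iexp \<theta> - (\<Sum>k\<le>1. (\<i>*\<theta>) ^ k/fact k))"
    by (simp add: g_def \<theta>_def algebra_simps)
   then have "norm (?r x) = norm (f x)*norm (iexp \<theta> - (\<Sum>k\<le>1. (\<i>*\<theta>) ^ k/fact k))"
    by (simp only: norm_mult norm_character mult_1_left)
   also have "... <= norm (f x)*\<bar>\<theta>\<bar> ^ 2"
   proof (intro mult_left_mono)
    have "norm (iexp \<theta> - (\<Sum>k\<le>1. (\<i>*\<theta>) ^ k/fact k)) <= \<bar>\<theta>\<bar> ^ Suc 1/fact (Suc 1)"
     by (rule iexp_approx1)
    also have "... <= \<bar>\<theta>\<bar> ^ 2" by (simp add: numeral_2_eq_2)
    finally show "norm (iexp \<theta> - (\<Sum>k\<le>1. (\<i>*\<theta>) ^ k/fact k)) <= \<bar>\<theta>\<bar> ^ 2" .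
   qed simp
   also have "norm (f x)*\<bar>\<theta>\<bar> ^ 2 <= norm (f x)*(2*pi*((1 + norm x)*norm \<eta>)) ^ 2"
   proof (intro power_mono mult_left_mono)
    have "\<bar>x \<bullet> \<eta>\<bar> <= norm x*norm \<eta>" by (rule Cauchy_Schwarz_ineq2)
    also have "... <= (1 + norm x)*norm \<eta>" by (intro mult_right_mono) auto
    finally show "\<bar>\<theta>\<bar> <= 2*pi*((1 + norm x)*norm \<eta>)" by (simp add: \<theta>_def abs_mult)
   qed simp_all
   finally show "norm (?r x) <= norm \<eta> ^ 2*((2*pi)^2*((1 + norm x) ^ 2*norm (f x)))"
    by (simp only: power_mult_distrib mult_ac)
  qed
  finally show ?thesis by (simp add: C_def mult.commute)
 qed
 show ?thesis
  unfolding has_derivative_at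
 proof (intro conjI bl)
  show "(%h. norm (fourier f (w + h) - fourier f w - ?D h)/norm h) \<midarrow>0\<rightarrow> 0"
  proof (rule tendsto_sandwich[of "%_. 0" _ _ "%h. C*norm h"])
   have "norm (fourier f (w + h) - fourier f w - ?D h)/norm h <= C*norm h" for h
    using bound[of h] by (cases "h = 0") (auto simp: field_simps power2_eq_square)
   then show "\<forall>\<^sub>F h in at 0. norm (fourier f (w + h) - fourier f w - ?D h)/norm h <= C*norm h" by simp
   show "((%h. C*norm h) \<longlongrightarrow> 0) (at (0 :: real^'a))"
    by (auto intro!: tendsto_eq_intros)
  qed auto
 qed
qed

lemma schwartz_fourier:
 assumes "f\<in>schwartz"
 shows "fourier f\<in>schwartz"
proof (rule schwartz_coinduct[of _ "fourier ` schwartz"])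
 fix h i assume "h\<in>fourier ` (schwartz :: (real^'a => complex) set)"
 then obtain g where g: "g\<in>schwartz" and h: "h = fourier g" by auto
 show "rapid h" unfolding h by (rule rapid_fourier[OF g])
 show "h differentiable (at x)" for x
  unfolding h differentiable_def using fourier_has_derivative[OF g] by blast
 have "partial i h = fourier (%x. (- 2*cplx pi*\<i>)*(cplx (x $ i)*g x))"
 proof
  fix w
  show "partial i h w = fourier (%x. (- 2*cplx pi*\<i>)*(cplx (x $ i)*g x)) w"
   unfolding h partial_eq_derivative[OF fourier_has_derivative[OF g]] fourier_eq
   by (intro Bochner_Integration.integral_cong) (auto simp: inner_axis)
 qed
 then show "partial i h\<in>fourier ` schwartz"
  using schwartz_cmult[OF schwartz_coordinate[OF g]] by blast
qed (use assms in auto)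

lemma schwartz_reflect:
 assumes "f\<in>schwartz"
 shows "(%x. f (- x))\<in>schwartz"
proof -
 have m: "mat (-1) *v x = - x" for x :: "real^'a"
  by (simp add: vec_eq_iff matrix_vector_mult_def mat_def if_distrib[of "%a. a*_"] cong: if_cong)
 have "mat (-1) ** mat (-1) = (mat 1 :: real^'a^'a)"
  by (simp add: matrix_eq matrix_vector_mul_assoc[symmetric] m)
 from schwartz_matrix[OF assms this] show ?thesis by (simp add: m)
qed

lemma schwartz_ifourier: "f\<in>schwartz ==> ifourier f\<in>schwartz"
 unfolding ifourier_def[abs_def] by (intro schwartz_reflect schwartz_fourier)

lemma integrable_tensor:
 fixes f g :: "'a::euclidean_space => complex"
 assumes f: "integrable lborel f" and g: "integrable lborel g"
  and [measurable]: "case_prod u\<in>borel_measurable (lborel \<Otimes>\<^sub>M lborel)"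
  and u: "!!x y. norm (u x y) <= 1"
 shows "integrable (lborel \<Otimes>\<^sub>M lborel) (%(x, y). f x*g y*u x y)"
proof (rule integrable_bound_fun)
 have [measurable]: "f\<in>borel_fun" "g\<in>borel_fun"
  using f g by (auto simp: borel_measurable_integrable)
 show "integrable (lborel \<Otimes>\<^sub>M lborel) (%(x, y). norm (f x)*norm (g y))"
  by (rule lborel_pair.Fubini_integrable) (use f g in \<open>auto intro!: integrable_mult_left\<close>)
 show "AE z in lborel \<Otimes>\<^sub>M lborel. norm (case z of (x, y) => f x*g y*u x y) <= norm (case z of (x, y) => norm (f x)*norm (g y))"
  using u by (auto simp: norm_mult mult_left_le)
 show "(%(x, y). f x*g y*u x y)\<in>borel_measurable (lborel \<Otimes>\<^sub>M lborel)" by measurable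
qed

section \<open>Gaussian kernels and Fourier inversion\<close>

lemma
 fixes F :: "real^'n::finite => 'a::{banach,second_countable_topology}"
 assumes "c ~= 0" and F: "F\<in>borel_fun"
 shows integrable_lborel_scale: "integrable lborel (%x. F (c *\<^sub>R x)) \<longleftrightarrow> integrable lborel F"
  and integral_lborel_scale: "(LBINT x. F (c *\<^sub>R x)) = (1/\<bar>c\<bar> ^ CARD('n)) *\<^sub>R (LBINT x. F x)"
proof -
 have m: "mat c *v x = c *\<^sub>R x" for x :: "real^'n"
  by (simp add: vec_eq_iff matrix_vector_mult_def mat_def if_distrib[of "%a. a*_"] cong: if_cong)
 have d: "det (mat c :: real^'n^'n) = c ^ CARD('n)"
  by (subst det_diagonal) (auto simp: mat_def)
 show "integrable lborel (%x. F (c *\<^sub>R x)) \<longleftrightarrow> integrable lborel F"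
  using integrable_lborel_matrix[of "mat c :: real^'n^'n" F] assms by (simp add: m d)
 show "(LBINT x. F (c *\<^sub>R x)) = (1/\<bar>c\<bar> ^ CARD('n)) *\<^sub>R (LBINT x. F x)"
  using integral_lborel_matrix[of "mat c :: real^'n^'n" F] assms by (simp add: m d power_abs)
qed

text \<open>The transform of this kernel is known from the characteristic function of the normal
  law, and its integral is 1, so it serves both as damping factor and as approximate
  identity.\<close>

definition gauss :: "real^'n::finite => real" where
 "gauss x = (\<Prod>i\<in>UNIV. std_normal_density (x $ i))"

lemma gauss_pos: "0 < gauss x" unfolding gauss_def by (intro prod_pos ballI normal_density_pos) simp
lemma gauss_le: "gauss (x :: real^'n::finite) <= gauss (0 :: real^'n)"
 unfolding gauss_def by (intro prod_mono) (auto simp: std_normal_density_def divide_right_mono)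
lemma gauss_continuous: "continuous_on A gauss"
 unfolding gauss_def[abs_def] std_normal_density_def by (intro continuous_intros) auto
lemma gauss_measurable [measurable]: "gauss\<in>borel_fun"
 by (intro borel_measurable_continuous_onI gauss_continuous)
lemma gauss_minus: "gauss (- x) = gauss x"
 by (simp add: gauss_def std_normal_density_def)

lemma
 shows integrable_gauss: "integrable lborel (gauss :: real^'n::finite => real)"
  and integral_gauss: "(LBINT x. gauss (x :: real^'n)) = 1"
proof -
 have i: "integrable lborel std_normal_density"
  by (rule integrable_normal_density) simp
 have e: "(LBINT x. std_normal_density x) = 1"
  using integral_normal_density[of 1 0] by simp
 show "integrable lborel (gauss :: real^'n::finite => real)"
  unfolding gauss_def[abs_def] by (rule integrable_lborel_vec_prod) (rule i)
 show "(LBINT x. gauss (x :: real^'n)) = 1"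
  unfolding gauss_def by (subst integral_lborel_vec_prod) (simp_all add: i e)
qed

lemma fourier_gauss:
 "(LBINT x. gauss (x :: real^'n::finite) *\<^sub>R iexp (t \<bullet> x)) = cplx (gauss t/gauss (0 :: real^'n))"
proof -
 have i: "integrable lborel (%x. std_normal_density x *\<^sub>R iexp (c*x))" for c
 proof (rule integrable_bound_fun[of _ std_normal_density])
  show "integrable lborel std_normal_density" by (rule integrable_normal_density) simp
 qed (auto simp: norm_mult)
 have e: "(LBINT x. std_normal_density x *\<^sub>R iexp (c*x)) = cplx (exp (- c\<^sup>2/2))" for c
 proof -
  have "char std_normal_distribution c = (LBINT x. std_normal_density x *\<^sub>R iexp (c*x))"
   unfolding char_def by (subst integral_density) auto
  then show ?thesis using char_std_normal_distribution by (simp add: fun_eq_iff)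
 qed
 have eq: "gauss x *\<^sub>R iexp (t \<bullet> x) = (\<Prod>i\<in>UNIV. std_normal_density (x $ i) *\<^sub>R iexp (t $ i*x $ i))" for x
  by (simp add: gauss_def scaleR_conv_of_real prod.distrib inner_vec_def exp_sum sum_distrib_left)
 have "(LBINT x. gauss (x :: real^'n) *\<^sub>R iexp (t \<bullet> x)) = (\<Prod>i\<in>UNIV. cplx (exp (- (t $ i)\<^sup>2/2)))"
  unfolding eq by (subst integral_lborel_vec_prod[OF i]) (simp only: e)
 also have "... = cplx (gauss t/gauss (0 :: real^'n))"
  unfolding gauss_def prod_dividef[symmetric] of_real_prod by (intro prod.cong) (simp_all add: std_normal_density_def)
 finally show ?thesis .
qed

text \<open>The inverse integral is damped by Gaussians tending to 1. After exchanging the integrals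
  the damping becomes an average of f over a Gaussian of width \<open>eps n\<close> around x. The
  damped integrals thus tend to the inverse transform and to f x.\<close>

lemma fourier_inversion:
 fixes f :: "real^'n::finite => complex"
 assumes f: "f\<in>schwartz"
 shows "ifourier (fourier f) x = f x"
proof -
 have [measurable]: "f\<in>borel_fun" "fourier f\<in>borel_fun"
  using f by (auto intro: schwartz_measurable schwartz_fourier)
 define eps where "eps n = 1/real (Suc n)" for n
 have eps: "0 < eps n" for n by (simp add: eps_def)
 have eps0: "eps \<longlonglongrightarrow> 0" unfolding eps_def[abs_def] by (rule LIMSEQ_inverse_real_of_nat[unfolded inverse_eq_divide])
 define \<gamma> where "\<gamma> n w = gauss ((2*pi*eps n) *\<^sub>R (w :: real^'n))/gauss (0 :: real^'n)" for n w
 have [measurable]: "\<gamma> n\<in>borel_fun" for n unfolding \<gamma>_def[abs_def] by measurable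
 have \<gamma>1: "0 <= \<gamma> n w" "\<gamma> n w <= 1" for n w
  using gauss_pos[of "0 :: real^'n"] gauss_pos[of "(2*pi*eps n) *\<^sub>R w"] gauss_le[of "(2*pi*eps n) *\<^sub>R w"] by (auto simp: \<gamma>_def less_imp_le)
 have \<gamma>i: "integrable lborel (%w. cplx (\<gamma> n w))" for n
 proof -
  have "integrable lborel (%w::real^'n. gauss ((2*pi*eps n) *\<^sub>R w))"
   using eps[of n] integrable_gauss by (simp add: integrable_lborel_scale)
  then have "integrable lborel (\<gamma> n)" unfolding \<gamma>_def[abs_def] by simp
  then show ?thesis by (rule integrable_of_real)
 qed
 have "(%n. LBINT w. character x w*fourier f w*cplx (\<gamma> n w)) \<longlonglongrightarrow> (LBINT w. character x w*fourier f w)"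
 proof (rule integral_dominated_convergence)
  show "integrable lborel (%w. norm (fourier f w))" by (intro integrable_norm integrable_schwartz schwartz_fourier f)
  show "AE w in lborel. (%n. character x w*fourier f w*cplx (\<gamma> n w)) \<longlonglongrightarrow> character x w*fourier f w"
  proof (rule AE_I2)
   fix w :: "real^'n"
   have "(%n. (2*pi*eps n) *\<^sub>R w) \<longlonglongrightarrow> (2*pi*0) *\<^sub>R w" by (intro tendsto_intros eps0)
   then have "(%n. gauss ((2*pi*eps n) *\<^sub>R w)) \<longlonglongrightarrow> gauss (0 :: real^'n)"
    using continuous_on_tendsto_compose[OF gauss_continuous[of UNIV]] by simp
   then have "(%n. \<gamma> n w) \<longlonglongrightarrow> gauss (0 :: real^'n)/gauss (0 :: real^'n)"
    unfolding \<gamma>_def using gauss_pos[of "0 :: real^'n"] by (intro tendsto_divide tendsto_const) auto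
   then have "(%n. \<gamma> n w) \<longlonglongrightarrow> 1" using gauss_pos[of "0 :: real^'n"] by simp
   then have "(%n. character x w*fourier f w*cplx (\<gamma> n w)) \<longlonglongrightarrow> character x w*fourier f w*cplx 1"
    by (intro tendsto_intros)
   then show "(%n. character x w*fourier f w*cplx (\<gamma> n w)) \<longlonglongrightarrow> character x w*fourier f w" by simp
  qed
  show "AE w in lborel. norm (character x w*fourier f w*cplx (\<gamma> n w)) <= norm (fourier f w)" for n
   using \<gamma>1 by (auto simp: norm_mult mult_left_le)
 qed measurable
 moreover have "(LBINT w. character x w*fourier f w*cplx (\<gamma> n w)) = (LBINT z. gauss z *\<^sub>R f (x + eps n *\<^sub>R z))" for n
 proof -
  have kernel: "(LBINT w. cplx (\<gamma> n w)*character (x - y) w) = cplx ((1/eps n) ^ CARD('n)*gauss ((1/eps n) *\<^sub>R (y - x)))" for y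
  proof -
   let ?c = "2*pi*eps n"
   let ?F = "%u. gauss u *\<^sub>R iexp (((1/eps n) *\<^sub>R (x - y)) \<bullet> u)"
   have "(LBINT w. cplx (\<gamma> n w)*character (x - y) w) = (LBINT w. cplx (1/gauss (0 :: real^'n))*?F (?c *\<^sub>R w))"
   proof (rule Bochner_Integration.integral_cong)
    fix w :: "real^'n"
    have "((1/eps n) *\<^sub>R (x - y)) \<bullet> (?c *\<^sub>R w) = 2*pi*((x - y) \<bullet> w)"
     using eps[of n] by simp
    then have "character (x - y) w = iexp (((1/eps n) *\<^sub>R (x - y)) \<bullet> (?c *\<^sub>R w))"
     unfolding character_def by (simp add: mult_ac)
    then show "cplx (\<gamma> n w)*character (x - y) w = cplx (1/gauss (0 :: real^'n))*?F (?c *\<^sub>R w)"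
     by (simp only: \<gamma>_def scaleR_conv_of_real) simp
   qed simp
   also have "... = cplx (1/gauss (0 :: real^'n))*(LBINT w. ?F (?c *\<^sub>R w))"
    by (rule integral_mult_right_zero)
   also have "(LBINT w. ?F (?c *\<^sub>R w)) = (1/\<bar>?c\<bar> ^ CARD('n)) *\<^sub>R (LBINT u. ?F u)"
    by (rule integral_lborel_scale) (use eps[of n] in auto)
   also have "(LBINT u. ?F u) = cplx (gauss ((1/eps n) *\<^sub>R (x - y))/gauss (0 :: real^'n))"
    by (rule fourier_gauss)
   also have "gauss ((1/eps n) *\<^sub>R (x - y)) = gauss ((1/eps n) *\<^sub>R (y - x))"
    using gauss_minus[of "(1/eps n) *\<^sub>R (x - y)"] by (simp add: scaleR_right_diff_distrib)
   finally have "(LBINT w. cplx (\<gamma> n w)*character (x - y) w) =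
    cplx (1/(gauss (0::real^'n))^2*(1/\<bar>?c\<bar> ^ CARD('n))*gauss ((1/eps n) *\<^sub>R (y - x)))"
    by (simp add: scaleR_conv_of_real power2_eq_square mult_ac)
   \<comment> \<open>One factor 1/gauss(0) comes from normalising \<gamma>, the other from
     \<open>fourier_gauss\<close>; together they cancel the powers of 2 pi in the Jacobian of the
     scaling.\<close>
   moreover have "1/(gauss (0::real^'n))^2 = (2*pi) ^ CARD('n)"
    by (simp add: gauss_def std_normal_density_def power_divide power_mult[symmetric])
      (simp add: power_mult mult.commute[of _ 2])
   moreover have "(2*pi) ^ CARD('n)*(1/\<bar>?c\<bar> ^ CARD('n)) = (1/eps n) ^ CARD('n)"
    using eps[of n] by (simp add: power_mult_distrib power_divide abs_mult)
   ultimately show ?thesis by (simp only:)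
  qed
  have "integrable (lborel \<Otimes>\<^sub>M lborel) (%(w, y). cplx (\<gamma> n w)*f y*character (x - y) w)"
   by (rule integrable_tensor) (auto intro!: \<gamma>i integrable_schwartz f)
  note fub = lborel_pair.Fubini_integral[OF this]
  have "(LBINT w. character x w*fourier f w*cplx (\<gamma> n w)) = (LBINT w. (LBINT y. cplx (\<gamma> n w)*f y*character (x - y) w))"
  proof (rule Bochner_Integration.integral_cong)
   fix w :: "real^'n"
   have "character (x - y) w = character x w*character (- w) y" for y
    using character_add_left[of x "- y" w] by (simp add: character_minus character_commute[of y])
   then have "(LBINT y. cplx (\<gamma> n w)*f y*character (x - y) w) = (LBINT y. (character x w*cplx (\<gamma> n w))*(character (- w) y*f y))"
    by (simp add: mult_ac)
   also have "... = (character x w*cplx (\<gamma> n w))*fourier f w"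
    unfolding fourier_eq by (rule integral_mult_right_zero)
   finally show "character x w*fourier f w*cplx (\<gamma> n w) = (LBINT y. cplx (\<gamma> n w)*f y*character (x - y) w)"
    by (simp add: mult_ac)
  qed simp
  also have "... = (LBINT y. (LBINT w. cplx (\<gamma> n w)*f y*character (x - y) w))"
   using fub by simp
  also have "... = (LBINT y. f y*cplx ((1/eps n) ^ CARD('n)*gauss ((1/eps n) *\<^sub>R (y - x))))"
  proof (rule Bochner_Integration.integral_cong)
   fix y :: "real^'n"
   have "(LBINT w. cplx (\<gamma> n w)*f y*character (x - y) w) = f y*(LBINT w. cplx (\<gamma> n w)*character (x - y) w)"
    by (subst integral_mult_right_zero[symmetric]) (simp add: mult_ac)
   then show "(LBINT w. cplx (\<gamma> n w)*f y*character (x - y) w) = f y*cplx ((1/eps n) ^ CARD('n)*gauss ((1/eps n) *\<^sub>R (y - x)))"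
    by (simp add: kernel)
  qed simp
  also have "... = (LBINT y. f (y + x)*cplx ((1/eps n) ^ CARD('n)*gauss ((1/eps n) *\<^sub>R y)))"
   by (subst integral_lborel_translate[of _ x, symmetric]) auto
  also have "... = (eps n ^ CARD('n)) *\<^sub>R (LBINT z. f (eps n *\<^sub>R z + x)*cplx ((1/eps n) ^ CARD('n)*gauss z))"
   using eps[of n] integral_lborel_scale[of "eps n" "%y. f (y + x)*cplx ((1/eps n) ^ CARD('n)*gauss ((1/eps n) *\<^sub>R y))"]
   by simp
  also have "... = (LBINT z. (eps n ^ CARD('n)) *\<^sub>R (f (eps n *\<^sub>R z + x)*cplx ((1/eps n) ^ CARD('n)*gauss z)))"
   by simp
  also have "... = (LBINT z. gauss z *\<^sub>R f (x + eps n *\<^sub>R z))"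
   using eps[of n] by (intro Bochner_Integration.integral_cong) (auto simp: scaleR_conv_of_real power_divide add.commute)
  finally show ?thesis .
 qed
 moreover have "(%n. LBINT z. gauss z *\<^sub>R f (x + eps n *\<^sub>R z)) \<longlonglongrightarrow> (LBINT z. gauss (z :: real^'n) *\<^sub>R f x)"
 proof -
  have "\<exists>C>0. \<forall>x. (1 + norm x) ^ 0*norm (f x) <= C" by (rule schwartz_bound[OF f])
  then obtain C where C: "!!x. norm (f x) <= C" by auto
  show ?thesis
  proof (rule integral_dominated_convergence)
   show "integrable lborel (%z::real^'n. gauss z*C)" by (intro integrable_mult_left integrable_gauss)
   show "AE z in lborel. norm (gauss z *\<^sub>R f (x + eps n *\<^sub>R z)) <= gauss z*C" for n
    using C gauss_pos[where 'a = 'n] by (intro AE_I2) (simp add: abs_of_pos mult_left_mono less_imp_le)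
   show "AE z in lborel. (%n. gauss z *\<^sub>R f (x + eps n *\<^sub>R z)) \<longlonglongrightarrow> gauss z *\<^sub>R f x"
   proof (rule AE_I2)
    fix z :: "real^'n"
    have "(%n. x + eps n *\<^sub>R z) \<longlonglongrightarrow> x + 0 *\<^sub>R z" by (intro tendsto_intros eps0)
    then have "(%n. f (x + eps n *\<^sub>R z)) \<longlonglongrightarrow> f x"
     using continuous_on_tendsto_compose[OF schwartz_continuous[OF f]] by simp
    then show "(%n. gauss z *\<^sub>R f (x + eps n *\<^sub>R z)) \<longlonglongrightarrow> gauss z *\<^sub>R f x" by (intro tendsto_intros)
   qed
  qed measurable
 qed
 moreover have "(LBINT z. gauss (z :: real^'n) *\<^sub>R f x) = f x"
  using integrable_gauss[where 'n = 'n] integral_gauss[where 'n = 'n] by simp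
 ultimately show ?thesis using LIMSEQ_unique by (simp add: ifourier_eq)
qed

lemma fourier_ifourier:
 assumes "f\<in>schwartz"
 shows "fourier (ifourier f) = f"
proof
 fix x
 have "fourier (ifourier f) x = (LBINT y. character (- x) (- y)*ifourier f (- y))"
 proof -
  have [measurable]: "ifourier f\<in>borel_fun" using schwartz_ifourier[OF assms] by auto
  show ?thesis
   using integral_lborel_scale[of "-1" "%y. character (- x) y*ifourier f y"] by (simp add: fourier_eq)
 qed
 also have "... = ifourier (fourier f) x"
  by (simp add: ifourier_def fourier_eq[of "fourier f"] character_minus character_minus_right)
 finally show "fourier (ifourier f) x = f x" using fourier_inversion[OF assms] by simp
qed

section \<open>Smooth cutoff functions\<close>

text \<open>Infinite differentiability as membership in a family closed under derivatives, so that
  no derivative of higher order has to be named.\<close>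

definition smooth1 :: "(real => real) => bool" where
 "smooth1 f \<longleftrightarrow> (\<exists>X. f\<in>X \<and> (\<forall>g\<in>X. \<exists>g'\<in>X. \<forall>x. (g has_real_derivative g' x) (at x)))"

lemma smooth1I:
 assumes "f\<in>X" "!!g. g\<in>X ==> \<exists>g'\<in>X. \<forall>x. (g has_real_derivative g' x) (at x)"
 shows "smooth1 f"
 using assms unfolding smooth1_def by blast

lemma smooth1D:
 assumes "smooth1 f"
 obtains f' where "smooth1 f'" "!!x. (f has_real_derivative f' x) (at x)"
 using assms unfolding smooth1_def by blast

lemma smooth1_continuous: "smooth1 f ==> continuous_on A f"
 by (meson DERIV_isCont continuous_at_imp_continuous_on smooth1D)

lemma smooth1_antiderivative:
 assumes "smooth1 f" "!!x. (F has_real_derivative f x) (at x)"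
 shows "smooth1 F"
proof (rule smooth1I[of _ "insert F {f. smooth1 f}"])
 fix g assume "g\<in>insert F {f. smooth1 f}"
 then show "\<exists>g'\<in>insert F {f. smooth1 f}. \<forall>x. (g has_real_derivative g' x) (at x)"
  using assms smooth1D by (metis insert_iff mem_Collect_eq)
qed simp

lemma smooth1_affine:
 assumes "smooth1 f"
 shows "smooth1 (%x. k*f (c*x + b) + l)"
proof (rule smooth1I[of _ "{(%x. k*f (c*x + b) + l) | f k l. smooth1 f}"])
 fix g assume "g\<in>{(%x. k*f (c*x + b) + l) | f k l. smooth1 f}"
 then obtain f k l where g: "g = (%x. k*f (c*x + b) + l)" and "smooth1 f" by blast
 then obtain f' where f': "smooth1 f'" "!!x. (f has_real_derivative f' x) (at x)" using smooth1D by blast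
 have "(g has_real_derivative (k*c)*f' (c*x + b) + 0) (at x)" for x
  unfolding g by (auto intro!: derivative_eq_intros DERIV_chain2[OF f'(2)])
 then show "\<exists>g'\<in>{(%x. k*f (c*x + b) + l) | f k l. smooth1 f}. \<forall>x. (g has_real_derivative g' x) (at x)"
  using f'(1) by (intro bexI[of _ "%x. (k*c)*f' (c*x + b) + 0"]) blast+
qed (use assms in blast)

text \<open>All derivatives of a product are finite sums of products of smooth functions. Lists of
  pairs encode these sums.\<close>

lemma smooth1_mult:
 assumes "smooth1 f" "smooth1 g"
 shows "smooth1 (%x. f x*g x)"
proof -
 let ?h = "%L x. \<Sum>(f, g)\<leftarrow>L. f x*g x"
 let ?X = "{?h L | L. \<forall>(f, g)\<in>set L. smooth1 f \<and> smooth1 g}"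
 show ?thesis
 proof (rule smooth1I[of _ ?X])
  show "(%x. f x*g x)\<in>?X" using assms by (intro CollectI exI[of _ "[(f, g)]"]) auto
  have "\<exists>L'. (\<forall>(f, g)\<in>set L'. smooth1 f \<and> smooth1 g) \<and> (\<forall>x. (?h L has_real_derivative ?h L' x) (at x))"
   if "\<forall>(f, g)\<in>set L. smooth1 f \<and> smooth1 g" for L
   using that
  proof (induction L)
   case (Cons p L)
   obtain u v where p: "p = (u, v)" by force
   obtain L' where L': "\<forall>(f, g)\<in>set L'. smooth1 f \<and> smooth1 g" "!!x. (?h L has_real_derivative ?h L' x) (at x)"
    using Cons by auto
   obtain u' where u': "smooth1 u'" "!!x. (u has_real_derivative u' x) (at x)"
    using Cons.prems p smooth1D[of u] by auto
   obtain v' where v': "smooth1 v'" "!!x. (v has_real_derivative v' x) (at x)"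
    using Cons.prems p smooth1D[of v] by auto
   have "(?h (p # L) has_real_derivative ?h ((u', v) # (u, v') # L') x) (at x)" for x
    using DERIV_add[OF DERIV_mult[OF u'(2)[of x] v'(2)[of x]] L'(2)[of x]] by (simp add: p algebra_simps)
   moreover have "\<forall>(f, g)\<in>set ((u', v) # (u, v') # L'). smooth1 f \<and> smooth1 g"
    using L'(1) u'(1) v'(1) Cons.prems p by auto
   ultimately show ?case by (intro exI[of _ "(u', v) # (u, v') # L'"]) simp
  next
   case Nil
   show ?case by (intro exI[of _ "[]"]) simp
  qed
  note step = this
  fix g assume "g\<in>?X"
  then obtain L where g: "g = ?h L" and L: "\<forall>(f, g)\<in>set L. smooth1 f \<and> smooth1 g" by auto
  obtain L' where L': "\<forall>(f, g)\<in>set L'. smooth1 f \<and> smooth1 g" "\<forall>x. (?h L has_real_derivative ?h L' x) (at x)"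
   using step[OF L] by auto
  show "\<exists>g'\<in>?X. \<forall>x. (g has_real_derivative g' x) (at x)"
   unfolding g using L' by (intro bexI[of _ "?h L'"] CollectI exI[of _ L']) auto
 qed
qed

text \<open>The classical functions p(1/x) exp(-1/x), extended by 0. They are closed under
  derivatives: p becomes (p - p') X^2.\<close>

definition flat :: "real poly => real => real" where
 "flat p x = (if 0 < x then poly p (1/x)*exp (- (1/x)) else 0)"

lemma flat_limit: "((%h::real. poly p (1/h)*exp (- (1/h))) \<longlongrightarrow> 0) (at_right 0)"
proof -
 have "((%x::real. \<Sum>i\<le>degree p. coeff p i*(x ^ i/exp x)) \<longlongrightarrow> (\<Sum>i\<le>degree p. coeff p i*0)) (at_top :: real filter)"
  by (intro tendsto_sum tendsto_mult tendsto_const tendsto_power_div_exp_0)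
 then have "((%x. poly p x*exp (- x)) \<longlongrightarrow> 0) at_top"
  by (simp add: poly_altdef sum_distrib_right exp_minus divide_inverse mult.assoc)
 moreover have "filterlim (%h::real. 1/h) at_top (at_right 0)"
  using filterlim_inverse_at_top_right by (simp add: inverse_eq_divide)
 ultimately show ?thesis by (rule filterlim_compose)
qed

lemma flat_derivative:
 "(flat p has_real_derivative flat ((p - pderiv p)*[:0, 0, 1:]) x) (at x)"
proof -
 consider "0 < x" | "x < 0" | "x = 0" by linarith
 then show ?thesis
 proof cases
  case 1
  have "((%x. poly p (1/x)*exp (- (1/x))) has_real_derivative flat ((p - pderiv p)*[:0, 0, 1:]) x) (at x)"
   using 1 by (auto intro!: derivative_eq_intros DERIV_chain2[OF poly_DERIV] simp: flat_def field_simps power2_eq_square)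
  then show ?thesis
   by (rule has_field_derivative_transform_within_open[of _ _ _ "{0<..}"]) (use 1 in \<open>auto simp: flat_def\<close>)
 next
  case 2
  have "((%_. 0) has_real_derivative flat ((p - pderiv p)*[:0, 0, 1:]) x) (at x)"
   using 2 by (simp add: flat_def)
  then show ?thesis
   by (rule has_field_derivative_transform_within_open[of _ _ _ "{..<0}"]) (use 2 in \<open>auto simp: flat_def\<close>)
 next
  case 3
  \<comment> \<open>At the origin the quotient by h is absorbed by multiplying p with X, which
    leaves a function of the same form.\<close>
  have "((%h. (flat p (0 + h) - flat p 0)/h) \<longlongrightarrow> 0) (at_right 0)"
  proof (rule Lim_transform_eventually[OF flat_limit[of "p*[:0, 1:]"]])
   show "\<forall>\<^sub>F h in at_right 0. poly (p*[:0, 1:]) (1/h)*exp (- (1/h)) = (flat p (0 + h) - flat p 0)/h"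
    by (auto simp: eventually_at_right_field flat_def intro!: exI[of _ 1])
  qed
  moreover have "((%h. (flat p (0 + h) - flat p 0)/h) \<longlongrightarrow> 0) (at_left 0)"
  proof (rule Lim_transform_eventually[OF tendsto_const])
   show "\<forall>\<^sub>F h in at_left 0. 0 = (flat p (0 + h) - flat p 0)/h"
    by (auto simp: eventually_at_left_field flat_def intro!: exI[of _ "-1"])
  qed
  ultimately have "((%h. (flat p (0 + h) - flat p 0)/h) \<longlongrightarrow> 0) (at 0)"
   by (simp add: filterlim_split_at)
  then show ?thesis unfolding DERIV_def 3 by (simp add: flat_def)
 qed
qed

lemma smooth1_flat: "smooth1 (flat p)"
proof (rule smooth1I[of _ "range flat"])
 fix g assume "g\<in>range flat"
 then show "\<exists>g'\<in>range flat. \<forall>x. (g has_real_derivative g' x) (at x)"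
  using flat_derivative by blast
qed simp

text \<open>The normalised antiderivative of a nonnegative smooth bump living on [0, 1] is constant
  to the left and to the right of that interval.\<close>

lemma smooth_step:
 obtains \<sigma> where "smooth1 \<sigma>" "!!x. x <= 0 ==> \<sigma> x = 0" "!!x. 1 <= x ==> \<sigma> x = 1"
  "!!x. 0 <= \<sigma> x" "!!x. \<sigma> x <= 1"
proof -
 define b where "b x = flat 1 x*flat 1 (1 - x)" for x
 have "smooth1 (%x. flat 1 x*(1*flat 1 ((-1)*x + 1) + 0))"
  by (intro smooth1_mult smooth1_affine smooth1_flat)
 then have sb: "smooth1 b" unfolding b_def[abs_def] by simp
 have b0: "0 <= b x" for x by (auto simp: b_def flat_def)
 have bpos: "0 < b x" if "0 < x" "x < 1" for x using that by (auto simp: b_def flat_def)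
 have bz: "b x = 0" if "x <= 0 \<or> 1 <= x" for x using that by (auto simp: b_def flat_def)
 have "\<exists>F. \<forall>x. - \<infinity> < ereal x --> ereal x < \<infinity> --> (F has_vector_derivative b x) (at x)"
  by (rule einterval_antiderivative)
    (auto intro: continuous_on_interior[OF smooth1_continuous[OF sb, of UNIV]])
 then obtain F where "!!x. (F has_vector_derivative b x) (at x)" by auto
 then have F: "(F has_real_derivative b x) (at x)" for x
  by (simp add: has_real_derivative_iff_has_vector_derivative)
 have mono: "F x <= F y" if "x <= y" for x y
  by (rule DERIV_nonneg_imp_nondecreasing[OF that]) (use F b0 in blast)
 have F01: "F 0 < F 1"
 proof (rule DERIV_pos_imp_increasing_open[of 0 1 F])
  show "continuous_on {0..1} F" using F by (meson DERIV_isCont continuous_at_imp_continuous_on)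
  fix x :: real assume "0 < x" "x < 1"
  then show "\<exists>y. (F has_real_derivative y) (at x) \<and> 0 < y" using F bpos by blast
 qed simp
 have const: "F x = F y" if "x < y" "!!z. x < z ==> z < y ==> b z = 0" for x y
 proof -
  have "\<exists>z>x. z < y \<and> F y - F x = (y - x)*b z" by (rule MVT2[OF that(1)]) (rule F)
  then obtain z where "x < z" "z < y" "F y - F x = (y - x)*b z" by blast
  then show ?thesis using that(2) by simp
 qed
 have left: "F x = F 0" if "x <= 0" for x using const[of x 0] bz that by (cases "x = 0") auto
 have right: "F x = F 1" if "1 <= x" for x using const[of 1 x] bz that by (cases "x = 1") auto
 define \<sigma> where "\<sigma> x = (F x - F 0)/(F 1 - F 0)" for x
 have bounds: "F 0 <= F x" "F x <= F 1" for x
 proof -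
  consider "x <= 0" | "0 <= x" "x <= 1" | "1 <= x" by linarith
  then have "F 0 <= F x \<and> F x <= F 1"
  proof cases
   case 1 then show ?thesis using left[of x] F01 by simp
  next
   case 2 then show ?thesis using mono by auto
  next
   case 3 then show ?thesis using right[of x] F01 by auto
  qed
  then show "F 0 <= F x" "F x <= F 1" by auto
 qed
 have "smooth1 (%x. 1/(F 1 - F 0)*F (1*x + 0) + (- F 0/(F 1 - F 0)))"
  by (intro smooth1_affine smooth1_antiderivative[OF sb F])
 then have "smooth1 \<sigma>" unfolding \<sigma>_def[abs_def] by (simp add: diff_divide_distrib)
 moreover have "\<sigma> x = 0" if "x <= 0" for x using left[OF that] by (simp add: \<sigma>_def)
 moreover have "\<sigma> x = 1" if "1 <= x" for x using right[OF that] F01 by (simp add: \<sigma>_def)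
 moreover have "0 <= \<sigma> x" "\<sigma> x <= 1" for x using bounds[of x] F01 by (auto simp: \<sigma>_def)
 ultimately show ?thesis by (rule that)
qed

text \<open>A partial derivative replaces one factor by its derivative, so such products form a
  closed family. Vanishing beyond R is inherited by derivatives because that region is open.\<close>

lemma schwartz_smooth_product:
 fixes g :: "'n::finite => real => real"
 assumes "!!i. smooth1 (g i)" "!!i t. R < \<bar>t\<bar> ==> g i t = 0"
 shows "(%x::real^'n. cplx (\<Prod>i\<in>UNIV. g i (x $ i)))\<in>schwartz"
proof -
 let ?P = "%g x. cplx (\<Prod>i\<in>UNIV. g i (x $ i)) :: complex"
 let ?X = "{?P g | g. \<forall>i. smooth1 (g i) \<and> (\<forall>t. R < \<bar>t\<bar> --> g i t = 0)} :: (real^'n => complex) set"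
 have der: "(?P g has_derivative (%y. cplx (\<Sum>k\<in>UNIV. (g' k (x $ k)*y $ k)*(\<Prod>j\<in>UNIV - {k}. g j (x $ j))))) (at x)"
  if "!!i t. (g i has_real_derivative g' i t) (at t)" for g g' :: "'n => real => real" and x :: "real^'n"
 proof -
  have "((%x. g i (x $ i)) has_derivative (%y. g' i (x $ i)*y $ i)) (at x)" for i
  proof -
   have "((%x. x $ i) has_derivative (%y. y $ i)) (at x)"
    by (intro bounded_linear_imp_has_derivative bounded_linear_vec_nth)
   from has_derivative_compose[OF this that[of i "x $ i", unfolded has_field_derivative_def]]
   show ?thesis by simp
  qed
  then have "((%x. \<Prod>i\<in>UNIV. g i (x $ i)) has_derivative (%y. \<Sum>k\<in>UNIV. (g' k (x $ k)*y $ k)*(\<Prod>j\<in>UNIV - {k}. g j (x $ j)))) (at x)"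
   by (rule has_derivative_prod)
  then show ?thesis by (rule has_derivative_of_real)
 qed
 show ?thesis
 proof (rule schwartz_coinduct[of _ ?X])
  show "?P g\<in>?X" using assms by blast
 next
  fix h x assume "h\<in>?X"
  then obtain g where h: "h = ?P g" and g: "!!i. smooth1 (g i)" by blast
  have "\<forall>i. \<exists>f'. \<forall>t. (g i has_real_derivative f' t) (at t)" using g smooth1D by metis
  then obtain g' where "!!i t. (g i has_real_derivative g' i t) (at t)" by metis
  then show "h differentiable (at x)" unfolding h differentiable_def using der by blast
 next
  fix h assume "h\<in>?X"
  then obtain g where h: "h = ?P g" and g: "!!i. smooth1 (g i)" and z: "!!i t. R < \<bar>t\<bar> ==> g i t = 0" by blast
  have cont: "continuous_on UNIV h"
   unfolding h
   by (intro continuous_intros continuous_on_compose2[OF smooth1_continuous[OF g, of UNIV]]) auto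
  let ?K = "cbox (\<chi> i. - R) (\<chi> i. R) :: (real^'n) set"
  show "rapid h" unfolding rapid_def
  proof
   fix N
   have "compact ((%x. norm x ^ N *\<^sub>R h x) ` ?K)"
    by (intro compact_continuous_image continuous_intros continuous_on_subset[OF cont]) auto
   then have "bounded (insert 0 ((%x. norm x ^ N *\<^sub>R h x) ` ?K))"
    using compact_imp_bounded by simp
   moreover have "range (%x. norm x ^ N *\<^sub>R h x) \<subseteq> insert 0 ((%x. norm x ^ N *\<^sub>R h x) ` ?K)"
   proof
    fix y assume "y\<in>range (%x. norm x ^ N *\<^sub>R h x)"
    then obtain x where y: "y = norm x ^ N *\<^sub>R h x" by blast
    show "y\<in>insert 0 ((%x. norm x ^ N *\<^sub>R h x) ` ?K)"
    proof (cases "x\<in>?K")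
     case False
     then obtain i where "R < \<bar>x $ i\<bar>" by (auto simp: mem_box_cart abs_le_iff not_le) (meson abs_le_D1 abs_le_D2 abs_minus_cancel linorder_not_less minus_le_iff)+
     then have "h x = 0" unfolding h using z by (auto intro!: bexI[of _ i])
     then show ?thesis by (simp add: y)
    qed (use y in blast)
   qed
   ultimately show "bounded (range (%x. norm x ^ N *\<^sub>R h x))" using bounded_subset by blast
  qed
 next
  fix h i assume "h\<in>?X"
  then obtain g where h: "h = ?P g" and g: "!!i. smooth1 (g i)" and z: "!!i t. R < \<bar>t\<bar> ==> g i t = 0" by blast
  have "\<forall>i. \<exists>f'. smooth1 f' \<and> (\<forall>t. (g i has_real_derivative f' t) (at t))" using g smooth1D by metis
  then obtain g' where g': "!!i. smooth1 (g' i)" "!!i t. (g i has_real_derivative g' i t) (at t)" by metis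
  have z': "g' i t = 0" if "R < \<bar>t\<bar>" for i t
  proof -
   have "open {t. R < \<bar>t :: real\<bar>}" by (intro open_Collect_less continuous_intros)
   then have "((%_. 0) has_real_derivative g' i t) (at t)"
    by (rule has_field_derivative_transform_within_open[OF g'(2)]) (use that z in auto)
   then show ?thesis using DERIV_unique DERIV_const by blast
  qed
  have "partial i h = ?P (g(i := g' i))"
  proof
   fix x :: "real^'n"
   have "partial i h x = cplx (\<Sum>k\<in>UNIV. (g' k (x $ k)*axis i 1 $ k)*(\<Prod>j\<in>UNIV - {k}. g j (x $ j)))"
    unfolding h by (rule partial_eq_derivative[OF der[OF g'(2)]])
   also have "(\<Sum>k\<in>UNIV. (g' k (x $ k)*axis i 1 $ k)*(\<Prod>j\<in>UNIV - {k}. g j (x $ j))) = g' i (x $ i)*(\<Prod>j\<in>UNIV - {i}. g j (x $ j))"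
    by (subst sum.remove[of _ i]) (auto simp: axis_def)
   also have "... = (\<Prod>j\<in>UNIV. (g(i := g' i)) j (x $ j))"
    by (subst (2) prod.remove[of _ i]) auto
   finally show "partial i h x = ?P (g(i := g' i)) x" .
  qed
  then show "partial i h\<in>?X" using g g'(1) z z' by (intro CollectI exI[of _ "g(i := g' i)"]) auto
 qed
qed

lemma schwartz_cutoff:
 obtains cut :: "real^'n::finite => complex"
 where "cut\<in>schwartz" "!!x. \<forall>i. \<bar>x $ i\<bar> <= R ==> cut x = 1"
proof -
 obtain \<sigma> where \<sigma>: "smooth1 \<sigma>" "!!x. x <= 0 ==> \<sigma> x = 0" "!!x. 1 <= x ==> \<sigma> x = 1"
  using smooth_step by metis
 define \<theta> where "\<theta> t = (1*\<sigma> (1*t + (R + 1)) + 0)*(1*\<sigma> ((-1)*t + (R + 1)) + 0)" for t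
 have "smooth1 \<theta>" unfolding \<theta>_def[abs_def] by (intro smooth1_mult smooth1_affine \<sigma>(1))
 moreover have "\<theta> t = 0" if "\<bar>R\<bar> + 1 < \<bar>t\<bar>" for t
 proof (cases "0 <= t")
  case True
  then have "(-1)*t + (R + 1) <= 0" using that by linarith
  then show ?thesis using \<sigma>(2) by (simp add: \<theta>_def)
 next
  case False
  then have "1*t + (R + 1) <= 0" using that by linarith
  then show ?thesis using \<sigma>(2) by (simp add: \<theta>_def)
 qed
 moreover have "\<theta> t = 1" if "\<bar>t\<bar> <= R" for t
  using that \<sigma>(3)[of "t + (R + 1)"] \<sigma>(3)[of "R + 1 - t"] by (simp add: \<theta>_def abs_le_iff)
 ultimately show ?thesis
  by (intro that[of "%x. cplx (\<Prod>i\<in>UNIV. \<theta> (x $ i))"] schwartz_smooth_product[of _ "\<bar>R\<bar> + 1"]) auto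
qed

section \<open>Uniqueness of the representing function\<close>

lemma AE_zero_if_integral_box_zero:
 fixes g :: "'a::euclidean_space => 'b::{banach,second_countable_topology}"
 assumes g: "integrable lborel g" and box: "!!a b. (LINT x:box a b|lborel. g x) = 0"
 shows "AE x in lborel. g x = 0"
proof (rule sigma_finite_measure.density_zero[OF sigma_finite_lborel g])
 fix A assume "A\<in>sets (lborel :: 'a measure)"
 let ?E = "range (%(a, b). box a b) :: 'a set set"
 have si: "set_integrable lborel A g" if "A\<in>sets borel" for A
  unfolding set_integrable_def using g that by (intro integrable_mult_indicator) auto
 \<comment> \<open>The Dynkin argument over boxes needs the integral over the whole space in order
   to handle complements.\<close>
 have UN: "(LBINT x. g x) = 0"
 proof -
  have "(%n. LINT x:box (- (real n *\<^sub>R One)) (real n *\<^sub>R One)|lborel. g x) \<longlonglongrightarrow> (LBINT x. g x)"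
   unfolding set_lebesgue_integral_def
  proof (rule integral_dominated_convergence)
   show "integrable lborel (%x. norm (g x))" using g by simp
   show "AE x in lborel. (%n. indicat_real (box (- (real n *\<^sub>R One)) (real n *\<^sub>R One)) x *\<^sub>R g x) \<longlonglongrightarrow> g x"
   proof (rule AE_I2)
    fix x :: 'a
    have "x\<in>(\<Union>n::nat. box (- (real n *\<^sub>R One)) (real n *\<^sub>R One))" by (simp only: UN_box_eq_UNIV UNIV_I)
    then obtain n :: nat where n: "x\<in>box (- (real n *\<^sub>R One)) (real n *\<^sub>R One)" by blast
    have "x\<in>box (- (real m *\<^sub>R One)) (real m *\<^sub>R One)" if "n <= m" for m
     using n that by (force simp: mem_box)
    then show "(%n. indicat_real (box (- (real n *\<^sub>R One)) (real n *\<^sub>R One)) x *\<^sub>R g x) \<longlonglongrightarrow> g x"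
     by (intro tendsto_eventually) (auto simp: eventually_sequentially intro!: exI[of _ n])
   qed
  qed (use g in \<open>auto simp: indicator_def\<close>)
  then show ?thesis by (simp add: box LIMSEQ_const_iff)
 qed
 have "Int_stable ?E" by (auto simp: Int_stable_def box_Int_box)
 moreover have "?E \<subseteq> Pow UNIV" by simp
 moreover have "A\<in>sigma_sets UNIV ?E" using \<open>A\<in>sets lborel\<close> by (simp add: borel_eq_box)
 ultimately show "(LBINT x:A. g x) = 0"
 proof (induction rule: sigma_sets_induct_disjoint)
  case (basic A)
  then show ?case using box by auto
 next
  case (compl A)
  then have A: "A\<in>sets borel" by (simp add: borel_eq_box)
  have "(LINT x:UNIV - A|lborel. g x) = (LBINT x. g x) - (LBINT x:A. g x)"
  proof -
   have "indicat_real (UNIV - A) x *\<^sub>R g x = g x - indicat_real A x *\<^sub>R g x" for x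
    by (simp add: indicator_def)
   then show ?thesis
    unfolding set_lebesgue_integral_def
    using Bochner_Integration.integral_diff[OF g si[OF A, unfolded set_integrable_def]] by simp
  qed
  then show ?case using compl UN by simp
 next
  case (union A)
  then have A: "A i\<in>sets borel" for i by (auto simp: borel_eq_box)
  have "(LINT x:(\<Union>i. A i)|lborel. g x) = (\<Sum>i. (LINT x:(A i)|lborel. g x))"
   by (rule lebesgue_integral_countable_add)
     (use A union in \<open>auto simp: disjoint_family_on_def intro!: si\<close>)
  then show ?case using union by simp
 qed (auto simp: set_lebesgue_integral_def)
qed

text \<open>As h is integrable only against Schwartz functions, it is first multiplied by a cutoff.
  Indicators of boxes are then bounded limits of smooth products of steps whose steepness grows with
  n.\<close>

lemma AE_zero_if_schwartz_integral_zero: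
 fixes h :: "real^'n::finite => complex"
 assumes h [measurable]: "h\<in>borel_fun"
  and int: "!!f. f\<in>schwartz ==> integrable lborel (%x. h x*f x)"
  and zero: "!!f. f\<in>schwartz ==> (LBINT x. h x*f x) = 0"
 shows "AE x in lborel. h x = 0"
proof -
 obtain \<sigma> where \<sigma>: "smooth1 \<sigma>" "!!x. x <= 0 ==> \<sigma> x = 0" "!!x. 1 <= x ==> \<sigma> x = 1"
  "!!x. 0 <= \<sigma> x" "!!x. \<sigma> x <= 1"
  using smooth_step by metis
 have "AE x in lborel. (\<forall>i. \<bar>x $ i\<bar> <= real R) --> h x = 0" for R :: nat
 proof -
  obtain cut :: "real^'n => complex" where cut: "cut\<in>schwartz" "!!x. \<forall>i. \<bar>x $ i\<bar> <= real R ==> cut x = 1"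
   using schwartz_cutoff[of "real R"] by blast
  define g where "g x = h x*cut x" for x
  have g: "integrable lborel g" unfolding g_def[abs_def] by (rule int[OF cut(1)])
  have "AE x in lborel. g x = 0"
  proof (rule AE_zero_if_integral_box_zero[OF g])
   fix a b :: "real^'n"
   define \<beta> where "\<beta> n i t = (1*\<sigma> (real n*t + (- real n*a $ i)) + 0)*(1*\<sigma> ((- real n)*t + real n*b $ i) + 0)" for n i t
   define B where "B n x = cplx (\<Prod>i\<in>UNIV. \<beta> n i (x $ i))" for n and x :: "real^'n"
   define R where "R = norm a + norm b"
   have \<beta>0: "\<beta> n i t = 0" if "t <= a $ i \<or> b $ i <= t" for n i t
   proof -
    have "real n*t + (- real n*a $ i) <= 0 \<or> (- real n)*t + real n*b $ i <= 0"
     using that mult_left_mono[of t "a $ i" "real n"] mult_left_mono[of "b $ i" t "real n"] by auto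
    then show ?thesis using \<sigma>(2) by (auto simp: \<beta>_def)
   qed
   have B: "B n\<in>schwartz" for n
    unfolding B_def[abs_def]
   proof (rule schwartz_smooth_product)
    show "smooth1 (\<beta> n i)" for i unfolding \<beta>_def[abs_def] by (intro smooth1_mult smooth1_affine \<sigma>(1))
    show "\<beta> n i t = 0" if "R < \<bar>t\<bar>" for i t
     using that component_le_norm_cart[of a i] component_le_norm_cart[of b i]
     by (intro \<beta>0) (auto simp: R_def)
   qed
   have \<beta>1: "(%n. \<beta> n i t) \<longlonglongrightarrow> 1" if "a $ i < t" "t < b $ i" for i t
   proof -
    obtain N1 :: nat where N1: "1/(t - a $ i) <= real N1" using real_arch_simple by blast
    obtain N2 :: nat where N2: "1/(b $ i - t) <= real N2" using real_arch_simple by blast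
    have "\<beta> n i t = 1" if "max N1 N2 <= n" for n
    proof -
     have "1/(t - a $ i) <= real n" "1/(b $ i - t) <= real n" using N1 N2 that by linarith+
     then have "1 <= real n*(t - a $ i)" "1 <= real n*(b $ i - t)"
      using \<open>a $ i < t\<close> \<open>t < b $ i\<close> by (auto simp: field_simps)
     then show ?thesis by (simp add: \<beta>_def \<sigma>(3) algebra_simps)
    qed
    then show ?thesis
     by (intro tendsto_eventually) (auto simp: eventually_sequentially intro!: exI[of _ "max N1 N2"])
   qed
   have lim: "(%n. B n x) \<longlonglongrightarrow> cplx (indicat_real (box a b) x)" for x
   proof (cases "x\<in>box a b")
    case True
    then have "(%n. B n x) \<longlonglongrightarrow> cplx (\<Prod>i\<in>(UNIV::'n set). 1)"
     unfolding B_def by (intro tendsto_intros \<beta>1) (auto simp: mem_box_cart)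
    then show ?thesis using True by simp
   next
    case False
    then obtain i where "x $ i <= a $ i \<or> b $ i <= x $ i" by (auto simp: mem_box_cart not_less)
    then have "B n x = 0" for n unfolding B_def using \<beta>0 by (auto intro!: bexI[of _ i])
    then show ?thesis using False by simp
   qed
   have \<beta>b: "0 <= \<beta> n i t \<and> \<beta> n i t <= 1" for n i t
    using \<sigma>(4,5) by (auto simp: \<beta>_def intro!: mult_le_one)
   have Bb: "norm (B n x) <= 1" for n x
    unfolding B_def norm_of_real abs_prod
    by (rule prod_le_1) (use \<beta>b in \<open>auto simp: abs_le_iff intro: order_trans[of _ 0]\<close>)
   have "(%n. LBINT x. g x*B n x) \<longlonglongrightarrow> (LBINT x. g x*cplx (indicat_real (box a b) x))"
   proof (rule integral_dominated_convergence)
    show "integrable lborel (%x. norm (g x))" using g by simp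
    show "AE x in lborel. (%n. g x*B n x) \<longlonglongrightarrow> g x*cplx (indicat_real (box a b) x)"
     by (intro AE_I2 tendsto_intros lim)
    show "AE x in lborel. norm (g x*B n x) <= norm (g x)" for n
     using Bb by (auto simp: norm_mult mult_left_le)
    have [measurable]: "g\<in>borel_fun" using g by (simp add: borel_measurable_integrable)
    show "(%x. g x*cplx (indicat_real (box a b) x))\<in>borel_measurable lborel" by measurable
    show "(%x. g x*B n x)\<in>borel_measurable lborel" for n
     using schwartz_measurable[OF B[of n]] by measurable
   qed
   moreover have "(LBINT x. g x*B n x) = 0" for n
    using zero[OF schwartz_mult[OF cut(1) B[of n]]] by (simp add: g_def mult.assoc)
   ultimately show "(LINT x:box a b|lborel. g x) = 0"
    by (simp add: LIMSEQ_const_iff set_lebesgue_integral_def scaleR_conv_of_real mult.commute)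
  qed
  then show ?thesis
   by eventually_elim (use cut(2) in \<open>auto simp: g_def\<close>)
 qed
 then have "AE x in lborel. \<forall>R::nat. (\<forall>i. \<bar>x $ i\<bar> <= real R) --> h x = 0"
  unfolding AE_all_countable by blast
 then show ?thesis
 proof eventually_elim
  case (elim x)
  obtain R :: nat where "norm x <= real R" using real_arch_simple by blast
  then have "\<forall>i. \<bar>x $ i\<bar> <= real R" using component_le_norm_cart[of x] order_trans by blast
  then show ?case using elim by blast
 qed
qed

lemma represents_unique:
 assumes g: "represents g T" and h: "represents h T"
 shows "AE x in lborel. g x = h x"
proof -
 have "AE x in lborel. g x - h x = 0"
 proof (rule AE_zero_if_schwartz_integral_zero)
  show "(%x. g x - h x)\<in>borel_fun" using g h by (auto simp: represents_def)
  fix f :: "real^'a => complex" assume f: "f\<in>schwartz"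
  have i: "integrable lborel (%x. g x*f x)" "integrable lborel (%x. h x*f x)"
   and e: "(LBINT x. g x*f x) = (LBINT x. h x*f x)"
   using g h f by (auto simp: represents_def)
  show "integrable lborel (%x. (g x - h x)*f x)" "(LBINT x. (g x - h x)*f x) = 0"
   using i e by (simp_all add: left_diff_distrib)
 qed
 then show ?thesis by simp
qed

section \<open>Weighted square-integrable functions\<close>

lemma borel_measurable_cnj [measurable (raw)]:
 "f\<in>borel_measurable M ==> (%x. cnj (f x))\<in>borel_measurable M"
 using measurable_compose[of f M borel cnj borel] borel_measurable_continuous_onI[of cnj] continuous_on_cnj[OF continuous_on_id]
 by blast

definition weight :: "real => 'a::real_normed_vector => real" where
 "weight t x = (1 + (norm x)^2) powr t"

lemma weight_pos [simp]: "0 < weight t x"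
proof -
 have "0 < 1 + (norm x)^2" by (simp add: add_pos_nonneg)
 then show ?thesis by (simp add: weight_def)
qed
lemma weight_nonneg [simp]: "0 <= weight t x"
 by (simp add: less_imp_le)
lemma weight_add: "weight (s + t) x = weight s x*weight t x"
 by (simp add: weight_def powr_add)
lemma weight_zero [simp]: "weight 0 x = 1"
 using weight_pos[of 0 x] unfolding weight_def by (metis powr_gt_zero powr_zero_eq_one)
lemma weight_minus: "weight (- t) x = 1/weight t x"
 by (simp add: weight_def powr_minus_divide)
lemma weight_mono: "s <= t ==> weight s x <= weight t x"
 unfolding weight_def by (rule powr_mono) auto
lemma weight_measurable [measurable]: "weight t\<in>borel_measurable (borel :: 'a::{real_normed_vector,second_countable_topology} measure)"
 unfolding weight_def[abs_def] by measurable

lemma weight_poly: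
 assumes "t <= real K"
 shows "weight t x <= (1 + norm x) ^ (2*K)"
proof -
 have "weight t x <= weight (real K) x" by (rule weight_mono[OF assms])
 also have "... = (1 + (norm x)^2) ^ K"
  unfolding weight_def by (rule powr_realpow) (simp add: add_pos_nonneg)
 also have "... <= ((1 + norm x)^2) ^ K"
  using norm_ge_zero[of x] by (intro power_mono) (auto simp: power2_sum simp del: norm_ge_zero)
 finally show ?thesis by (simp add: power_mult)
qed

text \<open>Peetre's inequality. For negative t the roles of x and y are exchanged in the same
  quadratic estimate.\<close>

lemma weight_peetre:
 "weight t x <= 2 powr \<bar>t\<bar>*weight t y*weight \<bar>t\<bar> (y - x)"
proof -
 have le: "1 + (norm x)^2 <= 2*(1 + (norm y)^2)*(1 + (norm (y - x))^2)" for x y :: 'a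
 proof -
  have "norm x <= norm y + norm (y - x)" using norm_triangle_ineq4[of y "y - x"] by simp
  then have "(norm x)^2 <= (norm y + norm (y - x))^2" by (intro power_mono) auto
  also have "... <= 2*(norm y)^2 + 2*(norm (y - x))^2"
   using sum_squares_bound[of "norm y" "norm (y - x)"] by (simp add: power2_sum)
  moreover have "0 <= (norm y)^2*(norm (y - x))^2" by simp
  moreover have "2*(1 + (norm y)^2)*(1 + (norm (y - x))^2) =
   2 + 2*(norm y)^2 + 2*(norm (y - x))^2 + 2*((norm y)^2*(norm (y - x))^2)"
   by (simp add: algebra_simps)
  ultimately show ?thesis by linarith
 qed
 show ?thesis
 proof (cases "0 <= t")
  case True
  have "weight t x <= (2*(1 + (norm y)^2)*(1 + (norm (y - x))^2)) powr t"
   unfolding weight_def using True le by (intro powr_mono2) auto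
  then show ?thesis using True by (simp only: weight_def powr_mult abs_of_nonneg)
 next
  case False
  define r where "r = - t"
  have r: "0 < r" "\<bar>t\<bar> = r" "t = - r" using False by (auto simp: r_def)
  have "weight r y <= (2*(1 + (norm x)^2)*(1 + (norm (x - y))^2)) powr r"
   unfolding weight_def using r le by (intro powr_mono2) auto
  then have "weight r y <= 2 powr r*weight r x*weight r (y - x)"
   by (simp only: weight_def powr_mult norm_minus_commute[of y x])
  then have "1/weight r x <= 2 powr r*(1/weight r y)*weight r (y - x)"
   by (simp add: field_simps)
  then show ?thesis unfolding r(3) using r(1) by (simp add: weight_minus abs_of_pos)
 qed
qed

text \<open>If a factor on the right is 0 the left side is 0; otherwise, if one is infinite, so is
  their product. The finite case is the nonnegativity of the integral of (C a - A b)^2.\<close>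

lemma nn_integral_Cauchy_Schwarz:
 fixes a b :: "'a => real"
 assumes [measurable]: "a\<in>borel_measurable M" "b\<in>borel_measurable M"
  and a: "!!x. 0 <= a x" and b: "!!x. 0 <= b x"
 shows "(\<integral>\<^sup>+x. ennreal (a x*b x) \<partial>M)^2 <= (\<integral>\<^sup>+x. ennreal ((a x)^2) \<partial>M)*(\<integral>\<^sup>+x. ennreal ((b x)^2) \<partial>M)"
  (is "?C^2 <= ?A*?B")
proof -
 have zero: "?C = 0" if "?A = 0 \<or> ?B = 0"
  using that a b by (auto simp: nn_integral_0_iff_AE ennreal_eq_0_iff elim!: eventually_mono)
 show ?thesis
 proof (cases "?A = 0 \<or> ?B = 0")
  case True
  then show ?thesis using zero by simp
 next
  case nz: False
  show ?thesis
  proof (cases "?A = \<infinity> \<or> ?B = \<infinity>")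
   case True
   then have "?A*?B = \<infinity>" using nz by (auto simp: ennreal_mult_eq_top_iff)
   then show ?thesis by simp
  next
   case False
   then have iA: "integrable M (%x. (a x)^2)" and iB: "integrable M (%x. (b x)^2)"
    by (auto intro!: integrableI_bounded simp: top.not_eq_extremum)
   have iC: "integrable M (%x. a x*b x)"
   proof (rule integrable_bound_fun[OF Bochner_Integration.integrable_add[OF iA iB]])
    show "AE x in M. norm (a x*b x) <= norm ((a x)^2 + (b x)^2)"
    proof (rule AE_I2)
     fix x
     have "0 <= a x*b x" using a b by simp
     then show "norm (a x*b x) <= norm ((a x)^2 + (b x)^2)"
      using sum_squares_bound[of "a x" "b x"] by simp
    qed
   qed measurable
   define A B C where "A = (LINT x|M. (a x)^2)" and "B = (LINT x|M. (b x)^2)" and "C = (LINT x|M. a x*b x)"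
   have eqs: "?A = ennreal A" "?B = ennreal B" "?C = ennreal C"
    unfolding A_def B_def C_def using a b iA iB iC by (auto intro!: nn_integral_eq_integral)
   have A0: "0 < A" using nz eqs(1) by (auto simp: ennreal_eq_0_iff)
   have B0: "0 <= B" "0 <= C" unfolding B_def C_def using a b by auto
   have "0 <= (LINT x|M. (C*a x - A*b x)^2)" by simp
   also have "(LINT x|M. (C*a x - A*b x)^2) = (LINT x|M. (C^2*(a x)^2 - (2*A*C)*(a x*b x)) + A^2*(b x)^2)"
    by (simp add: power2_eq_square algebra_simps)
   also have "... = (C^2*A - (2*A*C)*C) + A^2*B"
    unfolding A_def B_def C_def using iA iB iC by simp
   finally have "0 <= A*(A*B - C\<^sup>2)" by (simp add: power2_eq_square algebra_simps)
   then have "C^2 <= A*B" using A0 by (simp add: zero_le_mult_iff)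
   then have "ennreal (C^2) <= ennreal (A*B)" by (rule ennreal_leI)
   then show ?thesis unfolding eqs using A0 B0 by (simp add: ennreal_mult ennreal_power)
  qed
 qed
qed

text \<open>If p is not integrable, its Bochner integral is 0 by convention and the bound is
  trivial.\<close>

lemma integral_Cauchy_Schwarz_bound:
 fixes p :: "'a => complex" and a b :: "'a => real"
 assumes [measurable]: "a\<in>borel_measurable M" "b\<in>borel_measurable M"
  and "!!x. 0 <= a x" "!!x. 0 <= b x" and p: "!!x. norm (p x) <= a x*b x"
 shows "ennreal ((norm (LINT x|M. p x))^2) <= (\<integral>\<^sup>+x. ennreal ((a x)^2) \<partial>M)*(\<integral>\<^sup>+x. ennreal ((b x)^2) \<partial>M)"
proof (cases "integrable M p")
 case True
 have "ennreal (norm (LINT x|M. p x)) <= (\<integral>\<^sup>+x. ennreal (norm (p x)) \<partial>M)"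
  by (rule integral_norm_bound_ennreal[OF True])
 also have "... <= (\<integral>\<^sup>+x. ennreal (a x*b x) \<partial>M)"
  by (intro nn_integral_mono ennreal_leI p)
 finally have "(ennreal (norm (LINT x|M. p x)))^2 <= (\<integral>\<^sup>+x. ennreal (a x*b x) \<partial>M)^2"
  by (rule power_mono) simp
 also have "... <= (\<integral>\<^sup>+x. ennreal ((a x)^2) \<partial>M)*(\<integral>\<^sup>+x. ennreal ((b x)^2) \<partial>M)"
  by (rule nn_integral_Cauchy_Schwarz) (use assms in auto)
 finally show ?thesis by (simp add: ennreal_power)
qed (simp add: not_integrable_integral_eq)

text \<open>The Fourier image of the Sobolev space of order s, as functions rather than classes;
  null sets are handled explicitly.\<close>

definition wL2 :: "real => (real^'n::finite => complex) set" where
 "wL2 s = {h. h\<in>borel_fun \<and> integrable lborel (%w. (norm (h w))^2*weight s w)}"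

lemma wL2_measurable [measurable_dest]: "h\<in>wL2 s ==> h\<in>borel_fun"
 by (simp add: wL2_def)
lemma wL2_integrable: "h\<in>wL2 s ==> integrable lborel (%w. (norm (h w))^2*weight s w)"
 by (simp add: wL2_def)

lemma wL2_mono: "h\<in>wL2 t ==> s <= t ==> h\<in>wL2 s"
 unfolding wL2_def
 by (auto elim!: integrable_bound_fun simp: abs_mult abs_of_pos
   intro!: AE_I2 mult_left_mono weight_mono)

lemma integrable_weighted_L2_pair:
 assumes g: "g\<in>wL2 s" and h: "h\<in>wL2 (- s)"
 shows "integrable lborel (%w. g w*h w)"
proof (rule integrable_bound_fun)
 have [measurable]: "g\<in>borel_fun" "h\<in>borel_fun" using g h by auto
 show "integrable lborel (%w. (norm (g w))^2*weight s w + (norm (h w))^2*weight (- s) w)"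
  by (intro Bochner_Integration.integrable_add wL2_integrable g h)
 show "AE w in lborel. norm (g w*h w) <= norm ((norm (g w))^2*weight s w + (norm (h w))^2*weight (- s) w)"
 proof (rule AE_I2)
  fix w
  let ?a = "norm (g w)*weight (s/2) w" and ?b = "norm (h w)*weight (- s/2) w"
  have "?a*?b = norm (g w*h w)*(weight (s/2) w*weight (- s/2) w)"
   by (simp add: norm_mult)
  also have "weight (s/2) w*weight (- s/2) w = 1"
   by (subst weight_add[symmetric]) simp
  finally have "norm (g w*h w) = ?a*?b" by simp
  also have "... <= ?a^2 + ?b^2"
  proof -
   have "0 <= ?a*?b" by simp
   then show ?thesis using sum_squares_bound[of ?a ?b] by linarith
  qed
  also have "... = (norm (g w))^2*weight s w + (norm (h w))^2*weight (- s) w"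
   using weight_add[of "s/2" "s/2" w] weight_add[of "- s/2" "- s/2" w]
   by (simp add: power_mult_distrib power2_eq_square)
  finally show "norm (g w*h w) <= norm ((norm (g w))^2*weight s w + (norm (h w))^2*weight (- s) w)"
   by simp
 qed
qed (use g h in measurable)

lemma rapid_weighted_L2:
 assumes "rapid f" and [measurable]: "f\<in>borel_fun"
 shows "f\<in>wL2 s"
proof -
 obtain K :: nat where K: "s <= real K" using real_arch_simple by blast
 obtain C where C: "0 < C" "!!x. (1 + norm x) ^ 0*norm (f x) <= C*decay x"
  using rapid_decay_bound[OF assms(1)] by blast
 have C1: "norm (f x) <= C" for x
 proof -
  have "decay x <= 1" by (simp add: decay_def inverse_le_1_iff)
  then have "C*decay x <= C*1" using C(1) by (intro mult_left_mono) auto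
  then show ?thesis using C(2)[of x] by simp
 qed
 have "integrable lborel (%w. C*((1 + norm w) ^ (2*K)*norm (f w)))"
  by (intro integrable_mult_right integrable_rapid assms)
 then have "integrable lborel (%w. (norm (f w))^2*weight s w)"
 proof (rule integrable_bound_fun)
  show "AE w in lborel. norm ((norm (f w))^2*weight s w) <= norm (C*((1 + norm w) ^ (2*K)*norm (f w)))"
  proof (rule AE_I2)
   fix w
   have "(norm (f w))^2*weight s w <= (C*norm (f w))*(1 + norm w) ^ (2*K)"
    unfolding power2_eq_square using C1 C(1) by (intro mult_mono mult_right_mono weight_poly K) auto
   then show "norm ((norm (f w))^2*weight s w) <= norm (C*((1 + norm w) ^ (2*K)*norm (f w)))"
    using C(1) by (simp add: abs_mult mult_ac)
  qed
 qed measurable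
 then show ?thesis by (simp add: wL2_def)
qed

lemma schwartz_weighted_L2: "f\<in>schwartz ==> f\<in>wL2 s"
 by (intro rapid_weighted_L2 schwartz_rapid schwartz_measurable)

lemma integrable_weighted_L2_schwartz:
 "h\<in>wL2 s ==> f\<in>schwartz ==> integrable lborel (%x. h x*f x)"
 by (rule integrable_weighted_L2_pair) (auto intro: schwartz_weighted_L2)

text \<open>A large inverse power lies in the dual space \<open>wL2 (- s)\<close>: \<open>L\<close>
  compensates a negative s and the dimension buys integrability. This is what temperedness and the
  convolution integrals rely on.\<close>

lemma wL2_polynomial_decay:
 fixes h :: "real^'n::finite => complex"
 assumes "h\<in>wL2 s"
 obtains K where "integrable lborel (%x. norm (h x)*inverse ((1 + norm x) ^ K))"
proof -
 obtain L :: nat where L: "- s <= real L" using real_arch_simple by blast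
 define K where "K = L + CARD('n)"
 have "(%x::real^'n. cplx (inverse ((1 + norm x) ^ K)))\<in>wL2 (- s)"
  unfolding wL2_def
 proof (intro CollectI conjI)
  show "integrable lborel (%x::real^'n. (norm (cplx (inverse ((1 + norm x) ^ K))))^2*weight (- s) x)"
  proof (rule integrable_bound_fun[OF integrable_decay])
   show "AE x::real^'n in lborel. norm ((norm (cplx (inverse ((1 + norm x) ^ K))))^2*weight (- s) x) <= norm (decay x)"
   proof (rule AE_I2)
    fix x :: "real^'n"
    have p: "0 < (1 + norm x) ^ K" "0 < 1 + norm x" by (simp_all add: add_pos_nonneg)
    have "(norm (cplx (inverse ((1 + norm x) ^ K))))^2 = inverse ((1 + norm x) ^ (2*K))"
     unfolding norm_of_real using p by (simp add: power_inverse power_mult[symmetric] mult.commute)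
    then have "(norm (cplx (inverse ((1 + norm x) ^ K))))^2*weight (- s) x <= inverse ((1 + norm x) ^ (2*K))*(1 + norm x) ^ (2*L)"
     using p by (simp add: mult_left_mono weight_poly[OF L])
    also have "... = decay x" using p by (simp add: decay_def K_def power_add field_simps)
    finally show "norm ((norm (cplx (inverse ((1 + norm x) ^ K))))^2*weight (- s) x) <= norm (decay x)"
     by (simp add: abs_mult)
   qed
  qed measurable
 qed measurable
 from integrable_norm[OF integrable_weighted_L2_pair[OF assms this]]
 show ?thesis by (intro that[of K]) (simp only: norm_mult norm_of_real, simp add: abs_of_pos add_pos_nonneg)
qed

section \<open>Distributions represented by weighted square-integrable functions\<close>

lemma represents_measurable: "represents h T ==> h\<in>borel_fun"
 by (simp add: represents_def)

lemma represents_add: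
 "represents g S ==> represents h T ==> represents (%x. g x + h x) (%f. S f + T f)"
 unfolding represents_def by (auto simp: distrib_right)
lemma represents_cmult: "represents h T ==> represents (%x. c*h x) (%f. c*T f)"
 unfolding represents_def by (auto simp: mult.assoc)
lemma represents_diff:
 "represents g S ==> represents h T ==> represents (%x. g x - h x) (%f. S f - T f)"
 unfolding represents_def by (auto simp: left_diff_distrib)
lemma represents_sum:
 assumes "!!i. i\<in>I ==> represents (h i) (T i)"
 shows "represents (%x. \<Sum>i\<in>I. h i x) (%f. \<Sum>i\<in>I. T i f)"
 using assms
proof (induction I rule: infinite_finite_induct)
 case (insert i I)
 then show ?case using represents_add[of "h i" "T i"] by simp
qed (auto simp: represents_def)

lemma represents_weighted_L2:
 "h\<in>wL2 s ==> (!!f. f\<in>schwartz ==> T f = (LBINT x. h x*f x)) ==> represents h T"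
 unfolding represents_def using integrable_weighted_L2_schwartz by auto

lemma
 assumes "represents h (dist_fourier T)"
 shows fourier_fun_represents: "represents (fourier_fun T) (dist_fourier T)"
  and fourier_fun_continuous: "continuous_on UNIV h ==> continuous_on UNIV (fourier_fun T)"
proof -
 let ?P = "%h. represents h (dist_fourier T) \<and>
   ((\<exists>g. continuous_on UNIV g \<and> represents g (dist_fourier T)) --> continuous_on UNIV h)"
 have "\<exists>h. ?P h" using assms by blast
 then have *: "?P (fourier_fun T)" unfolding fourier_fun_def by (rule someI_ex)
 then show "represents (fourier_fun T) (dist_fourier T)" by blast
 show "continuous_on UNIV (fourier_fun T)" if "continuous_on UNIV h" using*assms that by blast
qed

lemma fourier_fun_AE:
 assumes "represents h (dist_fourier T)"
 shows "AE w in lborel. fourier_fun T w = h w"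
 by (rule represents_unique[OF fourier_fun_represents[OF assms] assms])

text \<open>By Fourier inversion, T integrates h against the inverse transform of the test function,
  and \<open>fourier_bound\<close> controls that transform at the rate which h tolerates. Membership
  in a Sobolev space thereby becomes a condition on h alone.\<close>

lemma tempered_if_represents:
 fixes T :: "'n::finite dist"
 assumes h: "h\<in>wL2 s" and rep: "represents h (dist_fourier T)"
 shows "tempered_distribution T"
proof -
 have T: "T \<eta> = (LBINT x. h x*ifourier \<eta> x)" if "\<eta>\<in>schwartz" for \<eta>
  using rep schwartz_ifourier[OF that] by (auto simp: represents_def dist_fourier_def fourier_ifourier[OF that])
 have int: "integrable lborel (%x. h x*ifourier \<eta> x)" if "\<eta>\<in>schwartz" for \<eta>
  using integrable_weighted_L2_schwartz[OF h schwartz_ifourier[OF that]] .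
 have if_add: "ifourier (%x. f x + g x) y = ifourier f y + ifourier g y" if "f\<in>schwartz" "g\<in>schwartz" for f g :: "real^'n => complex" and y
  unfolding ifourier_eq using integrable_schwartz[OF schwartz_character[OF that(1)]] integrable_schwartz[OF schwartz_character[OF that(2)]]
  by (simp add: distrib_left)
 have if_cmult: "ifourier (%x. c*f x) y = c*ifourier f y" for c and f :: "real^'n => complex" and y
  unfolding ifourier_eq by (simp add: mult.left_commute[of _ c])
 obtain K where K: "integrable lborel (%x. norm (h x)*inverse ((1 + norm x) ^ K))"
  using wL2_polynomial_decay[OF h] .
 obtain C N where CN: "!!(f :: real^'n => complex) w. f\<in>schwartz ==>
  (1 + norm w) ^ K*norm (fourier f w) <= C * schwartz_seminorm N f"
  using fourier_bound[where 'n = 'n and K = K] by blast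
 define I where "I = (LBINT x. norm (h x)*inverse ((1 + norm x) ^ K))"
 have "norm (T \<eta>) <= (I*C) * schwartz_seminorm N \<eta>" if \<eta>: "\<eta>\<in>schwartz" for \<eta>
 proof -
  have "norm (T \<eta>) <= (LBINT x. norm (h x*ifourier \<eta> x))"
   unfolding T[OF \<eta>] by (rule integral_norm_bound)
  also have "... <= (LBINT x. (norm (h x)*inverse ((1 + norm x) ^ K))*(C * schwartz_seminorm N \<eta>))"
  proof (rule integral_mono)
   fix x :: "real^'n"
   have p: "0 < (1 + norm x) ^ K" by (simp add: add_pos_nonneg)
   have "norm (ifourier \<eta> x) <= inverse ((1 + norm x) ^ K)*(C * schwartz_seminorm N \<eta>)"
    using CN[OF \<eta>, of "- x"] p by (simp add: ifourier_def field_simps)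
   then show "norm (h x*ifourier \<eta> x) <= (norm (h x)*inverse ((1 + norm x) ^ K))*(C * schwartz_seminorm N \<eta>)"
    by (simp add: norm_mult mult.assoc mult_left_mono)
  qed (intro integrable_norm int \<eta> integrable_mult_left K)+
  also have "... = (I*C) * schwartz_seminorm N \<eta>" by (simp add: I_def)
  finally show ?thesis .
 qed
 then show ?thesis
  unfolding tempered_distribution_def
  using int by (auto simp: T schwartz_add schwartz_cmult if_add if_cmult distrib_left mult.left_commute[of _ _ "ifourier _ _"] intro!: exI)
qed

lemma sobolev_iff:
 assumes rep: "represents h (dist_fourier T)"
 shows "T\<in>sobolev s \<longleftrightarrow> h\<in>wL2 s"
proof -
 have m: "fourier_fun T\<in>borel_fun" "h\<in>borel_fun"
  using represents_measurable fourier_fun_represents rep by blast+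
 have "integrable lborel (%w. (norm (fourier_fun T w))^2*(1 + (norm w)^2) powr s) \<longleftrightarrow>
  integrable lborel (%w. (norm (h w))^2*weight s w)"
  unfolding weight_def
  by (rule integrable_cong_AE) (use m fourier_fun_AE[OF rep] in \<open>auto elim: eventually_mono\<close>)
 then show ?thesis
  using tempered_if_represents[OF _ rep] rep m by (auto simp: sobolev_def wL2_def)
qed

lemma sobolev_fourier_fun:
 assumes "T\<in>sobolev s"
 shows "represents (fourier_fun T) (dist_fourier T)" "fourier_fun T\<in>wL2 s"
proof -
 obtain h where "represents h (dist_fourier T)" using assms by (auto simp: sobolev_def)
 then show r: "represents (fourier_fun T) (dist_fourier T)" by (rule fourier_fun_represents)
 show "fourier_fun T\<in>wL2 s" using sobolev_iff[OF r] assms by simp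
qed

definition wnorm :: "real => (real^'n::finite => complex) => real" where
 "wnorm s h = sqrt (LBINT w. (norm (h w))^2*weight s w)"

lemma
 fixes h :: "real^'n::finite => complex"
 assumes rep: "represents h (dist_fourier T)"
 shows sobolev_norm_eq: "sobolev_norm s T = wnorm s h"
  and sobolev_seminorm_eq: "sobolev_seminorm r T = sqrt (LBINT w. norm w powr (2*r)*(norm (h w))^2)"
  and pairing_eq: "represents g (dist_fourier S) ==> pairing T S = (LBINT w. h w*cnj (g w))"
  and sobolev_inner_eq: "represents g (dist_fourier S) ==>
   sobolev_inner s T S = (LBINT w. (h w*cplx (weight s w))*cnj (g w))"
proof -
 have [measurable]: "fourier_fun T\<in>borel_fun" "h\<in>borel_fun"
  using represents_measurable fourier_fun_represents rep by blast+
 note ae = fourier_fun_AE[OF rep]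
 show "sobolev_norm s T = wnorm s h"
  unfolding sobolev_norm_def wnorm_def weight_def
  by (intro arg_cong[of _ _ sqrt] integral_cong_AE) (use ae in \<open>auto elim: eventually_mono\<close>)
 show "sobolev_seminorm r T = sqrt (LBINT w. norm w powr (2*r)*(norm (h w))^2)"
  unfolding sobolev_seminorm_def
  by (intro arg_cong[of _ _ sqrt] integral_cong_AE) (use ae in \<open>auto elim: eventually_mono\<close>)
 assume r: "represents g (dist_fourier S)"
 have [measurable]: "fourier_fun S\<in>borel_fun" "g\<in>borel_fun"
  using represents_measurable fourier_fun_represents r by blast+
 note ae2 = fourier_fun_AE[OF r]
 show "pairing T S = (LBINT w. h w*cnj (g w))"
 proof -
  have "AE w in lborel. fourier_fun T w*cnj (fourier_fun S w) = h w*cnj (g w)"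
   using ae ae2 by eventually_elim simp
  then show ?thesis unfolding pairing_def by (intro integral_cong_AE) auto
 qed
 show "sobolev_inner s T S = (LBINT w. (h w*cplx (weight s w))*cnj (g w))"
 proof -
  have "AE w in lborel. fourier_fun T w*cnj (fourier_fun S w)*cplx (weight s w) =
    h w*cplx (weight s w)*cnj (g w)"
   using ae ae2 by eventually_elim simp
  then show ?thesis unfolding sobolev_inner_def weight_def[symmetric] by (intro integral_cong_AE) auto
 qed
qed

text \<open>Sums of levels are built on the Fourier side; this returns a distribution having a given
  function as transform.\<close>

lemma exists_dist_represented:
 assumes h: "h\<in>wL2 s"
 obtains T where "represents h (dist_fourier T)" "T\<in>sobolev s"
proof -
 define T where "T \<eta> = (LBINT x. h x*ifourier \<eta> x)" for \<eta>
 have "represents h (dist_fourier T)"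
  by (rule represents_weighted_L2[OF h])
    (auto simp: dist_fourier_def T_def fourier_inversion cong: Bochner_Integration.integral_cong)
 then show ?thesis using that h sobolev_iff by blast
qed

section \<open>Matrices\<close>

lemma matpow_0 [simp]: "matpow A 0 = mat 1" by (simp add: matpow_def)
lemma matpow_Suc: "matpow A (Suc j) = A ** matpow A j" by (simp add: matpow_def)
lemma matpow_Suc2: "matpow A (Suc j) = matpow A j ** A"
proof (induction j)
 case (Suc j)
 have "matpow A (Suc (Suc j)) = A ** (matpow A j ** A)" by (simp only: matpow_Suc[of A "Suc j"] Suc)
 then show ?case by (simp add: matrix_mul_assoc matpow_Suc)
qed (simp add: matpow_Suc)
lemma matpow_Suc_mult: "matpow A (Suc j) *v x = matpow A j *v (A *v x)"
 by (simp add: matpow_Suc2 matrix_vector_mul_assoc)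

lemma det_matpow: "det (matpow A j) = det A ^ j"
 by (induction j) (simp_all add: matpow_Suc det_mul)

lemma transpose_matpow: "transpose (matpow A j) = matpow (transpose A) j"
 by (induction j) (simp_all add: matpow_Suc[of A] matpow_Suc2[of "transpose A"] matrix_transpose_mul)

lemma matrix_inv_unique:
 fixes A B :: "real^'n^'n::finite"
 assumes "A ** B = mat 1"
 shows "matrix_inv A = B"
proof -
 have "B ** A = mat 1" using assms matrix_left_right_inverse by blast
 then have "invertible A" using assms unfolding invertible_def by blast
 then have "matrix_inv A ** A = mat 1" using someI_ex[of "%A'. A ** A' = mat 1 \<and> A' ** A = mat 1"]
  by (simp add: invertible_def matrix_inv_def)
 then have "matrix_inv A ** (A ** B) = B" by (simp add: matrix_mul_assoc)
 then show ?thesis by (simp add: assms)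
qed

lemma matrix_inv_det:
 fixes A :: "real^'n^'n::finite"
 assumes "det A ~= 0"
 shows "A ** matrix_inv A = mat 1" "matrix_inv A ** A = mat 1"
 using assms invertible_det_nz[of A] someI_ex[of "%A'. A ** A' = mat 1 \<and> A' ** A = mat 1"]
 by (auto simp: invertible_def matrix_inv_def)

lemma matrix_inv_transpose:
 fixes A :: "real^'n^'n::finite"
 assumes "det A ~= 0"
 shows "matrix_inv (transpose A) = transpose (matrix_inv A)"
 by (rule matrix_inv_unique) (simp add: matrix_transpose_mul[symmetric] matrix_inv_det[OF assms])

lemma matpow_inverse:
 fixes A :: "real^'n^'n::finite"
 assumes "A ** B = mat 1"
 shows "matpow A j ** matpow B j = mat 1"
proof (induction j)
 case (Suc j)
 have "matpow A (Suc j) ** matpow B (Suc j) = matpow A j ** (A ** B) ** matpow B j"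
  by (simp only: matpow_Suc2[of A] matpow_Suc[of B] matrix_mul_assoc)
 then show ?case using Suc assms by simp
qed simp

lemma matrix_inv_matpow:
 fixes A :: "real^'n^'n::finite"
 assumes "det A ~= 0"
 shows "matrix_inv (matpow A j) = matpow (matrix_inv A) j"
 by (rule matrix_inv_unique) (rule matpow_inverse[OF matrix_inv_det(1)[OF assms]])

lemma represents_affine_subst:
 fixes A :: "real^'n^'n::finite"
 assumes d: "det A ~= 0" and rep: "represents h (dist_fourier T)"
 defines "B \<equiv> matrix_inv (transpose A)"
 shows "represents (%w. cplx (1/\<bar>det A\<bar>)*(character b (B *v w)*h (B *v w))) (dist_fourier (affine_subst A b T))"
proof -
 have [measurable]: "h\<in>borel_fun" using rep by (rule represents_measurable)
 have dt: "det (transpose A) ~= 0" using d by (simp add: det_transpose)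
 note inv = matrix_inv_det[OF dt, folded B_def]
 have BA: "B *v (transpose A *v x) = x" for x by (simp only: matrix_vector_mul_assoc inv matrix_vector_mul_lid)
 have inner: "k \<bullet> (B *v x) = (matrix_inv A *v k) \<bullet> x" for k x
  unfolding B_def matrix_inv_transpose[OF d]
  by (metis dot_lmul_matrix inner_commute matrix_transpose_mul transpose_matrix_vector transpose_transpose vector_transpose_matrix)
 show ?thesis
  unfolding represents_def
 proof (intro conjI ballI)
  show "(%w. cplx (1/\<bar>det A\<bar>)*(character b (B *v w)*h (B *v w)))\<in>borel_fun" by measurable
  fix f :: "real^'n => complex" assume f: "f\<in>schwartz"
  have [measurable]: "f\<in>borel_fun" using f by auto
  \<comment> \<open>\<open>f2\<close> is chosen so that its Fourier transform is the test function
    to which \<open>affine_subst\<close> applies T. The substitution then acts on the argument of h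
    instead.\<close>
  define f2 where "f2 z = cplx \<bar>det A\<bar>*(character b z*f (transpose A *v z))" for z
  have f2: "f2\<in>schwartz"
   unfolding f2_def[abs_def] by (intro schwartz_cmult schwartz_character schwartz_matrix[OF f inv(2)])
  have four: "fourier f2 y = fourier f (matrix_inv A *v (y - b))" for y
  proof -
   let ?F = "%x. character (b - y) (B *v x)*f x"
   have "fourier f2 y = (LBINT z. cplx \<bar>det A\<bar>*?F (transpose A *v z))"
    unfolding fourier_eq f2_def
    using character_add_left[of "- y" b] by (intro Bochner_Integration.integral_cong) (simp_all add: BA mult_ac del: transpose_matrix_vector)
   also have "... = cplx \<bar>det A\<bar>*(LBINT z. ?F (transpose A *v z))" by (rule integral_mult_right_zero)
   also have "(LBINT z. ?F (transpose A *v z)) = (1/\<bar>det (transpose A)\<bar>) *\<^sub>R (LBINT x. ?F x)"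
    by (rule integral_lborel_matrix[OF dt]) measurable
   also have "cplx \<bar>det A\<bar>*... = (LBINT x. ?F x)"
    using d by (simp add: det_transpose scaleR_conv_of_real)
   also have "... = fourier f (matrix_inv A *v (y - b))"
    unfolding fourier_eq character_def inner
    by (simp add: matrix_vector_mult_diff_distrib)
   finally show ?thesis .
  qed
  have T: "dist_fourier T f2 = (LBINT x. h x*f2 x)" and i: "integrable lborel (%x. h x*f2 x)"
   using rep f2 by (auto simp: represents_def)
  let ?G = "%w. cplx (1/\<bar>det A\<bar>)*(character b (B *v w)*h (B *v w))*f w"
  have eq: "h z*f2 z = (cplx \<bar>det A\<bar>)^2*?G (transpose A *v z)" for z
   using d by (simp add: f2_def BA power2_eq_square del: transpose_matrix_vector)
  have "integrable lborel (%z. (1/(cplx \<bar>det A\<bar>)^2)*((cplx \<bar>det A\<bar>)^2*?G (transpose A *v z)))"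
   using i unfolding eq by (rule integrable_mult_right)
  then have "integrable lborel (%z. ?G (transpose A *v z))"
   unfolding mult.assoc[symmetric, of "1/(cplx \<bar>det A\<bar>)^2"] using d by (simp del: transpose_matrix_vector)
  then show "integrable lborel ?G"
   by (subst (asm) integrable_lborel_matrix[OF dt]) auto
  have "dist_fourier (affine_subst A b T) f = dist_fourier T f2/cplx \<bar>det A\<bar>"
   by (simp add: dist_fourier_def affine_subst_def four[abs_def])
  also have "dist_fourier T f2 = (cplx \<bar>det A\<bar>)^2*(LBINT z. ?G (transpose A *v z))"
   unfolding T eq by (rule integral_mult_right_zero)
  also have "(LBINT z. ?G (transpose A *v z)) = (1/\<bar>det (transpose A)\<bar>) *\<^sub>R (LBINT x. ?G x)"
   by (rule integral_lborel_matrix[OF dt]) measurable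
  also have "(cplx \<bar>det A\<bar>)^2*.../cplx \<bar>det A\<bar> = (LBINT x. ?G x)"
   using d by (simp add: det_transpose scaleR_conv_of_real power2_eq_square)
  finally show "dist_fourier (affine_subst A b T) f = (LBINT x. ?G x)" .
 qed
qed

text \<open>The transform of \<open>dil_shift M j k\<close> of a distribution with transform h. The
  normalisation m^(j/2) divided by the Jacobian m^j leaves m^(-j/2).\<close>

definition fourier_atom :: "real^'n^'n::finite => nat => int^'n => (real^'n => complex) => real^'n => complex" where
 "fourier_atom M j k h w = cplx (\<bar>det M\<bar> powr (- real j/2)) *
   (character (vec_of_int k) (matpow (matrix_inv (transpose M)) j *v w)*h (matpow (matrix_inv (transpose M)) j *v w))"

lemma represents_dil_shift:
 fixes M :: "real^'n^'n::finite"
 assumes d: "det M ~= 0" and rep: "represents h (dist_fourier g)"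
 shows "represents (fourier_atom M j k h) (dist_fourier (dil_shift M j k g))"
proof -
 have d': "det (matpow M j) ~= 0" "det (transpose M) ~= 0" using d by (auto simp: det_matpow det_transpose)
 have B: "matrix_inv (transpose (matpow M j)) = matpow (matrix_inv (transpose M)) j"
  by (simp only: transpose_matpow matrix_inv_matpow[OF d'(2)])
 have "\<bar>det M\<bar> powr (real j/2)*(1/\<bar>det (matpow M j)\<bar>) = \<bar>det M\<bar> powr (- real j/2)"
 proof -
  have "\<bar>det (matpow M j)\<bar> = \<bar>det M\<bar> powr real j" using d by (simp add: det_matpow power_abs powr_realpow)
  moreover have "\<bar>det M\<bar> powr (real j/2 - real j) = \<bar>det M\<bar> powr (real j/2)/\<bar>det M\<bar> powr real j"
   by (rule powr_diff)
  ultimately show ?thesis by simp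
 qed
 then have c: "cplx (\<bar>det M\<bar> powr (real j/2))*cplx (1/\<bar>det (matpow M j)\<bar>) = cplx (\<bar>det M\<bar> powr (- real j/2))"
  by (metis of_real_mult)
 have "represents (%w. cplx (\<bar>det M\<bar> powr (real j/2))*(cplx (1/\<bar>det (matpow M j)\<bar>) *
   (character (vec_of_int k) (matpow (matrix_inv (transpose M)) j *v w)*h (matpow (matrix_inv (transpose M)) j *v w))))
  (%f. cplx (\<bar>det M\<bar> powr (real j/2))*dist_fourier (affine_subst (matpow M j) (vec_of_int k) g) f)"
  using represents_affine_subst[OF d'(1) rep, of "vec_of_int k"] unfolding B by (rule represents_cmult)
 moreover have "(%f. cplx (\<bar>det M\<bar> powr (real j/2))*dist_fourier (affine_subst (matpow M j) (vec_of_int k) g) f) = dist_fourier (dil_shift M j k g)"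
  by (simp add: dist_fourier_def dil_shift_def)
 ultimately show ?thesis
  unfolding mult.assoc[symmetric, of "cplx (\<bar>det M\<bar> powr (real j/2))"] c
  by (simp add: fourier_atom_def[abs_def] mult.assoc)
qed

section \<open>Fourier transforms of compactly supported distributions\<close>

lemma rapid_translate_bound:
 fixes \<kappa> :: "real^'n::finite => complex"
 assumes "\<kappa>\<in>schwartz"
 obtains C where "0 < C"
  "!!w t. norm (\<kappa> (w - t)) <= C*inverse ((1 + norm w) ^ K)*(1 + norm t) ^ K"
proof -
 obtain C where C: "0 < C" "!!x. (1 + norm x) ^ K*norm (\<kappa> x) <= C"
  using schwartz_bound[OF assms] by blast
 have "norm (\<kappa> (w - t)) <= C*inverse ((1 + norm w) ^ K)*(1 + norm t) ^ K" for w t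
 proof -
  have n: "norm w <= norm (w - t) + norm t" using norm_triangle_ineq[of "w - t" t] by simp
  have "1 + a <= (1 + b)*(1 + c)" if "a <= b + c" "0 <= b" "0 <= c" for a b c :: real
  proof -
   have "(1 + b)*(1 + c) = 1 + b + c + b*c" by (simp add: algebra_simps)
   then show ?thesis using that(1) mult_nonneg_nonneg[OF that(2,3)] by linarith
  qed
  from this[OF n] have "1 + norm w <= (1 + norm (w - t))*(1 + norm t)" by simp
  then have "(1 + norm w) ^ K <= (1 + norm (w - t)) ^ K*(1 + norm t) ^ K"
   by (subst power_mult_distrib[symmetric]) (intro power_mono, auto)
  then have "(1 + norm w) ^ K*norm (\<kappa> (w - t)) <= ((1 + norm (w - t)) ^ K*norm (\<kappa> (w - t)))*(1 + norm t) ^ K"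
   using mult_right_mono[of _ _ "norm (\<kappa> (w - t))"] by (fastforce simp: mult_ac)
  also have "... <= C*(1 + norm t) ^ K" using C(2) by (intro mult_right_mono) auto
  finally have "(1 + norm w) ^ K*norm (\<kappa> (w - t)) <= C*(1 + norm t) ^ K" .
  moreover have "0 < (1 + norm w) ^ K" by (simp add: add_pos_nonneg)
  ultimately show ?thesis by (simp add: field_simps)
 qed
 then show ?thesis using that C(1) by blast
qed

lemma compact_support_cutoff:
 fixes T :: "'n::finite dist"
 assumes T: "tempered_distribution T" and "compactly_supported T"
 obtains c where "c\<in>schwartz" "!!\<eta>. \<eta>\<in>schwartz ==> T (%x. c x*\<eta> x) = T \<eta>"
proof -
 obtain K where K: "compact K" "!!f. f\<in>schwartz ==> closure {x. f x ~= 0} \<inter> K = {} ==> T f = 0"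
  using assms(2) by (auto simp: compactly_supported_def)
 obtain R where R: "!!x. x\<in>K ==> norm x <= R"
  using compact_imp_bounded[OF K(1)] by (auto simp: bounded_iff)
 \<comment> \<open>The extra unit keeps the closure of the support of \<eta> - c \<eta> away from
   K.\<close>
 obtain c :: "real^'n => complex" where c: "c\<in>schwartz" "!!x. \<forall>i. \<bar>x $ i\<bar> <= R + 1 ==> c x = 1"
  using schwartz_cutoff[of "R + 1"] by blast
 have "T (%x. c x*\<eta> x) = T \<eta>" if \<eta>: "\<eta>\<in>schwartz" for \<eta>
 proof -
  have c\<eta>: "(%x. c x*\<eta> x)\<in>schwartz" by (rule schwartz_mult[OF c(1) \<eta>])
  let ?f = "%x. \<eta> x - c x*\<eta> x"
  have f: "?f\<in>schwartz" by (rule schwartz_diff[OF \<eta> c\<eta>])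
  have "{x. ?f x ~= 0} \<subseteq> (\<Union>i. {x. R + 1 <= \<bar>x $ i\<bar>})"
  proof
   fix x assume "x\<in>{x. ?f x ~= 0}"
   then have "c x ~= 1" by auto
   then obtain i where "\<not> \<bar>x $ i\<bar> <= R + 1" using c(2) by blast
   then show "x\<in>(\<Union>i. {x. R + 1 <= \<bar>x $ i\<bar>})" by (intro UN_I[of i]) auto
  qed
  moreover have "closed (\<Union>i::'n. {x::real^'n. R + 1 <= \<bar>x $ i\<bar>})"
   by (intro closed_UN) (auto intro!: closed_Collect_le continuous_intros)
  ultimately have "closure {x. ?f x ~= 0} \<subseteq> (\<Union>i. {x. R + 1 <= \<bar>x $ i\<bar>})" by (rule closure_minimal)
  moreover have "(\<Union>i. {x. R + 1 <= \<bar>x $ i\<bar>}) \<inter> K = {}"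
  proof -
   have "\<not> R + 1 <= \<bar>x $ i\<bar>" if "x\<in>K" for x i
    using R[OF that] component_le_norm_cart[of x i] by linarith
   then show ?thesis by blast
  qed
  ultimately have "T ?f = 0" using K(2)[OF f] by blast
  moreover have "T \<eta> = T (%x. ?f x + c x*\<eta> x)" by simp
  then have "T \<eta> = T ?f + T (%x. c x*\<eta> x)"
   using T f c\<eta> by (simp only: tempered_distribution_def)
  ultimately show ?thesis by simp
 qed
 then show ?thesis using that c(1) by blast
qed

text \<open>A cutoff equal to 1 near the support does not change T, and on the Fourier side
  multiplication becomes convolution. Unlike h, the convolution is determined at every
  point.\<close>

lemma represents_convolution:
 fixes T :: "'n::finite dist"
 assumes T: "tempered_distribution T" "compactly_supported T"
  and rep: "represents h (dist_fourier T)" and h: "h\<in>wL2 \<nu>"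
 obtains \<kappa> where "\<kappa>\<in>schwartz" "represents (%t. LBINT w. h w*\<kappa> (w - t)) (dist_fourier T)"
proof -
 obtain c where c: "c\<in>schwartz" "!!\<eta>. \<eta>\<in>schwartz ==> T (%x. c x*\<eta> x) = T \<eta>"
  using compact_support_cutoff[OF T] by blast
 define \<kappa> where "\<kappa> = ifourier c"
 have \<kappa>: "\<kappa>\<in>schwartz" unfolding \<kappa>_def by (rule schwartz_ifourier[OF c(1)])
 have [measurable]: "h\<in>borel_fun" "\<kappa>\<in>borel_fun" "c\<in>borel_fun"
  using h \<kappa> c(1) by auto
 obtain K where K: "integrable lborel (%x. norm (h x)*inverse ((1 + norm x) ^ K))"
  using wL2_polynomial_decay[OF h] .
 obtain C where C: "0 < C" "!!w t. norm (\<kappa> (w - t)) <= C*inverse ((1 + norm w) ^ K)*(1 + norm t) ^ K"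
  using rapid_translate_bound[OF \<kappa>] by blast
 have pos: "0 < (1 + norm x) ^ K" for x :: "real^'n" by (simp add: add_pos_nonneg)
 have "represents (%t. LBINT w. h w*\<kappa> (w - t)) (dist_fourier T)"
  unfolding represents_def
 proof (intro conjI ballI)
  show "(%t. LBINT w. h w*\<kappa> (w - t))\<in>borel_fun" by measurable
  fix f :: "real^'n => complex" assume f: "f\<in>schwartz"
  have [measurable]: "f\<in>borel_fun" using f by auto
  define p where "p = ifourier (%x. c x*fourier f x)"
  have cf: "(%x. c x*fourier f x)\<in>schwartz" by (intro schwartz_mult c schwartz_fourier f)
  have p: "p\<in>schwartz" unfolding p_def by (rule schwartz_ifourier[OF cf])
  have fp: "fourier p = (%x. c x*fourier f x)" unfolding p_def by (rule fourier_ifourier[OF cf])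
  have p_eq: "p w = (LBINT t. f t*\<kappa> (w - t))" for w
  proof -
   have int: "integrable (lborel \<Otimes>\<^sub>M lborel) (%(x, t). c x*f t*character (w - t) x)"
    by (rule integrable_tensor) (auto intro: integrable_schwartz c f)
   have "p w = (LBINT x. (LBINT t. c x*f t*character (w - t) x))"
    unfolding p_def ifourier_eq
   proof (rule Bochner_Integration.integral_cong)
    fix x :: "real^'n"
    have "character (w - t) x = character w x*character (- x) t" for t
     using character_add_left[of w "- t" x] by (simp add: character_minus character_commute[of t])
    then have "(LBINT t. c x*f t*character (w - t) x) = (LBINT t. (character w x*c x)*(character (- x) t*f t))"
     by (simp add: mult_ac)
    also have "... = (character w x*c x)*fourier f x" unfolding fourier_eq by (rule integral_mult_right_zero)
    finally show "character w x*(c x*fourier f x) = (LBINT t. c x*f t*character (w - t) x)"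
     by (simp only: mult.assoc)
   qed simp
   also have "... = (LBINT t. (LBINT x. c x*f t*character (w - t) x))"
    using lborel_pair.Fubini_integral[OF int] by simp
   also have "... = (LBINT t. f t*\<kappa> (w - t))"
   proof (rule Bochner_Integration.integral_cong)
    fix t :: "real^'n"
    have "(LBINT x. c x*f t*character (w - t) x) = (LBINT x. f t*(character (w - t) x*c x))"
     by (simp add: mult_ac)
    also have "... = f t*\<kappa> (w - t)" unfolding \<kappa>_def ifourier_eq by (rule integral_mult_right_zero)
    finally show "(LBINT x. c x*f t*character (w - t) x) = f t*\<kappa> (w - t)" .
   qed simp
   finally show ?thesis .
  qed
  \<comment> \<open>Polynomial factors are redistributed so that \<open>?a\<close> and
    \<open>?b\<close> are integrable separately and the remaining factor \<open>?u\<close> is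
    bounded by 1; Fubini then applies.\<close>
  let ?a = "%w. h w*cplx (inverse ((1 + norm w) ^ K))"
  let ?b = "%t. cplx C*(f t*cplx ((1 + norm t) ^ K))"
  let ?u = "%w t. \<kappa> (w - t)*cplx ((1 + norm w) ^ K*inverse ((1 + norm t) ^ K)/C)"
  have int: "integrable (lborel \<Otimes>\<^sub>M lborel) (%(w, t). ?a w*?b t*?u w t)"
  proof (rule integrable_tensor)
   have "integrable lborel (%w. norm (?a w))"
    using K by (simp only: norm_mult norm_of_real) (simp add: abs_of_pos pos)
   then show "integrable lborel ?a" by (simp add: integrable_norm_iff)
   have "integrable lborel (%t. norm (f t*cplx ((1 + norm t) ^ K)))"
    using integrable_schwartz_norm[OF f, of K] pos by (simp only: norm_mult norm_of_real) (simp add: abs_of_pos mult.commute)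
   then have "integrable lborel (%t. f t*cplx ((1 + norm t) ^ K))" by (simp add: integrable_norm_iff)
   then show "integrable lborel ?b" by (rule integrable_mult_right)
   fix w t :: "real^'n"
   have "norm (?u w t) = norm (\<kappa> (w - t))*((1 + norm w) ^ K*inverse ((1 + norm t) ^ K)/C)"
    unfolding norm_mult norm_of_real using C(1) pos by (simp add: abs_of_pos)
   also have "... <= (C*inverse ((1 + norm w) ^ K)*(1 + norm t) ^ K)*((1 + norm w) ^ K*inverse ((1 + norm t) ^ K)/C)"
    using C pos by (intro mult_right_mono C(2)) (simp add: less_imp_le)
   also have "... = 1"
   proof -
    have "(C*inverse a*b)*(a*inverse b/C) = 1" if "0 < a" "0 < b" for a b :: real
     using that C(1) by (simp add: field_simps)
    then show ?thesis using pos by blast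
   qed
   finally show "norm (?u w t) <= 1" .
  next
   show "case_prod ?u\<in>borel_measurable (lborel \<Otimes>\<^sub>M lborel)" by measurable
  qed
  have prod_eq: "?a w*?b t*?u w t = h w*f t*\<kappa> (w - t)" for w t
  proof -
   have nz: "cplx ((1 + norm w) ^ K) ~= 0" "cplx ((1 + norm t) ^ K) ~= 0" "cplx C ~= 0"
    unfolding of_real_eq_0_iff using pos[of w] pos[of t] C(1) by linarith+
   have "(h w*inverse a)*(d*(f t*b))*(\<kappa> (w - t)*(a*inverse b/d)) = h w*f t*\<kappa> (w - t)"
    if "a ~= 0" "b ~= 0" "d ~= 0" for a b d using that by (simp add: field_simps)
   from this[OF nz] show ?thesis by (simp only: of_real_mult of_real_inverse of_real_divide)
  qed
  have int': "integrable (lborel \<Otimes>\<^sub>M lborel) (%(w, t). h w*f t*\<kappa> (w - t))"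
   using int unfolding prod_eq .
  have inner: "(LBINT w. h w*f t*\<kappa> (w - t)) = (LBINT w. h w*\<kappa> (w - t))*f t" for t
   by (subst integral_mult_left_zero[symmetric]) (simp add: mult_ac)
  show "integrable lborel (%t. (LBINT w. h w*\<kappa> (w - t))*f t)"
   using lborel_pair.integrable_snd[OF int'] unfolding inner .
  have "dist_fourier T f = T (%x. c x*fourier f x)"
   using c(2)[OF schwartz_fourier[OF f]] by (simp add: dist_fourier_def)
  also have "... = dist_fourier T p" by (simp add: dist_fourier_def fp)
  also have "... = (LBINT w. h w*p w)" using rep p by (simp add: represents_def)
  also have "... = (LBINT w. (LBINT t. h w*f t*\<kappa> (w - t)))"
  proof (rule Bochner_Integration.integral_cong)
   fix w :: "real^'n"
   have "(LBINT t. h w*f t*\<kappa> (w - t)) = (LBINT t. h w*(f t*\<kappa> (w - t)))" by (simp add: mult_ac)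
   then show "h w*p w = (LBINT t. h w*f t*\<kappa> (w - t))" by (simp add: p_eq)
  qed simp
  also have "... = (LBINT t. (LBINT w. h w*f t*\<kappa> (w - t)))"
   using lborel_pair.Fubini_integral[OF int'] by simp
  also have "... = (LBINT t. (LBINT w. h w*\<kappa> (w - t))*f t)" unfolding inner ..
  finally show "dist_fourier T f = (LBINT t. (LBINT w. h w*\<kappa> (w - t))*f t)" .
 qed
 with \<kappa> show ?thesis by (rule that)
qed

lemma convolution_continuous:
 fixes h \<kappa> :: "real^'n::finite => complex"
 assumes h: "h\<in>wL2 \<nu>" and \<kappa>: "\<kappa>\<in>schwartz"
 shows "continuous_on UNIV (%t. LBINT w. h w*\<kappa> (w - t))"
 unfolding continuous_on_sequentially
proof (intro allI ballI impI, elim conjE)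
 fix X and t :: "real^'n" assume X: "X \<longlonglongrightarrow> t"
 have [measurable]: "h\<in>borel_fun" "\<kappa>\<in>borel_fun" using h \<kappa> by auto
 obtain K where K: "integrable lborel (%x. norm (h x)*inverse ((1 + norm x) ^ K))"
  using wL2_polynomial_decay[OF h] .
 obtain C where C: "0 < C" "!!w t. norm (\<kappa> (w - t)) <= C*inverse ((1 + norm w) ^ K)*(1 + norm t) ^ K"
  using rapid_translate_bound[OF \<kappa>] by blast
 obtain R where R: "!!n. norm (X n) <= R" using convergent_imp_Bseq[OF convergentI[OF X]] by (auto simp: Bseq_def)
 show "((%t. LBINT w. h w*\<kappa> (w - t)) \<circ> X) \<longlonglongrightarrow> (LBINT w. h w*\<kappa> (w - t))"
  unfolding o_def
 proof (rule integral_dominated_convergence)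
  show "integrable lborel (%w. (norm (h w)*inverse ((1 + norm w) ^ K))*(C*(1 + R) ^ K))"
   by (rule integrable_mult_left[OF K])
  show "AE w in lborel. (%n. h w*\<kappa> (w - X n)) \<longlonglongrightarrow> h w*\<kappa> (w - t)"
  proof (rule AE_I2)
   fix w
   have "(%n. w - X n) \<longlonglongrightarrow> w - t" by (intro tendsto_intros X)
   then have "(%n. \<kappa> (w - X n)) \<longlonglongrightarrow> \<kappa> (w - t)"
    using continuous_on_tendsto_compose[OF schwartz_continuous[OF \<kappa>]] by simp
   then show "(%n. h w*\<kappa> (w - X n)) \<longlonglongrightarrow> h w*\<kappa> (w - t)" by (intro tendsto_intros)
  qed
  show "AE w in lborel. norm (h w*\<kappa> (w - X n)) <= (norm (h w)*inverse ((1 + norm w) ^ K))*(C*(1 + R) ^ K)" for n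
  proof (rule AE_I2)
   fix w :: "real^'n"
   have "norm (\<kappa> (w - X n)) <= C*inverse ((1 + norm w) ^ K)*(1 + norm (X n)) ^ K" by (rule C(2))
   also have "... <= C*inverse ((1 + norm w) ^ K)*(1 + R) ^ K"
    using R[of n] C(1) by (intro mult_left_mono power_mono) auto
   finally have "norm (h w)*norm (\<kappa> (w - X n)) <= norm (h w)*(C*inverse ((1 + norm w) ^ K)*(1 + R) ^ K)"
    by (rule mult_left_mono) simp
   then show "norm (h w*\<kappa> (w - X n)) <= (norm (h w)*inverse ((1 + norm w) ^ K))*(C*(1 + R) ^ K)"
    by (simp add: norm_mult mult_ac)
  qed
 qed measurable
qed

text \<open>Cauchy-Schwarz bounds the square of a convolution value by an average of |h|^2, and
  Peetre's inequality moves the weight inside this average at the price of a power that \<kappa>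
  absorbs. Summing over the lattice then only involves \<open>decay\<close>, whose lattice sums are
  uniformly bounded.\<close>

lemma convolution_lattice_bound:
 fixes h \<kappa> :: "real^'n::finite => complex" and A B :: "real^'n^'n"
 assumes h: "h\<in>wL2 \<nu>" and \<kappa>: "\<kappa>\<in>schwartz" and AB: "B ** A = mat 1"
 defines "g \<equiv> %t. LBINT w. h w*\<kappa> (w - t)"
 obtains C where "0 < C" "!!x. (nsum (%l. ennreal ((norm (g (A *v (x + vec_of_int l))))^2*weight \<nu> (A *v (x + vec_of_int l))))) <= ennreal C"
proof -
 have [measurable]: "h\<in>borel_fun" "\<kappa>\<in>borel_fun" using h \<kappa> by auto
 obtain L where L: "0 < L" "!!x y. (nsum (%l. ennreal (decay (y - A *v (x + vec_of_int l))))) <= ennreal L"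
  using lattice_sum_decay[OF AB] by blast
 obtain K :: nat where K: "\<bar>\<nu>\<bar> <= real K" using real_arch_simple by blast
 obtain C where C: "0 < C" "!!x. (1 + norm x) ^ (2*K)*norm (\<kappa> x) <= C*decay x"
  using rapid_decay_bound[OF schwartz_rapid[OF \<kappa>]] by blast
 define I where "I = (LBINT x. norm (\<kappa> x))"
 have I0: "0 <= I" unfolding I_def by simp
 have I: "(\<integral>\<^sup>+w. ennreal (norm (\<kappa> (w - t))) \<partial>lborel) = ennreal I" for t
 proof -
  have "(\<integral>\<^sup>+w. ennreal (norm (\<kappa> (w - t))) \<partial>lborel) = (\<integral>\<^sup>+w. ennreal (norm (\<kappa> w)) \<partial>lborel)"
   using nn_integral_lborel_translate[of "%w. ennreal (norm (\<kappa> w))" "- t"] by simp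
  then show ?thesis unfolding I_def
   using nn_integral_eq_integral[OF integrable_norm[OF integrable_schwartz[OF \<kappa>]]] by simp
 qed
 define D where "D = I*(2 powr \<bar>\<nu>\<bar>*C)"
 have D0: "0 <= D" using I0 C(1) by (simp add: D_def)
 let ?H = "%w. (norm (h w))^2*weight \<nu> w"
 have kernel: "weight \<nu> t*norm (\<kappa> (w - t)) <= (2 powr \<bar>\<nu>\<bar>*C)*(weight \<nu> w*decay (w - t))" for w t
 proof -
  have "weight \<nu> t*norm (\<kappa> (w - t)) <= (2 powr \<bar>\<nu>\<bar>*weight \<nu> w*weight \<bar>\<nu>\<bar> (w - t))*norm (\<kappa> (w - t))"
   by (intro mult_right_mono weight_peetre) simp
  also have "... = (2 powr \<bar>\<nu>\<bar>*weight \<nu> w)*(weight \<bar>\<nu>\<bar> (w - t)*norm (\<kappa> (w - t)))" by simp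
  also have "... <= (2 powr \<bar>\<nu>\<bar>*weight \<nu> w)*(C*decay (w - t))"
  proof (intro mult_left_mono)
   have "weight \<bar>\<nu>\<bar> (w - t)*norm (\<kappa> (w - t)) <= (1 + norm (w - t)) ^ (2*K)*norm (\<kappa> (w - t))"
    by (intro mult_right_mono weight_poly K) simp
   also have "... <= C*decay (w - t)" by (rule C(2))
   finally show "weight \<bar>\<nu>\<bar> (w - t)*norm (\<kappa> (w - t)) <= C*decay (w - t)" .
  qed simp
  finally show ?thesis by (simp add: mult_ac)
 qed
 have point: "ennreal ((norm (g t))^2*weight \<nu> t) <= ennreal D*(\<integral>\<^sup>+w. ennreal (?H w)*ennreal (decay (w - t)) \<partial>lborel)" for t
 proof -
  \<comment> \<open>The kernel is split evenly between the two factors, so that h appears squared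
    against one full power of |\<kappa>|.\<close>
  let ?a = "%w. norm (h w) * sqrt (norm (\<kappa> (w - t)))" and ?b = "%w. sqrt (norm (\<kappa> (w - t)))"
  have "ennreal ((norm (g t))^2) <= (\<integral>\<^sup>+w. ennreal ((?a w)^2) \<partial>lborel)*(\<integral>\<^sup>+w. ennreal ((?b w)^2) \<partial>lborel)"
   unfolding g_def by (rule integral_Cauchy_Schwarz_bound) (auto simp: norm_mult mult.assoc)
  also have "... = (\<integral>\<^sup>+w. ennreal ((norm (h w))^2*norm (\<kappa> (w - t))) \<partial>lborel)*ennreal I"
   by (simp add: power_mult_distrib I)
  finally have "ennreal ((norm (g t))^2)*ennreal (weight \<nu> t) \<le>
    ((\<integral>\<^sup>+w. ennreal ((norm (h w))^2*norm (\<kappa> (w - t))) \<partial>lborel)*ennreal I)*ennreal (weight \<nu> t)"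
   by (rule mult_right_mono) simp
  also have "... = ennreal I*(\<integral>\<^sup>+w. ennreal ((norm (h w))^2*norm (\<kappa> (w - t)))*ennreal (weight \<nu> t) \<partial>lborel)"
   by (subst nn_integral_multc) (auto simp: mult_ac)
  also have "... <= ennreal I*(\<integral>\<^sup>+w. ennreal (2 powr \<bar>\<nu>\<bar>*C)*(ennreal (?H w)*ennreal (decay (w - t))) \<partial>lborel)"
  proof (intro mult_left_mono nn_integral_mono)
   fix w
   have "(norm (h w))^2*(weight \<nu> t*norm (\<kappa> (w - t))) <= (norm (h w))^2*((2 powr \<bar>\<nu>\<bar>*C)*(weight \<nu> w*decay (w - t)))"
    by (intro mult_left_mono kernel) simp
   then have "ennreal ((norm (h w))^2*norm (\<kappa> (w - t))*weight \<nu> t) <= ennreal ((2 powr \<bar>\<nu>\<bar>*C)*(?H w*decay (w - t)))"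
    by (intro ennreal_leI) (simp add: mult_ac)
   then show "ennreal ((norm (h w))^2*norm (\<kappa> (w - t)))*ennreal (weight \<nu> t) <= ennreal (2 powr \<bar>\<nu>\<bar>*C)*(ennreal (?H w)*ennreal (decay (w - t)))"
    using C(1) by (simp add: ennreal_mult)
  qed simp
  also have "... = ennreal D*(\<integral>\<^sup>+w. ennreal (?H w)*ennreal (decay (w - t)) \<partial>lborel)"
   using I0 C(1) by (subst nn_integral_cmult) (auto simp: D_def ennreal_mult mult_ac)
  finally show ?thesis by (simp add: ennreal_mult)
 qed
 define J where "J = (LBINT w. ?H w)"
 have J: "(\<integral>\<^sup>+w. ennreal (?H w) \<partial>lborel) = ennreal J"
  unfolding J_def by (rule nn_integral_eq_integral[OF wL2_integrable[OF h]]) simp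
 have J0: "0 <= J" unfolding J_def by simp
 have "(nsum (%l. ennreal ((norm (g (A *v (x + vec_of_int l))))^2*weight \<nu> (A *v (x + vec_of_int l))))) <= ennreal (D*(J*L) + 1)" for x
 proof -
  have "(nsum (%l. ennreal ((norm (g (A *v (x + vec_of_int l))))^2*weight \<nu> (A *v (x + vec_of_int l)))))
   <= (\<integral>\<^sup>+l. ennreal D*(\<integral>\<^sup>+w. ennreal (?H w)*ennreal (decay (w - A *v (x + vec_of_int l))) \<partial>lborel) \<partial>count_space UNIV)"
   by (intro nn_integral_mono point)
  also have "... = ennreal D*(\<integral>\<^sup>+l. (\<integral>\<^sup>+w. ennreal (?H w)*ennreal (decay (w - A *v (x + vec_of_int l))) \<partial>lborel) \<partial>count_space UNIV)"
   by (rule nn_integral_cmult) simp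
  also have "(\<integral>\<^sup>+l. (\<integral>\<^sup>+w. ennreal (?H w)*ennreal (decay (w - A *v (x + vec_of_int l))) \<partial>lborel) \<partial>count_space UNIV) =
   (\<integral>\<^sup>+w. (nsum (%l. ennreal (?H w)*ennreal (decay (w - A *v (x + vec_of_int l))))) \<partial>lborel)"
   by (rule nn_integral_count_space_nn_integral[symmetric]) auto
  also have "... = (\<integral>\<^sup>+w. ennreal (?H w)*(nsum (%l. ennreal (decay (w - A *v (x + vec_of_int l))))) \<partial>lborel)"
   by (intro nn_integral_cong nn_integral_cmult) simp
  also have "... <= (\<integral>\<^sup>+w. ennreal (?H w)*ennreal L \<partial>lborel)"
   by (intro nn_integral_mono mult_left_mono L(2)) simp
  also have "... = ennreal (J*L)"
   using J0 L(1) by (subst nn_integral_multc) (measurable, simp only: J, simp add: ennreal_mult)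
  finally have "(nsum (%l. ennreal ((norm (g (A *v (x + vec_of_int l))))^2*weight \<nu> (A *v (x + vec_of_int l))))) <= ennreal D*ennreal (J*L)"
   by (simp add: mult_left_mono)
  also have "... = ennreal (D*(J*L))" using D0 J0 L(1) by (simp add: ennreal_mult)
  also have "... <= ennreal (D*(J*L) + 1)" by (intro ennreal_leI) simp
  finally show ?thesis .
 qed
 moreover have "0 < D*(J*L) + 1" using D0 J0 L(1) by (intro add_nonneg_pos) auto
 ultimately show ?thesis by (rule that[rotated])
qed

lemma continuous_AE_eq_imp_eq:
 fixes f g :: "'a::euclidean_space => 'b::t2_space"
 assumes "continuous_on UNIV f" "continuous_on UNIV g" and ae: "AE x in lborel. f x = g x"
 shows "f = g"
proof -
 have op: "open {x. f x ~= g x}" using assms by (intro open_Collect_neq)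
 have "{x. f x ~= g x}\<in>null_sets lborel"
  by (rule AE_iff_null_sets[THEN iffD2]) (use op ae in \<open>auto simp: borel_open\<close>)
 then have "negligible {x. f x ~= g x}"
  by (simp add: negligible_iff_null_sets null_sets_completionI)
 then have "{x. f x ~= g x} = {}" using open_not_negligible[OF op] by blast
 then show ?thesis by auto
qed

section \<open>Symbols and the transform of a scaling function\<close>

lemma symbol_eq_sum: "symbol a w = (\<Sum>k | a k ~= 0. a k*character (vec_of_int k) w)"
 by (simp add: symbol_def character_def)

lemma continuous_symbol: "continuous_on A (symbol a)"
 unfolding symbol_eq_sum[abs_def] by (intro continuous_intros continuous_on_character)

lemma symbol_measurable [measurable]: "symbol a\<in>borel_fun"
 by (intro borel_measurable_continuous_onI continuous_symbol)

lemma norm_symbol_le: "norm (symbol a w) <= (\<Sum>k | a k ~= 0. norm (a k))"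
 unfolding symbol_eq_sum by (rule norm_sum[THEN order_trans]) (simp add: norm_mult)

lemma character_int [simp]: "character (vec_of_int k) (vec_of_int l) = 1"
proof -
 have "vec_of_int k \<bullet> vec_of_int l = real_of_int (\<Sum>i\<in>UNIV. k $ i*l $ i)" by (simp add: inner_vec_def)
 then have "2*cplx pi*\<i>*cplx (vec_of_int k \<bullet> vec_of_int l) =
   2 * of_int (\<Sum>i\<in>UNIV. k $ i*l $ i)*cplx pi*\<i>"
  by (simp del: of_int_sum add: mult_ac)
 then show ?thesis unfolding character_def using exp_integer_2pi[of "of_int (\<Sum>i\<in>UNIV. k $ i*l $ i)"]
  by (simp only: Ints_of_int) (simp add: mult_ac)
qed

lemma character_periodic [simp]: "character (vec_of_int k) (x + vec_of_int l) = character (vec_of_int k) x"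
 by (simp add: character_add_right)

lemma symbol_periodic [simp]: "symbol a (w + vec_of_int l) = symbol a w"
 by (simp add: symbol_eq_sum)

text \<open>Continuity, gained from the convolution formula, upgrades the refinement equation from
  almost everywhere to everywhere.\<close>

lemma scaling_function_fourier:
 fixes M :: "real^'n^'n::finite"
 assumes d: "det M ~= 0" and sf: "scaling_function M a \<phi>" and \<phi>: "\<phi>\<in>sobolev \<nu>"
 defines "\<Phi> \<equiv> fourier_fun \<phi>" and "N' \<equiv> matrix_inv (transpose M)"
 shows "represents \<Phi> (dist_fourier \<phi>)" "\<Phi>\<in>wL2 \<nu>" "continuous_on UNIV \<Phi>" "\<Phi> 0 = 1"
  "!!w. \<Phi> w = symbol a (N' *v w)*\<Phi> (N' *v w)"
  "!!A B :: real^'n^'n. B ** A = mat 1 ==> \<exists>C>0. \<forall>x. (nsum (%l. ennreal ((norm (\<Phi> (A *v (x + vec_of_int l))))^2*weight \<nu> (A *v (x + vec_of_int l))))) <= ennreal C"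
proof -
 show rep: "represents \<Phi> (dist_fourier \<phi>)" and L2: "\<Phi>\<in>wL2 \<nu>"
  using sobolev_fourier_fun[OF \<phi>] by (auto simp: \<Phi>_def)
 obtain \<kappa> where \<kappa>: "\<kappa>\<in>schwartz" "represents (%t. LBINT w. \<Phi> w*\<kappa> (w - t)) (dist_fourier \<phi>)"
  using represents_convolution[OF _ _ rep L2] sf by (auto simp: scaling_function_def)
 have cc: "continuous_on UNIV (%t. LBINT w. \<Phi> w*\<kappa> (w - t))"
  by (rule convolution_continuous[OF L2 \<kappa>(1)])
 show cont: "continuous_on UNIV \<Phi>"
  unfolding \<Phi>_def by (rule fourier_fun_continuous[OF \<kappa>(2) cc])
 \<comment> \<open>Both sides are continuous and represent the same distribution, hence agree
   pointwise. The lattice bound for convolutions so becomes one for \<Phi>.\<close>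
 have conv: "\<Phi> = (%t. LBINT w. \<Phi> w*\<kappa> (w - t))"
  by (rule continuous_AE_eq_imp_eq[OF cont cc represents_unique[OF rep \<kappa>(2)]])
 show "\<Phi> 0 = 1" using sf by (simp add: scaling_function_def \<Phi>_def)
 show "\<exists>C>0. \<forall>x. (nsum (%l. ennreal ((norm (\<Phi> (A *v (x + vec_of_int l))))^2*weight \<nu> (A *v (x + vec_of_int l))))) <= ennreal C"
  if AB: "B ** A = mat 1" for A B :: "real^'n^'n"
 proof -
  obtain C where "0 < C" "!!x. (\<integral>\<^sup>+l. ennreal ((norm (LBINT w. \<Phi> w*\<kappa> (w - A *v (x + vec_of_int l))))^2 *
    weight \<nu> (A *v (x + vec_of_int l))) \<partial>count_space UNIV) <= ennreal C"
   using convolution_lattice_bound[OF L2 \<kappa>(1) AB] by blast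
  moreover have "(LBINT w. \<Phi> w*\<kappa> (w - t)) = \<Phi> t" for t
   by (rule fun_cong[OF conv, symmetric])
  ultimately show ?thesis by auto
 qed
 let ?m = "cplx \<bar>det M\<bar>"
 have "represents (%w. ?m*(\<Sum>k | a k ~= 0. a k*(cplx (1/\<bar>det M\<bar>)*(character (vec_of_int k) (N' *v w)*\<Phi> (N' *v w)))))
   (%f. ?m*(\<Sum>k | a k ~= 0. a k*dist_fourier (affine_subst M (vec_of_int k) \<phi>) f))"
  unfolding N'_def by (intro represents_cmult represents_sum represents_affine_subst[OF d rep])
 moreover have "?m*(\<Sum>k | a k ~= 0. a k*(cplx (1/\<bar>det M\<bar>)*(character (vec_of_int k) (N' *v w)*\<Phi> (N' *v w)))) = symbol a (N' *v w)*\<Phi> (N' *v w)" for w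
  using d by (simp add: symbol_eq_sum sum_distrib_left sum_distrib_right mult.assoc)
 ultimately have ref: "represents (%w. symbol a (N' *v w)*\<Phi> (N' *v w))
   (%f. ?m*(\<Sum>k | a k ~= 0. a k*dist_fourier (affine_subst M (vec_of_int k) \<phi>) f))" by simp
 have "represents (%w. symbol a (N' *v w)*\<Phi> (N' *v w)) (dist_fourier \<phi>)"
 proof -
  have "dist_fourier \<phi> f = ?m*(\<Sum>k | a k ~= 0. a k*dist_fourier (affine_subst M (vec_of_int k) \<phi>) f)"
   if "f\<in>schwartz" for f
   using sf schwartz_fourier[OF that] unfolding scaling_function_def dist_fourier_def by blast
  with ref show ?thesis unfolding represents_def by simp
 qed
 from represents_unique[OF rep this]
 have "AE w in lborel. \<Phi> w = symbol a (N' *v w)*\<Phi> (N' *v w)" .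
 moreover have "continuous_on UNIV (%w. symbol a (N' *v w)*\<Phi> (N' *v w))"
  by (intro continuous_intros continuous_on_compose2[OF continuous_symbol[of UNIV]] continuous_on_compose2[OF cont]) auto
 ultimately have "\<Phi> = (%w. symbol a (N' *v w)*\<Phi> (N' *v w))" using continuous_AE_eq_imp_eq[OF cont] by blast
 then show "\<Phi> w = symbol a (N' *v w)*\<Phi> (N' *v w)" for w by (rule fun_cong)
qed

section \<open>Isotropic dilations\<close>

text \<open>Both dilation and isotropy quantify over eigenvalues, so one is needed to conclude
  \<rho> > 1. If det(A - z) had no zero, its reciprocal would be entire; homogenising to det(w A -
  z) shows that it tends to 0 at infinity, against Liouville.\<close>

lemma eigenval_exists:
 fixes M :: "real^'n^'n::finite"
 obtains c where "eigenval M c"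
proof -
 define A where "A = map_matrix cplx M"
 define D where "D w z = det (\<chi> i j. w*A $ i $ j - (if i = j then z else 0))" for w z
 have D_alt: "D w z = (\<Sum>p | p permutes UNIV. of_int (sign p)*(\<Prod>i\<in>UNIV. w*A $ i $ p i - (if i = p i then z else 0)))" for w z
  by (simp add: D_def det_def)
 have hom: "D w z = z ^ CARD('n)*D (w/z) 1" if "z ~= 0" for w z
 proof -
  have "D w z = det (\<chi> i. z *s (\<chi> j. w/z*A $ i $ j - (if i = j then 1 else 0)))"
   unfolding D_def using that by (intro arg_cong[of _ _ det]) (auto simp: vec_eq_iff field_simps)
  also have "... = (\<Prod>i\<in>(UNIV::'n set). z)*det (\<chi> i. (\<chi> j. w/z*A $ i $ j - (if i = j then 1 else 0)))"
   by (rule det_rows_mul)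
  finally show ?thesis by (simp add: D_def)
 qed
 have "\<exists>z. D 1 z = 0"
 proof (rule ccontr)
  assume "\<not> (\<exists>z. D 1 z = 0)"
  then have nz: "D 1 z ~= 0" for z by blast
  have hol: "(%z. 1/D 1 z) holomorphic_on UNIV"
  proof (intro holomorphic_intros)
   show "D 1 holomorphic_on UNIV"
   proof -
    have "(%z. \<Sum>p | p permutes (UNIV::'n set). of_int (sign p)*(\<Prod>i\<in>UNIV. 1*A $ i $ p i - (if i = p i then z else 0))) holomorphic_on UNIV"
    proof (intro holomorphic_intros)
     fix p and i :: 'n
     show "(%z. if i = p i then z else 0) holomorphic_on UNIV" by (cases "i = p i") auto
    qed
    then show ?thesis by (simp add: D_alt[abs_def])
   qed
  qed (use nz in auto)
  have "D 0 1 ~= 0"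
  proof -
   have "D 0 1 = det (\<chi> i j. - (if i = j then 1 else (0::complex)) :: complex^'n^'n)" by (simp add: D_def)
   also have "... = (-1) ^ CARD('n)" by (subst det_diagonal) auto
   finally show ?thesis by simp
  qed
  moreover have "isCont (%w. D w 1) 0" unfolding D_alt by (intro continuous_intros)
  ultimately have "((%w. w ^ CARD('n)/D w 1) \<longlongrightarrow> 0 ^ CARD('n)/D 0 1) (at 0)"
   by (intro tendsto_intros) (auto simp: isCont_def)
  moreover have "filterlim (%z::complex. inverse z) (at 0) at_infinity"
   unfolding filterlim_at
   by (auto simp: tendsto_inverse_0 eventually_at_infinity intro!: exI[of _ 1])
  ultimately have "((%z. inverse z ^ CARD('n)/D (inverse z) 1) \<longlongrightarrow> 0 ^ CARD('n)/D 0 1) at_infinity"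
   by (rule filterlim_compose)
  moreover have "0 ^ CARD('n)/D 0 1 = 0" by (simp add: power_0_left)
  ultimately have "((%z. inverse z ^ CARD('n)/D (inverse z) 1) \<longlongrightarrow> 0) at_infinity" by (simp only:)
  moreover have "\<forall>\<^sub>F z in at_infinity. inverse z ^ CARD('n)/D (inverse z) 1 = 1/D 1 z"
   unfolding eventually_at_infinity
  proof (intro exI[of _ 1] allI impI)
   fix z :: complex assume "1 <= norm z"
   then have "z ~= 0" by auto
   then show "inverse z ^ CARD('n)/D (inverse z) 1 = 1/D 1 z"
    by (simp add: hom[of z 1] divide_inverse power_inverse)
  qed
  ultimately have "((%z. 1/D 1 z) \<longlongrightarrow> 0) at_infinity" by (rule Lim_transform_eventually)
  from Liouville_weak_0[OF hol this, of 0] nz show False by simp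
 qed
 then obtain z where z: "D 1 z = 0" by blast
 define E where "E = (\<chi> i j. 1*A $ i $ j - (if i = j then z else 0))"
 have "det E = 0" using z by (simp add: D_def E_def)
 then have "\<not> (\<exists>B. B ** E = mat 1)" by (metis det_I det_mul mult_zero_right zero_neq_one)
 then obtain v where v: "E *v v = 0" "v ~= 0" unfolding matrix_left_invertible_ker by blast
 have "A *v v = z *s v"
 proof -
  have "E *v v = A *v v - z *s v"
   by (simp add: E_def vec_eq_iff matrix_vector_mult_def left_diff_distrib sum_subtractf if_distrib[of "%a. a*_"] cong: if_cong)
  then show ?thesis using v by simp
 qed
 then show ?thesis using that[of z] v by (auto simp: eigenval_def A_def)
qed

lemma norm_matrix_vector_le: "norm (A *v x) <= opnorm A*norm (x :: real^'n::finite)"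
 unfolding opnorm_def by (rule onorm) (rule matrix_vector_mul_bounded_linear)

lemma opnorm_transpose: "opnorm (transpose A) = opnorm (A :: real^'n^'n::finite)"
proof -
 have le: "opnorm (transpose A) <= opnorm A" for A :: "real^'n^'n"
  unfolding opnorm_def[of "transpose A"]
 proof (rule onorm_le)
  fix x
  let ?y = "transpose A *v x"
  have "(norm ?y)^2 = x \<bullet> (A *v ?y)"
   using dot_lmul_matrix[of x A ?y] by (simp add: power2_norm_eq_inner)
  also have "... <= norm x*norm (A *v ?y)" using Cauchy_Schwarz_ineq2[of x "A *v ?y"] by linarith
  also have "... <= norm x*(opnorm A*norm ?y)" by (intro mult_left_mono norm_matrix_vector_le) simp
  finally have "norm ?y*norm ?y <= (opnorm A*norm x)*norm ?y" by (simp add: power2_eq_square mult_ac)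
  then show "norm ?y <= opnorm A*norm x"
   by (cases "norm ?y = 0") (auto intro: mult_right_le_imp_le simp: opnorm_def onorm_pos_le matrix_vector_mul_bounded_linear)
 qed
 show ?thesis using le[of A] le[of "transpose A"] by simp
qed

text \<open>\<open>N\<close> is the transpose of the dilation matrix and \<open>N'\<close> its
  inverse. Only upper bounds on the powers are kept here; the lower ones enter just at the end, when
  operator norms are compared with powers of \<rho>.\<close>

locale isotropic_dilation =
 fixes N N' :: "real^'n^'n::finite" and \<rho> c_0 :: real
 assumes N'N: "N' ** N = mat 1" and NN': "N ** N' = mat 1"
  and \<rho>: "1 < \<rho>" and c_0: "0 < c_0"
  and norm_N: "norm (matpow N j *v x) <= c_0*\<rho> ^ j*norm x"
  and norm_N': "norm (matpow N' j *v x) <= c_0/\<rho> ^ j*norm x"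
  and det_N: "\<bar>det N\<bar> = \<rho> ^ CARD('n)"
  and N_int: "\<exists>k. N *v vec_of_int l = vec_of_int k"

text \<open>Isotropy passes to the transpose because transposition preserves operator norms. The
  constant \<open>c_1\<close> here bounds norms from below; it is not the \<open>c_1\<close> defined
  later from \<open>c_0\<close>.\<close>

lemma isotropic_dilationI:
 fixes M :: "real^'n^'n::finite"
 assumes dil: "dilation_matrix M" and iso: "isotropic M"
 defines "\<rho> \<equiv> \<bar>det M\<bar> powr (1/real CARD('n))"
 obtains c_0 c_1 where "det M ~= 0" "0 < c_1" "isotropic_dilation (transpose M) (matrix_inv (transpose M)) \<rho> c_0"
  "!!j. c_1*\<rho> ^ j <= opnorm (matpow (transpose M) j)"
  "!!j. c_1/\<rho> ^ j <= opnorm (matpow (matrix_inv (transpose M)) j)"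
proof -
 obtain c where "eigenval M c" by (rule eigenval_exists)
 then have "1 < cmod c" "cmod c = \<rho>" using dil iso by (auto simp: dilation_matrix_def isotropic_def Let_def \<rho>_def)
 then have \<rho>: "1 < \<rho>" by simp
 then have d: "det M ~= 0" by (auto simp: \<rho>_def)
 then have dt: "det (transpose M) ~= 0" by (simp add: det_transpose)
 obtain C1 C2 where C: "0 < C1" "0 < C2" "!!j::int. C1*\<rho> powi j <= opnorm (matpowi M j)" "!!j::int. opnorm (matpowi M j) <= C2*\<rho> powi j"
  using iso by (auto simp: isotropic_def Let_def \<rho>_def)
 have N: "C1*\<rho> ^ j <= opnorm (matpow (transpose M) j)" "opnorm (matpow (transpose M) j) <= C2*\<rho> ^ j" for j
  using C(3,4)[of "int j"] by (simp_all add: matpowi_def opnorm_transpose flip: transpose_matpow)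
 have N': "C1/\<rho> ^ j <= opnorm (matpow (matrix_inv (transpose M)) j)" "opnorm (matpow (matrix_inv (transpose M)) j) <= C2/\<rho> ^ j" for j
 proof -
  have "matpowi M (- int j) = matpow (matrix_inv M) j" by (cases "j = 0") (simp_all add: matpowi_def)
  moreover have "\<rho> powi (- int j) = 1/\<rho> ^ j" by (simp add: power_int_minus divide_inverse)
  ultimately show "C1/\<rho> ^ j <= opnorm (matpow (matrix_inv (transpose M)) j)" "opnorm (matpow (matrix_inv (transpose M)) j) <= C2/\<rho> ^ j"
   using C(3,4)[of "- int j"] by (simp_all add: matrix_inv_transpose[OF d] opnorm_transpose flip: transpose_matpow)
 qed
 have "isotropic_dilation (transpose M) (matrix_inv (transpose M)) \<rho> C2"
 proof
  show "matrix_inv (transpose M) ** transpose M = mat 1" "transpose M ** matrix_inv (transpose M) = mat 1"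
   using matrix_inv_det[OF dt] by auto
  show "1 < \<rho>" "0 < C2" by fact+
  show "norm (matpow (transpose M) j *v x) <= C2*\<rho> ^ j*norm x" for j x
   by (rule order_trans[OF norm_matrix_vector_le]) (intro mult_right_mono N, simp)
  show "norm (matpow (matrix_inv (transpose M)) j *v x) <= C2/\<rho> ^ j*norm x" for j x
   by (rule order_trans[OF norm_matrix_vector_le]) (intro mult_right_mono N', simp)
  show "\<bar>det (transpose M)\<bar> = \<rho> ^ CARD('n)"
   using d by (simp add: det_transpose \<rho>_def powr_powr flip: powr_realpow)
  show "\<exists>k. transpose M *v vec_of_int l = vec_of_int k" for l
  proof -
   have "\<forall>i j. \<exists>z::int. M $ i $ j = of_int z" using dil by (auto simp: dilation_matrix_def elim!: Ints_cases) (metis Ints_cases)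
   then obtain Z where Z: "!!i j. M $ i $ j = of_int (Z i j)" by metis
   have "transpose M *v vec_of_int l = vec_of_int (\<chi> i. \<Sum>j\<in>UNIV. Z j i*l $ j)"
    by (simp add: vec_eq_iff matrix_vector_mult_def transpose_def Z del: transpose_matrix_vector)
   then show ?thesis by blast
  qed
 qed
 then show ?thesis using that d C(1) N(1) N'(1) by blast
qed

section \<open>Fourier series on the unit cube\<close>

text \<open>The torus modelled as a probability measure on \<open>real^'n\<close> concentrated on
  the unit cube, so that periodic functions keep their type.\<close>

definition cube :: "(real^'n::finite) measure" where
 "cube = density lborel (%x. ennreal (indicator unit_cube x))"

lemma space_cube [simp]: "space cube = UNIV" by (simp add: cube_def)
lemma sets_cube [simp, measurable_cong]: "sets cube = sets borel" by (simp add: cube_def)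

lemma nn_integral_cube:
 assumes [measurable]: "f\<in>borel_fun"
 shows "(\<integral>\<^sup>+x. f x \<partial>cube) = (\<integral>\<^sup>+x. indicator unit_cube x*f x \<partial>lborel)"
 unfolding cube_def by (subst nn_integral_density) (auto simp: ennreal_indicator)

lemma integral_cube:
 fixes f :: "real^'n::finite => 'a::{banach,second_countable_topology}"
 assumes [measurable]: "f\<in>borel_fun"
 shows "(LINT x|cube. f x) = (LBINT x. indicator unit_cube x *\<^sub>R f x)"
  and "integrable cube f \<longleftrightarrow> integrable lborel (%x. indicator unit_cube x *\<^sub>R f x)"
 unfolding cube_def by (subst integral_density integrable_density; auto)+

lemma AE_cube: "(AE x in cube. P x) \<longleftrightarrow> (AE x in lborel. x\<in>unit_cube --> P x)"
proof -
 have "(%x. ennreal (indicator (unit_cube :: (real^'a) set) x))\<in>borel_measurable lborel" by measurable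
 from AE_density[OF this, of P] show ?thesis unfolding cube_def by (simp add: indicator_def)
qed

lemma prob_space_cube: "prob_space (cube :: (real^'n::finite) measure)"
proof
 have "emeasure (cube :: (real^'n) measure) UNIV = (\<integral>\<^sup>+x. 1 \<partial>(cube :: (real^'n::finite) measure))" by simp
 also have "... = 1" by (subst nn_integral_cube) (auto simp: emeasure_unit_cube)
 finally show "emeasure (cube :: (real^'n) measure) (space cube) = 1" by simp
qed

lemma emeasure_cube_UNIV [simp]: "emeasure cube UNIV = 1"
 using prob_space.emeasure_space_1[OF prob_space_cube] by simp

interpretation cube: prob_space "cube :: (real^'n::finite) measure" by (rule prob_space_cube)

lemma cube_integrable_bounded:
 fixes f :: "real^'n::finite => 'a::{banach,second_countable_topology}"
 assumes "f\<in>borel_fun" "!!x. norm (f x) <= B"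
 shows "integrable cube f"
 by (rule cube.integrable_const_bound[of _ B]) (use assms in auto)

lemma integral_count_space_single:
 "(LINT l|count_space UNIV. (if l = k then c else 0)) = (c :: 'a::{banach,second_countable_topology})"
 by (rule lebesgue_integral_count_space_finite_support[THEN trans]) (cases "c = 0"; simp)+

text \<open>A shifted cube also meets each coset of the lattice exactly once, so its periodisation
  against p gives back p.\<close>

lemma integral_cube_periodic_shift:
 fixes p :: "real^'n::finite => complex"
 assumes p [measurable]: "p\<in>borel_fun" and bounded: "!!x. norm (p x) <= B"
  and per: "!!x l. p (x + vec_of_int l) = p x"
 shows "(LINT x|cube. p (x + h)) = (LINT x|cube. p x)"
proof -
 let ?F = "%x. indicator unit_cube (x - h) *\<^sub>R p x"
 have "integrable cube (%x. p (x + h))"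
  by (rule cube_integrable_bounded) (use bounded in auto)
 then have i: "integrable lborel (%x. ?F (x + h))" by (subst (asm) integral_cube(2)) auto
 then have int: "integrable lborel ?F" by (subst (asm) integrable_lborel_translate) auto
 have inner: "(LINT l|count_space UNIV. ?F (x + vec_of_int l)) = p x" for x
 proof -
  let ?l = "- (\<chi> i. \<lfloor>(x - h) $ i\<rfloor>) :: int^'n"
  have iff: "x + vec_of_int l - h\<in>unit_cube \<longleftrightarrow> l = ?l" for l
  proof -
   have "x + vec_of_int l - h = (x - h) - vec_of_int (- l)" by simp
   then show ?thesis using unit_cube_translate_iff[of "x - h" "- l"] by (metis minus_minus)
  qed
  have "?F (x + vec_of_int l) = (if l = ?l then p x else 0)" for l
   by (simp only: iff per indicator_def) simp
  then show ?thesis by (simp only: integral_count_space_single)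
 qed
 have "(LINT x|cube. p (x + h)) = (LBINT x. ?F (x + h))" by (subst integral_cube) auto
 also have "... = (LBINT x. ?F x)" by (rule integral_lborel_translate) measurable
 also have "... = (LBINT x. indicator unit_cube x *\<^sub>R (LINT l|count_space UNIV. ?F (x + vec_of_int l)))"
  by (rule integral_periodize[OF int])
 also have "... = (LBINT x. indicator unit_cube x *\<^sub>R p x)" by (simp only: inner)
 also have "... = (LINT x|cube. p x)" by (subst integral_cube) auto
 finally show ?thesis .
qed

lemma integral_cube_character:
 "(LINT x|cube. character (vec_of_int (k :: int^'n::finite)) x) = (if k = 0 then 1 else 0)"
proof (cases "k = 0")
 case True
 then show ?thesis using cube.prob_space[where 'n = 'n] by simp
next
 case False
 then obtain i where i: "k $ i ~= 0" by (auto simp: vec_eq_iff)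
 \<comment> \<open>Half a period in a coordinate where k is nonzero: the shift by \<open>h\<close>
   changes the sign of the character while preserving the integral.\<close>
 define h where "h = axis i (1/(2*real_of_int (k $ i)))"
 have half: "vec_of_int k \<bullet> h = 1/2" using i by (simp add: h_def inner_axis)
 have h: "character (vec_of_int k) h = -1"
  unfolding character_def half using exp_pi_i by (simp add: mult_ac)
 have "(LINT x|cube. character (vec_of_int k) (x + h)) = (LINT x|cube. character (vec_of_int k) x)"
  by (rule integral_cube_periodic_shift[of _ 1]) auto
 moreover have "(LINT x|cube. character (vec_of_int k) (x + h)) = - (LINT x|cube. character (vec_of_int k) x)"
  by (simp add: character_add_right h)
 ultimately show ?thesis using False by simp
qed

lemma character_mult_cnj: "character (vec_of_int k) x*cnj (character (vec_of_int l) x) = character (vec_of_int (k - l)) x"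
 using character_add_left[of "vec_of_int k" "- vec_of_int l" x] by (simp add: character_minus)

section \<open>Density of trigonometric polynomials\<close>

inductive_set trig :: "(real^'n::finite => complex) set" where
 base: "(%x. c*character (vec_of_int k) x)\<in>trig"
| add: "p\<in>trig ==> q\<in>trig ==> (%x. p x + q x)\<in>trig"

lemma trig_const: "(%_. c)\<in>trig" using trig.base[of c 0] by simp

lemma trig_mult:
 assumes "p\<in>trig" "q\<in>trig"
 shows "(%x. p x*q x)\<in>trig"
 using assms
proof induction
 case (base c k)
 have "(%x. (c*character (vec_of_int k) x)*q x)\<in>trig" if "q\<in>trig" for q
  using that
 proof induction
  case (base d l)
  have "(%x. c*character (vec_of_int k) x*(d*character (vec_of_int l) x)) = (%x. (c*d)*character (vec_of_int (k + l)) x)"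
   by (simp add: character_add_left mult_ac)
  then show ?case using trig.base by metis
 next
  case (add p q)
  then show ?case using trig.add by (fastforce simp: distrib_left)
 qed
 then show ?case using base by simp
next
 case (add p q')
 then show ?case using trig.add by (fastforce simp: distrib_right)
qed

lemma trig_sum:
 assumes "finite I" "!!i. i\<in>I ==> f i\<in>trig"
 shows "(%x. \<Sum>i\<in>I. f i x)\<in>trig"
 using assms by (induction I rule: finite_induct) (auto intro: trig.add trig_const)

lemma trig_measurable [measurable_dest]: "p\<in>trig ==> p\<in>borel_fun"
 by (induction rule: trig.induct) auto

lemma trig_finite_sum:
 assumes "p\<in>trig"
 obtains K a where "finite K" "!!x. p x = (\<Sum>k\<in>K. a k*character (vec_of_int k) x)"
proof -
 have "\<exists>K a. finite K \<and> (\<forall>x. p x = (\<Sum>k\<in>K. a k*character (vec_of_int k) x))"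
  using assms
 proof induction
  case (base c k)
  show ?case by (intro exI[of _ "{k}"] exI[of _ "%_. c"]) simp
 next
  case (add p q)
  then obtain K a L b where "finite K" "!!x. p x = (\<Sum>k\<in>K. a k*character (vec_of_int k) x)"
   "finite L" "!!x. q x = (\<Sum>k\<in>L. b k*character (vec_of_int k) x)" by blast
  moreover have "(\<Sum>k\<in>K. a k*character (vec_of_int k) x) = (\<Sum>k\<in>K \<union> L. (if k\<in>K then a k else 0)*character (vec_of_int k) x)" for x
   using \<open>finite K\<close> \<open>finite L\<close> by (intro sum.mono_neutral_cong_left) auto
  moreover have "(\<Sum>k\<in>L. b k*character (vec_of_int k) x) = (\<Sum>k\<in>K \<union> L. (if k\<in>L then b k else 0)*character (vec_of_int k) x)" for x
   using \<open>finite K\<close> \<open>finite L\<close> by (intro sum.mono_neutral_cong_left) auto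
  ultimately show ?case
   by (intro exI[of _ "K \<union> L"] exI[of _ "%k. (if k\<in>K then a k else 0) + (if k\<in>L then b k else 0)"])
     (simp add: distrib_right sum.distrib)
 qed
 then show ?thesis using that by blast
qed

text \<open>Embeds the torus in a vector space, where Stone-Weierstrass for real polynomials
  applies.\<close>

definition torus_map :: "real^'n::finite => complex^'n" where
 "torus_map x = (\<chi> i. exp (2*cplx pi*\<i>*cplx (x $ i)))"

lemma torus_map_nth: "torus_map x $ i = character (vec_of_int (axis i 1)) x"
proof -
 have "vec_of_int (axis i 1) \<bullet> x = x $ i"
  by (simp add: inner_vec_def axis_def if_distrib[of "%a. a*_"] if_distrib[of real_of_int] cong: if_cong)
 then show ?thesis by (simp add: torus_map_def character_def)
qed

lemma continuous_torus_map: "continuous_on A torus_map"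
 unfolding torus_map_def[abs_def] by (intro continuous_intros)

lemma torus_map_measurable [measurable]: "torus_map\<in>borel_fun"
 by (intro borel_measurable_continuous_onI continuous_torus_map)

text \<open>A real linear functional sees the real and imaginary parts of the coordinates, and these
  are combinations of a character and its conjugate.\<close>

lemma trig_real_polynomial:
 assumes "real_polynomial_function f"
 shows "(%x::real^'n::finite. cplx (f (torus_map x)))\<in>trig"
 using assms
proof induction
 case (linear f)
 have f: "f z = (\<Sum>i\<in>UNIV. Re (z $ i)*f (axis i 1) + Im (z $ i)*f (axis i \<i>))" for z :: "complex^'n"
 proof -
  have "z = (\<Sum>i\<in>UNIV. Re (z $ i) *\<^sub>R axis i 1 + Im (z $ i) *\<^sub>R axis i \<i>)"
   by (simp add: vec_eq_iff axis_def if_distrib[of "%a. _ *\<^sub>R a"] complex_eq_iff sum.distrib cong: if_cong)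
  then have "f z = f (\<Sum>i\<in>UNIV. Re (z $ i) *\<^sub>R axis i 1 + Im (z $ i) *\<^sub>R axis i \<i>)" by (rule arg_cong)
  also have "... = (\<Sum>i\<in>UNIV. Re (z $ i)*f (axis i 1) + Im (z $ i)*f (axis i \<i>))"
   using linear by (simp add: linear_simps bounded_linear.linear linear_sum)
  finally show ?thesis .
 qed
 have "(%x. cplx (Re (torus_map x $ i)*f (axis i 1) + Im (torus_map x $ i)*f (axis i \<i>)))\<in>trig" for i :: 'n
 proof -
  let ?k = "axis i 1 :: int^'n"
  have "cplx (Re (torus_map x $ i)*f (axis i 1) + Im (torus_map x $ i)*f (axis i \<i>)) =
   (of_real (f (axis i 1))/2 - \<i> * of_real (f (axis i \<i>))/2)*character (vec_of_int ?k) x +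
   (of_real (f (axis i 1))/2 + \<i> * of_real (f (axis i \<i>))/2)*character (vec_of_int (- ?k)) x" for x
   by (simp add: torus_map_nth character_minus complex_eq_iff field_simps)
  then show ?thesis using trig.add[OF trig.base trig.base] by (simp only:)
 qed
 then have "(%x. \<Sum>i\<in>UNIV. cplx (Re (torus_map x $ i)*f (axis i 1) + Im (torus_map x $ i)*f (axis i \<i>)))\<in>trig"
  by (intro trig_sum) auto
 then show ?case by (subst f) simp
next
 case (add f g)
 then show ?case using trig.add by fastforce
next
 case (mult f g)
 then show ?case using trig_mult by fastforce
qed (auto intro: trig_const)

definition trig_approx :: "(real^'n::finite => complex) => bool" where
 "trig_approx P \<longleftrightarrow> P\<in>borel_fun \<and>
   (\<forall>eps>0. \<exists>p\<in>trig. (\<integral>\<^sup>+x. ennreal ((norm (P x - p x))^2) \<partial>cube) < ennreal eps)"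

lemma norm_add_squared_le: "(norm (a + b))^2 <= 2*(norm a)^2 + 2*(norm (b :: 'a::real_normed_vector))^2"
proof -
 have "(norm (a + b))^2 <= (norm a + norm b)^2" by (intro power_mono norm_triangle_ineq) simp
 also have "... <= 2*(norm a)^2 + 2*(norm b)^2"
  using sum_squares_bound[of "norm a" "norm b"] by (simp add: power2_sum)
 finally show ?thesis .
qed

lemma nn_integral_norm_add_squared:
 fixes f g :: "'a => complex"
 assumes [measurable]: "f\<in>borel_measurable M" "g\<in>borel_measurable M"
 shows "(\<integral>\<^sup>+x. ennreal ((norm (f x + g x))^2) \<partial>M) <= 2*(\<integral>\<^sup>+x. ennreal ((norm (f x))^2) \<partial>M) + 2*(\<integral>\<^sup>+x. ennreal ((norm (g x))^2) \<partial>M)"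
proof -
 have "(\<integral>\<^sup>+x. ennreal ((norm (f x + g x))^2) \<partial>M) <= (\<integral>\<^sup>+x. 2*ennreal ((norm (f x))^2) + 2*ennreal ((norm (g x))^2) \<partial>M)"
 proof (rule nn_integral_mono)
  fix x
  have "ennreal ((norm (f x + g x))^2) <= ennreal (2*(norm (f x))^2 + 2*(norm (g x))^2)"
   by (intro ennreal_leI norm_add_squared_le)
  then show "ennreal ((norm (f x + g x))^2) <= 2*ennreal ((norm (f x))^2) + 2*ennreal ((norm (g x))^2)"
   by (simp add: ennreal_plus ennreal_mult')
 qed
 also have "... = 2*(\<integral>\<^sup>+x. ennreal ((norm (f x))^2) \<partial>M) + 2*(\<integral>\<^sup>+x. ennreal ((norm (g x))^2) \<partial>M)"
  by (simp add: nn_integral_add nn_integral_cmult)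
 finally show ?thesis .
qed

lemma ennreal_two_approx:
 assumes "0 < eps" "a < ennreal (eps/8)" "b < ennreal (eps/8)"
 shows "2*a + 2*b < ennreal eps"
proof -
 have "2*a + 2*b <= 2*ennreal (eps/8) + 2*ennreal (eps/8)"
  using assms by (intro add_mono mult_left_mono less_imp_le) auto
 also have "2*ennreal (eps/8) = ennreal (eps/4)" using ennreal_mult'[of 2 "eps/8"] assms(1) by simp
 also have "ennreal (eps/4) + ennreal (eps/4) = ennreal (eps/2)" using assms(1) by (simp flip: ennreal_plus)
 also have "... < ennreal eps" using assms(1) by (intro ennreal_lessI) auto
 finally show ?thesis .
qed

lemma trig_approx_close:
 assumes [measurable]: "P\<in>borel_fun"
  and "!!eps. 0 < eps ==> \<exists>Q. trig_approx Q \<and> (\<integral>\<^sup>+x. ennreal ((norm (P x - Q x))^2) \<partial>cube) < ennreal eps"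
 shows "trig_approx P"
 unfolding trig_approx_def
proof (intro conjI allI impI)
 fix eps :: real assume "0 < eps"
 then have e: "0 < eps/8" by simp
 obtain Q where Q: "trig_approx Q" "(\<integral>\<^sup>+x. ennreal ((norm (P x - Q x))^2) \<partial>cube) < ennreal (eps/8)"
  using assms(2)[OF e] by blast
 obtain p where p: "p\<in>trig" "(\<integral>\<^sup>+x. ennreal ((norm (Q x - p x))^2) \<partial>cube) < ennreal (eps/8)"
  using Q(1) e unfolding trig_approx_def by blast
 have [measurable]: "Q\<in>borel_fun" "p\<in>borel_fun"
  using Q(1) p(1) trig_measurable by (auto simp: trig_approx_def)
 have "(\<integral>\<^sup>+x. ennreal ((norm (P x - p x))^2) \<partial>cube) \<le>
   2*(\<integral>\<^sup>+x. ennreal ((norm (P x - Q x))^2) \<partial>cube) + 2*(\<integral>\<^sup>+x. ennreal ((norm (Q x - p x))^2) \<partial>cube)"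
  using nn_integral_norm_add_squared[of "%x. P x - Q x" cube "%x. Q x - p x"] by simp
 also have "... < ennreal eps" by (rule ennreal_two_approx) fact+
 finally show "\<exists>p\<in>trig. (\<integral>\<^sup>+x. ennreal ((norm (P x - p x))^2) \<partial>cube) < ennreal eps" using p(1) by blast
qed fact

lemma trig_approx_dominated:
 assumes Q: "!!n::nat. trig_approx (Q n)" and [measurable]: "P\<in>borel_fun" "G\<in>borel_fun"
  and lim: "!!x. (%n. Q n x) \<longlonglongrightarrow> P x" and G: "!!n x. norm (P x - Q n x) <= G x"
  and fin: "(\<integral>\<^sup>+x. ennreal ((G x)^2) \<partial>cube) < \<infinity>"
 shows "trig_approx P"
proof (rule trig_approx_close)
 have [measurable]: "Q n\<in>borel_fun" for n using Q by (simp add: trig_approx_def)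
 have "(%n. \<integral>\<^sup>+x. ennreal ((norm (P x - Q n x))^2) \<partial>cube) \<longlonglongrightarrow> (\<integral>\<^sup>+x. ennreal ((norm (P x - P x))^2) \<partial>cube)"
 proof (rule nn_integral_dominated_convergence[where w = "%x. ennreal ((G x)^2)"])
  show "AE x in cube. (%n. ennreal ((norm (P x - Q n x))^2)) \<longlonglongrightarrow> ennreal ((norm (P x - P x))^2)"
  proof (rule AE_I2)
   fix x
   have "(%n. (norm (P x - Q n x))^2) \<longlonglongrightarrow> (norm (P x - P x))^2" by (intro tendsto_intros lim)
   then show "(%n. ennreal ((norm (P x - Q n x))^2)) \<longlonglongrightarrow> ennreal ((norm (P x - P x))^2)" by (rule tendsto_ennrealI)
  qed
  show "AE x in cube. ennreal ((norm (P x - Q n x))^2) <= ennreal ((G x)^2)" for n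
   using G by (intro AE_I2 ennreal_leI power_mono) auto
 qed (use fin in auto)
 then have l: "(%n. \<integral>\<^sup>+x. ennreal ((norm (P x - Q n x))^2) \<partial>cube) \<longlonglongrightarrow> 0" by simp
 fix eps :: real assume "0 < eps"
 then have "\<forall>\<^sub>F n in sequentially. (\<integral>\<^sup>+x. ennreal ((norm (P x - Q n x))^2) \<partial>cube) < ennreal eps"
  by (intro order_tendstoD(2)[OF l]) simp
 then obtain n where "(\<integral>\<^sup>+x. ennreal ((norm (P x - Q n x))^2) \<partial>cube) < ennreal eps"
  by (auto simp: eventually_sequentially)
 then show "\<exists>Q. trig_approx Q \<and> (\<integral>\<^sup>+x. ennreal ((norm (P x - Q x))^2) \<partial>cube) < ennreal eps"
  using Q by blast
qed fact

lemma trig_approx_trig: "p\<in>trig ==> trig_approx p"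
 unfolding trig_approx_def using trig_measurable by (auto intro!: bexI[of _ p])

lemma trig_approx_add:
 assumes "trig_approx P" "trig_approx Q"
 shows "trig_approx (%x. P x + Q x)"
 unfolding trig_approx_def
proof (intro conjI allI impI)
 have [measurable]: "P\<in>borel_fun" "Q\<in>borel_fun"
  using assms by (auto simp: trig_approx_def)
 show "(%x. P x + Q x)\<in>borel_fun" by measurable
 fix eps :: real assume "0 < eps"
 then have e: "0 < eps/8" by simp
 obtain p where p: "p\<in>trig" "(\<integral>\<^sup>+x. ennreal ((norm (P x - p x))^2) \<partial>cube) < ennreal (eps/8)"
  using assms(1) e unfolding trig_approx_def by blast
 obtain q where q: "q\<in>trig" "(\<integral>\<^sup>+x. ennreal ((norm (Q x - q x))^2) \<partial>cube) < ennreal (eps/8)"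
  using assms(2) e unfolding trig_approx_def by blast
 have [measurable]: "p\<in>borel_fun" "q\<in>borel_fun"
  using q(1) p(1) trig_measurable by auto
 have "(\<integral>\<^sup>+x. ennreal ((norm ((P x + Q x) - (p x + q x)))^2) \<partial>cube) \<le>
   2*(\<integral>\<^sup>+x. ennreal ((norm (P x - p x))^2) \<partial>cube) + 2*(\<integral>\<^sup>+x. ennreal ((norm (Q x - q x))^2) \<partial>cube)"
  using nn_integral_norm_add_squared[of "%x. P x - p x" cube "%x. Q x - q x"] by (simp add: algebra_simps)
 also have "... < ennreal eps" by (rule ennreal_two_approx) fact+
 finally show "\<exists>r\<in>trig. (\<integral>\<^sup>+x. ennreal ((norm ((P x + Q x) - r x))^2) \<partial>cube) < ennreal eps"
  by (intro bexI[of _ "%x. p x + q x"] trig.add p(1) q(1))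
qed

lemma trig_approx_cmult:
 assumes "trig_approx P"
 shows "trig_approx (%x. c*P x)"
 unfolding trig_approx_def
proof (intro conjI allI impI)
 have [measurable]: "P\<in>borel_fun" using assms by (auto simp: trig_approx_def)
 show "(%x. c*P x)\<in>borel_fun" by measurable
 fix eps :: real assume eps: "0 < eps"
 define C where "C = (norm c)^2 + 1"
 have C: "0 < C" by (simp add: C_def add_nonneg_pos)
 obtain p where p: "p\<in>trig" "(\<integral>\<^sup>+x. ennreal ((norm (P x - p x))^2) \<partial>cube) < ennreal (eps/C)"
  using assms eps C unfolding trig_approx_def by (meson divide_pos_pos)
 have [measurable]: "p\<in>borel_fun" using p(1) trig_measurable by auto
 have "(\<integral>\<^sup>+x. ennreal ((norm (c*P x - c*p x))^2) \<partial>cube) <= (\<integral>\<^sup>+x. ennreal C*ennreal ((norm (P x - p x))^2) \<partial>cube)"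
 proof (rule nn_integral_mono)
  fix x
  have "(norm (c*P x - c*p x))^2 = (norm c)^2*(norm (P x - p x))^2"
   by (simp add: right_diff_distrib[symmetric] norm_mult power_mult_distrib)
  also have "... <= C*(norm (P x - p x))^2" by (intro mult_right_mono) (auto simp: C_def)
  finally show "ennreal ((norm (c*P x - c*p x))^2) <= ennreal C*ennreal ((norm (P x - p x))^2)"
   using C by (simp add: ennreal_leI flip: ennreal_mult)
 qed
 also have "... = ennreal C*(\<integral>\<^sup>+x. ennreal ((norm (P x - p x))^2) \<partial>cube)" by (rule nn_integral_cmult) measurable
 also have "... < ennreal C*ennreal (eps/C)" using C p(2) by (intro ennreal_mult_strict_left_mono) auto
 also have "... = ennreal eps" using C eps by (simp flip: ennreal_mult)
 finally show "\<exists>r\<in>trig. (\<integral>\<^sup>+x. ennreal ((norm (c*P x - r x))^2) \<partial>cube) < ennreal eps"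
  by (intro bexI[of _ "%x. c*p x"] trig_mult[OF trig_const[of c] p(1)])
qed

lemma trig_approx_sum:
 assumes "finite I" "!!i. i\<in>I ==> trig_approx (f i)"
 shows "trig_approx (%x. \<Sum>i\<in>I. f i x)"
 using assms by (induction I rule: finite_induct) (auto intro: trig_approx_add trig_approx_trig trig_const)

text \<open>Stone-Weierstrass on the compact product of circles; uniform approximation is stronger
  than quadratic approximation because the cube has mass 1.\<close>

lemma trig_approx_continuous:
 assumes f: "continuous_on UNIV f"
 shows "trig_approx (%x::real^'n::finite. cplx (f (torus_map x)))"
proof (rule trig_approx_close)
 show "(%x::real^'n. cplx (f (torus_map x)))\<in>borel_fun"
  using borel_measurable_continuous_onI[OF f] by measurable
 have comp: "compact {z::complex^'n. \<forall>i. norm (z $ i) = 1}"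
 proof -
  have "closed (\<Inter>i. {z::complex^'n. norm (z $ i) = 1})"
   by (intro closed_INT ballI closed_Collect_eq continuous_intros)
  moreover have "{z::complex^'n. \<forall>i. norm (z $ i) = 1} = (\<Inter>i. {z. norm (z $ i) = 1})" by auto
  moreover have "bounded {z::complex^'n. \<forall>i. norm (z $ i) = 1}"
   unfolding bounded_iff
  proof (intro exI ballI)
   fix z :: "complex^'n" assume "z\<in>{z. \<forall>i. norm (z $ i) = 1}"
   then show "norm z <= (\<Sum>i\<in>(UNIV::'n set). 1)" using L2_set_le_sum[of UNIV "%i. norm (z $ i)"] by (simp add: norm_vec_def)
  qed
  ultimately show ?thesis by (simp add: compact_eq_bounded_closed)
 qed
 fix eps :: real assume eps: "0 < eps"
 define d where "d = sqrt (eps/2)"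
 have d: "0 < d" using eps by (simp add: d_def)
 obtain g where g: "real_polynomial_function g" "!!z. z\<in>{z::complex^'n. \<forall>i. norm (z $ i) = 1} ==> \<bar>f z - g z\<bar> < d"
  using Stone_Weierstrass_real_polynomial_function[OF comp continuous_on_subset[OF f] d] by auto
 have t: "(%x::real^'n. cplx (g (torus_map x)))\<in>trig" by (rule trig_real_polynomial[OF g(1)])
 have "(\<integral>\<^sup>+x. ennreal ((norm (cplx (f (torus_map x)) - cplx (g (torus_map x))))^2) \<partial>cube) <= (\<integral>\<^sup>+x. ennreal (d^2) \<partial>(cube :: (real^'n::finite) measure))"
 proof (rule nn_integral_mono)
  fix x :: "real^'n"
  have "\<bar>f (torus_map x) - g (torus_map x)\<bar> <= d" by (rule less_imp_le, rule g(2)) (simp add: torus_map_nth)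
  then have "\<bar>f (torus_map x) - g (torus_map x)\<bar>^2 <= d^2" by (intro power_mono) auto
  then show "ennreal ((norm (cplx (f (torus_map x)) - cplx (g (torus_map x))))^2) <= ennreal (d^2)"
   by (intro ennreal_leI) (simp flip: of_real_diff)
 qed
 also have "... = ennreal (d^2)" using cube.emeasure_space_1[where 'n = 'n] by simp
 also have "... < ennreal eps" using eps by (simp add: d_def ennreal_lessI)
 finally show "\<exists>Q. trig_approx Q \<and> (\<integral>\<^sup>+x. ennreal ((norm (cplx (f (torus_map x)) - Q x))^2) \<partial>cube) < ennreal eps"
  using trig_approx_trig[OF t] by blast
qed

lemma cube_const_finite: "(\<integral>\<^sup>+x. ennreal c \<partial>(cube :: (real^'n::finite) measure)) < \<infinity>"
 using cube.emeasure_space_1[where 'n = 'n] by simp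

text \<open>Open sets are handled by continuous functions increasing to the indicator. They form an
  intersection-stable generator, and the approximable sets are closed under complements and disjoint
  countable unions.\<close>

lemma trig_approx_indicator:
 assumes "A\<in>sets (borel :: (complex^'n::finite) measure)"
 shows "trig_approx (%x::real^'n. cplx (indicat_real A (torus_map x)))"
proof -
 have op: "trig_approx (%x::real^'n. cplx (indicat_real U (torus_map x)))" if U: "open U" for U
 \<comment> \<open>The distance to the empty set is 0 by convention, so for the whole space the
   functions \<open>f n\<close> below would vanish.\<close>
 proof (cases "U = UNIV")
  case True
  then show ?thesis using trig_approx_trig[OF trig_const[of 1]] by simp
 next
  case False
  define f where "f n z = min 1 (real n*infdist z (- U))" for n z
  have cf: "continuous_on UNIV (f n)" for n
   unfolding f_def[abs_def] by (intro continuous_intros continuous_on_infdist)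
  have lim: "(%n. f n z) \<longlonglongrightarrow> indicat_real U z" for z
  proof (cases "z\<in>U")
   case True
   have "infdist z (- U) ~= 0"
    using True U False by (subst in_closed_iff_infdist_zero[symmetric]) auto
   then have p: "0 < infdist z (- U)" using infdist_nonneg[of z "- U"] by linarith
   obtain m :: nat where m: "1/infdist z (- U) <= real m" using real_arch_simple by blast
   have "f n z = 1" if "m <= n" for n
   proof -
    have "1/infdist z (- U) <= real n" using m that by linarith
    then show ?thesis using p by (simp add: f_def field_simps)
   qed
   then show ?thesis using True by (intro tendsto_eventually) (auto simp: eventually_sequentially)
  qed (simp add: f_def)
  have b: "0 <= f n z" "f n z <= 1" for n z by (auto simp: f_def infdist_nonneg)
  have mf: "U\<in>sets borel" using U by (rule borel_open)
  show ?thesis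
  proof (rule trig_approx_dominated[where Q = "%n x. cplx (f n (torus_map x))" and G = "%_. 2"])
   show "trig_approx (%x. cplx (f n (torus_map x)))" for n by (rule trig_approx_continuous[OF cf])
   show "(%n. cplx (f n (torus_map x))) \<longlonglongrightarrow> cplx (indicat_real U (torus_map x))" for x :: "real^'n"
    by (intro tendsto_of_real lim)
   show "norm (cplx (indicat_real U (torus_map x)) - cplx (f n (torus_map x))) <= 2" for n and x :: "real^'n"
    using b[of n "torus_map x"] by (simp flip: of_real_diff add: indicator_def)
   show "(%x::real^'n. cplx (indicat_real U (torus_map x)))\<in>borel_fun"
    using mf by measurable
  qed (auto simp: cube_const_finite)
 qed
 have "Int_stable {S::(complex^'n) set. open S}" by (auto simp: Int_stable_def)
 moreover have "{S::(complex^'n) set. open S} \<subseteq> Pow UNIV" by simp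
 moreover have "A\<in>sigma_sets UNIV {S. open S}" using assms by (simp add: borel_def)
 ultimately show ?thesis
 proof (induction rule: sigma_sets_induct_disjoint)
  case (basic A)
  then show ?case using op by simp
 next
  case empty
  then show ?case using trig_approx_trig[OF trig_const[of 0]] by simp
 next
  case (compl A)
  have "trig_approx (%x::real^'n. 1 + (-1)*cplx (indicat_real A (torus_map x)))"
   by (intro trig_approx_add trig_approx_cmult compl trig_approx_trig trig_const)
  then show ?case by (rule back_subst[where P = trig_approx]) (auto simp: indicator_def)
 next
  case (union A)
  have mA: "A i\<in>sets borel" for i using union(2) by (auto simp: borel_def)
  show ?case
  proof (rule trig_approx_dominated[where Q = "%n x. \<Sum>i<n. cplx (indicat_real (A i) (torus_map x))" and G = "%_. 2"])
   show "trig_approx (%x. \<Sum>i<n. cplx (indicat_real (A i) (torus_map x)))" for n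
    by (intro trig_approx_sum union) auto
   have sums: "(\<Sum>i<n. indicat_real (A i) z) = indicat_real (\<Union>i<n. A i) z" for n z
    using union(1) by (intro indicator_UN_disjoint[symmetric]) (auto simp: disjoint_family_on_def)
   have "(%n. indicat_real (\<Union>i<n. A i) z) \<longlonglongrightarrow> indicat_real (\<Union>i. A i) z" for z
    by (rule LIMSEQ_indicator_UN)
   then show "(%n. \<Sum>i<n. cplx (indicat_real (A i) (torus_map x))) \<longlonglongrightarrow> cplx (indicat_real (\<Union>i. A i) (torus_map x))" for x :: "real^'n"
    unfolding of_real_sum[symmetric] sums by (intro tendsto_of_real)
   show "norm (cplx (indicat_real (\<Union>i. A i) (torus_map x)) - (\<Sum>i<n. cplx (indicat_real (A i) (torus_map x)))) <= 2" for n and x :: "real^'n"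
    unfolding of_real_sum[symmetric] sums of_real_diff[symmetric] norm_of_real by (simp add: indicator_def)
   show "(%x::real^'n. cplx (indicat_real (\<Union>i. A i) (torus_map x)))\<in>borel_fun"
   proof -
    have "(\<Union>i. A i)\<in>sets borel" using mA by auto
    then show ?thesis by measurable
   qed
  qed (auto simp: cube_const_finite)
 qed
qed

text \<open>\<open>Arg2pi\<close> is continuous off the nonnegative real axis and vanishes on
  it.\<close>

lemma Arg2pi_measurable [measurable]: "Arg2pi\<in>borel_fun"
proof -
 have "closed (\<real>\<^sub>\<ge>\<^sub>0 :: complex set)" by (rule closed_nonneg_Reals_complex)
 then have "- (\<real>\<^sub>\<ge>\<^sub>0 :: complex set)\<in>sets borel" by (intro borel_open) (simp add: open_Compl)
 moreover have "continuous_on (- \<real>\<^sub>\<ge>\<^sub>0) Arg2pi"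
  by (intro continuous_at_imp_continuous_on ballI continuous_at_Arg2pi) auto
 ultimately have "(%z. indicator (- \<real>\<^sub>\<ge>\<^sub>0) z *\<^sub>R Arg2pi z)\<in>borel_fun"
  by (rule borel_measurable_continuous_on_indicator)
 moreover have "indicator (- \<real>\<^sub>\<ge>\<^sub>0) z *\<^sub>R Arg2pi z = Arg2pi z" for z
  using Arg2pi_eq_0[of z] by (auto simp: indicator_def complex_nonneg_Reals_iff complex_is_Real_iff)
 ultimately show ?thesis by (simp only:)
qed

text \<open>On the unit cube \<open>torus_map\<close> has the measurable inverse \<open>G\<close>,
  so P is a function of the torus up to null sets. Simple functions there are combinations of
  indicators.\<close>

lemma trig_approx_L2:
 fixes P :: "real^'n::finite => complex"
 assumes [measurable]: "P\<in>borel_fun" and fin: "(\<integral>\<^sup>+x. ennreal ((norm (P x))^2) \<partial>cube) < \<infinity>"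
  and "0 < eps"
 shows "\<exists>p\<in>trig. (\<integral>\<^sup>+x. ennreal ((norm (P x - p x))^2) \<partial>cube) < ennreal eps"
proof -
 define G where "G z = (\<chi> i. Arg2pi (z $ i)/(2*pi))" for z :: "complex^'n"
 have [measurable]: "G\<in>borel_fun"
 proof -
  have "(%z::complex^'n. z $ i)\<in>borel_fun" for i
   by (intro borel_measurable_continuous_onI continuous_intros)
  then have "(%z::complex^'n. Arg2pi (z $ i)/(2*pi))\<in>borel_fun" for i
   by (intro borel_measurable_divide measurable_compose[OF _ Arg2pi_measurable]) auto
  then show ?thesis unfolding G_def[abs_def] by (rule measurable_vec_lambda)
 qed
 have G: "G (torus_map x) = x" if "x\<in>unit_cube" for x
 proof -
  have "Arg2pi (torus_map x $ i) = 2*pi*(x $ i)" for i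
  proof (rule Arg2pi_unique[of 1])
   show "cplx 1*exp (\<i>*cplx (2*pi*x $ i)) = torus_map x $ i"
    by (simp add: torus_map_def mult_ac)
  qed (use that in \<open>auto simp: unit_cube_def\<close>)
  then show ?thesis by (simp add: G_def vec_eq_iff)
 qed
 define P' where "P' = P \<circ> G"
 have [measurable]: "P'\<in>borel_fun" unfolding P'_def o_def by measurable
 have PP': "AE x in cube. P' (torus_map x) = P x" unfolding AE_cube P'_def by (simp add: G)
 have fin': "(\<integral>\<^sup>+x. ennreal ((norm (P' (torus_map x)))^2) \<partial>cube) < \<infinity>"
 proof -
  have "(\<integral>\<^sup>+x. ennreal ((norm (P' (torus_map x)))^2) \<partial>cube) = (\<integral>\<^sup>+x. ennreal ((norm (P x))^2) \<partial>cube)"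
   by (rule nn_integral_cong_AE) (use PP' in \<open>auto elim: eventually_mono\<close>)
  then show ?thesis using fin by simp
 qed
 obtain S where S: "!!i. simple_function borel (S i)" "!!z. (%i. S i z) \<longlonglongrightarrow> P' z" "!!i z. norm (S i z) <= 2*norm (P' z)"
  using borel_measurable_implies_sequence_metric[of P' borel 0] by auto
 have [measurable]: "S i\<in>borel_fun" for i by (rule borel_measurable_simple_function[OF S(1)])
 have "trig_approx (%x::real^'n. P' (torus_map x))"
 proof (rule trig_approx_dominated[where Q = "%n x. S n (torus_map x)" and G = "%x. 3*norm (P' (torus_map x))"])
  fix n
  have eq: "S n z = (\<Sum>y\<in>range (S n). y*cplx (indicat_real (S n -` {y}) z))" for z
  proof -
   have "finite (range (S n))" using S(1)[of n] by (simp add: simple_function_def)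
   then have "(\<Sum>y\<in>range (S n). y*cplx (indicat_real (S n -` {y}) z)) = (\<Sum>y\<in>{S n z}. y*cplx (indicat_real (S n -` {y}) z))"
    by (intro sum.mono_neutral_right) (auto simp: indicator_def)
   then show ?thesis by simp
  qed
  have "trig_approx (%x::real^'n. \<Sum>y\<in>range (S n). y*cplx (indicat_real (S n -` {y}) (torus_map x)))"
  proof (intro trig_approx_sum trig_approx_cmult trig_approx_indicator)
   show "finite (range (S n))" using S(1)[of n] by (simp add: simple_function_def)
   show "S n -` {y}\<in>sets borel" if "y\<in>range (S n)" for y
    using S(1)[of n] that by (auto simp: simple_function_def)
  qed
  then show "trig_approx (%x::real^'n. S n (torus_map x))" by (subst eq)
 next
  fix n and x :: "real^'n"
  show "norm (P' (torus_map x) - S n (torus_map x)) <= 3*norm (P' (torus_map x))"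
   using norm_triangle_ineq4[of "P' (torus_map x)" "S n (torus_map x)"] S(3)[of n "torus_map x"] by linarith
 next
  have "(\<integral>\<^sup>+x. ennreal ((3*norm (P' (torus_map x)))^2) \<partial>cube) = (\<integral>\<^sup>+x. ennreal 9*ennreal ((norm (P' (torus_map x)))^2) \<partial>cube)"
   by (intro nn_integral_cong) (simp add: power_mult_distrib ennreal_mult)
  also have "... < \<infinity>" using fin' by (subst nn_integral_cmult) (auto simp: ennreal_mult_less_top)
  finally show "(\<integral>\<^sup>+x. ennreal ((3*norm (P' (torus_map x)))^2) \<partial>(cube :: (real^'n::finite) measure)) < \<infinity>" .
 qed (auto simp: S(2))
 then obtain p where p: "p\<in>trig" "(\<integral>\<^sup>+x. ennreal ((norm (P' (torus_map x) - p x))^2) \<partial>cube) < ennreal eps"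
  using \<open>0 < eps\<close> unfolding trig_approx_def by blast
 have [measurable]: "p\<in>borel_fun" using p(1) trig_measurable by auto
 have "(\<integral>\<^sup>+x. ennreal ((norm (P' (torus_map x) - p x))^2) \<partial>cube) = (\<integral>\<^sup>+x. ennreal ((norm (P x - p x))^2) \<partial>cube)"
  by (rule nn_integral_cong_AE) (use PP' in \<open>auto elim: eventually_mono\<close>)
 then show ?thesis using p by auto
qed

definition fourier_coeff :: "(real^'n::finite => complex) => int^'n => complex" where
 "fourier_coeff P k = (LINT x|cube. P x*cnj (character (vec_of_int k) x))"

text \<open>Completing the square for orthonormal characters. Taking the Fourier coefficients for a
  gives Bessel's inequality and the best approximation property.\<close>

lemma
 fixes P :: "real^'n::finite => complex"
 assumes [measurable]: "P\<in>borel_fun" and P2: "integrable cube (%x. (norm (P x))^2)"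
  and K: "finite K"
 shows fourier_distance: "(LINT x|cube. (norm (P x - (\<Sum>k\<in>K. a k*character (vec_of_int k) x)))^2) =
   (LINT x|cube. (norm (P x))^2) - (\<Sum>k\<in>K. (norm (fourier_coeff P k))^2) + (\<Sum>k\<in>K. (norm (a k - fourier_coeff P k))^2)"
  and integrable_fourier_distance: "integrable cube (%x. (norm (P x - (\<Sum>k\<in>K. a k*character (vec_of_int k) x)))^2)"
proof -
 let ?e = "%k x. character (vec_of_int k) (x :: real^'n)"
 let ?q = "%x. \<Sum>k\<in>K. a k*?e k x"
 have P1: "integrable cube P"
 proof (rule integrable_bound_fun[of _ "%x. 1 + (norm (P x))^2"])
  show "AE x in cube. norm (P x) <= norm (1 + (norm (P x))^2)"
  proof (rule AE_I2)
   fix x show "norm (P x) <= norm (1 + (norm (P x))^2)"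
   proof -
    have "t <= \<bar>1 + t^2\<bar>" if "0 <= t" for t :: real
     using sum_squares_bound[of t 1] that zero_le_power2[of t] by (simp add: algebra_simps)
    then show ?thesis by simp
   qed
  qed
 qed (use P2 in auto)
 have Pe: "integrable cube (%x. P x*cnj (?e k x))" for k
  by (rule integrable_bound_fun[OF P1]) (auto simp: norm_mult)
 have ee: "integrable cube (%x. ?e k x*cnj (?e l x))" for k l
  by (rule cube_integrable_bounded[of _ 1]) (auto simp: norm_mult)
 have eei: "(LINT x|cube. ?e k x*cnj (?e l x)) = (if k = l then 1 else 0)" for k l
  unfolding character_mult_cnj integral_cube_character by simp
 have point: "cplx ((norm (P x - ?q x))^2) = cplx ((norm (P x))^2) - (\<Sum>k\<in>K. cnj (a k)*(P x*cnj (?e k x)))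
   - cnj (\<Sum>k\<in>K. cnj (a k)*(P x*cnj (?e k x))) + (\<Sum>k\<in>K. \<Sum>l\<in>K. a k*cnj (a l)*(?e k x*cnj (?e l x)))" for x
 proof -
  have "(\<Sum>k\<in>K. cnj (a k)*(P x*cnj (?e k x))) = P x*cnj (?q x)" by (simp add: sum_distrib_left mult_ac)
  moreover have "(\<Sum>k\<in>K. \<Sum>l\<in>K. a k*cnj (a l)*(?e k x*cnj (?e l x))) = ?q x*cnj (?q x)"
   by (simp add: sum_product mult_ac)
  ultimately show ?thesis unfolding complex_norm_square by (simp add: algebra_simps)
 qed
 have int1: "integrable cube (%x. \<Sum>k\<in>K. cnj (a k)*(P x*cnj (?e k x)))"
  by (intro Bochner_Integration.integrable_sum integrable_mult_right Pe)
 have int2: "integrable cube (%x. \<Sum>k\<in>K. \<Sum>l\<in>K. a k*cnj (a l)*(?e k x*cnj (?e l x)))"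
  by (intro Bochner_Integration.integrable_sum integrable_mult_right ee)
 have int0: "integrable cube (%x. cplx ((norm (P x))^2))" by (rule integrable_of_real[OF P2])
 have intall: "integrable cube (%x. cplx ((norm (P x - ?q x))^2))"
  unfolding point by (intro Bochner_Integration.integrable_add Bochner_Integration.integrable_diff int0 int1 int2 integrable_cnj)
 then show intr: "integrable cube (%x. (norm (P x - ?q x))^2)" by (simp only: complex_of_real_integrable_eq)
 have s1: "(LINT x|cube. (\<Sum>k\<in>K. cnj (a k)*(P x*cnj (?e k x)))) = (\<Sum>k\<in>K. cnj (a k)*fourier_coeff P k)"
  by (subst Bochner_Integration.integral_sum) (auto intro!: integrable_mult_right Pe simp: fourier_coeff_def)
 have s2: "(LINT x|cube. (\<Sum>k\<in>K. \<Sum>l\<in>K. a k*cnj (a l)*(?e k x*cnj (?e l x)))) = (\<Sum>k\<in>K. a k*cnj (a k))"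
 proof -
  have "(LINT x|cube. (\<Sum>k\<in>K. \<Sum>l\<in>K. a k*cnj (a l)*(?e k x*cnj (?e l x)))) = (\<Sum>k\<in>K. \<Sum>l\<in>K. a k*cnj (a l)*(if k = l then 1 else 0))"
   by (subst Bochner_Integration.integral_sum, (intro Bochner_Integration.integrable_sum integrable_mult_right ee),
     rule sum.cong[OF refl], subst Bochner_Integration.integral_sum, (intro integrable_mult_right ee), simp only: integral_mult_right_zero eei)
  also have "... = (\<Sum>k\<in>K. a k*cnj (a k))" using K by (simp add: if_distrib[of "%t. _*t"] cong: if_cong)
  finally show ?thesis .
 qed
 have "cplx (LINT x|cube. (norm (P x - ?q x))^2) = (LINT x|cube. cplx ((norm (P x - ?q x))^2))"
  by (rule integral_of_real[OF intr, symmetric])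
 also have "... = cplx (LINT x|cube. (norm (P x))^2) - (\<Sum>k\<in>K. cnj (a k)*fourier_coeff P k)
   - cnj (\<Sum>k\<in>K. cnj (a k)*fourier_coeff P k) + (\<Sum>k\<in>K. a k*cnj (a k))"
 proof -
  have "(LINT x|cube. cplx ((norm (P x - ?q x))^2)) = (LINT x|cube. cplx ((norm (P x))^2)) - (LINT x|cube. (\<Sum>k\<in>K. cnj (a k)*(P x*cnj (?e k x))))
   - (LINT x|cube. cnj (\<Sum>k\<in>K. cnj (a k)*(P x*cnj (?e k x)))) + (LINT x|cube. (\<Sum>k\<in>K. \<Sum>l\<in>K. a k*cnj (a l)*(?e k x*cnj (?e l x))))"
   unfolding point
   by (simp only: Bochner_Integration.integral_add Bochner_Integration.integral_diff Bochner_Integration.integrable_diff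
     int0 int1 int2 integrable_cnj)
  moreover have "(LINT x|cube. cnj (\<Sum>k\<in>K. cnj (a k)*(P x*cnj (?e k x)))) = cnj (\<Sum>k\<in>K. cnj (a k)*fourier_coeff P k)"
   unfolding s1[symmetric] by (rule Bochner_Integration.integral_cnj)
  ultimately show ?thesis unfolding s1 s2 integral_of_real[OF P2] by (simp only:)
 qed
 also have "... = cplx ((LINT x|cube. (norm (P x))^2) - (\<Sum>k\<in>K. (norm (fourier_coeff P k))^2) + (\<Sum>k\<in>K. (norm (a k - fourier_coeff P k))^2))"
  by (simp only: of_real_add of_real_diff of_real_sum complex_norm_square complex_cnj_diff cnj_sum complex_cnj_mult complex_cnj_cnj)
    (simp add: algebra_simps sum.distrib sum_subtractf)
 finally show "(LINT x|cube. (norm (P x - ?q x))^2) = (LINT x|cube. (norm (P x))^2) - (\<Sum>k\<in>K. (norm (fourier_coeff P k))^2) + (\<Sum>k\<in>K. (norm (a k - fourier_coeff P k))^2)"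
  by (rule of_real_eq_iff[THEN iffD1])
qed

lemma fourier_bessel:
 assumes "P\<in>borel_fun" "integrable cube (%x. (norm (P x))^2)" "finite K"
 shows "(\<Sum>k\<in>K. (norm (fourier_coeff P k))^2) <= (LINT x|cube. (norm (P x))^2)"
proof -
 have "0 <= (LINT x|cube. (norm (P x - (\<Sum>k\<in>K. fourier_coeff P k*character (vec_of_int k) x)))^2)" by simp
 then show ?thesis unfolding fourier_distance[OF assms] by simp
qed

text \<open>The partial sum over L is the best approximation with frequencies in L, so it beats a
  trigonometric polynomial whose frequencies L contains. This yields convergence along the net of
  finite sets, as unconditional summation demands.\<close>

lemma fourier_series_converges:
 assumes P [measurable]: "P\<in>borel_fun" and P2: "integrable cube (%x. (norm (P x))^2)" and eps: "0 < eps"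
 obtains K where "finite K" "!!L. finite L ==> K \<subseteq> L ==>
  (LINT x|cube. (norm (P x - (\<Sum>k\<in>L. fourier_coeff P k*character (vec_of_int k) x)))^2) < eps"
proof -
 have "(\<integral>\<^sup>+x. ennreal ((norm (P x))^2) \<partial>cube) < \<infinity>" using P2 by (simp add: integrable_iff_bounded)
 then obtain p where p: "p\<in>trig" "(\<integral>\<^sup>+x. ennreal ((norm (P x - p x))^2) \<partial>cube) < ennreal eps"
  using trig_approx_L2[OF P _ eps] by blast
 obtain K a where K: "finite K" "!!x. p x = (\<Sum>k\<in>K. a k*character (vec_of_int k) x)"
  using trig_finite_sum[OF p(1)] by blast
 have i: "integrable cube (%x. (norm (P x - p x))^2)" unfolding K(2) by (rule integrable_fourier_distance[OF P P2 K(1)])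
 have "ennreal (LINT x|cube. (norm (P x - p x))^2) < ennreal eps"
  using p(2) nn_integral_eq_integral[OF i] by simp
 then have lt: "(LINT x|cube. (norm (P x - p x))^2) < eps" by (simp add: ennreal_less_iff)
 have "(LINT x|cube. (norm (P x - (\<Sum>k\<in>L. fourier_coeff P k*character (vec_of_int k) x)))^2) < eps" if L: "finite L" "K \<subseteq> L" for L
 proof -
  have "(LINT x|cube. (norm (P x - (\<Sum>k\<in>L. fourier_coeff P k*character (vec_of_int k) x)))^2) = (LINT x|cube. (norm (P x))^2) - (\<Sum>k\<in>L. (norm (fourier_coeff P k))^2)"
   unfolding fourier_distance[OF P P2 L(1)] by simp
  also have "... <= (LINT x|cube. (norm (P x))^2) - (\<Sum>k\<in>K. (norm (fourier_coeff P k))^2)"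
   using L by (simp add: sum_mono2)
  also have "... <= (LINT x|cube. (norm (P x - p x))^2)"
   unfolding K(2) fourier_distance[OF P P2 K(1)] by (simp add: sum_nonneg)
  finally show ?thesis using lt by linarith
 qed
 then show ?thesis using that K(1) by blast
qed

section \<open>The bracket product\<close>

text \<open>The bracket product: the periodisation of F times the conjugate of \<theta>. On cosets
  where the series is not absolutely convergent the value is 0 by convention.\<close>

definition bracket :: "(real^'n::finite => complex) => (real^'n => complex) => real^'n => complex" where
 "bracket F \<theta> x = (LINT l|count_space UNIV. F (x + vec_of_int l)*cnj (\<theta> (x + vec_of_int l)))"

lemma bracket_measurable [measurable (raw)]:
 assumes [measurable]: "F\<in>borel_fun" "\<theta>\<in>borel_fun"
 shows "bracket F \<theta>\<in>borel_fun"
 unfolding bracket_def[abs_def] by measurable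

lemma bij_int_shift: "bij_betw (%l. l + k) (UNIV :: (int^'n::finite) set) UNIV"
 by (rule bij_betw_byWitness[where f' = "%l. l - k"]) auto

lemma bracket_periodic: "bracket F \<theta> (x + vec_of_int k) = bracket F \<theta> x"
 unfolding bracket_def
 using integral_bij_count_space[OF bij_int_shift[of k], of "%l. F (x + vec_of_int l)*cnj (\<theta> (x + vec_of_int l))"]
 by (simp add: add_ac)

text \<open>W is a weight carried by F, and V bounds |\<theta>|^2 / W without a division.
  Cauchy-Schwarz on each coset then pairs the sum of |F|^2 W with the uniformly bounded sum of
  V.\<close>

lemma
 fixes F \<theta> :: "real^'n::finite => complex" and V W :: "real^'n => real"
 assumes [measurable]: "F\<in>borel_fun" "\<theta>\<in>borel_fun" "V\<in>borel_fun" "W\<in>borel_fun"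
  and V: "!!x. 0 <= V x" and W: "!!x. 0 <= W x" and VW: "!!x. (norm (\<theta> x))^2 <= V x*W x"
  and B: "!!x. (nsum (%l. ennreal (V (x + vec_of_int l)))) <= ennreal B" and B0: "0 <= B"
  and F: "integrable lborel (%x. (norm (F x))^2*W x)"
 shows bracket_integrable: "integrable lborel (%x. F x*cnj (\<theta> x))"
  and bracket_L2: "integrable cube (%x. (norm (bracket F \<theta> x))^2)"
  and bracket_bound: "(LINT x|cube. (norm (bracket F \<theta> x))^2) <= B*(LBINT x. (norm (F x))^2*W x)"
  and bracket_coeff: "fourier_coeff (bracket F \<theta>) k = (LBINT x. F x*cnj (character (vec_of_int k) x*\<theta> x))"
proof -
 let ?S = "%x. nsum (%l. ennreal ((norm (F (x + vec_of_int l)))^2*W (x + vec_of_int l)))"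
 let ?T = "%x. nsum (%l. ennreal (norm (F (x + vec_of_int l)*cnj (\<theta> (x + vec_of_int l)))))"
 define I where "I = (LBINT x. (norm (F x))^2*W x)"
 have I0: "0 <= I" unfolding I_def using W by simp
 have S: "(\<integral>\<^sup>+x. ?S x \<partial>cube) = ennreal I"
 proof -
  have "(\<integral>\<^sup>+x. ?S x \<partial>cube) = (\<integral>\<^sup>+x. ennreal ((norm (F x))^2*W x) \<partial>lborel)"
   by (subst nn_integral_cube, measurable) (rule nn_integral_periodize[symmetric], measurable)
  then show ?thesis unfolding I_def by (simp add: nn_integral_eq_integral[OF F] W)
 qed
 have le: "norm (F x*cnj (\<theta> x)) <= (norm (F x) * sqrt (W x)) * sqrt (V x)" for x
 proof -
  have "norm (\<theta> x) <= sqrt (V x*W x)" using VW real_le_rsqrt by blast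
  then have "norm (F x)*norm (\<theta> x) <= norm (F x) * sqrt (V x*W x)" by (rule mult_left_mono) simp
  then show ?thesis by (simp add: norm_mult real_sqrt_mult mult_ac)
 qed
 have T: "(?T x)^2 <= ?S x*ennreal B" for x
 proof -
  have "?T x <= (nsum (%l. ennreal ((norm (F (x + vec_of_int l)) * sqrt (W (x + vec_of_int l))) * sqrt (V (x + vec_of_int l)))))"
   by (intro nn_integral_mono ennreal_leI le)
  then have "(?T x)^2 <= (nsum (%l. ennreal ((norm (F (x + vec_of_int l)) * sqrt (W (x + vec_of_int l))) * sqrt (V (x + vec_of_int l)))))^2"
   by (rule power_mono) simp
  also have "... <= (nsum (%l. ennreal ((norm (F (x + vec_of_int l)) * sqrt (W (x + vec_of_int l)))^2))) *
    (nsum (%l. ennreal ((sqrt (V (x + vec_of_int l)))^2)))"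
   by (rule nn_integral_Cauchy_Schwarz) (auto simp: V W)
  also have "... <= ?S x*ennreal B"
   using B[of x] by (simp add: power_mult_distrib V W mult_left_mono)
  finally show ?thesis .
 qed
 have bT: "ennreal (norm (bracket F \<theta> x)) <= ?T x" for x
 proof (cases "integrable (count_space UNIV) (%l. F (x + vec_of_int l)*cnj (\<theta> (x + vec_of_int l)))")
  case True
  then show ?thesis unfolding bracket_def by (rule integral_norm_bound_ennreal)
 qed (simp add: bracket_def not_integrable_integral_eq)
 \<comment> \<open>On the cube, which has mass 1, this deduces integrability of the coset sums from
   the bound on their squares.\<close>
 have T1: "t <= 1 + t^2" for t :: ennreal
 proof (cases t)
  case (real r)
  have "r <= 1 + r^2" using sum_squares_bound[of r 1] real by (simp add: algebra_simps)
  then have "ennreal r <= ennreal (1 + r^2)" by (rule ennreal_leI)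
  then show ?thesis using real by (simp add: ennreal_plus ennreal_power)
 qed (simp add: power2_eq_square)
 have "(\<integral>\<^sup>+x. ennreal (norm (F x*cnj (\<theta> x))) \<partial>lborel) = (\<integral>\<^sup>+x. ?T x \<partial>cube)"
  by (subst nn_integral_cube, measurable) (rule nn_integral_periodize, measurable)
 also have "... <= (\<integral>\<^sup>+x. 1 + ?S x*ennreal B \<partial>cube)"
 proof (rule nn_integral_mono)
  fix x
  have "?T x <= 1 + (?T x)^2" by (rule T1)
  also have "... <= 1 + ?S x*ennreal B" by (rule add_left_mono[OF T])
  finally show "?T x <= 1 + ?S x*ennreal B" .
 qed
 also have "... = 1 + ennreal I*ennreal B"
  using cube.emeasure_space_1[where 'n = 'n] by (subst nn_integral_add) (auto simp: nn_integral_multc S)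
 also have "... < \<infinity>" by (simp add: ennreal_mult_less_top)
 finally show int: "integrable lborel (%x. F x*cnj (\<theta> x))"
  by (intro integrableI_bounded) auto
 have "(\<integral>\<^sup>+x. ennreal ((norm (bracket F \<theta> x))^2) \<partial>cube) <= (\<integral>\<^sup>+x. ?S x*ennreal B \<partial>cube)"
 proof (rule nn_integral_mono)
  fix x
  have "ennreal ((norm (bracket F \<theta> x))^2) = (ennreal (norm (bracket F \<theta> x)))^2" by (simp add: ennreal_power)
  also have "... <= (?T x)^2" by (intro power_mono bT) simp
  also have "... <= ?S x*ennreal B" by (rule T)
  finally show "ennreal ((norm (bracket F \<theta> x))^2) <= ?S x*ennreal B" .
 qed
 also have "... = ennreal (B*I)" using I0 B0 by (subst nn_integral_multc, measurable) (simp only: S, simp add: ennreal_mult mult.commute)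
 finally have bound: "(\<integral>\<^sup>+x. ennreal ((norm (bracket F \<theta> x))^2) \<partial>cube) <= ennreal (B*I)" .
 show L2: "integrable cube (%x. (norm (bracket F \<theta> x))^2)"
  by (intro integrableI_bounded) (use le_less_trans[OF bound] in auto)
 show "(LINT x|cube. (norm (bracket F \<theta> x))^2) <= B*(LBINT x. (norm (F x))^2*W x)"
  using bound I0 B0 nn_integral_eq_integral[OF L2] by (simp add: I_def[symmetric])
 have intk: "integrable lborel (%x. F x*cnj (character (vec_of_int k) x*\<theta> x))"
  by (rule integrable_bound_fun[OF int]) (auto simp: norm_mult)
 have "(LBINT x. F x*cnj (character (vec_of_int k) x*\<theta> x)) =
  (LBINT x. indicator unit_cube x *\<^sub>R (LINT l|count_space UNIV. F (x + vec_of_int l)*cnj (character (vec_of_int k) (x + vec_of_int l)*\<theta> (x + vec_of_int l))))"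
  by (rule integral_periodize[OF intk])
 also have "... = (LBINT x. indicator unit_cube x *\<^sub>R (bracket F \<theta> x*cnj (character (vec_of_int k) x)))"
  unfolding bracket_def by (subst integral_mult_left_zero[symmetric]) (simp add: mult_ac)
 also have "... = fourier_coeff (bracket F \<theta>) k"
  unfolding fourier_coeff_def by (subst integral_cube) auto
 finally show "fourier_coeff (bracket F \<theta>) k = (LBINT x. F x*cnj (character (vec_of_int k) x*\<theta> x))" by simp
qed

text \<open>A periodic p is constant on cosets and leaves the lattice sum, which is then bounded by
  B.\<close>

lemma synthesis_bound:
 fixes p \<theta> :: "real^'n::finite => complex" and U :: "real^'n => real"
 assumes [measurable]: "p\<in>borel_fun" "\<theta>\<in>borel_fun" "U\<in>borel_fun"
  and U: "!!x. 0 <= U x" and per: "!!x l. p (x + vec_of_int l) = p x"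
  and B: "!!x. (nsum (%l. ennreal ((norm (\<theta> (x + vec_of_int l)))^2*U (x + vec_of_int l)))) <= ennreal B" and B0: "0 <= B"
  and p2: "integrable cube (%x. (norm (p x))^2)"
 shows "integrable lborel (%x. (norm (p x*\<theta> x))^2*U x)"
  and "(LBINT x. (norm (p x*\<theta> x))^2*U x) <= B*(LINT x|cube. (norm (p x))^2)"
proof -
 have "(\<integral>\<^sup>+x. ennreal ((norm (p x*\<theta> x))^2*U x) \<partial>lborel) =
  (\<integral>\<^sup>+x. (nsum (%l. ennreal ((norm (p (x + vec_of_int l)*\<theta> (x + vec_of_int l)))^2*U (x + vec_of_int l)))) \<partial>cube)"
  by (subst nn_integral_cube, measurable) (rule nn_integral_periodize, measurable)
 also have "... <= (\<integral>\<^sup>+x. ennreal ((norm (p x))^2)*ennreal B \<partial>cube)"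
 proof (rule nn_integral_mono)
  fix x
  have "(nsum (%l. ennreal ((norm (p (x + vec_of_int l)*\<theta> (x + vec_of_int l)))^2*U (x + vec_of_int l)))) =
   (nsum (%l. ennreal ((norm (p x))^2)*ennreal ((norm (\<theta> (x + vec_of_int l)))^2*U (x + vec_of_int l))))"
   by (intro nn_integral_cong) (simp add: per norm_mult power_mult_distrib ennreal_mult U mult.assoc)
  also have "... = ennreal ((norm (p x))^2)*(nsum (%l. ennreal ((norm (\<theta> (x + vec_of_int l)))^2*U (x + vec_of_int l))))"
   by (rule nn_integral_cmult) simp
  also have "... <= ennreal ((norm (p x))^2)*ennreal B" by (intro mult_left_mono B) simp
  finally show "(nsum (%l. ennreal ((norm (p (x + vec_of_int l)*\<theta> (x + vec_of_int l)))^2*U (x + vec_of_int l)))) <= ennreal ((norm (p x))^2)*ennreal B" .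
 qed
 also have "... = ennreal (B*(LINT x|cube. (norm (p x))^2))"
  using B0 by (subst nn_integral_multc) (auto simp: nn_integral_eq_integral[OF p2] ennreal_mult mult.commute)
 finally have bound: "(\<integral>\<^sup>+x. ennreal ((norm (p x*\<theta> x))^2*U x) \<partial>lborel) <= ennreal (B*(LINT x|cube. (norm (p x))^2))" .
 show i: "integrable lborel (%x. (norm (p x*\<theta> x))^2*U x)"
  by (intro integrableI_bounded) (use le_less_trans[OF bound] U in \<open>auto simp: abs_mult\<close>)
 have "ennreal (LBINT x. (norm (p x*\<theta> x))^2*U x) <= ennreal (B*(LINT x|cube. (norm (p x))^2))"
  using bound nn_integral_eq_integral[OF i] U by simp
 then show "(LBINT x. (norm (p x*\<theta> x))^2*U x) <= B*(LINT x|cube. (norm (p x))^2)"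
  using B0 by (simp add: ennreal_le_iff)
qed

section \<open>The weighted norms\<close>

lemma wnorm_nonneg [simp]: "0 <= wnorm s h"
 by (simp add: wnorm_def)

lemma wnorm_square: "(wnorm s h)^2 = (LBINT w. (norm (h w))^2*weight s w)"
 by (simp add: wnorm_def)

lemma wnorm_AE:
 assumes [measurable]: "g\<in>borel_fun" "h\<in>borel_fun" and "AE w in lborel. g w = h w"
 shows "wnorm s g = wnorm s h"
 unfolding wnorm_def
 by (intro arg_cong[of _ _ sqrt] integral_cong_AE) (use assms(3) in \<open>auto elim: eventually_mono\<close>)

lemma wL2_cmult: "h\<in>wL2 s ==> (%x. c*h x)\<in>wL2 s"
 unfolding wL2_def by (auto simp: norm_mult power_mult_distrib mult.assoc)

lemma wnorm_cmult: "wnorm s (%x. c*h x) = norm c*wnorm s h"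
 by (simp add: wnorm_def norm_mult power_mult_distrib mult.assoc real_sqrt_mult)

lemma
 assumes f: "f\<in>wL2 s" and g: "g\<in>wL2 s"
 shows wL2_add: "(%x. f x + g x)\<in>wL2 s"
  and wnorm_triangle: "wnorm s (%x. f x + g x) <= wnorm s f + wnorm s g"
proof -
 have [measurable]: "f\<in>borel_fun" "g\<in>borel_fun" using f g by auto
 let ?w = "weight s"
 let ?f = "%x. norm (f x) * sqrt (?w x)" and ?g = "%x. norm (g x) * sqrt (?w x)"
 have sq: "(?f x)^2 = (norm (f x))^2*?w x" "(?g x)^2 = (norm (g x))^2*?w x" for x
  by (simp_all add: power_mult_distrib)
 note fi = wL2_integrable[OF f] and gi = wL2_integrable[OF g]
 have fg: "integrable lborel (%x. ?f x*?g x)"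
 proof (rule integrable_bound_fun[OF Bochner_Integration.integrable_add[OF fi gi]])
  show "AE x in lborel. norm (?f x*?g x) <= norm ((norm (f x))^2*?w x + (norm (g x))^2*?w x)"
  proof (rule AE_I2)
   fix x
   have nn: "0 <= ?f x*?g x" by simp
   moreover have "2*(?f x*?g x) <= (?f x)^2 + (?g x)^2"
    using sum_squares_bound[of "?f x" "?g x"] by (simp only: mult.assoc)
   ultimately have "?f x*?g x <= (norm (f x))^2*?w x + (norm (g x))^2*?w x" unfolding sq by linarith
   then show "norm (?f x*?g x) <= norm ((norm (f x))^2*?w x + (norm (g x))^2*?w x)"
    using nn by (simp only: real_norm_def abs_of_nonneg)
  qed
 qed measurable
 have le: "(norm (f x + g x))^2*?w x <= (norm (f x))^2*?w x + 2*(?f x*?g x) + (norm (g x))^2*?w x" for x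
 proof -
  have "(norm (f x + g x))^2 <= (norm (f x) + norm (g x))^2" by (intro power_mono norm_triangle_ineq) simp
  then have "(norm (f x + g x))^2*?w x <= (norm (f x) + norm (g x))^2*?w x" by (rule mult_right_mono) simp
  also have "... = (norm (f x))^2*?w x + 2*(?f x*?g x) + (norm (g x))^2*?w x"
   by (simp add: power2_sum distrib_right distrib_left mult_ac)
  finally show ?thesis .
 qed
 have int: "integrable lborel (%x. (norm (f x))^2*?w x + 2*(?f x*?g x) + (norm (g x))^2*?w x)"
  by (intro Bochner_Integration.integrable_add integrable_mult_right fi gi fg)
 have fgi: "integrable lborel (%x. (norm (f x + g x))^2*?w x)"
  by (rule integrable_bound_fun[OF int]) (use le in \<open>auto simp: abs_mult intro!: order_trans[OF le] AE_I2\<close>)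
 then show "(%x. f x + g x)\<in>wL2 s" by (simp add: wL2_def)
 let ?a = "wnorm s f" and ?b = "wnorm s g"
 have cs: "(LBINT x. ?f x*?g x) <= ?a*?b"
 proof -
  have "(\<integral>\<^sup>+x. ennreal (?f x*?g x) \<partial>lborel)^2 <= (\<integral>\<^sup>+x. ennreal ((?f x)^2) \<partial>lborel)*(\<integral>\<^sup>+x. ennreal ((?g x)^2) \<partial>lborel)"
   by (rule nn_integral_Cauchy_Schwarz) auto
  moreover have "(\<integral>\<^sup>+x. ennreal ((?f x)^2) \<partial>lborel) = ennreal (?a^2)"
   unfolding sq wnorm_square by (rule nn_integral_eq_integral[OF fi]) simp
  moreover have "(\<integral>\<^sup>+x. ennreal ((?g x)^2) \<partial>lborel) = ennreal (?b^2)"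
   unfolding sq wnorm_square by (rule nn_integral_eq_integral[OF gi]) simp
  moreover have "(\<integral>\<^sup>+x. ennreal (?f x*?g x) \<partial>lborel) = ennreal (LBINT x. ?f x*?g x)"
   by (rule nn_integral_eq_integral[OF fg]) simp
  ultimately have "ennreal ((LBINT x. ?f x*?g x)^2) <= ennreal ((?a*?b)^2)"
   by (simp add: ennreal_power ennreal_mult power_mult_distrib)
  then have "(LBINT x. ?f x*?g x)^2 <= (?a*?b)^2" by (simp add: ennreal_le_iff)
  then show ?thesis by (rule power2_le_imp_le) simp
 qed
 have "(wnorm s (%x. f x + g x))^2 <= (LBINT x. (norm (f x))^2*?w x + 2*(?f x*?g x) + (norm (g x))^2*?w x)"
  unfolding wnorm_square by (rule integral_mono[OF fgi int le])
 also have "... = ?a^2 + 2*(LBINT x. ?f x*?g x) + ?b^2"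
  unfolding wnorm_square using fi gi fg by simp
 also have "... <= (?a + ?b)^2" using cs by (simp add: power2_sum)
 finally show "wnorm s (%x. f x + g x) <= ?a + ?b" by (rule power2_le_imp_le) simp
qed

lemma
 assumes f: "f\<in>wL2 s" and g: "g\<in>wL2 s"
 shows wL2_diff: "(%x. f x - g x)\<in>wL2 s"
  and wnorm_triangle_diff: "wnorm s (%x. f x - g x) <= wnorm s f + wnorm s g"
 using wL2_add[OF f wL2_cmult[OF g, of "-1"]] wnorm_triangle[OF f wL2_cmult[OF g, of "-1"]]
 by (simp_all add: wnorm_cmult[of s "-1" g, simplified])

lemma wnorm_minus_commute: "wnorm s (%x. f x - g x) = wnorm s (%x. g x - f x)"
 by (simp add: wnorm_def norm_minus_commute)

lemma wnorm_triangle3: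
 assumes "f\<in>wL2 s" "g\<in>wL2 s" "h\<in>wL2 s"
 shows "wnorm s (%x. f x - h x) <= wnorm s (%x. f x - g x) + wnorm s (%x. g x - h x)"
 using wnorm_triangle[OF wL2_diff[OF assms(1,2)] wL2_diff[OF assms(2,3)]] by simp

lemma wL2_zero [simp]: "(%_. 0)\<in>wL2 s" by (simp add: wL2_def)
lemma wnorm_zero [simp]: "wnorm s (%_. 0) = 0" by (simp add: wnorm_def)

lemma
 assumes "!!i. i\<in>I ==> f i\<in>wL2 s"
 shows wL2_sum: "(%x. \<Sum>i\<in>I. f i x)\<in>wL2 s"
  and wnorm_sum: "wnorm s (%x. \<Sum>i\<in>I. f i x) <= (\<Sum>i\<in>I. wnorm s (f i))"
proof -
 have "(%x. \<Sum>i\<in>I. f i x)\<in>wL2 s \<and> wnorm s (%x. \<Sum>i\<in>I. f i x) <= (\<Sum>i\<in>I. wnorm s (f i))"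
  using assms
 proof (induction I rule: infinite_finite_induct)
  case (insert i I)
  then show ?case
   using wL2_add[of "f i" s "%x. \<Sum>i\<in>I. f i x"] wnorm_triangle[of "f i" s "%x. \<Sum>i\<in>I. f i x"] by force
 qed auto
 then show "(%x. \<Sum>i\<in>I. f i x)\<in>wL2 s" "wnorm s (%x. \<Sum>i\<in>I. f i x) <= (\<Sum>i\<in>I. wnorm s (f i))" by auto
qed

lemma wnorm_mono:
 assumes "h\<in>wL2 t" "s <= t"
 shows "wnorm s h <= wnorm t h"
 unfolding wnorm_def
 by (intro real_sqrt_le_mono integral_mono wL2_integrable wL2_mono[OF assms] assms mult_left_mono weight_mono) auto

lemma wnorm_eq_0:
 assumes "h\<in>wL2 s" "wnorm s h = 0"
 shows "AE x in lborel. h x = 0"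
proof -
 have "(LBINT w. (norm (h w))^2*weight s w) = 0" using assms(2) by (simp add: wnorm_def)
 then have "AE x in lborel. (norm (h x))^2*weight s x = 0"
  by (subst (asm) integral_nonneg_eq_0_iff_AE) (use wL2_integrable[OF assms(1)] in auto)
 then show ?thesis
 proof eventually_elim
  case (elim x)
  then show ?case using weight_pos[of s x] by simp
 qed
qed

text \<open>Fatou's lemma for the weighted norm. Membership of the limit is part of the conclusion,
  since only pointwise limits of the levels are known.\<close>

lemma
 assumes g: "!!K::nat. g K\<in>wL2 s" "!!K. wnorm s (g K) <= C"
  and [measurable]: "h\<in>borel_fun" and lim: "AE x in lborel. (%K. g K x) \<longlonglongrightarrow> h x"
 shows wL2_limit: "h\<in>wL2 s" and wnorm_limit: "wnorm s h <= C"
proof -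
 have [measurable]: "g K\<in>borel_fun" for K using g by auto
 have C0: "0 <= C" using g(2)[of 0] wnorm_nonneg order_trans by blast
 let ?q = "%h x. ennreal ((norm (h x))^2*weight s x)"
 have "(\<integral>\<^sup>+x. ?q h x \<partial>lborel) = (\<integral>\<^sup>+x. liminf (%K. ?q (g K) x) \<partial>lborel)"
 proof (rule nn_integral_cong_AE)
  show "AE x in lborel. ?q h x = liminf (%K. ?q (g K) x)"
   using lim
  proof eventually_elim
   case (elim x)
   then have "(%K. ?q (g K) x) \<longlonglongrightarrow> ?q h x" by (intro tendsto_ennrealI tendsto_intros)
   then show ?case by (rule lim_imp_Liminf[OF sequentially_bot, symmetric])
  qed
 qed
 also have "... <= liminf (%K. \<integral>\<^sup>+x. ?q (g K) x \<partial>lborel)" by (rule nn_integral_liminf) measurable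
 also have "... <= ennreal (C^2)"
 proof (rule Liminf_le)
  have "(\<integral>\<^sup>+x. ?q (g K) x \<partial>lborel) <= ennreal (C^2)" for K
  proof -
   have "(\<integral>\<^sup>+x. ?q (g K) x \<partial>lborel) = ennreal ((wnorm s (g K))^2)"
    unfolding wnorm_square by (rule nn_integral_eq_integral[OF wL2_integrable[OF g(1)]]) simp
   also have "... <= ennreal (C^2)" using g(2) by (intro ennreal_leI power_mono) auto
   finally show ?thesis .
  qed
  then show "\<forall>\<^sub>F K in sequentially. (\<integral>\<^sup>+x. ?q (g K) x \<partial>lborel) <= ennreal (C^2)" by simp
 qed simp
 finally have le: "(\<integral>\<^sup>+x. ?q h x \<partial>lborel) <= ennreal (C^2)" .
 have i: "integrable lborel (%x. (norm (h x))^2*weight s x)"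
  by (intro integrableI_bounded) (use le_less_trans[OF le] in \<open>auto simp: abs_mult\<close>)
 then show "h\<in>wL2 s" by (simp add: wL2_def)
 have "ennreal ((wnorm s h)^2) <= ennreal (C^2)"
  using le unfolding wnorm_square by (simp add: nn_integral_eq_integral[OF i])
 then have "(wnorm s h)^2 <= C^2" by (simp add: ennreal_le_iff)
 then show "wnorm s h <= C" using C0 by (rule power2_le_imp_le)
qed

text \<open>Below and above the index where Y q^j crosses 1 the summands are dominated by geometric
  series running away from it, with common ratio q^\<gamma> for the smaller exponent \<gamma>. Their
  sums do not depend on where the crossing happens, hence not on Y.\<close>

lemma geometric_sum_bound:
 fixes q \<alpha> \<beta> :: real
 assumes q: "0 < q" "q < 1" and "0 < \<alpha>" "0 < \<beta>"
 obtains C where "0 < C" "!!Y J. 0 < Y ==> (\<Sum>j<J. min ((Y*q ^ j) powr \<alpha>) ((Y*q ^ j) powr (- \<beta>))) <= C"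
proof -
 define \<gamma> where "\<gamma> = min \<alpha> \<beta>"
 have \<gamma>: "0 < \<gamma>" "\<gamma> <= \<alpha>" "\<gamma> <= \<beta>" using assms by (auto simp: \<gamma>_def)
 define a where "a = q powr \<gamma>"
 have a: "0 < a" "a < 1" using q \<gamma> powr_less_mono2[of \<gamma> q 1] by (auto simp: a_def)
 have geo: "(\<Sum>j\<in>A. a ^ f j) <= 1/(1 - a)" if "inj_on f A" "finite A" for A :: "nat set" and f :: "nat => nat"
 proof -
  have "(\<Sum>j\<in>A. a ^ f j) = (\<Sum>i\<in>f ` A. a ^ i)" by (subst sum.reindex[OF that(1)]) simp
  also have "... <= (\<Sum>i. a ^ i)" using a that(2) by (intro sum_le_suminf summable_geometric) auto
  also have "... = 1/(1 - a)" using a by (intro suminf_geometric) auto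
  finally show ?thesis .
 qed
 have qa: "(q ^ i) powr \<gamma> = a ^ i" for i
  using q by (simp add: a_def powr_realpow[symmetric] powr_powr mult.commute)
 have small: "min (z powr \<alpha>) (z powr (- \<beta>)) <= (q ^ i) powr \<gamma>" if "0 < z" "z <= q ^ i" for z i
 proof -
  have "z <= 1" using that(2) q power_le_one[of q i] by linarith
  then have "z powr \<alpha> <= z powr \<gamma>" using that \<gamma> by (intro powr_mono') auto
  also have "... <= (q ^ i) powr \<gamma>" using that \<gamma> by (intro powr_mono2) auto
  finally show ?thesis by linarith
 qed
 have large: "min (z powr \<alpha>) (z powr (- \<beta>)) <= (q ^ i) powr \<gamma>" if "0 < z" "1/q ^ i <= z" for z i
 proof -
  have "1 <= 1/q ^ i" using q power_le_one[of q i] by (simp add: field_simps)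
  then have z: "1 <= z" using that by linarith
  have "z powr (- \<beta>) <= z powr (- \<gamma>)" using z \<gamma> by (intro powr_mono) auto
  also have "... = (1/z) powr \<gamma>" using that by (simp add: powr_minus_divide powr_divide)
  also have "... <= (q ^ i) powr \<gamma>"
   using that \<gamma> q by (intro powr_mono2) (auto simp: field_simps)
  finally show ?thesis by linarith
 qed
 have "(\<Sum>j<J. min ((Y*q ^ j) powr \<alpha>) ((Y*q ^ j) powr (- \<beta>))) <= 1/(1 - a) + 1/(1 - a)" if Y: "0 < Y" for Y J
 proof -
  have "\<exists>j. Y*q ^ j <= 1"
  proof -
   obtain j where "q ^ j < 1/Y" using real_arch_pow_inv[of "1/Y" q] Y q by auto
   then show ?thesis using Y by (intro exI[of _ j]) (simp add: field_simps)
  qed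
  define j0 where "j0 = (LEAST j. Y*q ^ j <= 1)"
  have j0: "Y*q ^ j0 <= 1" unfolding j0_def using \<open>\<exists>j. Y*q ^ j <= 1\<close> by (rule LeastI_ex)
  have j0': "1 < Y*q ^ j" if "j < j0" for j using not_less_Least[of j] that by (force simp: j0_def)
  let ?t = "%j. min ((Y*q ^ j) powr \<alpha>) ((Y*q ^ j) powr (- \<beta>))"
  have pos: "0 < Y*q ^ j" for j using Y q by simp
  have t1: "?t j <= a ^ (j - j0)" if "j0 <= j" for j
  proof -
   have "Y*q ^ j = (Y*q ^ j0)*q ^ (j - j0)" using that by (simp flip: power_add)
   also have "... <= 1*q ^ (j - j0)" using j0 q by (intro mult_right_mono) auto
   finally have "Y*q ^ j <= q ^ (j - j0)" by simp
   from small[OF pos this] show ?thesis by (simp add: qa)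
  qed
  \<comment> \<open>\<open>j0 - 1\<close> is the last index before the crossing, so the distances on
    this side start at 0 too.\<close>
  have t2: "?t j <= a ^ (j0 - 1 - j)" if "j < j0" for j
  proof -
   have "1 < Y*q ^ (j0 - 1)" using that by (intro j0') auto
   also have "q ^ (j0 - 1) = q ^ j*q ^ (j0 - 1 - j)" using that by (simp flip: power_add)
   finally have "1/q ^ (j0 - 1 - j) <= Y*q ^ j" using q by (simp add: field_simps)
   from large[OF pos this] show ?thesis by (simp add: qa)
  qed
  have "(\<Sum>j<J. ?t j) = (\<Sum>j\<in>{..<J} \<inter> {j0..}. ?t j) + (\<Sum>j\<in>{..<J} \<inter> {..<j0}. ?t j)"
   by (subst sum.union_disjoint[symmetric]) (auto intro!: sum.cong)
  also have "... <= (\<Sum>j\<in>{..<J} \<inter> {j0..}. a ^ (j - j0)) + (\<Sum>j\<in>{..<J} \<inter> {..<j0}. a ^ (j0 - 1 - j))"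
   by (intro add_mono sum_mono t1 t2) auto
  also have "... <= 1/(1 - a) + 1/(1 - a)"
   by (intro add_mono geo) (auto intro!: inj_onI)
  finally show ?thesis .
 qed
 moreover have "0 < 1/(1 - a) + 1/(1 - a)" using a by simp
 ultimately show ?thesis using that by blast
qed

text \<open>On a ball all weights are comparable, so truncations belong to every \<open>wL2\<close>.
  They also have the bounded support needed for pointwise convergence of the levels.\<close>

definition trunc :: "real => (real^'n::finite => complex) => real^'n => complex" where
 "trunc R F w = (if norm w <= R then F w else 0)"

lemma trunc_measurable [measurable (raw)]:
 assumes [measurable]: "F\<in>borel_fun"
 shows "trunc R F\<in>borel_fun"
 unfolding trunc_def[abs_def] by measurable

lemma trunc_limit: "(%R::nat. trunc (real R) F w) \<longlonglongrightarrow> F w"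
proof (rule tendsto_eventually)
 obtain R0 :: nat where "norm w <= real R0" using real_arch_simple by blast
 then show "\<forall>\<^sub>F R in sequentially. trunc (real R) F w = F w"
  by (auto simp: trunc_def eventually_sequentially intro!: exI[of _ R0])
qed

section \<open>Levels of a dilated shift-invariant system\<close>

text \<open>V stands for the quotient of |\<theta>|^2 by W, written without division because
  \<open>vanishing_weight\<close> can be 0.\<close>

definition analysis :: "(real^'n::finite => complex) => (real^'n => real) => real => bool" where
 "analysis \<theta> W B \<longleftrightarrow> \<theta>\<in>borel_fun \<and> W\<in>borel_fun \<and> (\<forall>x. 0 <= W x) \<and> 0 <= B \<and>
   (\<exists>V\<in>borel_fun. (\<forall>x. 0 <= V x \<and> (norm (\<theta> x))^2 <= V x*W x) \<and>
    (\<forall>x. (nsum (%l. ennreal (V (x + vec_of_int l)))) <= ennreal B))"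

definition synthesis :: "(real^'n::finite => complex) => (real^'n => real) => real => bool" where
 "synthesis \<theta> U B \<longleftrightarrow> \<theta>\<in>borel_fun \<and> U\<in>borel_fun \<and> (\<forall>x. 0 <= U x) \<and> 0 <= B \<and>
   (\<forall>x. (nsum (%l. ennreal ((norm (\<theta> (x + vec_of_int l)))^2*U (x + vec_of_int l)))) <= ennreal B)"

text \<open>The same lattice sum serves both purposes: V is |\<theta>|^2 times the weight of order
  t.\<close>

lemma synthesis_imp_analysis:
 assumes "synthesis \<theta> (weight t) B"
 shows "analysis \<theta> (weight (- t)) B"
proof -
 have "(norm (\<theta> x))^2 <= ((norm (\<theta> x))^2*weight t x)*weight (- t) x" for x
  using weight_add[of t "- t" x] by (simp add: mult.assoc)
 moreover have "(%x. (norm (\<theta> x))^2*weight t x)\<in>borel_fun"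
  using assms by (auto simp: synthesis_def)
 ultimately show ?thesis
  using assms unfolding synthesis_def analysis_def
  by (auto intro!: bexI[of _ "%x. (norm (\<theta> x))^2*weight t x"])
qed

context isotropic_dilation
begin

abbreviation "up j x \<equiv> matpow N j *v x"
abbreviation "down j x \<equiv> matpow N' j *v x"

lemma down_up [simp]: "down j (up j x) = x"
 by (simp add: matrix_vector_mul_assoc matpow_inverse[OF N'N])
lemma up_down [simp]: "up j (down j x) = x"
 by (simp add: matrix_vector_mul_assoc matpow_inverse[OF NN'])

definition m :: real where "m = \<bar>det N\<bar>"

lemma m_pos: "0 < m" using \<rho> by (simp add: m_def det_N)
lemma det_up: "det (matpow N j) ~= 0" "\<bar>det (matpow N j)\<bar> = m ^ j"
 using m_pos by (auto simp: det_matpow m_def power_abs)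

lemma
 fixes F :: "real^'n => 'a::{banach,second_countable_topology}"
 assumes "F\<in>borel_fun"
 shows integrable_up: "integrable lborel (%x. F (up j x)) \<longleftrightarrow> integrable lborel F"
  and integral_up: "(LBINT x. F x) = m ^ j *\<^sub>R (LBINT x. F (up j x))"
 using integrable_lborel_matrix[OF det_up(1) assms, of j] integral_lborel_matrix[OF det_up(1) assms, of j] m_pos
 by (simp_all add: det_up)

definition atom :: "nat => int^'n => (real^'n => complex) => real^'n => complex" where
 "atom j k \<theta> w = cplx (m powr (- real j/2))*(character (vec_of_int k) (down j w)*\<theta> (down j w))"

lemma atom_measurable [measurable (raw)]:
 assumes [measurable]: "\<theta>\<in>borel_fun"
 shows "atom j k \<theta>\<in>borel_fun"
 unfolding atom_def[abs_def] by measurable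

text \<open>The closed form of the sum over k of the coefficients of F against
  \<open>atom j k \<theta>'\<close> times \<open>atom j k \<theta>\<close>;
  \<open>level_converges\<close> below justifies it.\<close>

definition level :: "nat => (real^'n => complex) => (real^'n => complex) => (real^'n => complex) => real^'n => complex" where
 "level j \<theta> \<theta>' F w = bracket (%x. F (up j x)) \<theta>' (down j w)*\<theta> (down j w)"

lemma level_measurable [measurable (raw)]:
 assumes [measurable]: "\<theta>\<in>borel_fun" "\<theta>'\<in>borel_fun" "F\<in>borel_fun"
 shows "level j \<theta> \<theta>' F\<in>borel_fun"
proof -
 have [measurable]: "bracket (%x. F (up j x)) \<theta>'\<in>borel_fun" by (rule bracket_measurable) measurable
 show ?thesis unfolding level_def[abs_def] by measurable
qed

lemma m_half: "m ^ j*m powr (- real j/2) = m powr (real j/2)"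
proof -
 have "m ^ j*m powr (- real j/2) = m powr (real j + (- real j/2))"
  using m_pos by (simp only: powr_add powr_realpow)
 then show ?thesis by simp
qed

lemma m_half_square: "(m powr (real j/2))^2 = m ^ j"
 using m_pos by (simp add: powr_realpow[symmetric] power2_eq_square flip: powr_add)

text \<open>The substitution w = N^j x turns the coefficients into Fourier coefficients of the
  bracket; the Jacobian m^j against the normalisation m^(-j/2) leaves m^(j/2).\<close>

lemma
 assumes A: "analysis \<theta> W B" and F [measurable]: "F\<in>borel_fun"
  and int: "integrable lborel (%w. (norm (F w))^2*W (down j w))"
 shows coeff_integrable: "integrable lborel (%w. F w*cnj (atom j k \<theta> w))"
  and coeff_eq: "(LBINT w. F w*cnj (atom j k \<theta> w)) = cplx (m powr (real j/2))*fourier_coeff (bracket (%x. F (up j x)) \<theta>) k"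
  and level_bracket_L2: "integrable cube (%x. (norm (bracket (%x. F (up j x)) \<theta> x))^2)"
  and level_bracket_bound: "m ^ j*(LINT x|cube. (norm (bracket (%x. F (up j x)) \<theta> x))^2) <= B*(LBINT w. (norm (F w))^2*W (down j w))"
  and level_translates_integrable: "integrable lborel (%x. F (up j x)*cnj (\<theta> x))"
proof -
 obtain V where V [measurable]: "V\<in>borel_fun" and V': "!!x. 0 <= V x" "!!x. (norm (\<theta> x))^2 <= V x*W x"
  "!!x. (nsum (%l. ennreal (V (x + vec_of_int l)))) <= ennreal B"
  using A unfolding analysis_def by blast
 have W [measurable]: "W\<in>borel_fun" "\<theta>\<in>borel_fun" and W': "!!x. 0 <= W x" "0 <= B"
  using A unfolding analysis_def by auto
 have Fm: "(%x. F (up j x))\<in>borel_fun" by measurable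
 have int': "integrable lborel (%x. (norm (F (up j x)))^2*W x)"
  using int integrable_up[of "%w. (norm (F w))^2*W (down j w)" j] by simp
 note br = bracket_integrable[OF Fm W(2) V W(1) V'(1) W'(1) V'(2) V'(3) W'(2) int'] bracket_L2[OF Fm W(2) V W(1) V'(1) W'(1) V'(2) V'(3) W'(2) int']
  bracket_bound[OF Fm W(2) V W(1) V'(1) W'(1) V'(2) V'(3) W'(2) int'] bracket_coeff[OF Fm W(2) V W(1) V'(1) W'(1) V'(2) V'(3) W'(2) int', of k]
 show "integrable cube (%x. (norm (bracket (%x. F (up j x)) \<theta> x))^2)" by (rule br(2))
 show "integrable lborel (%x. F (up j x)*cnj (\<theta> x))" by (rule br(1))
 have "m ^ j*(LINT x|cube. (norm (bracket (%x. F (up j x)) \<theta> x))^2) <= m ^ j*(B*(LBINT x. (norm (F (up j x)))^2*W x))"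
  using m_pos by (intro mult_left_mono br(3)) auto
 also have "... = B*(LBINT w. (norm (F w))^2*W (down j w))"
  using integral_up[of "%w. (norm (F w))^2*W (down j w)" j] by simp
 finally show "m ^ j*(LINT x|cube. (norm (bracket (%x. F (up j x)) \<theta> x))^2) <= B*(LBINT w. (norm (F w))^2*W (down j w))" .
 let ?G = "%w. F w*cnj (atom j k \<theta> w)"
 have G: "?G (up j x) = cplx (m powr (- real j/2))*(F (up j x)*cnj (character (vec_of_int k) x*\<theta> x))" for x
  by (simp add: atom_def)
 have "integrable lborel (%x. F (up j x)*cnj (character (vec_of_int k) x*\<theta> x))"
  by (rule integrable_bound_fun[OF br(1)]) (auto simp: norm_mult)
 then have "integrable lborel (%x. ?G (up j x))" unfolding G by (rule integrable_mult_right)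
 then show "integrable lborel ?G" by (subst (asm) integrable_up) auto
 have "(LBINT w. ?G w) = m ^ j *\<^sub>R (LBINT x. ?G (up j x))" by (rule integral_up) measurable
 also have "(LBINT x. ?G (up j x)) = cplx (m powr (- real j/2))*fourier_coeff (bracket (%x. F (up j x)) \<theta>) k"
  unfolding G br(4) by (rule integral_mult_right_zero)
 also have "m ^ j *\<^sub>R ... = cplx (m ^ j*m powr (- real j/2))*fourier_coeff (bracket (%x. F (up j x)) \<theta>) k"
  by (simp add: scaleR_conv_of_real)
 finally show "(LBINT w. ?G w) = cplx (m powr (real j/2))*fourier_coeff (bracket (%x. F (up j x)) \<theta>) k"
  by (simp only: m_half)
qed

lemma level_bessel:
 assumes A: "analysis \<theta> W B" and F [measurable]: "F\<in>borel_fun"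
  and int: "integrable lborel (%w. (norm (F w))^2*W (down j w))" and K: "finite K"
 shows "(\<Sum>k\<in>K. (norm (LBINT w. F w*cnj (atom j k \<theta> w)))^2) <= B*(LBINT w. (norm (F w))^2*W (down j w))"
proof -
 let ?P = "bracket (%x. F (up j x)) \<theta>"
 have [measurable]: "\<theta>\<in>borel_fun" using A by (simp add: analysis_def)
 have P: "?P\<in>borel_fun" by (rule bracket_measurable) measurable
 have "(\<Sum>k\<in>K. (norm (LBINT w. F w*cnj (atom j k \<theta> w)))^2) = m ^ j*(\<Sum>k\<in>K. (norm (fourier_coeff ?P k))^2)"
  by (simp add: coeff_eq[OF A F int] norm_mult power_mult_distrib m_half_square sum_distrib_left)
 also have "... <= m ^ j*(LINT x|cube. (norm (?P x))^2)"
  using m_pos by (intro mult_left_mono fourier_bessel[OF P level_bracket_L2[OF A F int] K]) auto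
 also have "... <= B*(LBINT w. (norm (F w))^2*W (down j w))" by (rule level_bracket_bound[OF A F int])
 finally show ?thesis .
qed

text \<open>A level and the error of its partial sums have the same shape, a periodic function times
  \<theta>, both at the dilated point. For the error this function is the remainder of the Fourier
  series of the bracket, so the estimate \<open>gen\<close> covers both.\<close>

lemma
 assumes A: "analysis \<theta>' W B" and S: "synthesis \<theta> U B'" and F [measurable]: "F\<in>borel_fun"
  and int: "integrable lborel (%w. (norm (F w))^2*W (down j w))"
 shows level_L2: "integrable lborel (%w. (norm (level j \<theta> \<theta>' F w))^2*U (down j w))"
  and level_bound: "(LBINT w. (norm (level j \<theta> \<theta>' F w))^2*U (down j w)) <= B'*(B*(LBINT w. (norm (F w))^2*W (down j w)))"
  and level_converges: "0 < eps ==> \<exists>K. finite K \<and> (\<forall>L. finite L --> K \<subseteq> L -->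
   (LBINT w. (norm (level j \<theta> \<theta>' F w - (\<Sum>k\<in>L. (LBINT \<eta>. F \<eta>*cnj (atom j k \<theta>' \<eta>))*atom j k \<theta> w)))^2*U (down j w)) < eps)"
  and level_converges_integrable: "finite L ==>
   integrable lborel (%w. (norm (level j \<theta> \<theta>' F w - (\<Sum>k\<in>L. (LBINT \<eta>. F \<eta>*cnj (atom j k \<theta>' \<eta>))*atom j k \<theta> w)))^2*U (down j w))"
proof -
 let ?P = "bracket (%x. F (up j x)) \<theta>'"
 have [measurable]: "\<theta>'\<in>borel_fun" "\<theta>\<in>borel_fun" "U\<in>borel_fun"
  and U: "!!x. 0 <= U x" "0 <= B'"
  and S': "!!x. (nsum (%l. ennreal ((norm (\<theta> (x + vec_of_int l)))^2*U (x + vec_of_int l)))) <= ennreal B'"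
  using A S by (auto simp: analysis_def synthesis_def)
 have P [measurable]: "?P\<in>borel_fun" by (rule bracket_measurable) measurable
 note P2 = level_bracket_L2[OF A F int]
 have gen: "integrable lborel (%w. (norm (p (down j w)*\<theta> (down j w)))^2*U (down j w))"
   "(LBINT w. (norm (p (down j w)*\<theta> (down j w)))^2*U (down j w)) <= B'*(m ^ j*(LINT x|cube. (norm (p x))^2))"
  if pm [measurable]: "p\<in>borel_fun" and per: "!!x l. p (x + vec_of_int l) = p x" and p2: "integrable cube (%x. (norm (p x))^2)" for p
 proof -
  have [measurable]: "(%w. (norm (p (down j w)*\<theta> (down j w)))^2*U (down j w))\<in>borel_fun" by measurable
  have sb: "integrable lborel (%x. (norm (p x*\<theta> x))^2*U x)" "(LBINT x. (norm (p x*\<theta> x))^2*U x) <= B'*(LINT x|cube. (norm (p x))^2)"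
   by (rule synthesis_bound; (rule U per S' p2 | measurable))+
  show "integrable lborel (%w. (norm (p (down j w)*\<theta> (down j w)))^2*U (down j w))"
   by (subst integrable_up[of _ j, symmetric]) (use sb(1) in auto)
  have "(LBINT w. (norm (p (down j w)*\<theta> (down j w)))^2*U (down j w)) = m ^ j*(LBINT x. (norm (p x*\<theta> x))^2*U x)"
   by (subst integral_up[of _ j]) auto
  also have "... <= m ^ j*(B'*(LINT x|cube. (norm (p x))^2))" using m_pos by (intro mult_left_mono sb(2)) auto
  finally show "(LBINT w. (norm (p (down j w)*\<theta> (down j w)))^2*U (down j w)) <= B'*(m ^ j*(LINT x|cube. (norm (p x))^2))"
   by (simp add: mult_ac)
 qed
 show "integrable lborel (%w. (norm (level j \<theta> \<theta>' F w))^2*U (down j w))"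
  unfolding level_def by (rule gen(1)[OF P bracket_periodic P2])
 have "(LBINT w. (norm (level j \<theta> \<theta>' F w))^2*U (down j w)) <= B'*(m ^ j*(LINT x|cube. (norm (?P x))^2))"
  unfolding level_def by (rule gen(2)[OF P bracket_periodic P2])
 also have "... <= B'*(B*(LBINT w. (norm (F w))^2*W (down j w)))"
  using U by (intro mult_left_mono level_bracket_bound[OF A F int])
 finally show "(LBINT w. (norm (level j \<theta> \<theta>' F w))^2*U (down j w)) <= B'*(B*(LBINT w. (norm (F w))^2*W (down j w)))" .
 define p where "p L x = ?P x - (\<Sum>k\<in>L. fourier_coeff ?P k*character (vec_of_int k) x)" for L x
 have p_eq: "level j \<theta> \<theta>' F w - (\<Sum>k\<in>L. (LBINT \<eta>. F \<eta>*cnj (atom j k \<theta>' \<eta>))*atom j k \<theta> w) = p L (down j w)*\<theta> (down j w)" for L w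
 proof -
  have one: "cplx (m powr (real j/2))*cplx (m powr (- real j/2)) = 1"
   unfolding of_real_mult[symmetric] powr_add[symmetric] using m_pos by simp
  have "(LBINT \<eta>. F \<eta>*cnj (atom j k \<theta>' \<eta>))*atom j k \<theta> w = fourier_coeff ?P k*character (vec_of_int k) (down j w)*\<theta> (down j w)" for k
  proof -
   have "(LBINT \<eta>. F \<eta>*cnj (atom j k \<theta>' \<eta>))*atom j k \<theta> w =
    (cplx (m powr (real j/2))*cplx (m powr (- real j/2)))*(fourier_coeff ?P k*character (vec_of_int k) (down j w)*\<theta> (down j w))"
    unfolding coeff_eq[OF A F int] unfolding atom_def by (simp only: mult_ac)
   then show ?thesis unfolding one by simp
  qed
  then show ?thesis by (simp add: level_def p_def left_diff_distrib sum_distrib_right)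
 qed
 have pm: "p L\<in>borel_fun" for L unfolding p_def[abs_def] by measurable
 have pp: "p L (x + vec_of_int l) = p L x" for L x l by (simp add: p_def bracket_periodic)
 have p2: "integrable cube (%x. (norm (p L x))^2)" if "finite L" for L
  unfolding p_def by (rule integrable_fourier_distance[OF P P2 that])
 show "integrable lborel (%w. (norm (level j \<theta> \<theta>' F w - (\<Sum>k\<in>L. (LBINT \<eta>. F \<eta>*cnj (atom j k \<theta>' \<eta>))*atom j k \<theta> w)))^2*U (down j w))"
  if "finite L" unfolding p_eq by (rule gen(1)[OF pm pp p2[OF that]])
 assume eps: "0 < eps"
 \<comment> \<open>B' may be 0, hence the shift by 1 in the denominator.\<close>
 define \<delta> where "\<delta> = eps/((B' + 1)*m ^ j)"
 have \<delta>: "0 < \<delta>" using eps U m_pos by (simp add: \<delta>_def)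
 obtain K where K: "finite K" "!!L. finite L ==> K \<subseteq> L ==> (LINT x|cube. (norm (p L x))^2) < \<delta>"
  using fourier_series_converges[OF P P2 \<delta>] unfolding p_def by blast
 have "(LBINT w. (norm (p L (down j w)*\<theta> (down j w)))^2*U (down j w)) < eps" if L: "finite L" "K \<subseteq> L" for L
 proof -
  have "(LBINT w. (norm (p L (down j w)*\<theta> (down j w)))^2*U (down j w)) <= B'*(m ^ j*(LINT x|cube. (norm (p L x))^2))"
   by (rule gen(2)[OF pm pp p2[OF L(1)]])
  also have "... <= B'*(m ^ j*\<delta>)"
   using U m_pos K(2)[OF L] by (intro mult_left_mono) auto
  also have "... < (B' + 1)*(m ^ j*\<delta>)" using \<delta> m_pos by (intro mult_strict_right_mono) auto
  also have "... = eps"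
  proof -
   have "B' + 1 ~= 0" "m ^ j ~= 0" using U m_pos by auto
   then show ?thesis by (simp add: \<delta>_def)
  qed
  finally show ?thesis .
 qed
 then show "\<exists>K. finite K \<and> (\<forall>L. finite L --> K \<subseteq> L -->
   (LBINT w. (norm (level j \<theta> \<theta>' F w - (\<Sum>k\<in>L. (LBINT \<eta>. F \<eta>*cnj (atom j k \<theta>' \<eta>))*atom j k \<theta> w)))^2*U (down j w)) < eps)"
  unfolding p_eq using K(1) by blast
qed

text \<open>Enlarged to at least 1 so that \<open>weight_dilate\<close> applies also to the
  contracting maps \<open>down j\<close>.\<close>

definition c_1 :: real where "c_1 = max 1 c_0"
lemma c_1: "1 <= c_1" "c_0 <= c_1" by (auto simp: c_1_def)

lemma weight_dilate:
 fixes x y :: "real^'n"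
 assumes "norm y <= c*norm x" "1 <= c" "0 <= r"
 shows "weight r y <= c powr (2*r)*weight r x"
proof -
 have c: "0 < c" using assms by simp
 have "(norm y)^2 <= (c*norm x)^2" using assms by (intro power_mono) auto
 moreover have "1 <= c^2" using assms(2) by (simp add: one_le_power)
 ultimately have "1 + (norm y)^2 <= c^2*(1 + (norm x)^2)" by (simp add: distrib_left power_mult_distrib)
 then have "weight r y <= (c^2*(1 + (norm x)^2)) powr r"
  unfolding weight_def using assms(3) by (intro powr_mono2) auto
 also have "c^2 = c powr 2" using c by simp
 also have "(c powr 2*(1 + (norm x)^2)) powr r = c powr (2*r)*weight r x"
  using c by (simp only: powr_mult powr_powr weight_def)
 finally show ?thesis .
qed

lemma norm_up: "norm (up j x) <= (c_1*\<rho> ^ j)*norm x"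
 by (rule order_trans[OF norm_N mult_right_mono[OF mult_right_mono[OF c_1(2)]]]) (use \<rho> in auto)

lemma norm_down: "norm (down j x) <= c_1/\<rho> ^ j*norm x"
 by (rule order_trans[OF norm_N' mult_right_mono[OF divide_right_mono[OF c_1(2)]]]) (use \<rho> in auto)


lemma c_1_\<rho>: "1 <= c_1*\<rho> ^ j"
 using mult_mono[OF c_1(1) one_le_power[of \<rho> j]] c_1 \<rho> by simp

lemma weight_down:
 assumes "0 <= r" "r <= t"
 shows "weight r w <= (c_1*\<rho> ^ j) powr (2*r)*weight t (down j w)"
proof -
 have "weight r (up j (down j w)) <= (c_1*\<rho> ^ j) powr (2*r)*weight r (down j w)"
  by (rule weight_dilate[OF norm_up c_1_\<rho> assms(1)])
 also have "... <= (c_1*\<rho> ^ j) powr (2*r)*weight t (down j w)"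
  by (intro mult_left_mono weight_mono assms) simp
 finally show ?thesis by simp
qed

text \<open>For large j the points N^j (N^(-j) w + l) with l nonzero leave the support of F. The
  coset sum reduces to one term, and continuity at the origin gives the limit.\<close>

lemma level_pointwise_limit:
 assumes c: "continuous_on UNIV \<theta>" "continuous_on UNIV \<theta>'" "\<theta> 0 = 1" "\<theta>' 0 = 1"
  and supp: "!!w. R < norm w ==> F w = 0"
 shows "(%j. level j \<theta> \<theta>' F w) \<longlonglongrightarrow> F w"
proof -
 have \<rho>_top: "filterlim (%j. \<rho> ^ j) at_top sequentially"
  using \<rho> by (intro filterlim_at_infinity_imp_filterlim_at_top filterlim_realpow_sequentially_gt1) auto
 have "(%j. c_1/\<rho> ^ j*norm w) \<longlonglongrightarrow> 0"
 proof -
  have "(%j. c_1*norm w/\<rho> ^ j) \<longlonglongrightarrow> 0"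
   by (intro real_tendsto_divide_at_top[OF tendsto_const \<rho>_top])
  then show ?thesis by simp
 qed
 then have d0: "(%j. down j w) \<longlonglongrightarrow> 0"
  by (rule Lim_null_comparison[OF always_eventually[OF allI[OF norm_down]]])
 have "(%j. F w*cnj (\<theta>' (down j w))*\<theta> (down j w)) \<longlonglongrightarrow> F w*cnj (\<theta>' 0)*\<theta> 0"
  by (intro tendsto_intros continuous_on_tendsto_compose[OF c(1) d0] continuous_on_tendsto_compose[OF c(2) d0]) auto
 then have "(%j. F w*cnj (\<theta>' (down j w))*\<theta> (down j w)) \<longlonglongrightarrow> F w" by (simp add: c)
 moreover have "\<forall>\<^sub>F j in sequentially. F w*cnj (\<theta>' (down j w))*\<theta> (down j w) = level j \<theta> \<theta>' F w"
 proof -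
  have "\<forall>\<^sub>F j in sequentially. c_1*(R + norm w) < \<rho> ^ j"
   using \<rho>_top by (simp add: filterlim_at_top_dense)
  then show ?thesis
  proof eventually_elim
   case (elim j)
   have zero: "F (up j (down j w + vec_of_int l)) = 0" if l: "l ~= 0" for l
   proof (rule supp)
    obtain i where i: "l $ i ~= 0" using l by (auto simp: vec_eq_iff)
    have "1 <= \<bar>vec_of_int l $ i :: real\<bar>" using i by simp
    also have "... <= norm (vec_of_int l :: real^'n)" by (rule component_le_norm_cart)
    also have "... <= c_1/\<rho> ^ j*norm (up j (vec_of_int l))" using norm_down[of j "up j (vec_of_int l)"] by simp
    finally have "\<rho> ^ j <= c_1*norm (up j (vec_of_int l))" using \<rho> by (simp add: field_simps)
    then have "c_1*(R + norm w) < c_1*norm (up j (vec_of_int l))" using elim by linarith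
    then have "R + norm w < norm (up j (vec_of_int l))" using c_1 by simp
    moreover have "up j (down j w + vec_of_int l) = w + up j (vec_of_int l)"
     by (simp add: matrix_vector_right_distrib)
    moreover have "norm (up j (vec_of_int l)) <= norm (w + up j (vec_of_int l)) + norm w"
     using norm_triangle_ineq4[of "w + up j (vec_of_int l)" w] by simp
    ultimately show "R < norm (up j (down j w + vec_of_int l))" by simp
   qed
   have "(%l. F (up j (down j w + vec_of_int l))*cnj (\<theta>' (down j w + vec_of_int l))) = (%l. if l = 0 then F w*cnj (\<theta>' (down j w)) else 0)"
    using zero by (auto simp: fun_eq_iff)
   then show ?case by (simp add: level_def bracket_def integral_count_space_single)
  qed
 qed
 ultimately show ?thesis by (rule Lim_transform_eventually)
qed

lemma AE_lborel_matrix: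
 fixes A :: "real^'n^'n"
 assumes d: "det A ~= 0" and [measurable]: "Measurable.pred borel P" and ae: "AE x in lborel. P x"
 shows "AE x in lborel. P (A *v x)"
proof -
 have "AE x in distr lborel borel ((*v) A). P x"
  unfolding lborel_distr_matrix[OF d] by (subst AE_density) (use ae in \<open>auto elim: eventually_mono\<close>)
 then show ?thesis by (subst (asm) AE_distr_iff) auto
qed

lemma det_N'_matpow: "det (matpow N' j) ~= 0"
proof
 assume "det (matpow N' j) = 0"
 then have "det (matpow N j ** matpow N' j) = 0" by (simp add: det_mul)
 then show False by (simp add: matpow_inverse[OF NN'])
qed

text \<open>Summability over a coset depends only on the coset, so the a.e. statement on one cube
  spreads to countably many translates; an invertible substitution preserves null sets.\<close>

lemma AE_down_translates_integrable:
 assumes A: "analysis \<theta> W B" and F [measurable]: "F\<in>borel_fun"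
  and int: "integrable lborel (%w. (norm (F w))^2*W (down j w))"
 shows "AE w in lborel. integrable (count_space UNIV) (%l. F (up j (down j w + vec_of_int l))*cnj (\<theta> (down j w + vec_of_int l)))"
proof -
 have [measurable]: "\<theta>\<in>borel_fun" using A by (simp add: analysis_def)
 let ?f = "%y l. F (up j (y + vec_of_int l))*cnj (\<theta> (y + vec_of_int l))"
 let ?P = "%y. (nsum (%l. ennreal (norm (?f y l)))) < \<infinity>"
 have iff: "integrable (count_space UNIV) (?f y) \<longleftrightarrow> ?P y" for y by (simp add: integrable_iff_bounded)
 have [measurable]: "Measurable.pred borel ?P" by measurable
 have shift: "?P (y + vec_of_int k) = ?P y" for y k
  using nn_integral_bij_count_space[OF bij_int_shift[of k], of "%l. ennreal (norm (?f y l))"] by (simp add: add_ac)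
 have "AE y in lborel. y\<in>unit_cube --> ?P y"
  using AE_integrable_translates[OF level_translates_integrable[OF A F int]] unfolding iff .
 then have "AE y in distr lborel borel ((+) (vec_of_int k)). y\<in>unit_cube --> ?P y" for k :: "int^'n"
  by (subst lborel_distr_plus)
 then have "AE y in lborel. vec_of_int k + y\<in>unit_cube --> ?P (vec_of_int k + y)" for k :: "int^'n"
  by (subst (asm) AE_distr_iff) auto
 then have "AE y in lborel. \<forall>k::int^'n. vec_of_int k + y\<in>unit_cube --> ?P (vec_of_int k + y)"
  unfolding AE_all_countable by blast
 then have "AE y in lborel. ?P y"
 proof eventually_elim
  case (elim y)
  let ?k = "- (\<chi> i. \<lfloor>y $ i\<rfloor>) :: int^'n"
  have "vec_of_int ?k + y\<in>unit_cube" using unit_cube_translate_iff[of y "(\<chi> i. \<lfloor>y $ i\<rfloor>)"] by simp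
  then have "?P (vec_of_int ?k + y)" using elim by blast
  then show ?case using shift[of y ?k] by (simp add: add.commute)
 qed
 from AE_lborel_matrix[OF det_N'_matpow _ this, of j]
 show ?thesis unfolding iff by simp
qed

text \<open>On almost every coset the full series converges absolutely and dominates the truncated
  ones. This is what later removes the truncation.\<close>

lemma level_truncation_limit:
 assumes A: "analysis \<theta>' W B" and F [measurable]: "F\<in>borel_fun"
  and int: "integrable lborel (%w. (norm (F w))^2*W (down j w))"
 shows "AE w in lborel. (%R::nat. level j \<theta> \<theta>' (trunc (real R) F) w) \<longlonglongrightarrow> level j \<theta> \<theta>' F w"
 using AE_down_translates_integrable[OF A F int]
proof eventually_elim
 case (elim w)
 have "(%R::nat. bracket (%x. trunc (real R) F (up j x)) \<theta>' (down j w)) \<longlonglongrightarrow> bracket (%x. F (up j x)) \<theta>' (down j w)"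
  unfolding bracket_def
 proof (rule integral_dominated_convergence)
  show "integrable (count_space UNIV) (%l. norm (F (up j (down j w + vec_of_int l))*cnj (\<theta>' (down j w + vec_of_int l))))"
   using elim by (rule integrable_norm)
  show "AE l in count_space UNIV. (%R::nat. trunc (real R) F (up j (down j w + vec_of_int l))*cnj (\<theta>' (down j w + vec_of_int l)))
    \<longlonglongrightarrow> F (up j (down j w + vec_of_int l))*cnj (\<theta>' (down j w + vec_of_int l))"
   by (intro AE_I2 tendsto_mult trunc_limit tendsto_const)
 qed (auto simp: norm_mult trunc_def)
 then show ?case unfolding level_def by (intro tendsto_mult tendsto_const)
qed

end

lemma wL2_I:
 assumes "h\<in>borel_fun" and g: "integrable lborel g" and "!!x. (norm (h x))^2*weight r x <= g x"
 shows "h\<in>wL2 r"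
proof -
 have "integrable lborel (%x. (norm (h x))^2*weight r x)"
  by (rule integrable_bound_fun[OF g])
   (use assms in \<open>auto simp: abs_mult intro!: AE_I2 order_trans[OF _ abs_ge_self]\<close>)
 then show ?thesis using assms(1) by (simp add: wL2_def)
qed

text \<open>Integrating the lattice sum of V over one cell gives the integral of V over the whole
  space.\<close>

lemma analysis_weighted_L2:
 assumes "analysis \<theta> (weight r) B"
 shows "\<theta>\<in>wL2 (- r)"
proof -
 obtain V where V [measurable]: "V\<in>borel_fun" and V': "!!x. 0 <= V x" "!!x. (norm (\<theta> x))^2 <= V x*weight r x"
  "!!x. (nsum (%l. ennreal (V (x + vec_of_int l)))) <= ennreal B"
  using assms unfolding analysis_def by blast
 have "(\<integral>\<^sup>+x. ennreal (V x) \<partial>lborel) = (\<integral>\<^sup>+x. indicator unit_cube x*(nsum (%l. ennreal (V (x + vec_of_int l)))) \<partial>lborel)"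
  by (rule nn_integral_periodize) measurable
 also have "... <= (\<integral>\<^sup>+x. ennreal B*indicator (unit_cube :: (real^'a) set) x \<partial>lborel)"
  by (rule nn_integral_mono) (use V' in \<open>auto simp: indicator_def\<close>)
 also have "... = ennreal B" by (simp add: nn_integral_cmult_indicator emeasure_unit_cube)
 finally have "(\<integral>\<^sup>+x. ennreal (V x) \<partial>lborel) <= ennreal B" .
 then have "integrable lborel V"
  using V' le_less_trans[OF _ ennreal_less_top] by (intro integrableI_nonneg) auto
 moreover have "(norm (\<theta> x))^2*weight (- r) x <= V x" for x
 proof -
  have "(norm (\<theta> x))^2*weight (- r) x <= V x*weight r x*weight (- r) x"
   by (intro mult_right_mono V') simp
  also have "... = V x" using weight_add[of r "- r" x] by (simp add: mult.assoc)
  finally show ?thesis .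
 qed
 ultimately show ?thesis using assms by (intro wL2_I[of _ V]) (auto simp: analysis_def)
qed

abbreviation dpair :: "(real^'n::finite => complex) => (real^'n => complex) => complex" where
 "dpair F G \<equiv> (LBINT w. F w*cnj (G w))"

lemma wL2_cnj:
 assumes "G\<in>wL2 r"
 shows "(%w. cnj (G w))\<in>wL2 r"
proof -
 have [measurable]: "G\<in>borel_fun" using assms by auto
 show ?thesis using wL2_integrable[OF assms] by (simp add: wL2_def)
qed

lemma integrable_dual_pairing:
 assumes "F\<in>wL2 r" "G\<in>wL2 (- r)"
 shows "integrable lborel (%w. F w*cnj (G w))"
 by (rule integrable_weighted_L2_pair[OF assms(1) wL2_cnj[OF assms(2)]])

lemma dpair_bound:
 assumes F: "F\<in>wL2 r" and G: "G\<in>wL2 (- r)"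
 shows "norm (dpair F G) <= wnorm r F*wnorm (- r) G"
proof -
 have [measurable]: "F\<in>borel_fun" "G\<in>borel_fun" using F G by auto
 have nn: "(\<integral>\<^sup>+w. ennreal ((norm (H w) * sqrt (weight c w))^2) \<partial>lborel) = ennreal ((wnorm c H)^2)"
  if "H\<in>wL2 c" for H :: "real^'a => complex" and c
  unfolding wnorm_square power_mult_distrib
  using nn_integral_eq_integral[OF wL2_integrable[OF that]] by simp
 have "sqrt (weight r w) * sqrt (weight (- r) w) = 1" for w :: "real^'a"
  using weight_add[of r "- r" w] by (simp flip: real_sqrt_mult)
 then have "norm (F w*cnj (G w)) = (norm (F w) * sqrt (weight r w))*(norm (G w) * sqrt (weight (- r) w))" for w
  by (simp add: norm_mult mult_ac)
 then have "ennreal ((norm (dpair F G))^2) <= ennreal ((wnorm r F)^2)*ennreal ((wnorm (- r) G)^2)"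
  unfolding nn[OF F, symmetric] nn[OF G, symmetric] by (intro integral_Cauchy_Schwarz_bound) auto
 then have "(norm (dpair F G))^2 <= (wnorm r F*wnorm (- r) G)^2"
  by (simp add: ennreal_mult[symmetric] ennreal_le_iff power_mult_distrib)
 then show ?thesis by (rule power2_le_imp_le) simp
qed

text \<open>Multiplication by the weight is the Riesz isometry between dual spaces; it turns the
  Sobolev inner product into the unweighted pairing.\<close>

lemma
 assumes F: "F\<in>wL2 r"
 defines "G \<equiv> %w. F w*cplx (weight r w)"
 shows wL2_flip: "G\<in>wL2 (- r)" and wnorm_flip: "wnorm (- r) G = wnorm r F"
  and dpair_flip: "dpair F G = cplx ((wnorm r F)^2)"
   "dpair G F = cplx ((wnorm r F)^2)"
proof -
 have [measurable]: "F\<in>borel_fun" using F by auto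
 have eq: "(norm (G w))^2*weight (- r) w = (norm (F w))^2*weight r w" for w
  by (simp add: G_def norm_mult power_mult_distrib weight_minus power2_eq_square[of "weight r w"] abs_of_pos)
 show "G\<in>wL2 (- r)" using wL2_integrable[OF F] by (simp add: wL2_def eq) (simp add: G_def)
 show "wnorm (- r) G = wnorm r F" by (simp add: wnorm_def eq)
 have "F w*cnj (G w) = cplx ((norm (F w))^2*weight r w)" for w
  by (simp only: G_def complex_cnj_mult complex_cnj_complex_of_real mult.assoc[symmetric] complex_norm_square[symmetric] of_real_mult)
 then show "dpair F G = cplx ((wnorm r F)^2)" by (simp only: wnorm_square integral_complex_of_real)
 have "G w*cnj (F w) = cplx ((norm (F w))^2*weight r w)" for w
  by (simp only: G_def of_real_mult complex_norm_square mult_ac)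
 then show "dpair G F = cplx ((wnorm r F)^2)" by (simp only: wnorm_square integral_complex_of_real)
qed

lemma trunc_weighted_L2:
 assumes F: "F\<in>wL2 r"
 shows "trunc R F\<in>wL2 r'"
proof (rule wL2_I)
 show "trunc R F\<in>borel_fun" using wL2_measurable[OF F] by measurable
 show "integrable lborel (%w. (1 + R^2) powr \<bar>r' - r\<bar>*((norm (F w))^2*weight r w))"
  by (intro integrable_mult_right wL2_integrable[OF F])
 fix w :: "real^'a"
 show "(norm (trunc R F w))^2*weight r' w <= (1 + R^2) powr \<bar>r' - r\<bar>*((norm (F w))^2*weight r w)"
 proof (cases "norm w <= R")
  case True
  have "weight r' w = weight (r' - r) w*weight r w" using weight_add[of "r' - r" r w] by simp
  also have "... <= weight \<bar>r' - r\<bar> w*weight r w" by (intro mult_right_mono weight_mono) auto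
  also have "... <= (1 + R^2) powr \<bar>r' - r\<bar>*weight r w"
   unfolding weight_def[of "\<bar>r' - r\<bar>"] using True by (intro mult_right_mono powr_mono2 add_left_mono power_mono) auto
  finally have "(norm (F w))^2*weight r' w <= (norm (F w))^2*((1 + R^2) powr \<bar>r' - r\<bar>*weight r w)"
   by (rule mult_left_mono) simp
  then show ?thesis using True by (simp add: trunc_def mult_ac)
 qed (simp add: trunc_def)
qed

lemma trunc_converges:
 assumes F: "F\<in>wL2 r"
 shows "(%R::nat. wnorm r (%w. F w - trunc (real R) F w)) \<longlonglongrightarrow> 0"
proof -
 have [measurable]: "F\<in>borel_fun" using F by auto
 have "(%R::nat. LBINT w. (norm (F w - trunc (real R) F w))^2*weight r w) \<longlonglongrightarrow> (LBINT w::real^'a. (0::real))"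
 proof (rule integral_dominated_convergence)
  show "integrable lborel (%w. (norm (F w))^2*weight r w)" by (rule wL2_integrable[OF F])
  have "(%R::nat. (norm (F w - trunc (real R) F w))^2*weight r w) \<longlonglongrightarrow> (norm (F w - F w))^2*weight r w" for w
   by (intro tendsto_intros trunc_limit)
  then show "AE w in lborel. (%R::nat. (norm (F w - trunc (real R) F w))^2*weight r w) \<longlonglongrightarrow> 0" by simp
 qed (auto simp: trunc_def abs_mult)
 then have "(%R::nat. sqrt (LBINT w. (norm (F w - trunc (real R) F w))^2*weight r w)) \<longlonglongrightarrow> sqrt 0"
  by (intro tendsto_real_sqrt) simp
 then show ?thesis unfolding wnorm_def by simp
qed

definition weighted_seminorm :: "real => (real^'n::finite => complex) => real" where
 "weighted_seminorm n F = sqrt (LBINT w. norm w powr (2*n)*(norm (F w))^2)"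

lemma weighted_seminorm_nonneg [simp]: "0 <= weighted_seminorm n F"
 by (simp add: weighted_seminorm_def)

lemma norm_powr_double: "norm x powr (2*n) = ((norm x)^2) powr n"
proof -
 have "(norm x)^2 = norm x powr 2" by simp
 then show ?thesis by (simp only: powr_powr)
qed

lemma norm_powr_le_bessel_weight: "0 <= n ==> norm x powr (2*n) <= weight n x"
 unfolding norm_powr_double weight_def by (intro powr_mono2) auto

lemma norm_powr_mult_le: "0 <= n ==> norm x powr (2*n)*c^2 <= c^2*weight n x" for c :: real
 using mult_right_mono[OF norm_powr_le_bessel_weight[of n x], of "c^2"] by (simp only: mult.commute[of "c^2"] zero_le_power2)

lemma integrable_weighted_seminorm:
 assumes "0 <= n" and F: "F\<in>wL2 n"
 shows "integrable lborel (%w. norm w powr (2*n)*(norm (F w))^2)"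
proof (rule integrable_bound_fun[OF wL2_integrable[OF F]])
 show "(%w. norm w powr (2*n)*(norm (F w))^2)\<in>borel_measurable lborel" using wL2_measurable[OF F] by measurable
 show "AE w in lborel. norm (norm w powr (2*n)*(norm (F w))^2) <= norm ((norm (F w))^2*weight n w)"
  using norm_powr_mult_le[OF assms(1)] by (intro AE_I2) (simp add: abs_mult)
qed

lemma
 assumes "0 <= n" and F: "F\<in>wL2 n"
 shows weighted_seminorm_trunc: "weighted_seminorm n (trunc R F) <= weighted_seminorm n F"
  and weighted_seminorm_le: "weighted_seminorm n F <= wnorm n F"
 unfolding weighted_seminorm_def wnorm_def
proof -
 show "sqrt (LBINT w. norm w powr (2*n)*(norm (trunc R F w))^2) <= sqrt (LBINT w. norm w powr (2*n)*(norm (F w))^2)"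
  by (intro real_sqrt_le_mono integral_mono integrable_weighted_seminorm assms trunc_weighted_L2[OF F]) (simp add: trunc_def)
 show "sqrt (LBINT w. norm w powr (2*n)*(norm (F w))^2) <= sqrt (LBINT w. (norm (F w))^2*weight n w)"
  by (intro real_sqrt_le_mono integral_mono integrable_weighted_seminorm wL2_integrable norm_powr_mult_le assms)
qed

context isotropic_dilation
begin

lemma norm_down_le: "norm (down j w) <= c_1*norm w"
proof -
 have "c_1/\<rho> ^ j <= c_1" using \<rho> c_1 one_le_power[of \<rho> j] by (simp add: divide_le_eq)
 then show ?thesis using order_trans[OF norm_down mult_right_mono] by (metis norm_ge_zero)
qed

text \<open>The constant may depend on j: it serves only to show that atoms lie in the right
  space.\<close>

lemma weight_comparable: obtains C where "!!w. weight r w <= C*weight r (down j w)"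
proof (cases "0 <= r")
 case True
 show ?thesis by (rule that[OF weight_down[OF True order_refl]])
next
 case False
 then have "weight (- r) (down j w) <= c_1 powr (2*(- r))*weight (- r) w" for w
  using c_1 by (intro weight_dilate norm_down_le) auto
 then show ?thesis by (intro that[of "c_1 powr (2*(- r))"]) (simp add: weight_minus field_simps)
qed

lemma norm_atom: "norm (atom j k \<theta> w) = m powr (- real j/2)*norm (\<theta> (down j w))"
 by (simp add: atom_def norm_mult)

lemma atom_weighted_L2:
 assumes \<theta>: "\<theta>\<in>wL2 r"
 shows "atom j k \<theta>\<in>wL2 r"
proof -
 have [measurable]: "\<theta>\<in>borel_fun" using \<theta> by auto
 obtain C where C: "!!w. weight r w <= C*weight r (down j w)" by (rule weight_comparable[of r j]) blast
 have i: "integrable lborel (%w. (norm (\<theta> (down j w)))^2*weight r (down j w))"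
  using wL2_integrable[OF \<theta>] integrable_up[of "%w. (norm (\<theta> (down j w)))^2*weight r (down j w)" j] by simp
 show ?thesis
 proof (rule wL2_I[OF _ integrable_mult_right[OF i, of "(m powr (- real j/2))^2*C"]])
  fix w
  have "(norm (atom j k \<theta> w))^2*weight r w <= (norm (atom j k \<theta> w))^2*(C*weight r (down j w))"
   by (intro mult_left_mono C) simp
  then show "(norm (atom j k \<theta> w))^2*weight r w <= (m powr (- real j/2))^2*C*((norm (\<theta> (down j w)))^2*weight r (down j w))"
   by (simp add: norm_atom power_mult_distrib mult_ac)
 qed measurable
qed

text \<open>Enclosing K in a product of generators, levels and translates lets
  \<open>level_bessel\<close> be summed. The bound then reduces to a pointwise estimate of the
  weights accumulated over the levels.\<close>

lemma family_bessel:
 assumes U: "finite U" and A: "!!\<mu>. \<mu>\<in>U ==> analysis (\<theta> \<mu>) W B"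
  and \<gamma>: "!!j. 0 < \<gamma> j" and C: "!!w J. (\<Sum>j<J. \<gamma> j*W (down j w)) <= C*weight r w"
  and F: "F\<in>wL2 r" and K: "finite K" "K \<subseteq> U \<times> UNIV"
 shows "(\<Sum>(\<mu>, j, k)\<in>K. \<gamma> j*(norm (dpair F (atom j k (\<theta> \<mu>))))^2) <= real (card U)*(B*(C*(wnorm r F)^2))"
proof (cases "U = {}")
 case True
 then have "K = {}" using K(2) by auto
 then show ?thesis using True by simp
next
 case False
 then have W [measurable]: "W\<in>borel_fun" and W': "!!x. 0 <= W x" "0 <= B"
  using A unfolding analysis_def by blast+
 have [measurable]: "F\<in>borel_fun" using F by auto
 note Fi = wL2_integrable[OF F]
 have le: "W (down j w) <= C/\<gamma> j*weight r w" for j w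
 proof -
  have "\<gamma> j*W (down j w) <= (\<Sum>j<Suc j. \<gamma> j*W (down j w))"
   using \<gamma> W' by (intro member_le_sum) (auto intro!: mult_nonneg_nonneg simp: less_imp_le)
  then have "\<gamma> j*W (down j w) <= C*weight r w" using C[of w "Suc j"] by (rule order_trans)
  then show ?thesis using \<gamma>[of j] by (simp add: field_simps)
 qed
 have int: "integrable lborel (%w. (norm (F w))^2*W (down j w))" for j
 proof (rule integrable_bound_fun[OF integrable_mult_right[OF Fi, of "C/\<gamma> j"]])
  have "(norm (F w))^2*W (down j w) <= C/\<gamma> j*((norm (F w))^2*weight r w)" for w
   using mult_left_mono[OF le, of "(norm (F w))^2" j w] by (simp add: mult_ac)
  moreover have "0 <= (norm (F w))^2*W (down j w)" for w using W' by simp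
  ultimately show "AE w in lborel. norm ((norm (F w))^2*W (down j w)) <= norm (C/\<gamma> j*((norm (F w))^2*weight r w))"
   unfolding real_norm_def by (intro AE_I2) (metis abs_of_nonneg abs_ge_self order_trans)
 qed measurable
 define L where "L = (%(\<mu>, j, k). k) ` K"
 obtain J where J: "(%(\<mu>, j, k). j) ` K \<subseteq> {..<J}" using finite_nat_bounded[OF finite_imageI[OF K(1)]] by blast
 have L: "finite L" using K by (simp add: L_def)
 have KJ: "K \<subseteq> U \<times> {..<J} \<times> L" using K(2) J by (force simp: L_def)
 have "(\<Sum>(\<mu>, j, k)\<in>K. \<gamma> j*(norm (dpair F (atom j k (\<theta> \<mu>))))^2) <= (\<Sum>(\<mu>, j, k)\<in>U \<times> {..<J} \<times> L. \<gamma> j*(norm (dpair F (atom j k (\<theta> \<mu>))))^2)"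
  using \<gamma> by (intro sum_mono2[OF _ KJ]) (auto simp: U L less_imp_le)
 also have "... = (\<Sum>\<mu>\<in>U. \<Sum>j<J. \<gamma> j*(\<Sum>k\<in>L. (norm (dpair F (atom j k (\<theta> \<mu>))))^2))"
  by (simp add: sum.cartesian_product' sum_distrib_left)
 also have "... <= (\<Sum>\<mu>\<in>U. \<Sum>j<J. \<gamma> j*(B*(LBINT w. (norm (F w))^2*W (down j w))))"
  using \<gamma> by (intro sum_mono mult_left_mono level_bessel A int L) (auto simp: less_imp_le)
 also have "... = real (card U)*(B*(\<Sum>j<J. LBINT w. \<gamma> j*((norm (F w))^2*W (down j w))))"
  by (simp add: sum_distrib_left mult_ac)
 also have "(\<Sum>j<J. LBINT w. \<gamma> j*((norm (F w))^2*W (down j w))) = (LBINT w. (norm (F w))^2*(\<Sum>j<J. \<gamma> j*W (down j w)))"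
  unfolding sum_distrib_left using int by (subst Bochner_Integration.integral_sum[symmetric]) (auto simp: mult_ac)
 also have "real (card U)*(B*...) <= real (card U)*(B*(LBINT w. C*((norm (F w))^2*weight r w)))"
 proof (intro mult_left_mono integral_mono)
  have "integrable lborel (%w. \<Sum>j<J. \<gamma> j*((norm (F w))^2*W (down j w)))"
   by (intro Bochner_Integration.integrable_sum integrable_mult_right int)
  then show "integrable lborel (%w. (norm (F w))^2*(\<Sum>j<J. \<gamma> j*W (down j w)))"
   by (simp add: sum_distrib_left mult_ac)
  show "(norm (F w))^2*(\<Sum>j<J. \<gamma> j*W (down j w)) <= C*((norm (F w))^2*weight r w)" for w
   using mult_left_mono[OF C[of w J], of "(norm (F w))^2"] by (simp add: mult_ac)
 qed (use Fi W' in auto)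
 finally show ?thesis by (simp add: wnorm_square)
qed

text \<open>With z = (1 + |w|^2) / \<rho>^(2j) each summand is at most a constant times the target
  weight times the minimum of z^s and z^(-(t - s)). Low levels are tamed by the smoothness surplus t
  - s, high levels by the factor \<rho>^(-2js).\<close>

lemma geometric_weight_negative:
 assumes "0 < s" "s < t"
 obtains C where "0 < C" "!!w J. (\<Sum>j<J. (\<rho> ^ j) powr (- 2 * s)*weight (- t) (down j w)) <= C*weight (- s) w"
proof -
 define q where "q = 1/\<rho>^2"
 have q: "0 < q" "q < 1" using \<rho> by (auto simp: q_def one_less_power)
 obtain C where C: "0 < C" "!!Y J. 0 < Y ==> (\<Sum>j<J. min ((Y*q ^ j) powr s) ((Y*q ^ j) powr (- (t - s)))) <= C"
  using geometric_sum_bound[OF q, of s "t - s"] assms by auto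
 have c1: "0 < c_1" using c_1 by simp
 have trm: "(\<rho> ^ j) powr (- 2 * s)*weight (- t) (down j w) \<le>
   c_1 powr (2*t)*weight (- s) w*min (((1 + (norm w)^2)*q ^ j) powr s) (((1 + (norm w)^2)*q ^ j) powr (- (t - s)))" for j w
 proof -
  define y where "y = 1 + (norm w)^2"
  define z where "z = y*q ^ j"
  define d where "d = 1 + (norm (down j w))^2"
  have y: "0 < y" by (simp add: y_def add_pos_nonneg)
  have z: "0 < z" using y q by (simp add: z_def)
  have d: "1 <= d" by (simp add: d_def)
  have qj: "q ^ j = 1/(\<rho> ^ j)^2" by (simp add: q_def power_one_over power2_eq_square power_mult_distrib)
  have "(norm w)^2 <= (c_1*\<rho> ^ j*norm (down j w))^2" using norm_up[of j "down j w"] by (intro power_mono) auto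
  then have "(norm w)^2*q ^ j <= c_1^2*(norm (down j w))^2"
   using \<rho> by (simp add: qj divide_le_eq power_mult_distrib mult_ac)
  moreover have "q ^ j <= 1" "1 <= c_1^2" using q c_1 by (auto intro: power_le_one one_le_power)
  ultimately have zd: "z <= c_1^2*d" by (simp add: z_def y_def d_def distrib_right distrib_left)
  have "1 <= c_1^2*d" using mult_mono[OF \<open>1 <= c_1^2\<close> d] by simp
  then have "(c_1^2*d) powr (- t) <= min 1 (z powr (- t))"
  proof -
   have "(c_1^2*d) powr (- t) <= z powr (- t)" using zd z assms by (intro powr_mono2') auto
   moreover have "(c_1^2*d) powr (- t) <= 1 powr (- t)"
    using \<open>1 <= c_1^2*d\<close> assms by (intro powr_mono2') auto
   ultimately show ?thesis by simp
  qed
  moreover have "d powr (- t) = c_1 powr (2*t)*(c_1^2*d) powr (- t)"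
  proof -
   have "c_1^2 = c_1 powr 2" using c1 by simp
   then have "(c_1^2*d) powr (- t) = c_1 powr (- (2*t))*d powr (- t)" by (simp only: powr_mult powr_powr) simp
   then show ?thesis using c1 by (simp add: powr_minus field_simps)
  qed
  ultimately have dt: "d powr (- t) <= c_1 powr (2*t)*min 1 (z powr (- t))" by (simp add: mult_left_mono)
  have "(\<rho> ^ j) powr (- 2 * s) = (z/y) powr s"
  proof -
   have "z/y = (\<rho> ^ j) powr (- 2)" using y \<rho> by (simp add: z_def qj powr_minus_divide)
   then show ?thesis by (simp add: powr_powr)
  qed
  also have "... = z powr s*y powr (- s)" by (simp add: powr_divide powr_minus_divide)
  finally have "(\<rho> ^ j) powr (- 2 * s)*d powr (- t) <= z powr s*y powr (- s)*(c_1 powr (2*t)*min 1 (z powr (- t)))"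
   using dt by (simp add: mult_left_mono)
  also have "... = c_1 powr (2*t)*y powr (- s)*(z powr s*min 1 (z powr (- t)))" by (simp add: mult_ac)
  also have "z powr s*min 1 (z powr (- t)) = min (z powr s) (z powr (- (t - s)))"
   by (subst min_mult_distrib_left) (simp add: powr_add[symmetric])
  finally show ?thesis by (simp add: weight_def d_def z_def y_def)
 qed
 have "(\<Sum>j<J. (\<rho> ^ j) powr (- 2 * s)*weight (- t) (down j w)) <= c_1 powr (2*t)*C*weight (- s) w" for J w
 proof -
  have "0 < 1 + (norm w)^2" by (simp add: add_pos_nonneg)
  have "(\<Sum>j<J. (\<rho> ^ j) powr (- 2 * s)*weight (- t) (down j w)) <= c_1 powr (2*t)*weight (- s) w *
   (\<Sum>j<J. min (((1 + (norm w)^2)*q ^ j) powr s) (((1 + (norm w)^2)*q ^ j) powr (- (t - s))))"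
   unfolding sum_distrib_left by (intro sum_mono trm)
  also have "... <= c_1 powr (2*t)*weight (- s) w*C"
   by (intro mult_left_mono C) (auto simp: add_pos_nonneg)
  finally show ?thesis by (simp add: mult_ac)
 qed
 then show ?thesis using C(1) c1 by (intro that[of "c_1 powr (2*t)*C"]) auto
qed

text \<open>The envelope of a dual wavelet: order n at the origin, from its mask, and growth of
  order t' at infinity, from the regularity of the dual scaling function.\<close>

definition vanishing_weight :: "real => real => real^'n => real" where
 "vanishing_weight n t' x = min 1 (norm x powr (2*n))*weight t' x"

lemma vanishing_weight_measurable [measurable]: "vanishing_weight n t'\<in>borel_fun"
 unfolding vanishing_weight_def[abs_def] by measurable

lemma vanishing_weight_le:
 assumes "0 <= t'" "t' <= n" and Y: "(norm x)^2 <= Y" "0 < Y"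
 shows "vanishing_weight n t' x <= 2 powr t'*min (Y powr n) (Y powr t')"
proof (cases "Y <= 1")
 case True
 have "min 1 (norm x powr (2*n)) <= Y powr n"
  using powr_mono2[of n "(norm x)^2" Y] assms by (simp add: norm_powr_double min.coboundedI2)
 moreover have "weight t' x <= 2 powr t'"
  unfolding weight_def using assms True by (intro powr_mono2) auto
 ultimately have "vanishing_weight n t' x <= Y powr n*2 powr t'"
  unfolding vanishing_weight_def by (intro mult_mono) auto
 moreover have "Y powr n <= Y powr t'" using assms True by (intro powr_mono') auto
 ultimately show ?thesis by (simp add: mult.commute min_absorb1)
next
 case False
 have "weight t' x <= (2*Y) powr t'"
  unfolding weight_def using assms False by (intro powr_mono2) auto
 then have "vanishing_weight n t' x <= 1*(2*Y) powr t'"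
  unfolding vanishing_weight_def by (intro mult_mono) auto
 moreover have "Y powr t' <= Y powr n" using assms False by (intro powr_mono) auto
 ultimately show ?thesis by (simp add: powr_mult min_absorb2)
qed

lemma vanishing_weight_down:
 assumes "0 <= t'" "t' <= n"
 shows "vanishing_weight n t' (down j w) <= 2 powr t'*((c_1/\<rho> ^ j) powr (2*n)*norm w powr (2*n))"
proof (cases "w = 0")
 case False
 have c: "0 < c_1/\<rho> ^ j" using c_1 \<rho> by simp
 have "vanishing_weight n t' (down j w) <= 2 powr t'*min ((norm (c_1/\<rho> ^ j*norm w))\<^sup>2 powr n) ((norm (c_1/\<rho> ^ j*norm w))\<^sup>2 powr t')"
 proof (intro vanishing_weight_le assms power_mono)
  show "norm (down j w) <= norm (c_1/\<rho> ^ j*norm w)" using norm_down[of j w] unfolding real_norm_def by linarith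
  show "0 < (norm (c_1/\<rho> ^ j*norm w))^2" using mult_pos_pos[OF c, of "norm w"] False by (metis less_irrefl norm_eq_zero zero_less_norm_iff zero_less_power2)
 qed simp
 also have "... <= 2 powr t'*norm (c_1/\<rho> ^ j*norm w) powr (2*n)"
  unfolding norm_powr_double by (intro mult_left_mono) auto
 also have "norm (c_1/\<rho> ^ j*norm w) powr (2*n) = (c_1/\<rho> ^ j) powr (2*n)*norm w powr (2*n)"
  using c by (simp only: real_norm_def abs_mult abs_of_pos abs_norm_cancel powr_mult)
 finally show ?thesis .
qed (simp add: vanishing_weight_def)

text \<open>Here the two exponents are n - s and s - t'. Vanishing of order n beats the factor
  \<rho>^(2js) at high levels, and regularity better than -s handles the low ones.\<close>

lemma geometric_weight_positive:
 assumes "0 <= t'" "t' < s" "s < n"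
 obtains C where "0 < C" "!!w J. (\<Sum>j<J. (\<rho> ^ j) powr (2 * s) * vanishing_weight n t' (down j w)) <= C*weight s w"
proof -
 define q where "q = 1/\<rho>^2"
 have q: "0 < q" "q < 1" using \<rho> by (auto simp: q_def one_less_power)
 obtain C where C: "0 < C" "!!Y J. 0 < Y ==> (\<Sum>j<J. min ((Y*q ^ j) powr (n - s)) ((Y*q ^ j) powr (- (s - t')))) <= C"
  using geometric_sum_bound[OF q, of "n - s" "s - t'"] assms by auto
 have c1: "0 < c_1" using c_1 by simp
 have "(\<Sum>j<J. (\<rho> ^ j) powr (2 * s) * vanishing_weight n t' (down j w)) <= 2 powr t'*c_1 powr (2 * s)*C*weight s w" for J w
 proof -
  define Y where "Y = c_1^2*(1 + (norm w)^2)"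
  have Y: "0 < Y" using c1 by (simp add: Y_def add_pos_nonneg)
  have trm: "(\<rho> ^ j) powr (2 * s) * vanishing_weight n t' (down j w) \<le>
   2 powr t'*Y powr s*min ((Y*q ^ j) powr (n - s)) ((Y*q ^ j) powr (- (s - t')))" for j
  proof -
   define y where "y = Y*q ^ j"
   have y: "0 < y" using Y q by (simp add: y_def)
   have qj: "q ^ j = 1/(\<rho> ^ j)^2" by (simp add: q_def power_one_over power2_eq_square power_mult_distrib)
   have "(norm (down j w))^2 <= (c_1/\<rho> ^ j*norm w)^2" by (intro power_mono norm_down) simp
   also have "... <= y" using q
    by (simp add: y_def Y_def qj power_mult_distrib power_divide divide_right_mono mult_left_mono)
   finally have "vanishing_weight n t' (down j w) <= 2 powr t'*min (y powr n) (y powr t')"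
    using assms y by (intro vanishing_weight_le) auto
   moreover have "(\<rho> ^ j) powr (2 * s) = Y powr s*y powr (- s)"
   proof -
    have "Y/y = (\<rho> ^ j) powr 2" using Y \<rho> by (simp add: y_def qj)
    then have "(\<rho> ^ j) powr (2 * s) = (Y/y) powr s" by (simp add: powr_powr)
    then show ?thesis by (simp add: powr_divide powr_minus_divide)
   qed
   ultimately have "(\<rho> ^ j) powr (2 * s) * vanishing_weight n t' (down j w) <= Y powr s*y powr (- s)*(2 powr t'*min (y powr n) (y powr t'))"
    by (simp add: mult_left_mono)
   also have "... = 2 powr t'*Y powr s*(y powr (- s)*min (y powr n) (y powr t'))" by (simp add: mult_ac)
   also have "y powr (- s)*min (y powr n) (y powr t') = min (y powr (n - s)) (y powr (- (s - t')))"
    by (subst min_mult_distrib_left) (simp add: powr_add[symmetric])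
   finally show ?thesis by (simp add: y_def)
  qed
  have "(\<Sum>j<J. (\<rho> ^ j) powr (2 * s) * vanishing_weight n t' (down j w)) <= 2 powr t'*Y powr s *
   (\<Sum>j<J. min ((Y*q ^ j) powr (n - s)) ((Y*q ^ j) powr (- (s - t'))))"
   unfolding sum_distrib_left by (intro sum_mono trm)
  also have "... <= 2 powr t'*Y powr s*C" by (intro mult_left_mono C Y) auto
  also have "Y powr s = c_1 powr (2 * s)*weight s w"
  proof -
   have "c_1^2 = c_1 powr 2" using c1 by simp
   then show ?thesis by (simp only: Y_def weight_def powr_mult powr_powr)
  qed
  finally show ?thesis by (simp add: mult_ac)
 qed
 then show ?thesis using C(1) c1 by (intro that[of "2 powr t'*c_1 powr (2 * s)*C"]) auto
qed

end

text \<open>K almost attains the supremum of the finite sums, so a disjoint set cannot add more than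
  eps.\<close>

lemma small_tail:
 fixes f :: "'i => real"
 assumes f: "!!i. 0 <= f i" and bound: "!!K. finite K ==> K \<subseteq> I ==> sum f K <= X" and eps: "0 < eps"
 obtains K where "finite K" "K \<subseteq> I" "!!L. finite L ==> L \<subseteq> I ==> L \<inter> K = {} ==> sum f L < eps"
proof -
 let ?A = "{K. finite K \<and> K \<subseteq> I}"
 have bdd: "bdd_above (sum f ` ?A)" using bound by (intro bdd_aboveI2[of _ _ X]) auto
 have "(SUP K\<in>?A. sum f K) - eps < (SUP K\<in>?A. sum f K)" using eps by simp
 then obtain K where K: "K\<in>?A" "(SUP K\<in>?A. sum f K) - eps < sum f K"
  by (subst (asm) less_cSUP_iff) (use bdd in auto)
 have "sum f L < eps" if L: "finite L" "L \<subseteq> I" "L \<inter> K = {}" for L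
 proof -
  have "sum f L + sum f K = sum f (L \<union> K)" using L K by (subst sum.union_disjoint) auto
  also have "... <= (SUP K\<in>?A. sum f K)" using L K by (intro cSUP_upper bdd) auto
  finally show ?thesis using K by linarith
 qed
 then show ?thesis using K that by blast
qed

lemma integrable_dominated:
 fixes f g :: "'a => real"
 assumes "f\<in>borel_measurable M" "integrable M g" "!!x. 0 <= f x" "!!x. f x <= g x"
 shows "integrable M f"
 using assms by (intro integrable_bound_fun[OF assms(2,1)] AE_I2) (simp add: order_trans[OF _ abs_ge_self])

section \<open>Wavelet systems on the Fourier side\<close>

text \<open>The analytic properties extracted from the masks. Generator 1 is the scaling function;
  the vanishing envelope is available only for generators from 2 on. Telescoping is asked almost
  everywhere, the limit everywhere but for bounded support.\<close>

locale wavelet_levels = isotropic_dilation N N' \<rho> c_0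
 for N N' :: "real^'n^'n::finite" and \<rho> c_0 :: real +
 fixes \<Psi> \<Psi>' :: "nat => real^'n => complex" and u :: nat and s t t' n B :: real
 assumes u: "1 <= u" and exponents: "0 < s" "s < t" "0 <= t'" "t' < s" "s < n"
  and synthesis: "!!\<mu>. \<mu>\<in>{1..u} ==> synthesis (\<Psi> \<mu>) (weight t) B"
  and analysis: "!!\<mu>. \<mu>\<in>{1..u} ==> analysis (\<Psi>' \<mu>) (weight t') B"
  and analysis_vanishing: "!!\<mu>. \<mu>\<in>{2..u} ==> analysis (\<Psi>' \<mu>) (vanishing_weight n t') B"
  and telescope: "!!j F. F\<in>wL2 t' ==>
   AE w in lborel. (\<Sum>\<mu>\<in>{1..u}. level j (\<Psi> \<mu>) (\<Psi>' \<mu>) F w) = level (Suc j) (\<Psi> 1) (\<Psi>' 1) F w"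
  and limit: "!!R F w. (!!w. R < norm w ==> F w = 0) ==> (%j. level j (\<Psi> 1) (\<Psi>' 1) F w) \<longlonglongrightarrow> F w"
begin

lemma sum_split: "(\<Sum>\<mu>\<in>{1..u}. f \<mu>) = f 1 + (\<Sum>\<mu>\<in>{2..u}. f \<mu>)" for f :: "nat => complex"
 using u by (subst sum.atLeast_Suc_atMost) (auto simp: numeral_2_eq_2)

lemma measurable_wavelets [measurable]:
 "\<mu>\<in>{1..u} ==> \<Psi> \<mu>\<in>borel_fun" "\<mu>\<in>{1..u} ==> \<Psi>' \<mu>\<in>borel_fun"
 using synthesis[of \<mu>] analysis[of \<mu>] by (auto simp: synthesis_def analysis_def)

lemma B_nonneg: "0 <= B"
 using synthesis[of 1] u by (simp add: synthesis_def)

lemma wavelet_weighted_L2: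
 assumes "\<mu>\<in>{1..u}"
 shows "\<Psi> \<mu>\<in>wL2 t" "\<Psi>' \<mu>\<in>wL2 (- t')"
 using analysis_weighted_L2[OF synthesis_imp_analysis[OF synthesis[OF assms]]] analysis_weighted_L2[OF analysis[OF assms]] by auto

lemma integrable_down:
 assumes F: "F\<in>wL2 t'"
 shows "integrable lborel (%w. (norm (F w))^2*weight t' (down j w))"
proof (rule integrable_bound_fun[OF integrable_mult_right[OF wL2_integrable[OF F], of "c_1 powr (2*t')"]])
 have [measurable]: "F\<in>borel_fun" using F by auto
 show "(%w. (norm (F w))^2*weight t' (down j w))\<in>borel_measurable lborel" by measurable
 have "(norm (F w))^2*weight t' (down j w) <= (norm (F w))^2*(c_1 powr (2*t')*weight t' w)" for w
  using exponents c_1 by (intro mult_left_mono weight_dilate norm_down_le) auto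
 then show "AE w in lborel. norm ((norm (F w))^2*weight t' (down j w)) <= norm (c_1 powr (2*t')*((norm (F w))^2*weight t' w))"
  by (intro AE_I2) (simp add: abs_mult abs_of_pos mult_ac)
qed

text \<open>Returning from the weight at the dilated point to the weight at w costs (c_1
  \<rho>^j)^(2r). For the wavelets this loss is compensated by vanishing in
  \<open>level_decay\<close>.\<close>

lemma
 assumes G: "integrable lborel (%w. (norm (G w))^2*weight t (down j w))" and [measurable]: "G\<in>borel_fun"
  and r: "0 <= r" "r <= s"
 shows undilate_weighted_L2: "G\<in>wL2 r"
  and undilate_weighted_norm: "(wnorm r G)^2 <= (c_1*\<rho> ^ j) powr (2*r)*(LBINT w. (norm (G w))^2*weight t (down j w))"
proof -
 note i = integrable_mult_right[OF G, of "(c_1*\<rho> ^ j) powr (2*r)"]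
 have le: "(norm (G w))^2*weight r w <= (c_1*\<rho> ^ j) powr (2*r)*((norm (G w))^2*weight t (down j w))" for w
  using mult_left_mono[OF weight_down[of r t w j], of "(norm (G w))^2"] r exponents by (simp add: mult_ac)
 show L2: "G\<in>wL2 r" by (rule wL2_I[OF _ i le]) simp
 show "(wnorm r G)^2 <= (c_1*\<rho> ^ j) powr (2*r)*(LBINT w. (norm (G w))^2*weight t (down j w))"
  unfolding wnorm_square using integral_mono[OF wL2_integrable[OF L2] i le] by simp
qed

lemma level_weighted_L2:
 assumes \<mu>: "\<mu>\<in>{1..u}" and F: "F\<in>wL2 s" and r: "0 <= r" "r <= s"
 shows "level j (\<Psi> \<mu>) (\<Psi>' \<mu>) F\<in>wL2 r"
proof -
 have [measurable]: "F\<in>borel_fun" using F by auto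
 have F': "F\<in>wL2 t'" using exponents by (intro wL2_mono[OF F]) simp
 show ?thesis
  by (rule undilate_weighted_L2[OF level_L2[OF analysis[OF \<mu>] synthesis[OF \<mu>] _ integrable_down[OF F']] _ r])
   (use \<mu> in measurable)
qed

text \<open>The triple \<open>(1, 0, k)\<close> stands for \<open>\<phi>\<^sub>0\<^sub>k\<close>; generator \<open>1\<close> occurs at level \<open>0\<close> only.\<close>

definition indices :: "(nat \<times> nat \<times> (int^'n)) set" where
 "indices = {(\<mu>, j, k). \<mu>\<in>{1..u} \<and> (\<mu> = 1 --> j = 0)}"

text \<open>As \<rho> is m^(1/d), the factor is the m^(-js/d) of the weighted family.
  \<open>dual_elem\<close> has the inverse factor, so expansion terms are independent of it.\<close>

definition elem :: "nat \<times> nat \<times> (int^'n) => real^'n => complex" where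
 "elem i w = (case i of (\<mu>, j, k) => cplx ((\<rho> ^ j) powr (- s))*atom j k (\<Psi> \<mu>) w)"

definition dual_elem :: "nat \<times> nat \<times> (int^'n) => real^'n => complex" where
 "dual_elem i w = (case i of (\<mu>, j, k) => cplx ((\<rho> ^ j) powr s)*atom j k (\<Psi>' \<mu>) w)"

lemma elem_weighted_L2:
 assumes "i\<in>indices"
 shows "elem i\<in>wL2 s" "dual_elem i\<in>wL2 (- s)"
proof -
 obtain \<mu> j k where i: "i = (\<mu>, j, k)" and \<mu>: "\<mu>\<in>{1..u}" using assms by (auto simp: indices_def)
 have "\<Psi> \<mu>\<in>wL2 s" "\<Psi>' \<mu>\<in>wL2 (- s)"
  using wL2_mono wavelet_weighted_L2[OF \<mu>] exponents by fastforce+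
 then show "elem i\<in>wL2 s" "dual_elem i\<in>wL2 (- s)"
  unfolding elem_def[abs_def] dual_elem_def[abs_def] i by (auto intro: wL2_cmult atom_weighted_L2)
qed

lemma norm_dual_pairing_elem:
 "(norm (dpair G (elem (\<mu>, j, k))))^2 = (\<rho> ^ j) powr (- 2 * s)*(norm (dpair G (atom j k (\<Psi> \<mu>))))^2"
 "(norm (dpair F (dual_elem (\<mu>, j, k))))^2 = (\<rho> ^ j) powr (2 * s)*(norm (dpair F (atom j k (\<Psi>' \<mu>))))^2"
proof -
 have scale: "norm (dpair F (%w. cplx c*E w)) = \<bar>c\<bar>*norm (dpair F E)" for F E c
  by (simp add: mult.left_commute[of _ "cplx c"] norm_mult)
 have sq: "((\<rho> ^ j) powr a)^2 = (\<rho> ^ j) powr (2*a)" for a by (simp add: power2_eq_square flip: powr_add)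
 show "(norm (dpair G (elem (\<mu>, j, k))))^2 = (\<rho> ^ j) powr (- 2 * s)*(norm (dpair G (atom j k (\<Psi> \<mu>))))^2"
  using sq[of "- s"] by (simp only: elem_def prod.case scale power_mult_distrib power2_abs) simp
 show "(norm (dpair F (dual_elem (\<mu>, j, k))))^2 = (\<rho> ^ j) powr (2 * s)*(norm (dpair F (atom j k (\<Psi>' \<mu>))))^2"
  using sq[of s] by (simp only: dual_elem_def prod.case scale power_mult_distrib power2_abs)
qed

lemma \<rho>_powr_pos: "0 < (\<rho> ^ j) powr a"
 using \<rho> by simp

text \<open>A synthesis bound of order t is an analysis bound for the weight of order -t, so
  \<open>family_bessel\<close> applies to all generators at once.\<close>

lemma bessel_elem:
 obtains C where "0 < C" "!!G K. G\<in>wL2 (- s) ==> finite K ==> K \<subseteq> indices ==>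
  (\<Sum>i\<in>K. (norm (dpair G (elem i)))^2) <= C*(wnorm (- s) G)^2"
proof -
 obtain C where C: "0 < C" "!!w J. (\<Sum>j<J. (\<rho> ^ j) powr (- 2 * s)*weight (- t) (down j w)) <= C*weight (- s) w"
  using geometric_weight_negative[of s t] exponents by blast
 have "(\<Sum>i\<in>K. (norm (dpair G (elem i)))^2) <= (real u*(B*C) + 1)*(wnorm (- s) G)^2"
  if G: "G\<in>wL2 (- s)" and K: "finite K" "K \<subseteq> indices" for G K
 proof -
  have "(\<Sum>i\<in>K. (norm (dpair G (elem i)))^2) = (\<Sum>(\<mu>, j, k)\<in>K. (\<rho> ^ j) powr (- 2 * s)*(norm (dpair G (atom j k (\<Psi> \<mu>))))^2)"
   by (intro sum.cong refl) (auto simp only: norm_dual_pairing_elem split: prod.split)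
  also have "... <= real (card {1..u})*(B*(C*(wnorm (- s) G)^2))"
   using K(2) by (intro family_bessel[OF _ synthesis_imp_analysis[OF synthesis] \<rho>_powr_pos C(2) G K(1)]) (auto simp: indices_def)
  also have "... <= (real u*(B*C) + 1)*(wnorm (- s) G)^2" by (simp add: distrib_right mult_ac)
  finally show ?thesis .
 qed
 moreover have "0 < real u*(B*C) + 1" using B_nonneg C by (simp add: add_nonneg_pos)
 ultimately show ?thesis using that by blast
qed

text \<open>The scaling function lacks the vanishing envelope, so its single level is estimated
  directly by \<open>level_bessel\<close>; only the wavelets are summed over levels.\<close>

lemma bessel_dual:
 obtains C where "0 < C" "!!F K. F\<in>wL2 s ==> finite K ==> K \<subseteq> indices ==>
  (\<Sum>i\<in>K. (norm (dpair F (dual_elem i)))^2) <= C*(wnorm s F)^2"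
proof -
 obtain C where C: "0 < C" "!!w J. (\<Sum>j<J. (\<rho> ^ j) powr (2 * s) * vanishing_weight n t' (down j w)) <= C*weight s w"
  using geometric_weight_positive[of t' s n] exponents by blast
 have "(\<Sum>i\<in>K. (norm (dpair F (dual_elem i)))^2) <= (real u*(B*C) + B + 1)*(wnorm s F)^2"
  if F: "F\<in>wL2 s" and K: "finite K" "K \<subseteq> indices" for F K
 proof -
  let ?f = "%i. (norm (dpair F (dual_elem i)))^2"
  let ?K = "K \<inter> ({2..u} \<times> UNIV)" and ?L = "(%(\<mu>, j, k). k) ` K"
  have F': "F\<in>wL2 t'" using exponents by (intro wL2_mono[OF F]) simp
  \<comment> \<open>K is enlarged to its wavelet part together with level-0 scaling atoms for every
    translation that occurs in K.\<close>
  have "sum ?f K <= sum ?f (?K \<union> (%k. (1, 0, k)) ` ?L)"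
  proof (intro sum_mono2 subsetI)
   fix i assume "i\<in>K"
   then show "i\<in>?K \<union> (%k. (1, 0, k)) ` ?L"
    using subsetD[OF K(2)] by (cases i; cases "fst i = 1") (force simp: indices_def)+
  qed (use K in auto)
  also have "... = sum ?f ?K + sum ?f ((%k. (1, 0, k)) ` ?L)"
   using K by (intro sum.union_disjoint) auto
  also have "sum ?f ((%k. (1, 0, k)) ` ?L) = (\<Sum>k\<in>?L. (norm (dpair F (atom 0 k (\<Psi>' 1))))^2)"
   by (subst sum.reindex) (auto simp: inj_on_def norm_dual_pairing_elem)
  also have "... <= B*(LBINT w. (norm (F w))^2*weight t' (down 0 w))"
   using u K(1) F' by (intro level_bessel[OF analysis] integrable_down) auto
  also have "(LBINT w. (norm (F w))^2*weight t' (down 0 w)) = (wnorm t' F)^2"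
   by (simp add: wnorm_square matpow_0)
  also have "B*(wnorm t' F)^2 <= B*(wnorm s F)^2"
   using exponents B_nonneg by (intro mult_left_mono power_mono wnorm_mono F) auto
  also have "sum ?f ?K = (\<Sum>(\<mu>, j, k)\<in>?K. (\<rho> ^ j) powr (2 * s)*(norm (dpair F (atom j k (\<Psi>' \<mu>))))^2)"
   by (intro sum.cong refl) (auto simp only: norm_dual_pairing_elem split: prod.split)
  also have "... <= real (card {2..u})*(B*(C*(wnorm s F)^2))"
   using K(1) by (intro family_bessel[OF _ analysis_vanishing \<rho>_powr_pos C(2) F]) auto
  also have "... <= real u*(B*(C*(wnorm s F)^2))"
   using B_nonneg C by (intro mult_right_mono) auto
  finally have "sum ?f K <= real u*(B*(C*(wnorm s F)^2)) + B*(wnorm s F)^2" by simp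
  also have "... <= (real u*(B*C) + B + 1)*(wnorm s F)^2" by (simp add: algebra_simps)
  finally show ?thesis .
 qed
 moreover have "0 < real u*(B*C) + B + 1" using B_nonneg C by (simp add: add_nonneg_pos)
 ultimately show ?thesis using that by blast
qed

text \<open>By duality from the Bessel inequality, tested against the Riesz representative of the sum.\<close>

lemma synthesis_elem:
 obtains C where "0 < C" "!!c K. finite K ==> K \<subseteq> indices ==>
  (wnorm s (%w. \<Sum>i\<in>K. c i*elem i w))^2 <= C*(\<Sum>i\<in>K. (norm (c i))^2)"
proof -
 obtain C where C: "0 < C" "!!G K. G\<in>wL2 (- s) ==> finite K ==> K \<subseteq> indices ==>
  (\<Sum>i\<in>K. (norm (dpair G (elem i)))^2) <= C*(wnorm (- s) G)^2" by (rule bessel_elem) blast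
 have "(wnorm s (%w. \<Sum>i\<in>K. c i*elem i w))^2 <= C*(\<Sum>i\<in>K. (norm (c i))^2)"
  if K: "finite K" "K \<subseteq> indices" for c K
 proof -
  define H where "H w = (\<Sum>i\<in>K. c i*elem i w)" for w
  have H: "H\<in>wL2 s"
   unfolding H_def[abs_def] using K by (intro wL2_sum wL2_cmult elem_weighted_L2) auto
  define G where "G w = H w*cplx (weight s w)" for w
  have G: "G\<in>wL2 (- s)" "wnorm (- s) G = wnorm s H" "dpair H G = cplx ((wnorm s H)^2)"
   using wL2_flip[OF H] wnorm_flip[OF H] dpair_flip(1)[OF H] unfolding G_def by auto
  have sw: "norm (dpair (elem i) G) = norm (dpair G (elem i))" for i
  proof -
   have "dpair (elem i) G = (LBINT w. cnj (G w*cnj (elem i w)))" by (simp add: mult.commute)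
   then show ?thesis by (simp only: Bochner_Integration.integral_cnj complex_mod_cnj)
  qed
  have "dpair H G = (LBINT w. (\<Sum>i\<in>K. c i*(elem i w*cnj (G w))))"
   by (simp add: H_def sum_distrib_right mult.assoc)
  also have "... = (\<Sum>i\<in>K. c i*dpair (elem i) G)"
   using K by (subst Bochner_Integration.integral_sum)
    (auto intro!: integrable_mult_right integrable_dual_pairing[OF elem_weighted_L2(1) G(1)])
  finally have "(wnorm s H)^2 = norm (\<Sum>i\<in>K. c i*dpair (elem i) G)"
   unfolding G(3) by (metis norm_of_real abs_power2)
  also have "... <= (\<Sum>i\<in>K. norm (c i)*norm (dpair G (elem i)))"
   by (rule order_trans[OF norm_sum]) (simp only: norm_mult sw order_refl)
  finally have "((wnorm s H)^2)^2 <= (\<Sum>i\<in>K. norm (c i)*norm (dpair G (elem i)))^2"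
   by (rule power_mono) simp
  also have "... <= (\<Sum>i\<in>K. (norm (c i))^2)*(\<Sum>i\<in>K. (norm (dpair G (elem i)))^2)"
   by (rule Cauchy_Schwarz_ineq_sum)
  also have "... <= (\<Sum>i\<in>K. (norm (c i))^2)*(C*(wnorm s H)^2)"
   using C(2)[OF G(1) K] unfolding G(2) by (intro mult_left_mono sum_nonneg) auto
  finally have *: "(wnorm s H)^2*(wnorm s H)^2 <= (C*(\<Sum>i\<in>K. (norm (c i))^2))*(wnorm s H)^2"
   by (simp add: power2_eq_square mult_ac)
  show ?thesis unfolding H_def[symmetric]
  proof (cases "wnorm s H = 0")
   case True
   then show "(wnorm s H)^2 <= C*(\<Sum>i\<in>K. (norm (c i))^2)" using C by (simp add: sum_nonneg)
  next
   case False
   then show "(wnorm s H)^2 <= C*(\<Sum>i\<in>K. (norm (c i))^2)"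
    using mult_right_le_imp_le[OF *] by simp
  qed
 qed
 with C(1) show ?thesis by (rule that)
qed

text \<open>Undilating costs \<rho>^(2jr) in the squared norm, while the vanishing envelope gains
  \<rho>^(-2jn) and replaces the full weight by |w|^(2n). This is how the seminorm, not the norm,
  appears on the right.\<close>

lemma level_decay:
 obtains D where "0 <= D" "!!\<mu> F r j. \<mu>\<in>{2..u} ==> F\<in>wL2 n ==> 0 <= r ==> r <= s ==>
  wnorm r (level j (\<Psi> \<mu>) (\<Psi>' \<mu>) F) <= D*(\<rho> ^ j) powr (r - n)*weighted_seminorm n F"
proof -
 \<comment> \<open>The square root of the collected factors: B from analysis, B from synthesis, 2^t'
   from the envelope, and the powers of \<open>c_1\<close> with r enlarged to s.\<close>
 define D where "D = B * sqrt (2 powr t')*c_1 powr (s + n)"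
 have D: "0 <= D" using B_nonneg by (simp add: D_def)
 have "wnorm r (level j (\<Psi> \<mu>) (\<Psi>' \<mu>) F) <= D*(\<rho> ^ j) powr (r - n)*weighted_seminorm n F"
  if \<mu>: "\<mu>\<in>{2..u}" and F: "F\<in>wL2 n" and r: "0 <= r" "r <= s" for \<mu> F r j
 proof -
  have \<mu>': "\<mu>\<in>{1..u}" using \<mu> by auto
  have [measurable]: "F\<in>borel_fun" using F by auto
  have n: "0 <= n" "t' <= n" using exponents by auto
  let ?k = "2 powr t'*(c_1/\<rho> ^ j) powr (2*n)"
  have i: "integrable lborel (%w. ?k*(norm w powr (2*n)*(norm (F w))^2))"
   by (intro integrable_mult_right integrable_weighted_seminorm n F)
  have nn: "0 <= (norm (F w))^2 * vanishing_weight n t' (down j w)" for w by (simp add: vanishing_weight_def)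
  have le: "(norm (F w))^2 * vanishing_weight n t' (down j w) <= ?k*(norm w powr (2*n)*(norm (F w))^2)" for w
   using mult_left_mono[OF vanishing_weight_down[OF exponents(3) n(2), of j w], of "(norm (F w))^2"] by (simp add: mult_ac)
  have vi: "integrable lborel (%w. (norm (F w))^2 * vanishing_weight n t' (down j w))"
   by (rule integrable_dominated[OF _ i nn le]) measurable
  let ?G = "level j (\<Psi> \<mu>) (\<Psi>' \<mu>) F"
  have Gm: "?G\<in>borel_fun" using \<mu>' by measurable
  note lev = level_L2[OF analysis_vanishing[OF \<mu>] synthesis[OF \<mu>'] _ vi] level_bound[OF analysis_vanishing[OF \<mu>] synthesis[OF \<mu>'] _ vi]
  have "(wnorm r ?G)^2 <= (c_1*\<rho> ^ j) powr (2*r)*(LBINT w. (norm (?G w))^2*weight t (down j w))"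
   by (rule undilate_weighted_norm[OF lev(1) Gm r]) simp
  also have "... <= (c_1*\<rho> ^ j) powr (2*r)*(B*(B*(LBINT w. (norm (F w))^2 * vanishing_weight n t' (down j w))))"
   by (intro mult_left_mono lev(2)) auto
  also have "... <= (c_1*\<rho> ^ j) powr (2*r)*(B*(B*(LBINT w. ?k*(norm w powr (2*n)*(norm (F w))^2))))"
   using B_nonneg by (intro mult_left_mono integral_mono[OF vi i le]) auto
  also have "... = (c_1 powr (2*r)*(\<rho> ^ j) powr (2*r))*(B*(B*(2 powr t'*(c_1 powr (2*n)*(\<rho> ^ j) powr (- 2*n))*(weighted_seminorm n F)^2)))"
  proof -
   have "(c_1/\<rho> ^ j) powr (2*n) = c_1 powr (2*n)*(\<rho> ^ j) powr (- 2*n)" by (simp add: powr_divide powr_minus_divide)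
   then show ?thesis by (simp add: powr_mult weighted_seminorm_def)
  qed
  also have "... = B^2*2 powr t'*c_1 powr (2*r + 2*n)*((\<rho> ^ j) powr (r - n))^2*(weighted_seminorm n F)^2"
  proof -
   have "((\<rho> ^ j) powr (r - n))^2 = (\<rho> ^ j) powr (2*r)*(\<rho> ^ j) powr (- 2*n)"
    by (simp add: power2_eq_square flip: powr_add)
   then show ?thesis by (simp only: powr_add power2_eq_square[of B] mult_ac)
  qed
  also have "... <= B^2*2 powr t'*c_1 powr (2 * s + 2*n)*((\<rho> ^ j) powr (r - n))^2*(weighted_seminorm n F)^2"
   using r c_1 by (intro mult_right_mono mult_left_mono powr_mono) auto
  also have "... = (D*(\<rho> ^ j) powr (r - n)*weighted_seminorm n F)^2"
  proof -
   have "(c_1 powr (s + n))^2 = c_1 powr (2 * s + 2*n)" by (simp add: power2_eq_square flip: powr_add)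
   then show ?thesis by (simp add: D_def power_mult_distrib)
  qed
  finally show ?thesis by (rule power2_le_imp_le) (use D in simp)
 qed
 with D show ?thesis by (rule that)
qed

text \<open>One null set is good for all J and K, since there are only countably many
  levels.\<close>

lemma telescope_sum:
 assumes F: "F\<in>wL2 t'"
 shows "AE w in lborel. \<forall>J K. level (J + K) (\<Psi> 1) (\<Psi>' 1) F w =
  level J (\<Psi> 1) (\<Psi>' 1) F w + (\<Sum>j<K. \<Sum>\<mu>\<in>{2..u}. level (J + j) (\<Psi> \<mu>) (\<Psi>' \<mu>) F w)"
proof -
 have "AE w in lborel. \<forall>j. (\<Sum>\<mu>\<in>{1..u}. level j (\<Psi> \<mu>) (\<Psi>' \<mu>) F w) = level (Suc j) (\<Psi> 1) (\<Psi>' 1) F w"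
  unfolding AE_all_countable using telescope[OF F] by blast
 then show ?thesis
 proof eventually_elim
  case (elim w)
  have step: "level (Suc j) (\<Psi> 1) (\<Psi>' 1) F w = level j (\<Psi> 1) (\<Psi>' 1) F w + (\<Sum>\<mu>\<in>{2..u}. level j (\<Psi> \<mu>) (\<Psi>' \<mu>) F w)" for j
   using elim[rule_format, of j, symmetric] by (simp only: sum_split)
  have "level (J + K) (\<Psi> 1) (\<Psi>' 1) F w = level J (\<Psi> 1) (\<Psi>' 1) F w + (\<Sum>j<K. \<Sum>\<mu>\<in>{2..u}. level (J + j) (\<Psi> \<mu>) (\<Psi>' \<mu>) F w)" for J K
   by (induction K) (simp_all add: step[unfolded One_nat_def])
  then show ?case by blast
 qed
qed

text \<open>Fatou is used twice. First the upper level tends to infinity for a truncated F, where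
  the pointwise limit is known; then the truncation radius tends to infinity, with the seminorm of
  the truncation bounded by that of F.\<close>

lemma approximation_order:
 obtains D where "0 <= D" "!!F r J. F\<in>wL2 n ==> 0 <= r ==> r <= s ==>
  wnorm r (%w. F w - level J (\<Psi> 1) (\<Psi>' 1) F w) <= D*(\<rho> ^ J) powr (r - n)*weighted_seminorm n F"
proof -
 obtain D where D: "0 <= D" "!!\<mu> F r j. \<mu>\<in>{2..u} ==> F\<in>wL2 n ==> 0 <= r ==> r <= s ==>
  wnorm r (level j (\<Psi> \<mu>) (\<Psi>' \<mu>) F) <= D*(\<rho> ^ j) powr (r - n)*weighted_seminorm n F" by (rule level_decay) blast
 \<comment> \<open>The worst decay ratio over all r up to s; s < n makes it less than 1, and the
   constant becomes independent of r.\<close>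
 define g where "g = \<rho> powr (s - n)"
 have g: "0 < g" "g < 1" using \<rho> exponents powr_less_mono[of "s - n" 0 \<rho>] by (auto simp: g_def)
 define D' where "D' = real u*D*(1/(1 - g))"
 have D': "0 <= D'" using D g by (simp add: D'_def)
 let ?Q = "%J. level J (\<Psi> 1) (\<Psi>' 1)"
 have one: "1\<in>{1..u}" using u by simp
 have diff: "wnorm r (%w. ?Q (J + K) F w - ?Q J F w) <= D'*(\<rho> ^ J) powr (r - n)*weighted_seminorm n F"
  and diff_L2: "(%w. ?Q (J + K) F w - ?Q J F w)\<in>wL2 r"
  if F: "F\<in>wL2 n" and r: "0 <= r" "r <= s" for F r J K
 proof -
  have Fs: "F\<in>wL2 s" "F\<in>wL2 t'" using exponents by (auto intro!: wL2_mono[OF F])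
  show L: "(%w. ?Q (J + K) F w - ?Q J F w)\<in>wL2 r"
   by (intro wL2_diff level_weighted_L2 one Fs r)
  have lev: "level j (\<Psi> \<mu>) (\<Psi>' \<mu>) F\<in>wL2 r" if "\<mu>\<in>{2..u}" for \<mu> j
   using that by (intro level_weighted_L2 Fs r) auto
  let ?S = "%w. \<Sum>j<K. \<Sum>\<mu>\<in>{2..u}. level (J + j) (\<Psi> \<mu>) (\<Psi>' \<mu>) F w"
  have S: "?S\<in>wL2 r" by (intro wL2_sum lev)
  have "wnorm r (%w. ?Q (J + K) F w - ?Q J F w) = wnorm r ?S"
   by (rule wnorm_AE[OF wL2_measurable[OF L] wL2_measurable[OF S]])
    (use telescope_sum[OF Fs(2)] in eventually_elim, simp)
  also have "... <= (\<Sum>j<K. wnorm r (%w. \<Sum>\<mu>\<in>{2..u}. level (J + j) (\<Psi> \<mu>) (\<Psi>' \<mu>) F w))"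
   by (intro wnorm_sum wL2_sum lev)
  also have "... <= (\<Sum>j<K. real u*D*(\<rho> ^ J) powr (r - n)*weighted_seminorm n F*g ^ j)"
  proof (intro sum_mono)
   fix j assume "j\<in>{..<K}"
   have "(\<rho> ^ (J + j)) powr (r - n) = (\<rho> ^ J) powr (r - n)*(\<rho> ^ j) powr (r - n)"
    by (simp add: power_add powr_mult)
   also have "... <= (\<rho> ^ J) powr (r - n)*(\<rho> ^ j) powr (s - n)"
    using r \<rho> one_le_power[of \<rho> j] by (intro mult_left_mono powr_mono) auto
   also have "(\<rho> ^ j) powr (s - n) = g ^ j"
    using \<rho> by (simp add: g_def powr_realpow[symmetric] powr_powr mult.commute)
   finally have pw: "(\<rho> ^ (J + j)) powr (r - n) <= (\<rho> ^ J) powr (r - n)*g ^ j" .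
   have "wnorm r (%w. \<Sum>\<mu>\<in>{2..u}. level (J + j) (\<Psi> \<mu>) (\<Psi>' \<mu>) F w) <= (\<Sum>\<mu>\<in>{2..u}. D*(\<rho> ^ (J + j)) powr (r - n)*weighted_seminorm n F)"
    by (rule order_trans[OF wnorm_sum[OF lev] sum_mono[OF D(2)[OF _ F r]]])
   also have "... = real (card {2..u})*(D*(\<rho> ^ (J + j)) powr (r - n)*weighted_seminorm n F)" by simp
   also have "... <= real u*(D*((\<rho> ^ J) powr (r - n)*g ^ j)*weighted_seminorm n F)"
    using D pw by (intro mult_mono mult_left_mono mult_right_mono) auto
   finally show "wnorm r (%w. \<Sum>\<mu>\<in>{2..u}. level (J + j) (\<Psi> \<mu>) (\<Psi>' \<mu>) F w) \<le>
     real u*D*(\<rho> ^ J) powr (r - n)*weighted_seminorm n F*g ^ j" by (simp add: mult_ac)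
  qed
  also have "... = real u*D*(\<rho> ^ J) powr (r - n)*weighted_seminorm n F*(\<Sum>j<K. g ^ j)" by (simp add: sum_distrib_left)
  also have "... <= real u*D*(\<rho> ^ J) powr (r - n)*weighted_seminorm n F*(1/(1 - g))"
  proof (intro mult_left_mono)
   have "(\<Sum>j<K. g ^ j) <= (\<Sum>j. g ^ j)" using g by (intro sum_le_suminf summable_geometric) auto
   then show "(\<Sum>j<K. g ^ j) <= 1/(1 - g)" using g by (simp add: suminf_geometric)
  qed (use D in auto)
  finally show "wnorm r (%w. ?Q (J + K) F w - ?Q J F w) <= D'*(\<rho> ^ J) powr (r - n)*weighted_seminorm n F"
   by (simp add: D'_def mult_ac)
 qed
 \<comment> \<open>First limit: the differences between two levels are bounded independently of K,
   and for the truncated function they converge pointwise.\<close>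
 have compact: "wnorm r (%w. trunc R F w - ?Q J (trunc R F) w) <= D'*(\<rho> ^ J) powr (r - n)*weighted_seminorm n (trunc R F)"
  and compact_L2: "(%w. trunc R F w - ?Q J (trunc R F) w)\<in>wL2 r"
  if F: "F\<in>wL2 n" and r: "0 <= r" "r <= s" for F r J R
 proof -
  let ?F = "trunc R F"
  have F': "?F\<in>wL2 n" "?F\<in>wL2 s" by (rule trunc_weighted_L2[OF F])+
  show "(%w. trunc R F w - ?Q J (trunc R F) w)\<in>wL2 r"
   by (intro wL2_diff level_weighted_L2 one F' r trunc_weighted_L2[OF F])
  have "(%K. ?Q (J + K) ?F w - ?Q J ?F w) \<longlonglongrightarrow> ?F w - ?Q J ?F w" for w
  proof (intro tendsto_diff tendsto_const)
   have "(%K. ?Q K ?F w) \<longlonglongrightarrow> ?F w" by (rule limit[of R]) (simp add: trunc_def)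
   from LIMSEQ_ignore_initial_segment[OF this, of J] show "(%K. ?Q (J + K) ?F w) \<longlonglongrightarrow> ?F w" by (simp add: add.commute)
  qed
  then show "wnorm r (%w. ?F w - ?Q J ?F w) <= D'*(\<rho> ^ J) powr (r - n)*weighted_seminorm n ?F"
   by (intro wnorm_limit[where g = "%K w. ?Q (J + K) ?F w - ?Q J ?F w", OF diff_L2[OF F'(1) r] diff[OF F'(1) r]])
    (use wL2_measurable[OF F'(2)] one in \<open>auto intro!: borel_measurable_diff level_measurable measurable_wavelets\<close>)
 qed
 have "wnorm r (%w. F w - ?Q J F w) <= D'*(\<rho> ^ J) powr (r - n)*weighted_seminorm n F"
  if F: "F\<in>wL2 n" and r: "0 <= r" "r <= s" for F r J
 proof -
  have [measurable]: "F\<in>borel_fun" using F by auto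
  have Ft: "F\<in>wL2 t'" using exponents by (auto intro!: wL2_mono[OF F])
  have n: "0 <= n" using exponents by simp
  show ?thesis
  proof (rule wnorm_limit[where g = "%R::nat. %w. trunc (real R) F w - ?Q J (trunc (real R) F) w"])
   show "(%w. F w - ?Q J F w)\<in>borel_fun" using one by measurable
   show "wnorm r (%w. trunc (real R) F w - ?Q J (trunc (real R) F) w) <= D'*(\<rho> ^ J) powr (r - n)*weighted_seminorm n F" for R :: nat
    using D' by (rule_tac order_trans[OF compact[OF F r] mult_left_mono[OF weighted_seminorm_trunc[OF n F]]]) simp
   show "AE w in lborel. (%R::nat. trunc (real R) F w - ?Q J (trunc (real R) F) w) \<longlonglongrightarrow> F w - ?Q J F w"
    using level_truncation_limit[OF analysis[OF one] wL2_measurable[OF F] integrable_down[OF Ft], of J "\<Psi> 1"]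
    by eventually_elim (intro tendsto_diff trunc_limit)
  qed (rule compact_L2[OF F r])
 qed
 with D' show ?thesis by (rule that)
qed

end

section \<open>Unconditional reconstruction and duality\<close>

context wavelet_levels
begin

lemma level_converges_norm:
 assumes \<mu>: "\<mu>\<in>{1..u}" and F: "F\<in>wL2 s" and eps: "0 < eps"
 obtains K where "finite K" "!!L. finite L ==> K \<subseteq> L ==>
  wnorm s (%w. level j (\<Psi> \<mu>) (\<Psi>' \<mu>) F w - (\<Sum>k\<in>L. dpair F (atom j k (\<Psi>' \<mu>))*atom j k (\<Psi> \<mu>) w)) < eps"
proof -
 have [measurable]: "F\<in>borel_fun" "\<Psi> \<mu>\<in>borel_fun" "\<Psi>' \<mu>\<in>borel_fun"
  using F \<mu> by auto
 have F': "F\<in>wL2 t'" using exponents by (intro wL2_mono[OF F]) simp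
 define c where "c = (c_1*\<rho> ^ j) powr (2 * s)"
 have c: "0 < c" using c_1 \<rho> by (auto simp: c_def)
 note lev = analysis[OF \<mu>] synthesis[OF \<mu>] wL2_measurable[OF F] integrable_down[OF F', of j]
 have e: "0 < eps^2/c" using eps c by simp
 obtain K where K: "finite K" "!!L. finite L ==> K \<subseteq> L ==> (LBINT w.
   (norm (level j (\<Psi> \<mu>) (\<Psi>' \<mu>) F w - (\<Sum>k\<in>L. dpair F (atom j k (\<Psi>' \<mu>))*atom j k (\<Psi> \<mu>) w)))^2*weight t (down j w)) < eps^2/c"
  using level_converges[OF lev e] by blast
 have "wnorm s (%w. level j (\<Psi> \<mu>) (\<Psi>' \<mu>) F w - (\<Sum>k\<in>L. dpair F (atom j k (\<Psi>' \<mu>))*atom j k (\<Psi> \<mu>) w)) < eps"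
  (is "wnorm s ?G < eps") if L: "finite L" "K \<subseteq> L" for L
 proof -
  have "(wnorm s ?G)^2 <= c*(LBINT w. (norm (?G w))^2*weight t (down j w))"
   unfolding c_def using exponents
   by (intro undilate_weighted_norm level_converges_integrable[OF lev L(1)]) (auto intro!: borel_measurable_diff borel_measurable_sum borel_measurable_times level_measurable atom_measurable)
  also have "... < c*(eps^2/c)" using K(2)[OF L] c by (rule mult_strict_left_mono)
  also have "... = eps^2" using c by simp
  finally show ?thesis by (rule power2_less_imp_less) (use eps in simp)
 qed
 with K(1) show ?thesis by (rule that)
qed

definition expansion :: "(nat \<times> nat \<times> (int^'n)) set => (real^'n => complex) => real^'n => complex" where
 "expansion K F w = (\<Sum>i\<in>K. dpair F (dual_elem i)*elem i w)"

lemma expansion_term: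
 "dpair F (dual_elem (\<mu>, j, k))*elem (\<mu>, j, k) w = dpair F (atom j k (\<Psi>' \<mu>))*atom j k (\<Psi> \<mu>) w"
proof -
 have "dpair F (dual_elem (\<mu>, j, k)) = cplx ((\<rho> ^ j) powr s)*dpair F (atom j k (\<Psi>' \<mu>))"
  by (simp add: dual_elem_def mult.left_commute[of _ "cplx _"])
 moreover have "cplx ((\<rho> ^ j) powr s)*cplx ((\<rho> ^ j) powr (- s)) = 1"
  unfolding of_real_mult[symmetric] powr_add[symmetric] using \<rho> by simp
 ultimately show ?thesis by (simp add: elem_def mult_ac)
qed

lemma expansion_weighted_L2: "K \<subseteq> indices ==> expansion K F\<in>wL2 s"
 unfolding expansion_def[abs_def] by (intro wL2_sum wL2_cmult elem_weighted_L2) auto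

lemma expansion_norm:
 obtains C where "0 < C" "!!F K. F\<in>wL2 s ==> finite K ==> K \<subseteq> indices ==>
  wnorm s (expansion K F) <= C*wnorm s F"
proof -
 obtain C where C: "0 < C" "!!c K. finite K ==> K \<subseteq> indices ==>
  (wnorm s (%w. \<Sum>i\<in>K. c i*elem i w))^2 <= C*(\<Sum>i\<in>K. (norm (c i))^2)" by (rule synthesis_elem) blast
 obtain D where D: "0 < D" "!!F K. F\<in>wL2 s ==> finite K ==> K \<subseteq> indices ==>
  (\<Sum>i\<in>K. (norm (dpair F (dual_elem i)))^2) <= D*(wnorm s F)^2" by (rule bessel_dual) blast
 have "wnorm s (expansion K F) <= sqrt (C*D)*wnorm s F"
  if F: "F\<in>wL2 s" and K: "finite K" "K \<subseteq> indices" for F K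
 proof -
  have "(wnorm s (expansion K F))^2 <= C*(\<Sum>i\<in>K. (norm (dpair F (dual_elem i)))^2)"
   unfolding expansion_def[abs_def] by (rule C(2)[OF K])
  also have "... <= C*(D*(wnorm s F)^2)" using C by (intro mult_left_mono D F K) auto
  also have "... = (sqrt (C*D)*wnorm s F)^2" using C D by (simp add: power_mult_distrib)
  finally show ?thesis by (rule power2_le_imp_le) (use C D in simp)
 qed
 moreover have "0 < sqrt (C*D)" using C D by simp
 ultimately show ?thesis using that by blast
qed

text \<open>Level sums converge only when levels are taken in order. Unconditional convergence
  follows because square-summable coefficients make expansions over sets disjoint from
  \<open>K_0\<close> small; hence any finite set above \<open>K_0\<close> gives nearly the same sum
  as one well chosen set \<open>K_1\<close>.\<close>

lemma reconstruction_trunc: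
 fixes R :: real
 assumes F_0: "F_0\<in>wL2 s" and eps: "0 < eps"
 defines "F \<equiv> trunc R F_0"
 obtains K where "finite K" "K \<subseteq> indices"
  "!!L. finite L ==> K \<subseteq> L ==> L \<subseteq> indices ==> wnorm s (%w. F w - expansion L F w) < eps"
proof -
 have F: "F\<in>wL2 r" for r unfolding F_def by (rule trunc_weighted_L2[OF F_0])
 \<comment> \<open>Four errors: F against level J, level J against the expansion over
   \<open>K_1\<close>, and the two expansions outside \<open>K_0\<close>.\<close>
 define e where "e = eps/4"
 have e: "0 < e" using eps by (simp add: e_def)
 obtain C where C: "0 < C" "!!c K. finite K ==> K \<subseteq> indices ==>
  (wnorm s (%w. \<Sum>i\<in>K. c i*elem i w))^2 <= C*(\<Sum>i\<in>K. (norm (c i))^2)" by (rule synthesis_elem) blast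
 obtain C' where C': "0 < C'" "!!F K. F\<in>wL2 s ==> finite K ==> K \<subseteq> indices ==>
  (\<Sum>i\<in>K. (norm (dpair F (dual_elem i)))^2) <= C'*(wnorm s F)^2" by (rule bessel_dual) blast
 have e': "0 < e^2/C" using C(1) e by simp
 obtain K_0 where K_0: "finite K_0" "K_0 \<subseteq> indices" "!!L. finite L ==> L \<subseteq> indices ==> L \<inter> K_0 = {} ==>
   (\<Sum>i\<in>L. (norm (dpair F (dual_elem i)))^2) < e^2/C"
  by (rule small_tail[of "%i. (norm (dpair F (dual_elem i)))^2" indices, OF _ C'(2)[OF F] e']) simp_all
 have tail: "wnorm s (expansion L F) < e" if "finite L" "L \<subseteq> indices" "L \<inter> K_0 = {}" for L
 proof -
  have "(wnorm s (expansion L F))^2 <= C*(\<Sum>i\<in>L. (norm (dpair F (dual_elem i)))^2)"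
   unfolding expansion_def[abs_def] by (rule C(2)[OF that(1,2)])
  also have "... < C*(e^2/C)" using K_0(3)[OF that] C(1) by (rule mult_strict_left_mono)
  also have "... = e^2" using C by simp
  finally show ?thesis by (rule power2_less_imp_less) (use e in simp)
 qed
 obtain D where D: "0 <= D" "!!F r J. F\<in>wL2 n ==> 0 <= r ==> r <= s ==>
  wnorm r (%w. F w - level J (\<Psi> 1) (\<Psi>' 1) F w) <= D*(\<rho> ^ J) powr (r - n)*weighted_seminorm n F"
  by (rule approximation_order) blast
 define g where "g = \<rho> powr (s - n)"
 have g: "0 < g" "g < 1" using \<rho> exponents powr_less_mono[of "s - n" 0 \<rho>] by (auto simp: g_def)
 have "(%J. D*g ^ J*weighted_seminorm n F) \<longlonglongrightarrow> D*0*weighted_seminorm n F"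
  using g by (intro tendsto_intros LIMSEQ_power_zero) simp
 then have "\<forall>\<^sub>F J in sequentially. D*g ^ J*weighted_seminorm n F < e"
  using e by (intro order_tendstoD(2)) auto
 then obtain J0 where J0: "!!J. J0 <= J ==> D*g ^ J*weighted_seminorm n F < e"
  unfolding eventually_sequentially by blast
 obtain J1 where J1: "(%(\<mu>, j, k). j) ` K_0 \<subseteq> {..<J1}" using finite_nat_bounded[OF finite_imageI[OF K_0(1)]] by blast
 define J where "J = max J0 J1"
 have one: "1\<in>{1..u}" using u by simp
 let ?Q = "level J (\<Psi> 1) (\<Psi>' 1) F"
 have Q: "wnorm s (%w. F w - ?Q w) < e"
 proof -
  have "(\<rho> ^ J) powr (s - n) = g ^ J" using \<rho> by (simp add: g_def powr_realpow[symmetric] powr_powr mult.commute)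
  then show ?thesis using D(2)[OF F, of s J] J0[of J] exponents by (simp add: J_def)
 qed
 \<comment> \<open>These pairs of generator and level add up, by telescoping, to the scaling level
   J.\<close>
 define P where "P = insert (1, 0) ({2..u} \<times> {..<J})"
 have P: "finite P" "!!p. p\<in>P ==> fst p\<in>{1..u}" using u by (auto simp: P_def)
 define lev where "lev p = level (snd p) (\<Psi> (fst p)) (\<Psi>' (fst p)) F" for p
 define part where "part p L w = (\<Sum>k\<in>L. dpair F (atom (snd p) k (\<Psi>' (fst p)))*atom (snd p) k (\<Psi> (fst p)) w)" for p L w
 have card: "0 < real (card P)" by (metis P(1) P_def card_gt_0_iff insert_not_empty of_nat_0_less_iff)
 have "\<forall>p\<in>P. \<exists>K. finite K \<and> (\<forall>L. finite L --> K \<subseteq> L --> wnorm s (%w. lev p w - part p L w) < e/card P)"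
 proof
  fix p assume "p\<in>P"
  have "0 < e/card P" using e card by simp
  then show "\<exists>K. finite K \<and> (\<forall>L. finite L --> K \<subseteq> L --> wnorm s (%w. lev p w - part p L w) < e/card P)"
   by (rule level_converges_norm[OF P(2)[OF \<open>p\<in>P\<close>] F, of _ "snd p"]) (unfold lev_def part_def, blast)
 qed
 then obtain k where k: "!!p. p\<in>P ==> finite (k p)"
  "!!p L. p\<in>P ==> finite L ==> k p \<subseteq> L ==> wnorm s (%w. lev p w - part p L w) < e/card P"
  by metis
 \<comment> \<open>One set of translates for all pairs: large enough for every level in P, and
   containing the translates of \<open>K_0\<close> so that \<open>K_0\<close> lies in
   \<open>K_1\<close>.\<close>
 define L where "L = (%(\<mu>, j, k). k) ` K_0 \<union> (\<Union>p\<in>P. k p)"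
 have L: "finite L" "!!p. p\<in>P ==> k p \<subseteq> L" using K_0(1) P k(1) by (auto simp: L_def)
 define f where "f p = (fst (fst p), snd (fst p), snd p)" for p :: "(nat \<times> nat) \<times> (int^'n)"
 define K_1 where "K_1 = f ` (P \<times> L)"
 have f: "inj f" by (auto simp: f_def inj_on_def prod_eq_iff)
 have K_1: "finite K_1" "K_1 \<subseteq> indices" using P L(1) u by (auto simp: K_1_def f_def P_def indices_def)
 have K_0_1: "K_0 \<subseteq> K_1"
 proof
  fix i assume i: "i\<in>K_0"
  obtain \<mu> j k where ijk: "i = (\<mu>, j, k)" by (cases i)
  have "j < J1" using subsetD[OF J1 imageI[OF i]] by (simp add: ijk)
  moreover have "\<mu>\<in>{1..u}" "\<mu> = 1 ==> j = 0" using subsetD[OF K_0(2) i] by (simp_all add: ijk indices_def)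
  ultimately have "(\<mu>, j)\<in>P" by (cases "\<mu> = 1") (auto simp: P_def J_def)
  moreover have "k\<in>L" using imageI[OF i, of "%(\<mu>, j, k). k"] by (simp add: ijk L_def)
  ultimately have "f ((\<mu>, j), k)\<in>K_1" unfolding K_1_def by blast
  then show "i\<in>K_1" by (simp add: f_def ijk)
 qed
 have exp1: "expansion K_1 F w = (\<Sum>p\<in>P. part p L w)" for w
  unfolding expansion_def K_1_def part_def
  by (subst sum.reindex[OF inj_on_subset[OF f subset_UNIV]]) (simp add: f_def expansion_term sum.cartesian_product')
 have lev_L2: "lev p\<in>wL2 s" "part p L\<in>wL2 s" if "p\<in>P" for p
 proof -
  show "lev p\<in>wL2 s" using P(2)[OF that] exponents unfolding lev_def by (intro level_weighted_L2 F) auto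
  have "\<Psi> (fst p)\<in>wL2 s" using wL2_mono[OF wavelet_weighted_L2(1)[OF P(2)[OF that]]] exponents by simp
  then show "part p L\<in>wL2 s" unfolding part_def[abs_def]
   by (intro wL2_sum wL2_cmult atom_weighted_L2)
 qed
 have Q_L2: "?Q\<in>wL2 s" using exponents by (intro level_weighted_L2[OF one] F) auto
 have Q_eq: "AE w in lborel. ?Q w = (\<Sum>p\<in>P. lev p w)"
  using telescope_sum[OF F]
 proof eventually_elim
  case (elim w)
  have "(\<Sum>p\<in>P. lev p w) = lev (1, 0) w + (\<Sum>p\<in>{2..u} \<times> {..<J}. lev p w)" unfolding P_def by (subst sum.insert) auto
  also have "(\<Sum>p\<in>{2..u} \<times> {..<J}. lev p w) = (\<Sum>j<J. \<Sum>\<mu>\<in>{2..u}. level j (\<Psi> \<mu>) (\<Psi>' \<mu>) F w)"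
   unfolding lev_def by (subst sum.swap) (simp add: sum.cartesian_product')
  finally show ?case using elim[rule_format, of 0 J] by (simp add: lev_def)
 qed
 have "wnorm s (%w. ?Q w - expansion K_1 F w) = wnorm s (%w. \<Sum>p\<in>P. lev p w - part p L w)"
 proof (rule wnorm_AE)
  show "(%w. ?Q w - expansion K_1 F w)\<in>borel_fun"
   using wL2_diff[OF Q_L2 expansion_weighted_L2[OF K_1(2)]] by auto
  show "(%w. \<Sum>p\<in>P. lev p w - part p L w)\<in>borel_fun"
   by (intro wL2_measurable[of _ s] wL2_sum wL2_diff lev_L2)
  show "AE w in lborel. ?Q w - expansion K_1 F w = (\<Sum>p\<in>P. lev p w - part p L w)"
   using Q_eq by eventually_elim (simp add: exp1 sum_subtractf)
 qed
 also have "... <= (\<Sum>p\<in>P. wnorm s (%w. lev p w - part p L w))"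
  by (intro wnorm_sum wL2_diff lev_L2)
 also have "... <= (\<Sum>p\<in>P. e/card P)" using k(2) L by (intro sum_mono less_imp_le) auto
 also have "... = e" using card by simp
 finally have QK: "wnorm s (%w. ?Q w - expansion K_1 F w) <= e" .
 \<comment> \<open>\<open>K\<close> and \<open>K_1\<close> share the part \<open>K_0\<close>, so
   their expansions differ only by two tails.\<close>
 have "wnorm s (%w. F w - expansion K F w) < eps" if K: "finite K" "K_0 \<subseteq> K" "K \<subseteq> indices" for K
 proof -
  have split: "expansion A F w = expansion K_0 F w + expansion (A - K_0) F w" if "finite A" "K_0 \<subseteq> A" for A w
   unfolding expansion_def using that by (subst sum.subset_diff[of K_0 A]) auto
  have ex: "expansion A F\<in>wL2 s" if "A \<subseteq> indices" for A by (rule expansion_weighted_L2[OF that])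
  have d: "K_1 - K_0 \<subseteq> indices" "K - K_0 \<subseteq> indices" using K K_1 by auto
  have "wnorm s (%w. F w - expansion K F w) <= wnorm s (%w. F w - ?Q w) + wnorm s (%w. ?Q w - expansion K F w)"
   by (rule wnorm_triangle3[OF F Q_L2 ex[OF K(3)]])
  also have "wnorm s (%w. ?Q w - expansion K F w) <= wnorm s (%w. ?Q w - expansion K_1 F w) + wnorm s (%w. expansion K_1 F w - expansion K F w)"
   by (rule wnorm_triangle3[OF Q_L2 ex[OF K_1(2)] ex[OF K(3)]])
  also have "wnorm s (%w. expansion K_1 F w - expansion K F w) = wnorm s (%w. expansion (K_1 - K_0) F w - expansion (K - K_0) F w)"
   by (simp add: split[OF K_1(1) K_0_1] split[OF K(1,2)])
  also have "... <= wnorm s (expansion (K_1 - K_0) F) + wnorm s (expansion (K - K_0) F)"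
   by (rule wnorm_triangle_diff[OF ex[OF d(1)] ex[OF d(2)]])
  finally show ?thesis
   using Q QK tail[OF finite_Diff[OF K_1(1)] d(1)] tail[OF finite_Diff[OF K(1)] d(2)]
   unfolding e_def Diff_disjoint Int_commute[of "_ - _"] by simp
 qed
 with K_0(1,2) show ?thesis by (rule that)
qed

text \<open>Truncations are dense, and expansions are bounded uniformly in the index set. The factor
  C + 1 accounts for the truncation error itself and for its expansion.\<close>

lemma reconstruction:
 assumes F: "F\<in>wL2 s" and eps: "0 < eps"
 obtains K where "finite K" "K \<subseteq> indices"
  "!!L. finite L ==> K \<subseteq> L ==> L \<subseteq> indices ==> wnorm s (%w. F w - expansion L F w) < eps"
proof -
 obtain C where C: "0 < C" "!!F K. F\<in>wL2 s ==> finite K ==> K \<subseteq> indices ==>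
  wnorm s (expansion K F) <= C*wnorm s F" by (rule expansion_norm) blast
 have "0 < eps/(2*(C + 1))" using C eps by simp
 from order_tendstoD(2)[OF trunc_converges[OF F] this] obtain R :: nat
  where R: "wnorm s (%w. F w - trunc (real R) F w) < eps/(2*(C + 1))"
  by (auto dest: eventually_happens)
 let ?F = "trunc (real R) F"
 have F': "?F\<in>wL2 s" by (rule trunc_weighted_L2[OF F])
 have eps2: "0 < eps/2" using eps by simp
 obtain K where K: "finite K" "K \<subseteq> indices"
  "!!L. finite L ==> K \<subseteq> L ==> L \<subseteq> indices ==> wnorm s (%w. ?F w - expansion L ?F w) < eps/2"
  by (rule reconstruction_trunc[OF F eps2]) blast
 have "wnorm s (%w. F w - expansion L F w) < eps" if L: "finite L" "K \<subseteq> L" "L \<subseteq> indices" for L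
 proof -
  note ex = expansion_weighted_L2[OF L(3)]
  let ?d = "%w. F w - ?F w"
  have d: "?d\<in>wL2 s" by (rule wL2_diff[OF F F'])
  have lin: "expansion L ?F w - expansion L F w = - expansion L ?d w" for w
  proof -
   have "dpair ?d (dual_elem i) = dpair F (dual_elem i) - dpair ?F (dual_elem i)" if "i\<in>L" for i
   proof -
    have "i\<in>indices" using L(3) that by auto
    from integrable_dual_pairing[OF F elem_weighted_L2(2)[OF this]] integrable_dual_pairing[OF F' elem_weighted_L2(2)[OF this]]
    show ?thesis by (simp add: left_diff_distrib)
   qed
   then have "expansion L ?d w = (\<Sum>i\<in>L. (dpair F (dual_elem i) - dpair ?F (dual_elem i))*elem i w)"
    unfolding expansion_def by (intro sum.cong) auto
   then show ?thesis by (simp add: expansion_def left_diff_distrib sum_subtractf)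
  qed
  have "wnorm s (%w. F w - expansion L F w) <= wnorm s ?d + wnorm s (%w. ?F w - expansion L F w)"
   by (rule wnorm_triangle3[OF F F' ex])
  also have "wnorm s (%w. ?F w - expansion L F w) <= wnorm s (%w. ?F w - expansion L ?F w) + wnorm s (%w. expansion L ?F w - expansion L F w)"
   by (rule wnorm_triangle3[OF F' ex ex])
  also have "wnorm s (%w. expansion L ?F w - expansion L F w) = wnorm s (expansion L ?d)"
   unfolding lin by (simp add: wnorm_def)
  also have "... <= C*wnorm s ?d" by (rule C(2)[OF d L(1,3)])
  finally have "wnorm s (%w. F w - expansion L F w) < (C + 1)*wnorm s ?d + eps/2"
   using K(3)[OF L] by (simp add: distrib_right)
  also have "(C + 1)*wnorm s ?d <= (C + 1)*(eps/(2*(C + 1)))" using R C by (intro mult_left_mono) auto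
  also have "... = eps/2" using C(1) by (simp add: field_simps)
  finally show ?thesis by simp
 qed
 with K(1,2) show ?thesis by (rule that)
qed

text \<open>F is replaced by a finite expansion and Cauchy-Schwarz is applied to the coefficients.
  Stating it with arbitrary bounds X and Y for the finite sums yields lower frame bounds for either
  family.\<close>

lemma dpair_square_le:
 assumes F: "F\<in>wL2 s" and G: "G\<in>wL2 (- s)"
  and X: "!!K. finite K ==> K \<subseteq> indices ==> (\<Sum>i\<in>K. (norm (dpair F (dual_elem i)))^2) <= X"
  and Y: "!!K. finite K ==> K \<subseteq> indices ==> (\<Sum>i\<in>K. (norm (dpair G (elem i)))^2) <= Y"
 shows "(norm (dpair F G))^2 <= X*Y"
proof -
 have XY: "0 <= X" "0 <= Y" using X[of "{}"] Y[of "{}"] by auto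
 have "norm (dpair F G) <= sqrt (X*Y) + eps" if eps: "0 < eps" for eps
 proof -
  have p: "0 < wnorm (- s) G + 1" by (simp add: add_nonneg_pos)
  then have e: "0 < eps/(wnorm (- s) G + 1)" using eps by simp
  obtain K where K: "finite K" "K \<subseteq> indices" "wnorm s (%w. F w - expansion K F w) < eps/(wnorm (- s) G + 1)"
   by (rule reconstruction[OF F e]) simp
  note ex = expansion_weighted_L2[OF K(2)]
  have sw: "norm (dpair (elem i) G) = norm (dpair G (elem i))" for i
  proof -
   have "dpair (elem i) G = (LBINT w. cnj (G w*cnj (elem i w)))" by (simp add: mult.commute)
   then show ?thesis by (simp only: Bochner_Integration.integral_cnj complex_mod_cnj)
  qed
  have "dpair F G = dpair (%w. F w - expansion K F w) G + dpair (expansion K F) G"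
   using integrable_dual_pairing[OF F G] integrable_dual_pairing[OF ex G] by (simp add: left_diff_distrib)
  also have "dpair (expansion K F) G = (LBINT w. (\<Sum>i\<in>K. dpair F (dual_elem i)*(elem i w*cnj (G w))))"
   by (simp add: expansion_def sum_distrib_right mult.assoc)
  also have "... = (\<Sum>i\<in>K. dpair F (dual_elem i)*dpair (elem i) G)"
   using K by (subst Bochner_Integration.integral_sum)
    (auto intro!: integrable_mult_right integrable_dual_pairing[OF elem_weighted_L2(1) G])
  finally have "norm (dpair F G) <= norm (dpair (%w. F w - expansion K F w) G) + norm (\<Sum>i\<in>K. dpair F (dual_elem i)*dpair (elem i) G)"
   using norm_triangle_ineq by simp
  moreover have "norm (dpair (%w. F w - expansion K F w) G) <= eps"
  proof -
   have "norm (dpair (%w. F w - expansion K F w) G) <= wnorm s (%w. F w - expansion K F w)*wnorm (- s) G"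
    by (rule dpair_bound[OF wL2_diff[OF F ex] G])
   also have "... <= eps/(wnorm (- s) G + 1)*(wnorm (- s) G + 1)" by (intro mult_mono less_imp_le[OF K(3)] less_imp_le[OF e]) auto
   also have "... = eps" using p by simp
   finally show ?thesis .
  qed
  moreover have "norm (\<Sum>i\<in>K. dpair F (dual_elem i)*dpair (elem i) G) <= sqrt (X*Y)"
  proof -
   have "norm (\<Sum>i\<in>K. dpair F (dual_elem i)*dpair (elem i) G) <= (\<Sum>i\<in>K. norm (dpair F (dual_elem i))*norm (dpair G (elem i)))"
    by (rule order_trans[OF norm_sum]) (simp only: norm_mult sw order_refl)
   then have "(norm (\<Sum>i\<in>K. dpair F (dual_elem i)*dpair (elem i) G))^2 <= (\<Sum>i\<in>K. norm (dpair F (dual_elem i))*norm (dpair G (elem i)))^2"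
    by (rule power_mono) simp
   also have "... <= (\<Sum>i\<in>K. (norm (dpair F (dual_elem i)))^2)*(\<Sum>i\<in>K. (norm (dpair G (elem i)))^2)"
    by (rule Cauchy_Schwarz_ineq_sum)
   also have "... <= X*Y" using XY by (intro mult_mono X Y K sum_nonneg) auto
   finally show ?thesis by (rule real_le_rsqrt)
  qed
  ultimately show ?thesis by simp
 qed
 then have "norm (dpair F G) <= sqrt (X*Y)" by (rule field_le_epsilon)
 then have "(norm (dpair F G))^2 <= (sqrt (X*Y))^2" by (rule power_mono) simp
 then show ?thesis using XY by simp
qed

end

text \<open>In both applications x is a squared norm. Applying \<open>lower\<close> to the infinite
  sum itself and cancelling one factor x gives the lower bound with constant 1/D.\<close>

lemma frame_sums:
 fixes f :: "'i => real"
 assumes f: "!!i. 0 <= f i" and upper: "!!K. finite K ==> K \<subseteq> I ==> sum f K <= C*x"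
  and lower: "!!Y. (!!K. finite K ==> K \<subseteq> I ==> sum f K <= Y) ==> x^2 <= (D*x)*Y" and x: "0 <= x" and D: "0 < D"
 shows "f summable_on I" "1/D*x <= infsum f I" "infsum f I <= C*x"
proof -
 show s: "f summable_on I"
  by (rule nonneg_bdd_above_summable_on[OF f]) (use upper in \<open>auto intro!: bdd_aboveI2[of _ _ "C*x"]\<close>)
 show "infsum f I <= C*x" by (rule infsum_le_finite_sums[OF s upper])
 have "x^2 <= (D*x)*infsum f I"
  by (rule lower) (rule finite_sum_le_infsum[OF s _ _ f])
 then have *: "x*x <= (D*infsum f I)*x" by (simp add: power2_eq_square mult_ac)
 show "1/D*x <= infsum f I"
 proof (cases "x = 0")
  case True
  then show ?thesis using f by (simp add: infsum_nonneg)
 next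
  case False
  then have "x <= D*infsum f I" using x by (intro mult_right_le_imp_le[OF *]) simp
  then show ?thesis using D by (simp add: field_simps)
 qed
qed

section \<open>From masks to wavelet systems\<close>

lemma vanishing_symbol_bound:
 assumes n: "0 < n" and O: "(%w. norm (symbol b w))\<in>O[at 0](%w. norm w powr n)"
 obtains C where "0 <= C" "!!x. (norm (symbol b x))^2 <= C*min 1 (norm x powr (2*n))"
proof -
 obtain c where c: "0 < c" "\<forall>\<^sub>F w in at 0. norm (norm (symbol b w)) <= c*norm (norm w powr n)"
  using landau_o.bigE[OF O] by blast
 then obtain \<delta> where \<delta>: "0 < \<delta>" "!!w. w ~= 0 ==> norm w < \<delta> ==> norm (symbol b w) <= c*norm w powr n"
  unfolding eventually_at dist_norm by auto
 have tends: "(%w. norm (symbol b w)) \<midarrow>0\<rightarrow> norm (symbol b 0)"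
  using continuous_symbol[of UNIV b] by (intro tendsto_norm) (simp add: continuous_on_def)
 have "(%w::real^'a. norm w powr n) \<midarrow>0\<rightarrow> 0"
  using n by (intro tendsto_zero_powrI[OF tendsto_norm_zero[OF tendsto_ident_at] tendsto_const]) auto
 from tendsto_mult_left[OF this, of c] have lim: "(%w::real^'a. c*norm w powr n) \<midarrow>0\<rightarrow> 0" by simp
 \<comment> \<open>The filter \<open>at 0\<close> ignores the origin; there the value 0 comes from
   continuity.\<close>
 have "(%w. norm (symbol b w)) \<midarrow>0\<rightarrow> (0::real)"
  by (rule tendsto_sandwich[OF _ _ tendsto_const lim]) (use c(2) in simp_all)
 from tendsto_unique[OF _ tends this] have zero: "symbol b 0 = 0" by simp
 define S where "S = (\<Sum>k | b k ~= 0. norm (b k))"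
 have S: "norm (symbol b x) <= S" for x unfolding S_def by (rule norm_symbol_le)
 \<comment> \<open>A lower bound for the minimum when |x| >= \<delta>; in that region only
   boundedness of the symbol is available.\<close>
 define d where "d = min 1 (\<delta> powr (2*n))"
 have d: "0 < d" "d <= 1" using \<delta> by (auto simp: d_def)
 have "(norm (symbol b x))^2 <= (c^2 + S^2/d)*min 1 (norm x powr (2*n))" for x
 proof -
  let ?m = "min 1 (norm x powr (2*n))"
  have S2: "(norm (symbol b x))^2 <= S^2" by (intro power_mono S) simp
  have Sd: "S^2 <= S^2/d" using d by (simp add: le_divide_eq mult_left_le)
  consider "x = 0" | "x ~= 0" "norm x < \<delta>" | "\<delta> <= norm x" by linarith
  then show ?thesis
  proof cases
   case 1
   then show ?thesis by (simp add: zero)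
  next
   case 2
   have "(norm (symbol b x))^2 <= (c*norm x powr n)^2" by (intro power_mono \<delta>(2) 2) simp
   also have "... = c^2*norm x powr (2*n)" by (simp add: power_mult_distrib power2_eq_square[of "_ powr _"] flip: powr_add)
   finally have *: "(norm (symbol b x))^2 <= c^2*norm x powr (2*n)" .
   show ?thesis
   proof (cases "norm x powr (2*n) <= 1")
    case True
    have "(norm (symbol b x))^2 <= (c^2 + S^2/d)*norm x powr (2*n)"
     by (rule order_trans[OF*mult_right_mono]) (use d in auto)
    then show ?thesis using True by (simp add: min_absorb2)
   next
    case False
    have "(norm (symbol b x))^2 <= c^2 + S^2/d" using S2 Sd by (simp add: add_increasing)
    then show ?thesis using False by (simp add: min_absorb1)
   qed
  next
   case 3
   have "d <= ?m" unfolding d_def using 3 \<delta> n by (intro min.mono powr_mono2) auto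
   then have "S^2 <= S^2/d*?m" using d by (simp add: le_divide_eq mult_left_mono)
   also have "... <= (c^2 + S^2/d)*?m" by (intro mult_right_mono) auto
   finally show ?thesis using S2 by linarith
  qed
 qed
 moreover have "0 <= c^2 + S^2/d" using d by simp
 ultimately show ?thesis using that by blast
qed

lemma analysis_mono:
 assumes A: "analysis \<theta> W B" "B <= B'"
 shows "analysis \<theta> W B'"
proof -
 obtain V where "V\<in>borel_fun" "\<forall>x. 0 <= V x \<and> (norm (\<theta> x))^2 <= V x*W x"
  "\<forall>x. (nsum (%l. ennreal (V (x + vec_of_int l)))) <= ennreal B"
  using A unfolding analysis_def by blast
 then show ?thesis
  using A unfolding analysis_def by (intro conjI bexI[of _ V]) (auto intro: order_trans[OF _ ennreal_leI])
qed

lemma synthesis_mono: "synthesis \<theta> U B ==> B <= B' ==> synthesis \<theta> U B'"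
 unfolding synthesis_def by (auto intro: order_trans[OF _ ennreal_leI])

text \<open>The lattice bounds are imposed at \<open>N'\<close> times the lattice, because each
  wavelet evaluates its scaling function there. The refinement equations make generator 1 the
  scaling function itself.\<close>

locale wavelet_masks = isotropic_dilation N N' \<rho> c_0
 for N N' :: "real^'n^'n::finite" and \<rho> c_0 :: real +
 fixes b b' :: "nat => int^'n => complex" and \<Phi> \<Phi>' :: "real^'n => complex" and u :: nat and s t t' n C :: real
 assumes u: "1 <= u" and exponents: "0 < s" "s < t" "0 <= t'" "t' < s" "s < n"
  and continuous: "continuous_on UNIV \<Phi>" "continuous_on UNIV \<Phi>'"
  and origin: "\<Phi> 0 = 1" "\<Phi>' 0 = 1"
  and refinement: "!!w. \<Phi> w = symbol (b 1) (N' *v w)*\<Phi> (N' *v w)" "!!w. \<Phi>' w = symbol (b' 1) (N' *v w)*\<Phi>' (N' *v w)"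
  and C: "0 <= C"
   "!!x. (nsum (%l. ennreal ((norm (\<Phi> (N' *v (x + vec_of_int l))))^2*weight t (N' *v (x + vec_of_int l))))) <= ennreal C"
   "!!x. (nsum (%l. ennreal ((norm (\<Phi>' (N' *v (x + vec_of_int l))))^2*weight (- t') (N' *v (x + vec_of_int l))))) <= ennreal C"
  and biorthogonal: "!!w q q'. q\<in>digits N ==> q'\<in>digits N ==>
   (\<Sum>\<mu>\<in>{1..u}. cnj (symbol (b \<mu>) (w + N' *v vec_of_int q)) * symbol (b' \<mu>) (w + N' *v vec_of_int q')) = (if q = q' then 1 else 0)"
  and vanishing: "!!\<mu>. \<mu>\<in>{2..u} ==> (%w. norm (symbol (b' \<mu>) w))\<in>O[at 0](%w. norm w powr n)"
begin

definition wavelet :: "(nat => int^'n => complex) => (real^'n => complex) => nat => real^'n => complex" where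
 "wavelet a \<theta> \<mu> w = symbol (a \<mu>) (N' *v w)*\<theta> (N' *v w)"

lemma wavelet_1: "wavelet b \<Phi> 1 = \<Phi>" "wavelet b' \<Phi>' 1 = \<Phi>'"
 by (simp_all add: wavelet_def fun_eq_iff refinement(1)[symmetric, simplified] refinement(2)[symmetric, simplified])

lemma norm_N'_le: "norm (N' *v x) <= c_1*norm x"
 using norm_down_le[of "Suc 0" x] by (simp add: matpow_Suc)

lemma norm_le_N': "norm x <= (c_1*\<rho>)*norm (N' *v x)"
 using norm_up[of "Suc 0" "N' *v x"] by (simp add: matpow_Suc matrix_vector_mul_assoc NN')

lemma \<Phi>_measurable [measurable]: "\<Phi>\<in>borel_fun" "\<Phi>'\<in>borel_fun"
 using continuous by (auto intro: borel_measurable_continuous_onI)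

lemma wavelet_measurable [measurable (raw)]:
 assumes [measurable]: "\<theta>\<in>borel_fun"
 shows "wavelet a \<theta> \<mu>\<in>borel_fun"
 unfolding wavelet_def[abs_def] by measurable

lemma nn_integral_lattice_cmult:
 fixes f g :: "real^'n => real"
 assumes "0 <= K" "!!x. g x <= K*f x" "!!x. (nsum (%l. ennreal (f (x + vec_of_int l)))) <= ennreal C"
 shows "(nsum (%l. ennreal (g (x + vec_of_int l)))) <= ennreal (K*C)"
proof -
 have "(nsum (%l. ennreal (g (x + vec_of_int l)))) <= (nsum (%l. ennreal K*ennreal (f (x + vec_of_int l))))"
  using assms(1,2) by (intro nn_integral_mono) (simp add: ennreal_mult'[symmetric] ennreal_leI)
 also have "... = ennreal K*(nsum (%l. ennreal (f (x + vec_of_int l))))" by (rule nn_integral_cmult) simp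
 also have "... <= ennreal K*ennreal C" by (intro mult_left_mono assms) simp
 finally show ?thesis using assms(1) C by (simp add: ennreal_mult)
qed

lemma synthesis_wavelet:
 assumes S: "!!x. norm (symbol (b \<mu>) x) <= S"
 shows "synthesis (wavelet b \<Phi> \<mu>) (weight t) ((S^2*(c_1*\<rho>) powr (2*t))*C)"
 unfolding synthesis_def
proof (intro conjI allI)
 fix x :: "real^'n"
 show "(nsum (%l. ennreal ((norm (wavelet b \<Phi> \<mu> (x + vec_of_int l)))^2*weight t (x + vec_of_int l)))) <= ennreal (S^2*(c_1*\<rho>) powr (2*t)*C)"
 proof (rule nn_integral_lattice_cmult[OF _ _ C(2)])
  fix x :: "real^'n"
  have "(norm (symbol (b \<mu>) (N' *v x)))^2 <= S^2" by (intro power_mono S) simp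
  moreover have "weight t x <= (c_1*\<rho>) powr (2*t)*weight t (N' *v x)"
   using c_1_\<rho>[of 1] exponents by (intro weight_dilate norm_le_N') auto
  ultimately have "((norm (symbol (b \<mu>) (N' *v x)))^2*(norm (\<Phi> (N' *v x)))^2)*weight t x \<le>
   (S^2*(norm (\<Phi> (N' *v x)))^2)*((c_1*\<rho>) powr (2*t)*weight t (N' *v x))"
   by (intro mult_mono) auto
  then show "(norm (wavelet b \<Phi> \<mu> x))^2*weight t x <= S^2*(c_1*\<rho>) powr (2*t)*((norm (\<Phi> (N' *v x)))^2*weight t (N' *v x))"
   by (simp add: wavelet_def norm_mult power_mult_distrib mult_ac)
 qed simp
qed (use C in auto)

text \<open>g records what the mask contributes: the constant 1 for mere boundedness, or the
  vanishing factor for \<mu> from 2 on.\<close>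

lemma analysis_wavelet:
 assumes S: "0 <= S" "!!x. (norm (symbol (b' \<mu>) (N' *v x)))^2 <= S*g x"
  and g: "g\<in>borel_fun" "!!x. 0 <= g x"
 shows "analysis (wavelet b' \<Phi>' \<mu>) (%x. g x*weight t' x) ((S*c_1 powr (2*t'))*C)"
proof -
 let ?f = "%x. (norm (\<Phi>' (N' *v x)))^2*weight (- t') (N' *v x)"
 let ?V = "%x. S*c_1 powr (2*t')*?f x"
 have le: "(norm (wavelet b' \<Phi>' \<mu> x))^2 <= ?V x*(g x*weight t' x)" for x
 proof -
  have "1 = weight (- t') (N' *v x)*weight t' (N' *v x)" using weight_add[of "- t'" t' "N' *v x"] by simp
  also have "... <= weight (- t') (N' *v x)*(c_1 powr (2*t')*weight t' x)"
   using c_1 exponents by (intro mult_left_mono weight_dilate norm_N'_le) auto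
  finally have "(S*g x*(norm (\<Phi>' (N' *v x)))^2)*1 <= (S*g x*(norm (\<Phi>' (N' *v x)))^2)*(weight (- t') (N' *v x)*(c_1 powr (2*t')*weight t' x))"
   using S g by (intro mult_left_mono) auto
  moreover have "(norm (wavelet b' \<Phi>' \<mu> x))^2 <= S*g x*(norm (\<Phi>' (N' *v x)))^2"
   unfolding wavelet_def norm_mult power_mult_distrib by (intro mult_right_mono S) simp
  ultimately show ?thesis by (simp add: mult_ac)
 qed
 have "?V\<in>borel_fun" by measurable
 moreover have "0 <= ?V x" for x using S by simp
 moreover have "(nsum (%l. ennreal (?V (x + vec_of_int l)))) <= ennreal ((S*c_1 powr (2*t'))*C)" for x
  using S by (intro nn_integral_lattice_cmult[OF _ _ C(3)]) auto
 ultimately show ?thesis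
  unfolding analysis_def using le S g C by (intro conjI bexI[of _ ?V]) auto
qed

lemma limit_wavelet:
 assumes "!!w. R < norm w ==> F w = 0"
 shows "(%j. level j \<Phi> \<Phi>' F w) \<longlonglongrightarrow> F w"
 by (rule level_pointwise_limit[OF continuous origin assms])

lemma lattice_decomposition:
 obtains k q where "q\<in>digits N" "vec_of_int l = N *v vec_of_int k + vec_of_int q"
proof -
 define k :: "int^'n" where "k = (\<chi> i. \<lfloor>(N' *v vec_of_int l) $ i\<rfloor>)"
 obtain r where r: "N *v vec_of_int k = vec_of_int r" using N_int by blast
 have "N' *v vec_of_int l - vec_of_int k\<in>unit_cube" unfolding unit_cube_translate_iff k_def ..
 moreover have "vec_of_int (l - r) = N *v (N' *v vec_of_int l - vec_of_int k)"
  by (simp add: matrix_vector_mult_diff_distrib matrix_vector_mul_assoc NN' r)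
 ultimately have "l - r\<in>digits N" unfolding digits_def unit_cube_def by blast
 then show ?thesis using that[of "l - r" k] r by simp
qed

text \<open>Writing wavelets through masks turns the sum of all levels j into one sum over l in the
  lattice, in which l carries the factor \<open>?s l\<close>. Biorthogonality makes this the
  indicator of N times the lattice, and reindexing those l gives the coset sum of level j +
  1.\<close>

lemma telescope_wavelet:
 assumes A: "!!\<mu>. \<mu>\<in>{1..u} ==> analysis (wavelet b' \<Phi>' \<mu>) W B" and F [measurable]: "F\<in>borel_fun"
  and int: "integrable lborel (%w. (norm (F w))^2*W (down j w))"
 shows "AE w in lborel. (\<Sum>\<mu>\<in>{1..u}. level j (wavelet b \<Phi> \<mu>) (wavelet b' \<Phi>' \<mu>) F w) = level (Suc j) \<Phi> \<Phi>' F w"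
proof -
 have "AE w in lborel. \<forall>\<mu>\<in>{1..u}. integrable (count_space UNIV) (%l. F (up j (down j w + vec_of_int l))*cnj (wavelet b' \<Phi>' \<mu> (down j w + vec_of_int l)))"
  by (intro AE_finite_allI AE_down_translates_integrable[OF A F int]) auto
 then show ?thesis
 proof eventually_elim
  case (elim w)
  define x where "x = down (Suc j) w"
  have down: "down j w = N *v x" by (simp add: x_def matpow_Suc matrix_vector_mul_assoc matrix_mul_assoc NN')
  have N'N_x: "N' *v (N *v x + y) = x + N' *v y" for y
   by (simp add: matrix_vector_right_distrib matrix_vector_mul_assoc N'N)
  have up: "up j (N *v x + y) = up (Suc j) (x + N' *v y)" for y
   by (simp only: matpow_Suc_mult) (simp add: matrix_vector_right_distrib matrix_vector_mul_assoc NN')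
  let ?f = "%l. F (up (Suc j) (x + N' *v vec_of_int l))*cnj (\<Phi>' (x + N' *v vec_of_int l))"
  let ?s = "%l. \<Sum>\<mu>\<in>{1..u}. cnj (symbol (b' \<mu>) (x + N' *v vec_of_int l)) * symbol (b \<mu>) x"
  have zero: "0\<in>digits N" unfolding digits_def by (auto intro!: image_eqI[of _ _ 0])
  have orth: "?s l = (if \<exists>k. vec_of_int l = N *v vec_of_int k then 1 else 0)" for l
  proof -
   obtain k q where kq: "q\<in>digits N" "vec_of_int l = N *v vec_of_int k + vec_of_int q" by (rule lattice_decomposition)
   have eq: "x + N' *v vec_of_int l = (x + N' *v vec_of_int q) + vec_of_int k"
    unfolding kq by (simp add: matrix_vector_right_distrib matrix_vector_mul_assoc N'N add_ac)
   have "?s l = cnj (\<Sum>\<mu>\<in>{1..u}. cnj (symbol (b \<mu>) (x + N' *v vec_of_int 0)) * symbol (b' \<mu>) (x + N' *v vec_of_int q))"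
    unfolding eq symbol_periodic by (simp add: mult.commute)
   also have "... = (if 0 = q then 1 else 0)" unfolding biorthogonal[OF zero kq(1)] by simp
   \<comment> \<open>A digit is N times a point of the half-open cube; if l is in N times the
     lattice, that point is integral and therefore 0.\<close>
   also have "0 = q \<longleftrightarrow> (\<exists>k. vec_of_int l = N *v vec_of_int k)"
   proof
    assume "\<exists>k. vec_of_int l = N *v vec_of_int k"
    then obtain k' where k': "vec_of_int l = N *v vec_of_int k'" by blast
    obtain y where y: "vec_of_int q = N *v y" "\<forall>i. 0 <= y $ i \<and> y $ i < 1" using kq(1) unfolding digits_def by auto
    have "N' *v vec_of_int l = N' *v (N *v vec_of_int k + vec_of_int q)" by (simp only: kq(2))
    then have yk: "y = vec_of_int (k' - k)"
     unfolding k' y(1) by (simp add: matrix_vector_right_distrib matrix_vector_mul_assoc N'N)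
    have "(k' - k) $ i = 0" for i
    proof -
     have "0 <= real_of_int ((k' - k) $ i) \<and> real_of_int ((k' - k) $ i) < 1"
      using y(2)[rule_format, of i] unfolding yk vec_of_int_nth .
     then have "0 <= (k' - k) $ i \<and> (k' - k) $ i < 1" by (simp only: of_int_0_le_iff of_int_less_1_iff)
     then show ?thesis by linarith
    qed
    then have "y = 0" unfolding yk by (simp add: vec_eq_iff)
    then have "(vec_of_int q :: real^'n) = vec_of_int 0" using y(1) by simp
    then show "0 = q" unfolding vec_of_int_eq by simp
   qed (use kq(2) in auto)
   finally show ?thesis .
  qed
  have "(\<Sum>\<mu>\<in>{1..u}. level j (wavelet b \<Phi> \<mu>) (wavelet b' \<Phi>' \<mu>) F w) =
   (\<Sum>\<mu>\<in>{1..u}. (LINT l|count_space UNIV. F (up j (down j w + vec_of_int l))*cnj (wavelet b' \<Phi>' \<mu> (down j w + vec_of_int l)))*(symbol (b \<mu>) x*\<Phi> x))"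
   by (simp add: level_def bracket_def wavelet_def down matrix_vector_mul_assoc N'N)
  also have "... = (LINT l|count_space UNIV. (\<Sum>\<mu>\<in>{1..u}. F (up j (down j w + vec_of_int l))*cnj (wavelet b' \<Phi>' \<mu> (down j w + vec_of_int l))*(symbol (b \<mu>) x*\<Phi> x)))"
   using elim by (subst Bochner_Integration.integral_sum) auto
  also have "... = (LINT l|count_space UNIV. \<Phi> x*(?f l*?s l))"
   by (intro Bochner_Integration.integral_cong refl) (simp add: down up wavelet_def N'N_x sum_distrib_left mult_ac)
  also have "... = \<Phi> x*(LINT l|count_space UNIV. ?f l*?s l)" by (rule integral_mult_right_zero)
  also have "(LINT l|count_space UNIV. ?f l*?s l) = (LINT k|count_space UNIV. F (up (Suc j) (x + vec_of_int k))*cnj (\<Phi>' (x + vec_of_int k)))"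
  proof -
   obtain \<iota> where \<iota>: "!!k. N *v vec_of_int k = vec_of_int (\<iota> k)" using N_int by metis
   have N'\<iota>: "N' *v vec_of_int (\<iota> k) = vec_of_int k" for k by (simp add: \<iota>[symmetric] matrix_vector_mul_assoc N'N)
   have inj: "inj \<iota>" by (rule injI) (metis N'\<iota> vec_of_int_eq)
   have "(LINT l|count_space UNIV. ?f l*?s l) = (LINT l|count_space UNIV. indicator (range \<iota>) l *\<^sub>R ?f l)"
    unfolding orth by (intro Bochner_Integration.integral_cong refl) (auto simp: \<iota> indicator_def)
   also have "... = (LINT l|count_space (range \<iota>). ?f l)"
    by (subst integral_restrict_space[symmetric]) (auto simp: restrict_count_space)
   also have "... = (LINT k|count_space UNIV. ?f (\<iota> k))"
    using inj by (subst integral_bij_count_space[of \<iota> UNIV "range \<iota>", symmetric]) (auto simp: bij_betw_def)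
   finally show ?thesis by (simp add: N'\<iota>)
  qed
  finally show ?case unfolding level_def bracket_def x_def[symmetric] by (simp add: mult.commute)
 qed
qed

lemma wavelet_levels_exists: obtains B where "wavelet_levels N N' \<rho> c_0 (wavelet b \<Phi>) (wavelet b' \<Phi>') u s t t' n B"
proof -
 define S where "S a = (\<Sum>\<mu>\<in>{1..u}. \<Sum>k | a \<mu> k ~= 0. norm (a \<mu> k))" for a :: "nat => int^'n => complex"
 have S: "norm (symbol (a \<mu>) x) <= S a" if "\<mu>\<in>{1..u}" for a \<mu> x
  unfolding S_def using that
  by (intro order_trans[OF norm_symbol_le] member_le_sum[where f = "%\<mu>. \<Sum>k | a \<mu> k ~= 0. norm (a \<mu> k)"]) (auto intro: sum_nonneg)
 have n: "0 < n" using exponents by simp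
 have "\<forall>\<mu>\<in>{2..u}. \<exists>D\<ge>0. \<forall>x. (norm (symbol (b' \<mu>) x))^2 <= D*min 1 (norm x powr (2*n))"
  using vanishing_symbol_bound[OF n vanishing] by metis
 then obtain D where D: "!!\<mu>. \<mu>\<in>{2..u} ==> 0 <= D \<mu>" "!!\<mu> x. \<mu>\<in>{2..u} ==> (norm (symbol (b' \<mu>) x))^2 <= D \<mu>*min 1 (norm x powr (2*n))"
  by metis
 define k where "k = c_1 powr (2*n)"
 have k: "1 <= k" using c_1 n unfolding k_def by (intro ge_one_powr_ge_zero) auto
 define E where "E = (\<Sum>\<mu>\<in>{2..u}. D \<mu>)*k"
 have E: "0 <= E" using D(1) k by (auto simp: E_def intro!: mult_nonneg_nonneg sum_nonneg)
 have DE: "(norm (symbol (b' \<mu>) (N' *v x)))^2 <= E*min 1 (norm x powr (2*n))" if \<mu>: "\<mu>\<in>{2..u}" for \<mu> x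
 proof -
  have "norm (N' *v x) powr (2*n) <= (c_1*norm x) powr (2*n)" using n by (intro powr_mono2 norm_N'_le) auto
  then have "min 1 (norm (N' *v x) powr (2*n)) <= k*min 1 (norm x powr (2*n))"
   using k by (subst min_mult_distrib_left) (auto simp: k_def powr_mult intro: min.mono)
  then have "(norm (symbol (b' \<mu>) (N' *v x)))^2 <= D \<mu>*(k*min 1 (norm x powr (2*n)))"
   by (rule order_trans[OF D(2)[OF \<mu>] mult_left_mono[OF _ D(1)[OF \<mu>]]])
  also have "... <= (\<Sum>\<mu>\<in>{2..u}. D \<mu>)*(k*min 1 (norm x powr (2*n)))"
   using \<mu> D k by (intro mult_right_mono member_le_sum) auto
  finally show ?thesis by (simp add: E_def mult_ac)
 qed
 let ?B1 = "((S b)^2*(c_1*\<rho>) powr (2*t))*C" and ?B2 = "((S b')^2*c_1 powr (2*t'))*C" and ?B3 = "(E*c_1 powr (2*t'))*C"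
 \<comment> \<open>One constant for the synthesis bound, the plain analysis bound and the vanishing
   analysis bound.\<close>
 define B where "B = ?B1 + ?B2 + ?B3"
 have nn: "0 <= ?B1" "0 <= ?B2" "0 <= ?B3" using C(1) E by simp_all
 have B: "?B1 <= B" "?B2 <= B" "?B3 <= B" using nn by (auto simp: B_def)
 have ana: "analysis (wavelet b' \<Phi>' \<mu>) (weight t') B" if \<mu>: "\<mu>\<in>{1..u}" for \<mu>
 proof (rule analysis_mono[OF _ B(2)])
  have "(norm (symbol (b' \<mu>) (N' *v x)))^2 <= (S b')^2*1" for x using S[OF \<mu>] by (simp add: power_mono)
  from analysis_wavelet[OF _ this] show "analysis (wavelet b' \<Phi>' \<mu>) (weight t') ?B2" by simp
 qed
 show ?thesis
 proof (rule that[of B], unfold_locales)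
  show "synthesis (wavelet b \<Phi> \<mu>) (weight t) B" if "\<mu>\<in>{1..u}" for \<mu>
   by (rule synthesis_mono[OF synthesis_wavelet[OF S[OF that]] B(1)])
  show "analysis (wavelet b' \<Phi>' \<mu>) (vanishing_weight n t') B" if "\<mu>\<in>{2..u}" for \<mu>
   using analysis_mono[OF analysis_wavelet[OF E DE[OF that]] B(3)] unfolding vanishing_weight_def[abs_def] by simp
  show "AE w in lborel. (\<Sum>\<mu>\<in>{1..u}. level j (wavelet b \<Phi> \<mu>) (wavelet b' \<Phi>' \<mu>) F w) = level (Suc j) (wavelet b \<Phi> 1) (wavelet b' \<Phi>' 1) F w"
   if F: "F\<in>wL2 t'" for j F
  proof -
   have [measurable]: "F\<in>borel_fun" using F by auto
   have "integrable lborel (%w. (norm (F w))^2*weight t' (down j w))"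
   proof (rule integrable_dominated[OF _ integrable_mult_right[OF wL2_integrable[OF F], of "c_1 powr (2*t')"]])
    have "(norm (F w))^2*weight t' (down j w) <= (norm (F w))^2*(c_1 powr (2*t')*weight t' w)" for w
     using exponents c_1 by (intro mult_left_mono weight_dilate norm_down_le) auto
    then show "(norm (F w))^2*weight t' (down j w) <= c_1 powr (2*t')*((norm (F w))^2*weight t' w)" for w
     by (simp add: mult_ac)
   qed auto
   then show ?thesis unfolding wavelet_1 by (intro telescope_wavelet[OF ana]) auto
  qed
  show "(%j. level j (wavelet b \<Phi> 1) (wavelet b' \<Phi>' 1) F w) \<longlonglongrightarrow> F w" if "!!w. R < norm w ==> F w = 0" for R F w
   unfolding wavelet_1 by (rule limit_wavelet[OF that])
 qed (use u exponents ana in auto)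
qed

end

section \<open>Transfer to distributions\<close>

lemma represents_AE:
 assumes h: "represents h T" and g [measurable]: "g\<in>borel_fun" and eq: "AE x in lborel. h x = g x"
 shows "represents g T"
 unfolding represents_def
proof (intro conjI ballI g)
 have [measurable]: "h\<in>borel_fun" using h by (simp add: represents_def)
 fix f :: "real^'a => complex" assume f: "f\<in>schwartz"
 have [measurable]: "f\<in>borel_fun" using f by (rule schwartz_measurable)
 have ae: "AE x in lborel. h x*f x = g x*f x" using eq by eventually_elim simp
 have i: "integrable lborel (%x. h x*f x)" and T: "T f = (LBINT x. h x*f x)" using h f by (auto simp: represents_def)
 show "integrable lborel (%x. g x*f x)" by (rule integrable_cong_AE_imp[OF i]) (use ae in \<open>auto elim: eventually_mono\<close>)
 show "T f = (LBINT x. g x*f x)" unfolding T by (rule integral_cong_AE) (use ae in auto)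
qed

lemma represents_fourier_diff_sum:
 assumes "represents H (dist_fourier S)" and "!!i. i\<in>K ==> represents (E i) (dist_fourier (e i))"
 shows "represents (%w. H w - (\<Sum>i\<in>K. E i w)) (dist_fourier (%\<eta>. S \<eta> - (\<Sum>i\<in>K. e i \<eta>)))"
 using represents_diff[OF assms(1) represents_sum[OF assms(2)]] by (simp add: dist_fourier_def)

lemma sobolev_has_sumI:
 assumes S: "represents H (dist_fourier S)" "H\<in>wL2 s"
  and e: "!!i. i\<in>I ==> represents (E i) (dist_fourier (e i))" "!!i. i\<in>I ==> E i\<in>wL2 s"
  and conv: "!!eps. 0 < eps ==> \<exists>K. finite K \<and> K \<subseteq> I \<and> (\<forall>L. finite L --> K \<subseteq> L --> L \<subseteq> I --> wnorm s (%w. H w - (\<Sum>i\<in>L. E i w)) < eps)"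
 shows "sobolev_has_sum s e I S"
 unfolding sobolev_has_sum_def
proof (intro conjI ballI)
 show "S\<in>sobolev s" using sobolev_iff[OF S(1)] S(2) by simp
 show "e i\<in>sobolev s" if "i\<in>I" for i using sobolev_iff[OF e(1)[OF that]] e(2)[OF that] by simp
 show "((%F. sobolev_norm s (%\<eta>. S \<eta> - (\<Sum>i\<in>F. e i \<eta>))) \<longlongrightarrow> 0) (finite_subsets_at_top I)"
 proof (rule tendstoI)
  fix eps :: real assume "0 < eps"
  then obtain K where K: "finite K" "K \<subseteq> I" "!!L. finite L ==> K \<subseteq> L ==> L \<subseteq> I ==> wnorm s (%w. H w - (\<Sum>i\<in>L. E i w)) < eps"
   using conv by meson
  have "dist (sobolev_norm s (%\<eta>. S \<eta> - (\<Sum>i\<in>L. e i \<eta>))) 0 < eps" if L: "finite L" "K \<subseteq> L" "L \<subseteq> I" for L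
  proof -
   have "sobolev_norm s (%\<eta>. S \<eta> - (\<Sum>i\<in>L. e i \<eta>)) = wnorm s (%w. H w - (\<Sum>i\<in>L. E i w))"
    using L(3) by (intro sobolev_norm_eq represents_fourier_diff_sum S(1) e(1)) auto
   then show ?thesis using K(3)[OF L] by simp
  qed
  then show "\<forall>\<^sub>F L in finite_subsets_at_top I. dist (sobolev_norm s (%\<eta>. S \<eta> - (\<Sum>i\<in>L. e i \<eta>))) 0 < eps"
   unfolding eventually_finite_subsets_at_top using K(1,2) by blast
 qed
qed

text \<open>\<open>sobolev_sum\<close> is a choice among all sums. Uniqueness on the Fourier side
  identifies the chosen one with the level constructed explicitly.\<close>

lemma sobolev_has_sum_unique:
 assumes S: "sobolev_has_sum s e I S" and T: "sobolev_has_sum s e I T"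
 shows "AE w in lborel. fourier_fun S w = fourier_fun T w"
proof -
 have sob: "S\<in>sobolev s" "T\<in>sobolev s" "!!i. i\<in>I ==> e i\<in>sobolev s" using S T by (auto simp: sobolev_has_sum_def)
 let ?E = "%i. fourier_fun (e i)"
 let ?d = "%w. fourier_fun S w - fourier_fun T w"
 have d: "?d\<in>wL2 s" by (intro wL2_diff sobolev_fourier_fun sob)
 have "((%K. sobolev_norm s (%\<eta>. S \<eta> - (\<Sum>i\<in>K. e i \<eta>)) + sobolev_norm s (%\<eta>. T \<eta> - (\<Sum>i\<in>K. e i \<eta>))) \<longlongrightarrow> 0 + 0) (finite_subsets_at_top I)"
  using S T by (intro tendsto_add) (auto simp: sobolev_has_sum_def)
 moreover have "\<forall>\<^sub>F K in finite_subsets_at_top I. wnorm s ?d <= sobolev_norm s (%\<eta>. S \<eta> - (\<Sum>i\<in>K. e i \<eta>)) + sobolev_norm s (%\<eta>. T \<eta> - (\<Sum>i\<in>K. e i \<eta>))"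
 proof (rule eventually_finite_subsets_at_top_weakI)
  fix K assume K: "finite K" "K \<subseteq> I"
  have E: "?E i\<in>wL2 s" "represents (?E i) (dist_fourier (e i))" if "i\<in>K" for i
   using sobolev_fourier_fun[OF sob(3)] that K(2) by auto
  have "sobolev_norm s (%\<eta>. S \<eta> - (\<Sum>i\<in>K. e i \<eta>)) = wnorm s (%w. fourier_fun S w - (\<Sum>i\<in>K. ?E i w))"
   by (intro sobolev_norm_eq represents_fourier_diff_sum sobolev_fourier_fun(1)[OF sob(1)] E(2))
  moreover have "sobolev_norm s (%\<eta>. T \<eta> - (\<Sum>i\<in>K. e i \<eta>)) = wnorm s (%w. (\<Sum>i\<in>K. ?E i w) - fourier_fun T w)"
   unfolding wnorm_minus_commute[of s _ "fourier_fun T"]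
   by (intro sobolev_norm_eq represents_fourier_diff_sum sobolev_fourier_fun(1)[OF sob(2)] E(2))
  moreover have "wnorm s ?d <= wnorm s (%w. fourier_fun S w - (\<Sum>i\<in>K. ?E i w)) + wnorm s (%w. (\<Sum>i\<in>K. ?E i w) - fourier_fun T w)"
   by (intro wnorm_triangle3 wL2_sum E sobolev_fourier_fun(2) sob)
  ultimately show "wnorm s ?d <= sobolev_norm s (%\<eta>. S \<eta> - (\<Sum>i\<in>K. e i \<eta>)) + sobolev_norm s (%\<eta>. T \<eta> - (\<Sum>i\<in>K. e i \<eta>))"
   by simp
 qed
 ultimately have "wnorm s ?d <= 0 + 0" by (rule tendsto_lowerbound) simp
 then have "wnorm s ?d = 0" using wnorm_nonneg[of s ?d] by linarith
 from wnorm_eq_0[OF d this] show ?thesis by eventually_elim simp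
qed

text \<open>The Riesz factor turns the inner products into pairings of dual spaces, and the
  bijection moves the sums to triples.\<close>

lemma sobolev_frameI:
 fixes E :: "'j => real^'n::finite => complex"
 assumes bij: "bij_betw g I J" and e: "!!i. i\<in>I ==> represents (E (g i)) (dist_fourier (e i))" "!!j. j\<in>J ==> E j\<in>wL2 s"
  and A: "0 < A" and bounds: "!!F. F\<in>wL2 s ==>
   (%j. (norm (dpair (%w. F w*cplx (weight s w)) (E j)))^2) summable_on J \<and>
   A*(wnorm s F)^2 <= (\<Sum>\<^sub>\<infinity>j\<in>J. (norm (dpair (%w. F w*cplx (weight s w)) (E j)))^2) \<and>
   (\<Sum>\<^sub>\<infinity>j\<in>J. (norm (dpair (%w. F w*cplx (weight s w)) (E j)))^2) <= C*(wnorm s F)^2"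
 shows "sobolev_frame s e I"
proof -
 have "e i\<in>sobolev s" if "i\<in>I" for i using sobolev_iff[OF e(1)[OF that]] e(2)[OF bij_betwE[OF bij, rule_format, OF that]] by simp
 moreover have "(%i. (cmod (sobolev_inner s f (e i)))^2) summable_on I \<and>
  A*(sobolev_norm s f)^2 <= (\<Sum>\<^sub>\<infinity>i\<in>I. (cmod (sobolev_inner s f (e i)))^2) \<and>
  (\<Sum>\<^sub>\<infinity>i\<in>I. (cmod (sobolev_inner s f (e i)))^2) <= C*(sobolev_norm s f)^2" if "f\<in>sobolev s" for f
 proof -
 note f = sobolev_fourier_fun[OF that]
 let ?F = "fourier_fun f"
 let ?c = "%j. (norm (dpair (%w. ?F w*cplx (weight s w)) (E j)))^2"
 have eq: "(cmod (sobolev_inner s f (e i)))^2 = ?c (g i)" if "i\<in>I" for i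
  unfolding sobolev_inner_eq[OF f(1) e(1)[OF that]] ..
 have sum: "(\<Sum>\<^sub>\<infinity>i\<in>I. (cmod (sobolev_inner s f (e i)))^2) = infsum ?c J"
  unfolding infsum_reindex_bij_betw[OF bij, symmetric] by (rule infsum_cong) (rule eq)
 have norm: "sobolev_norm s f = wnorm s ?F" by (rule sobolev_norm_eq[OF f(1)])
 have "(%i. ?c (g i)) summable_on I"
  unfolding summable_on_reindex_bij_betw[OF bij, of ?c] using bounds[OF f(2)] by (rule conjunct1)
 then have "(%i. (cmod (sobolev_inner s f (e i)))^2) summable_on I"
  by (rule summable_on_cong[THEN iffD1, rotated]) (simp add: eq)
 then show ?thesis using bounds[OF f(2)] unfolding sum norm by blast
 qed
 ultimately show ?thesis using A unfolding sobolev_frame_def by blast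
qed

text \<open>Attaches distributions to the functions of \<open>wavelet_levels\<close> and recalls the
  matrix M from which \<open>N\<close>, \<open>N'\<close> and \<rho> arise.\<close>

locale wavelet_distributions = wavelet_levels N N' \<rho> c_0 \<Psi> \<Psi>' u s t t' n B
 for N N' :: "real^'n^'n::finite" and \<rho> c_0 \<Psi> \<Psi>' u s t t' n B +
 fixes M :: "real^'n^'n" and \<phi> \<phi>' :: "'n dist" and \<psi> \<psi>' :: "nat => 'n dist"
 assumes det_M: "det M ~= 0" and N: "N = transpose M" "N' = matrix_inv (transpose M)"
  and \<rho>_eq: "\<rho> = \<bar>det M\<bar> powr (1/real CARD('n))"
  and represents_\<phi>: "represents (\<Psi> 1) (dist_fourier \<phi>)" "represents (\<Psi>' 1) (dist_fourier \<phi>')"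
  and represents_\<psi>: "!!\<mu>. \<mu>\<in>{2..u} ==> represents (\<Psi> \<mu>) (dist_fourier (\<psi> \<mu>))" "!!\<mu>. \<mu>\<in>{2..u} ==> represents (\<Psi>' \<mu>) (dist_fourier (\<psi>' \<mu>))"
begin

lemma represents_atom:
 assumes "represents h (dist_fourier g)"
 shows "represents (atom j k h) (dist_fourier (dil_shift M j k g))"
proof -
 have "det N = det M" by (simp add: N(1) det_transpose)
 then have "fourier_atom M j k h = atom j k h" by (simp add: fun_eq_iff fourier_atom_def atom_def m_def N(2)[symmetric])
 then show ?thesis using represents_dil_shift[OF det_M assms, of j k] by simp
qed

lemma \<rho>_powr: "(\<rho> ^ j) powr a = \<bar>det M\<bar> powr (real j*a/real CARD('n))"
proof -
 have "\<rho> ^ j = \<rho> powr real j" using \<rho> by (simp add: powr_realpow)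
 then show ?thesis by (simp add: \<rho>_eq powr_powr)
qed

definition index :: "'n index => nat \<times> nat \<times> (int^'n)" where
 "index i = (case i of Inl k => (1, 0, k) | Inr p => p)"

lemma bij_index: "bij_betw index (wavelet_index u) indices"
proof (rule bij_betwI')
 fix x y :: "'n index" assume "x\<in>wavelet_index u" "y\<in>wavelet_index u"
 then show "index x = index y \<longleftrightarrow> x = y" by (auto simp: index_def wavelet_index_def)
next
 fix x :: "'n index" assume "x\<in>wavelet_index u"
 then show "index x\<in>indices" using u by (auto simp: index_def wavelet_index_def indices_def)
next
 fix y assume "y\<in>indices"
 then obtain \<mu> j k where y: "y = (\<mu>, j, k)" "\<mu>\<in>{1..u}" "\<mu> = 1 ==> j = 0" by (auto simp: indices_def)
 show "\<exists>x\<in>wavelet_index u. y = index x"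
 proof (cases "\<mu> = 1")
  case True
  then show ?thesis using y by (intro bexI[of _ "Inl k"]) (auto simp: index_def wavelet_index_def)
 next
  case False
  then show ?thesis using y by (intro bexI[of _ "Inr y"]) (auto simp: index_def wavelet_index_def)
 qed
qed

lemma dist_fourier_cmult: "dist_fourier (%\<eta>. c*T \<eta>) = (%f. c*dist_fourier T f)"
 by (simp add: dist_fourier_def)

lemma represents_family:
 assumes "i\<in>wavelet_index u"
 shows "represents (elem (index i)) (dist_fourier (weighted_family M s \<phi> \<psi> i))"
  "represents (dual_elem (index i)) (dist_fourier (weighted_family M (- s) \<phi>' \<psi>' i))"
proof -
 have "represents (elem (index i)) (dist_fourier (weighted_family M s \<phi> \<psi> i)) \<and>
  represents (dual_elem (index i)) (dist_fourier (weighted_family M (- s) \<phi>' \<psi>' i))"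
 proof (cases i)
  case (Inl k)
  then show ?thesis using represents_atom[OF represents_\<phi>(1), of 0 k] represents_atom[OF represents_\<phi>(2), of 0 k]
   by (simp add: index_def elem_def[abs_def] dual_elem_def[abs_def] weighted_family_def)
 next
  case (Inr p)
  obtain \<mu> j k where p: "p = (\<mu>, j, k)" by (cases p)
  have \<mu>: "\<mu>\<in>{2..u}" using assms Inr p by (auto simp: wavelet_index_def)
  show ?thesis
   using represents_cmult[OF represents_atom[OF represents_\<psi>(1)[OF \<mu>]], of "cplx ((\<rho> ^ j) powr (- s))" j k]
    represents_cmult[OF represents_atom[OF represents_\<psi>(2)[OF \<mu>]], of "cplx ((\<rho> ^ j) powr s)" j k]
   by (simp add: Inr p index_def elem_def[abs_def] dual_elem_def[abs_def] weighted_family_def dist_fourier_cmult \<rho>_powr)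
 qed
 then show "represents (elem (index i)) (dist_fourier (weighted_family M s \<phi> \<psi> i))"
  "represents (dual_elem (index i)) (dist_fourier (weighted_family M (- s) \<phi>' \<psi>' i))" by auto
qed

text \<open>The upper bound is the Bessel inequality for \<open>elem\<close>. For the lower one,
  pairing F with its Riesz image G gives the squared norm, and \<open>dpair_square_le\<close>
  charges one factor to the dual Bessel bound D.\<close>

lemma frame: "sobolev_frame s (weighted_family M s \<phi> \<psi>) (wavelet_index u)"
proof -
 obtain C where C: "0 < C" "!!G K. G\<in>wL2 (- s) ==> finite K ==> K \<subseteq> indices ==>
  (\<Sum>i\<in>K. (norm (dpair G (elem i)))^2) <= C*(wnorm (- s) G)^2" by (rule bessel_elem) blast
 obtain D where D: "0 < D" "!!F K. F\<in>wL2 s ==> finite K ==> K \<subseteq> indices ==>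
  (\<Sum>i\<in>K. (norm (dpair F (dual_elem i)))^2) <= D*(wnorm s F)^2" by (rule bessel_dual) blast
 show ?thesis
 proof (rule sobolev_frameI[where E = elem, OF bij_index represents_family(1) elem_weighted_L2(1)])
  show "0 < 1/D" using D by simp
  fix F :: "real^'n => complex" assume F: "F\<in>wL2 s"
  let ?G = "%w. F w*cplx (weight s w)"
  note G = wL2_flip[OF F]
  have sq: "(norm (dpair F ?G))^2 = ((wnorm s F)^2)^2" unfolding dpair_flip(1)[OF F] norm_of_real by simp
  have up: "(\<Sum>j\<in>K. (norm (dpair ?G (elem j)))^2) <= C*(wnorm s F)^2" if "finite K" "K \<subseteq> indices" for K
    using C(2)[OF G that] unfolding wnorm_flip[OF F] .
  have low: "((wnorm s F)^2)^2 <= (D*(wnorm s F)^2)*Y"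
    if "!!K. finite K ==> K \<subseteq> indices ==> (\<Sum>j\<in>K. (norm (dpair ?G (elem j)))^2) <= Y" for Y
    using dpair_square_le[OF F G D(2)[OF F] that] unfolding sq .
  show "(%j. (norm (dpair ?G (elem j)))^2) summable_on indices \<and> 1/D*(wnorm s F)^2 <= (\<Sum>\<^sub>\<infinity>j\<in>indices. (norm (dpair ?G (elem j)))^2) \<and>
    (\<Sum>\<^sub>\<infinity>j\<in>indices. (norm (dpair ?G (elem j)))^2) <= C*(wnorm s F)^2"
   by (intro conjI frame_sums[OF zero_le_power2 up low zero_le_power2 D(1)])
 qed
qed

text \<open>The same argument with exchanged roles: F lives in the negative space, and its Riesz
  image is expanded.\<close>

lemma dual_frame: "sobolev_frame (- s) (weighted_family M (- s) \<phi>' \<psi>') (wavelet_index u)"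
proof -
 obtain C where C: "0 < C" "!!G K. G\<in>wL2 (- s) ==> finite K ==> K \<subseteq> indices ==>
  (\<Sum>i\<in>K. (norm (dpair G (elem i)))^2) <= C*(wnorm (- s) G)^2" by (rule bessel_elem) blast
 obtain D where D: "0 < D" "!!F K. F\<in>wL2 s ==> finite K ==> K \<subseteq> indices ==>
  (\<Sum>i\<in>K. (norm (dpair F (dual_elem i)))^2) <= D*(wnorm s F)^2" by (rule bessel_dual) blast
 show ?thesis
 proof (rule sobolev_frameI[where E = dual_elem, OF bij_index represents_family(2) elem_weighted_L2(2)])
  show "0 < 1/C" using C by simp
  fix F :: "real^'n => complex" assume F: "F\<in>wL2 (- s)"
  let ?G = "%w. F w*cplx (weight (- s) w)"
  note G = wL2_flip[OF F, unfolded minus_minus]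
  have sq: "(norm (dpair ?G F))^2 = ((wnorm (- s) F)^2)^2" unfolding dpair_flip(2)[OF F] norm_of_real by simp
  have up: "(\<Sum>j\<in>K. (norm (dpair ?G (dual_elem j)))^2) <= D*(wnorm (- s) F)^2" if "finite K" "K \<subseteq> indices" for K
    using D(2)[OF G that] unfolding wnorm_flip[OF F, unfolded minus_minus] .
  have low: "((wnorm (- s) F)^2)^2 <= (C*(wnorm (- s) F)^2)*Y"
    if "!!K. finite K ==> K \<subseteq> indices ==> (\<Sum>j\<in>K. (norm (dpair ?G (dual_elem j)))^2) <= Y" for Y
    using dpair_square_le[OF G F that C(2)[OF F]] unfolding sq by (simp only: mult.commute[of Y])
  show "(%j. (norm (dpair ?G (dual_elem j)))^2) summable_on indices \<and> 1/C*(wnorm (- s) F)^2 <= (\<Sum>\<^sub>\<infinity>j\<in>indices. (norm (dpair ?G (dual_elem j)))^2) \<and>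
    (\<Sum>\<^sub>\<infinity>j\<in>indices. (norm (dpair ?G (dual_elem j)))^2) <= D*(wnorm (- s) F)^2"
   by (intro conjI frame_sums[OF zero_le_power2 up low zero_le_power2 C(1)])
 qed
qed

lemma represents_recon_term:
 assumes F: "represents F (dist_fourier f)" and \<theta>: "represents \<theta> (dist_fourier g)" "represents \<theta>' (dist_fourier g')"
 shows "represents (%w. dpair F (atom j k \<theta>')*atom j k \<theta> w) (dist_fourier (recon_term M g g' f j k))"
 using represents_cmult[OF represents_atom[OF \<theta>(1)], of "pairing f (dil_shift M j k g')" j k]
 by (simp add: recon_term_def dist_fourier_cmult pairing_eq[OF F represents_atom[OF \<theta>(2)]])

lemma reconstruction_sum:
 assumes "f\<in>sobolev s"
 shows "sobolev_has_sum s (recon_family M \<phi> \<phi>' \<psi> \<psi>' f) (wavelet_index u) f"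
proof (rule sobolev_has_sumI)
 let ?F = "fourier_fun f"
 note f = sobolev_fourier_fun[OF assms]
 let ?E = "%i w. dpair ?F (dual_elem (index i))*elem (index i) w"
 show "represents ?F (dist_fourier f)" "?F\<in>wL2 s" by (rule f)+
 show "represents (?E i) (dist_fourier (recon_family M \<phi> \<phi>' \<psi> \<psi>' f i))" if "i\<in>wavelet_index u" for i
 proof (cases i)
  case (Inl k)
  then show ?thesis using represents_recon_term[OF f(1) represents_\<phi>, of 0 k]
   by (simp add: index_def recon_family_def expansion_term[simplified])
 next
  case (Inr p)
  obtain \<mu> j k where p: "p = (\<mu>, j, k)" by (cases p)
  have \<mu>: "\<mu>\<in>{2..u}" using that Inr p by (auto simp: wavelet_index_def)
  show ?thesis using represents_recon_term[OF f(1) represents_\<psi>(1)[OF \<mu>] represents_\<psi>(2)[OF \<mu>], of j k]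
   by (simp add: Inr p index_def recon_family_def expansion_term)
 qed
 show "?E i\<in>wL2 s" if "i\<in>wavelet_index u" for i
  using bij_betwE[OF bij_index] that by (intro wL2_cmult elem_weighted_L2) auto
 fix eps :: real assume "0 < eps"
 then obtain K where K: "finite K" "K \<subseteq> indices"
  "!!L. finite L ==> K \<subseteq> L ==> L \<subseteq> indices ==> wnorm s (%w. ?F w - expansion L ?F w) < eps"
  by (rule reconstruction[OF f(2)]) blast
 \<comment> \<open>The preimage under \<open>index\<close> carries the finite set found for triples
   back to \<open>wavelet_index\<close>.\<close>
 let ?K = "index -` K \<inter> wavelet_index u"
 have inj: "inj_on index (wavelet_index u)" and img: "index ` wavelet_index u = indices" using bij_index by (auto simp: bij_betw_def)
 have fin: "finite ?K" by (rule finite_vimage_IntI[OF K(1) inj])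
 have "wnorm s (%w. ?F w - (\<Sum>i\<in>L. ?E i w)) < eps" if L: "finite L" "?K \<subseteq> L" "L \<subseteq> wavelet_index u" for L
 proof -
  have "K \<subseteq> index ` L"
  proof
   fix j assume "j\<in>K"
   then obtain i where "i\<in>wavelet_index u" "j = index i" using K(2) img by blast
   then show "j\<in>index ` L" using \<open>j\<in>K\<close> L(2) by blast
  qed
  moreover have "index ` L \<subseteq> indices" using L(3) img by blast
  ultimately have "wnorm s (%w. ?F w - expansion (index ` L) ?F w) < eps" using L(1) by (intro K(3)) auto
  then show ?thesis by (simp add: expansion_def sum.reindex[OF inj_on_subset[OF inj L(3)]])
 qed
 then show "\<exists>K. finite K \<and> K \<subseteq> wavelet_index u \<and> (\<forall>L. finite L --> K \<subseteq> L --> L \<subseteq> wavelet_index u --> wnorm s (%w. ?F w - (\<Sum>i\<in>L. ?E i w)) < eps)"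
  using fin by blast
qed

text \<open>The explicit level function is realised as a distribution first; it is a sum of the
  series, so by uniqueness the chosen sum has the same transform.\<close>

lemma
 assumes \<mu>: "\<mu>\<in>{1..u}" and g: "represents (\<Psi> \<mu>) (dist_fourier g)" "represents (\<Psi>' \<mu>) (dist_fourier g')" and f: "f\<in>sobolev s"
 shows level_summable: "sobolev_summable s (recon_term M g g' f j) UNIV"
  and represents_level_sum: "represents (level j (\<Psi> \<mu>) (\<Psi>' \<mu>) (fourier_fun f)) (dist_fourier (sobolev_sum s (recon_term M g g' f j) UNIV))"
proof -
 let ?F = "fourier_fun f"
 note F = sobolev_fourier_fun[OF f]
 have L2: "level j (\<Psi> \<mu>) (\<Psi>' \<mu>) ?F\<in>wL2 s" using exponents by (intro level_weighted_L2[OF \<mu> F(2)]) auto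
 obtain S where S: "represents (level j (\<Psi> \<mu>) (\<Psi>' \<mu>) ?F) (dist_fourier S)" "S\<in>sobolev s" using exists_dist_represented[OF L2] by blast
 have \<Psi>: "\<Psi> \<mu>\<in>wL2 s" using wL2_mono[OF wavelet_weighted_L2(1)[OF \<mu>]] exponents by simp
 have sum: "sobolev_has_sum s (recon_term M g g' f j) UNIV S"
 proof (rule sobolev_has_sumI[OF S(1) L2 represents_recon_term[OF F(1) g]])
  show "(%w. dpair ?F (atom j k (\<Psi>' \<mu>))*atom j k (\<Psi> \<mu>) w)\<in>wL2 s" for k
   by (intro wL2_cmult atom_weighted_L2 \<Psi>)
  fix eps :: real assume "0 < eps"
  then show "\<exists>K. finite K \<and> K \<subseteq> UNIV \<and> (\<forall>L. finite L --> K \<subseteq> L --> L \<subseteq> UNIV -->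
    wnorm s (%w. level j (\<Psi> \<mu>) (\<Psi>' \<mu>) ?F w - (\<Sum>k\<in>L. dpair ?F (atom j k (\<Psi>' \<mu>))*atom j k (\<Psi> \<mu>) w)) < eps)"
   by (rule level_converges_norm[OF \<mu> F(2), of _ j]) blast
 qed
 then show "sobolev_summable s (recon_term M g g' f j) UNIV" unfolding sobolev_summable_def by blast
 let ?T = "sobolev_sum s (recon_term M g g' f j) UNIV"
 have T: "sobolev_has_sum s (recon_term M g g' f j) UNIV ?T" unfolding sobolev_sum_def
  by (rule someI[where P = "sobolev_has_sum s (recon_term M g g' f j) UNIV"]) (rule sum)
 then have "?T\<in>sobolev s" by (simp add: sobolev_has_sum_def)
 note T' = sobolev_fourier_fun(1)[OF this]
 show "represents (level j (\<Psi> \<mu>) (\<Psi>' \<mu>) ?F) (dist_fourier ?T)"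
 proof (rule represents_AE[OF T' wL2_measurable[OF L2]])
  show "AE w in lborel. fourier_fun ?T w = level j (\<Psi> \<mu>) (\<Psi>' \<mu>) ?F w"
   using sobolev_has_sum_unique[OF T sum] fourier_fun_AE[OF S(1)] by eventually_elim simp
 qed
qed

text \<open>By telescoping, the scaling part together with all wavelet levels below J has the
  transform of scaling level J, which \<open>approximation_order\<close> measures.\<close>

lemma represents_partial_recon:
 assumes f: "f\<in>sobolev s"
 shows "represents (%w. fourier_fun f w - level J (\<Psi> 1) (\<Psi>' 1) (fourier_fun f) w) (dist_fourier (%\<eta>. f \<eta> - partial_recon M s u \<phi> \<phi>' \<psi> \<psi>' J f \<eta>))"
proof (rule represents_AE)
 let ?F = "fourier_fun f"
 note F = sobolev_fourier_fun[OF f]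
 have one: "1\<in>{1..u}" using u by simp
 have Ft: "?F\<in>wL2 t'" using exponents by (intro wL2_mono[OF F(2)]) simp
 have "represents (%w. \<Sum>j<J. \<Sum>\<mu>\<in>{2..u}. level j (\<Psi> \<mu>) (\<Psi>' \<mu>) ?F w)
   (%\<eta>. \<Sum>j<J. \<Sum>\<mu>\<in>{2..u}. dist_fourier (sobolev_sum s (recon_term M (\<psi> \<mu>) (\<psi>' \<mu>) f j) UNIV) \<eta>)"
  by (intro represents_sum represents_level_sum represents_\<psi> f) auto
 from represents_diff[OF F(1) represents_add[OF represents_level_sum[OF one represents_\<phi> f, of 0] this]]
 show "represents (%w. ?F w - (level 0 (\<Psi> 1) (\<Psi>' 1) ?F w + (\<Sum>j<J. \<Sum>\<mu>\<in>{2..u}. level j (\<Psi> \<mu>) (\<Psi>' \<mu>) ?F w)))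
   (dist_fourier (%\<eta>. f \<eta> - partial_recon M s u \<phi> \<phi>' \<psi> \<psi>' J f \<eta>))"
  by (simp add: dist_fourier_def partial_recon_def)
 show "(%w. ?F w - level J (\<Psi> 1) (\<Psi>' 1) ?F w)\<in>borel_fun"
  using exponents by (intro wL2_measurable[of _ s] wL2_diff level_weighted_L2 one F(2)) auto
 show "AE w in lborel. ?F w - (level 0 (\<Psi> 1) (\<Psi>' 1) ?F w + (\<Sum>j<J. \<Sum>\<mu>\<in>{2..u}. level j (\<Psi> \<mu>) (\<Psi>' \<mu>) ?F w)) = ?F w - level J (\<Psi> 1) (\<Psi>' 1) ?F w"
  using telescope_sum[OF Ft]
 proof eventually_elim
  case (elim w)
  then show ?case using elim[rule_format, of 0 J] by simp
 qed
qed

text \<open>The lower norm bounds with \<kappa> are used in both directions: they bound the factor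
  with exponent -r by \<rho>^(-jr), which cancels the growth in r of the error, and replace
  \<rho>^(-jn) by the norm of the inverse power.\<close>

lemma simultaneous_approximation:
 fixes \<kappa> :: real and \<sigma> :: nat
 assumes s: "s = real \<sigma>" and \<kappa>: "0 < \<kappa>" "!!j. \<kappa>*\<rho> ^ j <= opnorm (matpow (transpose M) j)" "!!j. \<kappa>/\<rho> ^ j <= opnorm (matpow (matrix_inv (transpose M)) j)"
 shows "simultaneous_approximation_order M \<sigma> n u \<phi> \<phi>' \<psi> \<psi>'"
proof -
 have sob: "f\<in>sobolev s" "fourier_fun f\<in>wL2 n" if "f\<in>sobolev n" for f :: "'n dist"
  using sobolev_iff[OF sobolev_fourier_fun(1)[OF that]] wL2_mono[OF sobolev_fourier_fun(2)[OF that]] sobolev_fourier_fun(2)[OF that] exponents by auto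
 have n: "0 <= n" using exponents by simp
 obtain D where D: "0 <= D" "!!F r J. F\<in>wL2 n ==> 0 <= r ==> r <= s ==>
  wnorm r (%w. F w - level J (\<Psi> 1) (\<Psi>' 1) F w) <= D*(\<rho> ^ J) powr (r - n)*weighted_seminorm n F"
  by (rule approximation_order) blast
 define C where "C = (\<Sum>r\<le>\<sigma>. inverse (\<kappa> ^ r))*D/\<kappa> powr n"
 have C: "0 <= C" using D(1) \<kappa>(1) by (simp add: C_def sum_nonneg)
 have "(\<Sum>r\<le>\<sigma>. inverse (opnorm (matpow (transpose M) j) ^ r) * sobolev_seminorm r (%\<eta>. f \<eta> - partial_recon M \<sigma> u \<phi> \<phi>' \<psi> \<psi>' j f \<eta>))
   <= C * opnorm (matpow (matrix_inv (transpose M)) j) powr n * sobolev_seminorm n f" if f: "f\<in>sobolev n" for f j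
 proof -
  let ?F = "fourier_fun f"
  let ?R = "%w. ?F w - level j (\<Psi> 1) (\<Psi>' 1) ?F w"
  have \<rho>j: "0 < \<rho> ^ j" using \<rho> by simp
  have Fn: "sobolev_seminorm n f = weighted_seminorm n ?F"
   unfolding weighted_seminorm_def by (rule sobolev_seminorm_eq[OF sobolev_fourier_fun(1)[OF f]])
  have one: "1\<in>{1..u}" using u by simp
  have "inverse (opnorm (matpow (transpose M) j) ^ r) * sobolev_seminorm r (%\<eta>. f \<eta> - partial_recon M \<sigma> u \<phi> \<phi>' \<psi> \<psi>' j f \<eta>)
    <= inverse (\<kappa> ^ r)*(D*(\<rho> ^ j) powr (- n)*weighted_seminorm n ?F)" if r: "r <= \<sigma>" for r
  proof -
   have L2: "?R\<in>wL2 (real r)"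
    using r s exponents by (intro wL2_diff level_weighted_L2 one sobolev_fourier_fun sob(1)[OF f] wL2_mono[OF sob(2)[OF f]]) auto
   have "sobolev_seminorm r (%\<eta>. f \<eta> - partial_recon M \<sigma> u \<phi> \<phi>' \<psi> \<psi>' j f \<eta>) = weighted_seminorm r ?R"
    unfolding weighted_seminorm_def using sobolev_seminorm_eq[OF represents_partial_recon[OF sob(1)[OF f]]] by (simp add: s)
   also have "... <= wnorm r ?R" by (rule weighted_seminorm_le[OF _ L2]) simp
   also have "... <= D*(\<rho> ^ j) powr (real r - n)*weighted_seminorm n ?F"
    using r s by (intro D(2) sob(2)[OF f]) auto
   finally have le: "sobolev_seminorm r (%\<eta>. f \<eta> - partial_recon M \<sigma> u \<phi> \<phi>' \<psi> \<psi>' j f \<eta>) <= D*(\<rho> ^ j) powr (real r - n)*weighted_seminorm n ?F" .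
   have "inverse (opnorm (matpow (transpose M) j) ^ r) <= inverse ((\<kappa>*\<rho> ^ j) ^ r)"
    using \<kappa> \<rho>j by (intro le_imp_inverse_le power_mono) auto
   then have "inverse (opnorm (matpow (transpose M) j) ^ r) * sobolev_seminorm r (%\<eta>. f \<eta> - partial_recon M \<sigma> u \<phi> \<phi>' \<psi> \<psi>' j f \<eta>)
     <= inverse ((\<kappa>*\<rho> ^ j) ^ r)*(D*(\<rho> ^ j) powr (real r - n)*weighted_seminorm n ?F)"
    using le \<kappa>(1) \<rho>j by (intro mult_mono) (auto simp: sobolev_seminorm_def)
   also have "... = inverse (\<kappa> ^ r)*(D*(inverse ((\<rho> ^ j) ^ r)*(\<rho> ^ j) powr (real r - n))*weighted_seminorm n ?F)"
    by (simp add: power_mult_distrib mult_ac)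
   also have "inverse ((\<rho> ^ j) ^ r)*(\<rho> ^ j) powr (real r - n) = (\<rho> ^ j) powr (- n)"
   proof -
    have "inverse ((\<rho> ^ j) ^ r) = (\<rho> ^ j) powr (- real r)" using \<rho>j by (simp add: powr_minus powr_realpow)
    then show ?thesis by (simp flip: powr_add)
   qed
   finally show ?thesis .
  qed
  then have "(\<Sum>r\<le>\<sigma>. inverse (opnorm (matpow (transpose M) j) ^ r) * sobolev_seminorm r (%\<eta>. f \<eta> - partial_recon M \<sigma> u \<phi> \<phi>' \<psi> \<psi>' j f \<eta>))
    <= (\<Sum>r\<le>\<sigma>. inverse (\<kappa> ^ r))*(D*(\<rho> ^ j) powr (- n)*weighted_seminorm n ?F)"
   unfolding sum_distrib_right by (intro sum_mono) auto
  also have "... = C*(\<kappa>/\<rho> ^ j) powr n*weighted_seminorm n ?F"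
   using \<kappa>(1) by (simp add: C_def powr_divide powr_minus_divide)
  also have "... <= C * opnorm (matpow (matrix_inv (transpose M)) j) powr n*weighted_seminorm n ?F"
   using \<kappa> \<rho>j n C by (intro mult_right_mono mult_left_mono powr_mono2) auto
  finally show ?thesis unfolding Fn .
 qed
 moreover have "sobolev_summable \<sigma> (recon_term M \<phi> \<phi>' f 0) UNIV" "\<mu>\<in>{2..u} ==> sobolev_summable \<sigma> (recon_term M (\<psi> \<mu>) (\<psi>' \<mu>) f i) UNIV"
  if f: "f\<in>sobolev n" for f i \<mu>
  using level_summable[of 1 \<phi> \<phi>' f 0] level_summable[of \<mu> "\<psi> \<mu>" "\<psi>' \<mu>" f i] u represents_\<phi> represents_\<psi> sob(1)[OF f] by (auto simp: s)
 ultimately show ?thesis unfolding simultaneous_approximation_order_def by blast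
qed

end

theorem theorem4p3:
  fixes M :: "real^'n^'n::finite" and s u :: nat and n :: real
    and a a' :: "int^'n \<Rightarrow> complex"
    and b b' :: "nat \<Rightarrow> int^'n \<Rightarrow> complex"
    and \<phi> \<phi>' :: "'n dist" and \<psi> \<psi>' :: "nat \<Rightarrow> 'n dist"
  assumes "dilation_matrix M" and "isotropic M" and "1 \<le> s"
    and "mra_wavelet_system M s u a a' b b' \<phi> \<phi>' \<psi> \<psi>'"
    and "real s < n"
    and "\<And>\<mu>. \<mu> \<in> {2..u} \<Longrightarrow>
           (\<lambda>\<xi>. norm (symbol (b' \<mu>) \<xi>)) \<in> O[at 0](\<lambda>\<xi>. norm \<xi> powr n)"
  shows "dual_wavelet_frames M s u \<phi> \<phi>' \<psi> \<psi>' \<and>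
         simultaneous_approximation_order M s n u \<phi> \<phi>' \<psi> \<psi>'"
proof -
 define \<rho> where "\<rho> = \<bar>det M\<bar> powr (1/real CARD('n))"
 define N where "N = transpose M"
 define N' where "N' = matrix_inv (transpose M)"
 obtain c_0 \<kappa> where d: "det M ~= 0" and \<kappa>: "0 < \<kappa>" and iso: "isotropic_dilation N N' \<rho> c_0"
  and op: "!!j. \<kappa>*\<rho> ^ j <= opnorm (matpow (transpose M) j)" "!!j. \<kappa>/\<rho> ^ j <= opnorm (matpow (matrix_inv (transpose M)) j)"
  unfolding \<rho>_def N_def N'_def by (rule isotropic_dilationI[OF assms(1,2)]) blast
 interpret isotropic_dilation N N' \<rho> c_0 by (rule iso)
 note mra = assms(4)[unfolded mra_wavelet_system_def]
 have sf: "scaling_function M (b 1) \<phi>" "scaling_function M (b' 1) \<phi>'" using mra by auto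
 \<comment> \<open>Exponents strictly inside the smoothness range, where actual membership in a
   Sobolev space is available.\<close>
 have "ereal (real s) < Sup {ereal \<nu> | \<nu>. \<phi>\<in>sobolev \<nu>}" "ereal (- real s) < Sup {ereal \<nu> | \<nu>. \<phi>'\<in>sobolev \<nu>}"
  using mra unfolding smoothness_exponent_def by blast+
 then obtain t \<nu> where t: "\<phi>\<in>sobolev t" "real s < t" and \<nu>: "\<phi>'\<in>sobolev \<nu>" "- real s < \<nu>"
  unfolding less_Sup_iff by auto
 \<comment> \<open>Taking the maximum with 0 keeps t' nonnegative, as weight comparisons under
   dilation need; -t' <= \<nu> keeps \<phi>' in the space of order -t'.\<close>
 define t' where "t' = max 0 (- \<nu>)"
 have t': "0 <= t'" "t' < real s" using \<nu> assms(3) by (auto simp: t'_def)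
 have \<phi>': "\<phi>'\<in>sobolev (- t')"
 proof -
  note r = sobolev_fourier_fun[OF \<nu>(1)]
  have "fourier_fun \<phi>'\<in>wL2 (- t')" by (rule wL2_mono[OF r(2)]) (simp add: t'_def)
  then show ?thesis using sobolev_iff[OF r(1)] by simp
 qed
 note \<Phi> = scaling_function_fourier[OF d sf(1) t(1), folded N'_def] and \<Phi>' = scaling_function_fourier[OF d sf(2) \<phi>', folded N'_def]
 obtain C1 where C1: "0 < C1" "!!x. (nsum (%l. ennreal ((norm (fourier_fun \<phi> (N' *v (x + vec_of_int l))))^2*weight t (N' *v (x + vec_of_int l))))) <= ennreal C1"
  using \<Phi>(6)[OF NN'] by blast
 obtain C2 where C2: "0 < C2" "!!x. (nsum (%l. ennreal ((norm (fourier_fun \<phi>' (N' *v (x + vec_of_int l))))^2*weight (- t') (N' *v (x + vec_of_int l))))) <= ennreal C2"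
  using \<Phi>'(6)[OF NN'] by blast
 \<comment> \<open>A nonzero determinant bounded by u in modulus rules out u = 0.\<close>
 have u: "1 <= u" using mra d by (cases u) auto
 have pos: "0 < real s" "0 <= C1 + C2" using assms(3) C1(1) C2(1) by auto
 have bio: "(\<Sum>\<mu>\<in>{1..u}. cnj (symbol (b \<mu>) (w + N' *v vec_of_int q)) * symbol (b' \<mu>) (w + N' *v vec_of_int q')) = (if q = q' then 1 else 0)"
  if "q\<in>digits N" "q'\<in>digits N" for w q q'
  using mra that unfolding modulation_matrix_def N'_def N_def by blast
 interpret masks: wavelet_masks N N' \<rho> c_0 b b' "fourier_fun \<phi>" "fourier_fun \<phi>'" u "real s" t t' n "C1 + C2"
 proof unfold_locales
  show "(nsum (%l. ennreal ((norm (fourier_fun \<phi> (N' *v (x + vec_of_int l))))^2*weight t (N' *v (x + vec_of_int l))))) <= ennreal (C1 + C2)" for x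
   by (rule order_trans[OF C1(2) ennreal_leI]) (use C2 in simp)
  show "(nsum (%l. ennreal ((norm (fourier_fun \<phi>' (N' *v (x + vec_of_int l))))^2*weight (- t') (N' *v (x + vec_of_int l))))) <= ennreal (C1 + C2)" for x
   by (rule order_trans[OF C2(2) ennreal_leI]) (use C1 in simp)
 qed (rule u t(2) t' assms(5,6) \<Phi>(3-5) \<Phi>'(3-5) bio pos | assumption)+
 obtain B where B: "wavelet_levels N N' \<rho> c_0 (masks.wavelet b (fourier_fun \<phi>)) (masks.wavelet b' (fourier_fun \<phi>')) u (real s) t t' n B"
  by (rule masks.wavelet_levels_exists)
 have wf: "wavelet_function M (b \<mu>) \<phi> (\<psi> \<mu>)" "wavelet_function M (b' \<mu>) \<phi>' (\<psi>' \<mu>)" if "\<mu>\<in>{2..u}" for \<mu> using mra that by auto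
 interpret wavelet_distributions N N' \<rho> c_0 "masks.wavelet b (fourier_fun \<phi>)" "masks.wavelet b' (fourier_fun \<phi>')" u "real s" t t' n B M \<phi> \<phi>' \<psi> \<psi>'
 proof (rule wavelet_distributions.intro[OF B], unfold_locales)
  show "represents (masks.wavelet b (fourier_fun \<phi>) 1) (dist_fourier \<phi>)" "represents (masks.wavelet b' (fourier_fun \<phi>') 1) (dist_fourier \<phi>')"
   unfolding masks.wavelet_1 by (rule \<Phi>(1) \<Phi>'(1))+
  show "represents (masks.wavelet b (fourier_fun \<phi>) \<mu>) (dist_fourier (\<psi> \<mu>))" "represents (masks.wavelet b' (fourier_fun \<phi>') \<mu>) (dist_fourier (\<psi>' \<mu>))" if "\<mu>\<in>{2..u}" for \<mu>
   using wf[OF that] unfolding wavelet_function_def masks.wavelet_def[abs_def] N'_def[symmetric] by auto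
 qed (use d in \<open>simp_all add: N_def N'_def \<rho>_def\<close>)
 show ?thesis
  unfolding dual_wavelet_frames_def
  using frame dual_frame reconstruction_sum simultaneous_approximation[OF refl \<kappa> op] by blast
qed

end
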